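(* Let $\mathcal{F}$ be either of the symbols $\mathcal{A}$ or $\mathcal{S}$ (the assertions hold for both). Let $k$ be an odd integer with $k\ge 3$, and let $r$ be an integer with $1\le r\le k-2$. In all sums below, $k_1,\dots,k_r$ range over positive integers. (1) For every $i\in\mathbb{Z}$ with $1\le i\le r$, we have \[ \sum_{\substack{k_1+\dots+k_r=k\\ k_i\ge 3}}\zeta_{\mathcal{F}}(k_1,\dots,k_r)=(-1)^r\sum_{\substack{k_1+\dots+k_r=k\\ k_i\ge 3}}\zeta_{\mathcal{F}}^{\star}(k_1,\dots,k_r)\in\mathbb{Q}\,\mathfrak{Z}_{\mathcal{F}}(k). \] (2) For all distinct $i,j\in\mathbb{Z}$ with $1\le i,j\le r$, we have \[ \sum_{\substack{k_1+\dots+k_r=k\\ k_i,k_j\ge 2}}\zeta_{\mathcal{F}}(k_1,\dots,k_r)=(-1)^r\sum_{\substack{k_1+\dots+k_r=k\\ k_i,k_j\ge 2}}\zeta_{\mathcal{F}}^{\star}(k_1,\dots,k_r)\in\mathbb{Q}\,\mathfrak{Z}_{\mathcal{F}}(k). \]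
   Context: Finite values: let $\mathcal{A}=\prod_p\mathbb{F}_p/\bigoplus_p\mathbb{F}_p$, $p$ running over all primes; this is a $\mathbb{Q}$-algebra, and an element is determined by its components at all but finitely many $p$. For $k_1,\dots,k_r\in\mathbb{Z}_{\ge1}$, \[ \zeta_{\mathcal{A}}(k_1,\dots,k_r)=\Bigl(\sum_{p>m_1>\dots>m_r\ge1}\tfrac{1}{m_1^{k_1}\cdots m_r^{k_r}}\bmod p\Bigr)_p,\qquad \zeta_{\mathcal{A}}^{\star}(k_1,\dots,k_r)=\Bigl(\sum_{p>m_1\ge\dots\ge m_r\ge1}\tfrac{1}{m_1^{k_1}\cdots m_r^{k_r}}\bmod p\Bigr)_p\in\mathcal{A}. \] Symmetric values: for $k_1\ge2$ the multiple zeta(-star) values are $\zeta(k_1,\dots,k_r)=\sum_{m_1>\dots>m_r\ge1}m_1^{-k_1}\cdots m_r^{-k_r}$ and $\zeta^{\star}(k_1,\dots,k_r)=\sum_{m_1\ge\dots\ge m_r\ge1}m_1^{-k_1}\cdots m_r^{-k_r}$, with $\zeta(\emptyset)=\zeta^{\star}(\emptyset)=1$; let $\mathcal{Z}$ be the $\mathbb{Q}$-linear subspace of $\mathbb{R}$ spanned by the multiple zeta values (including $\zeta(\emptyset)=1$). If $k_1=1$, $\zeta(k_1,\dots,k_r)\in\mathcal{Z}$ denotes the (say harmonic) regularised value: the regularised $\zeta$ is the unique extension of $\zeta$ to all indices that is multiplicative for the harmonic (stuffle) product and satisfies $\zeta(1)=0$; and the regularised $\zeta^{\star}(k_1,\dots,k_r)$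 is the sum of the regularised $\zeta(\boldsymbol{l})$ over the $2^{r-1}$ indices $\boldsymbol{l}$ obtained from $(k_1,\dots,k_r)$ by replacing some (possibly none) of the commas by plus signs. (Using the shuffle regularisation instead gives the same symmetric values below.) For $k_1,\dots,k_r\in\mathbb{Z}_{\ge1}$, \[ \zeta_{\mathcal{S}}(k_1,\dots,k_r)=\sum_{j=0}^{r}(-1)^{k_1+\dots+k_j}\zeta(k_j,\dots,k_1)\zeta(k_{j+1},\dots,k_r)\bmod\zeta(2)\in\mathcal{Z}/\zeta(2)\mathcal{Z}, \] and $\zeta_{\mathcal{S}}^{\star}(k_1,\dots,k_r)\in\mathcal{Z}/\zeta(2)\mathcal{Z}$ is defined by the same formula with $\zeta$ replaced by $\zeta^{\star}$. For $k\in\mathbb{Z}_{\ge2}$, $\mathfrak{Z}_{\mathcal{A}}(k)=(B_{p-k}/k\bmod p)_p\in\mathcal{A}$ (defined for all sufficiently large $p$), where $B_n$ is the $n$-th Bernoulli number, and $\mathfrak{Z}_{\mathcal{S}}(k)=\zeta(k)\bmod\zeta(2)\in\mathcal{Z}/\zeta(2)\mathcal{Z}$. *)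

theory Defs
  imports
    "HOL-Analysis.Infinite_Sum"
    "HOL-Computational_Algebra.Formal_Power_Series"
    "HOL-Number_Theory.Modular_Inverse"
begin

section \<open>Rational vector spaces\<close>

class rat_vector = ab_group_add +
  fixes scaleQ :: "rat \<Rightarrow> 'a \<Rightarrow> 'a"  (infixr \<open>*\<^sub>Q\<close> 75)
  assumes scaleQ_add_right: "a *\<^sub>Q (x + y) = a *\<^sub>Q x + a *\<^sub>Q y"
    and scaleQ_add_left: "(a + b) *\<^sub>Q x = a *\<^sub>Q x + b *\<^sub>Q x"
    and scaleQ_scaleQ: "a *\<^sub>Q b *\<^sub>Q x = (a * b) *\<^sub>Q x"
    and scaleQ_one: "1 *\<^sub>Q x = x"

interpretation rat_vector: vector_space "scaleQ :: rat \<Rightarrow> 'a \<Rightarrow> 'a::rat_vector"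
  by standard (simp_all add: scaleQ_add_right scaleQ_add_left scaleQ_scaleQ scaleQ_one)

instantiation real :: rat_vector
begin

definition scaleQ_real :: "rat \<Rightarrow> real \<Rightarrow> real"
  where "scaleQ_real q x = of_rat q * x"

instance
  by standard (simp_all add: scaleQ_real_def algebra_simps of_rat_add of_rat_mult)

end


section \<open>Indices and multiple harmonic sums\<close>

text \<open>An index \<open>(k\<^sub>1, \<dots>, k\<^sub>r)\<close> is a list of positive natural numbers.\<close>

definition is_index :: "nat list \<Rightarrow> bool"
  where "is_index ks \<longleftrightarrow> (\<forall>k\<in>set ks. k \<ge> 1)"

definition admissible :: "nat list \<Rightarrow> bool"
  where "admissible ks \<longleftrightarrow> is_index ks \<and> (ks \<noteq> [] \<longrightarrow> hd ks \<ge> 2)"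

definition compositions :: "nat \<Rightarrow> nat \<Rightarrow> nat list set"
  where "compositions k r = {ks. is_index ks \<and> length ks = r \<and> sum_list ks = k}"

definition strict_tuples :: "nat \<Rightarrow> nat list set"
  where "strict_tuples r = {ms. length ms = r \<and> sorted_wrt (>) ms \<and> (\<forall>m\<in>set ms. m \<ge> 1)}"

definition weak_tuples :: "nat \<Rightarrow> nat list set"
  where "weak_tuples r = {ms. length ms = r \<and> sorted_wrt (\<ge>) ms \<and> (\<forall>m\<in>set ms. m \<ge> 1)}"

definition zeta_term :: "nat list \<Rightarrow> nat list \<Rightarrow> 'a::field"
  where "zeta_term ks ms = (\<Prod>i<length ks. 1 / of_nat (ms ! i) ^ (ks ! i))"


section \<open>The ring \<open>\<A>\<close>\<close>

text \<open>
  A family in \<open>\<Prod>\<^sub>p \<F>\<^sub>p\<close> is represented by a sequence of integers, of which the terms at prime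
  positions \<open>p\<close> are read modulo \<open>p\<close>; the terms at other positions are ignored.
\<close>

definition almost_cong :: "(nat \<Rightarrow> int) \<Rightarrow> (nat \<Rightarrow> int) \<Rightarrow> bool"
  where "almost_cong f g \<longleftrightarrow> (\<forall>\<^sub>F p in cofinite. prime p \<longrightarrow> [f p = g p] (mod int p))"

lemma almost_cong_equivp: "equivp almost_cong"
proof (rule equivpI)
  show "reflp almost_cong"
    by (rule reflpI) (simp add: almost_cong_def)
  show "symp almost_cong"
    by (rule sympI) (auto simp: almost_cong_def cong_sym_eq)
  show "transp almost_cong"
  proof (rule transpI)
    fix f g h assume "almost_cong f g" "almost_cong g h"
    then show "almost_cong f h"
      unfolding almost_cong_def by eventually_elim (auto intro: cong_trans)
  qed
qed

quotient_type poor_adele = "nat \<Rightarrow> int" / almost_cong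
  by (rule almost_cong_equivp)

text \<open>
  The residue modulo \<open>p\<close> of a rational number. The value is meaningful if \<open>p\<close> is a prime not
  dividing the denominator.
\<close>

definition rat_residue :: "nat \<Rightarrow> rat \<Rightarrow> int"
  where "rat_residue p q =
    fst (quotient_of q) * modular_inverse (int p) (snd (quotient_of q))"

lemma rat_residue_cong:
  assumes "coprime b (int p)" and "q * of_int b = of_int a"
  shows "[rat_residue p q * b = a] (mod int p)"
proof -
  obtain n d where nd: "quotient_of q = (n, d)" by (cases "quotient_of q")
  have d0: "d > 0" using nd by (rule quotient_of_denom_pos)
  have q: "q = of_int n / of_int d" using nd by (rule quotient_of_div)
  have "of_int (n * b) = (of_int (a * d) :: rat)"
    using assms(2) d0 by (simp add: q field_simps)
  then have nb: "n * b = a * d" by (simp only: of_int_eq_iff)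
  have "coprime n d" using nd by (rule quotient_of_coprime)
  moreover have "d dvd n * b" using nb by simp
  ultimately have "d dvd b" by (simp add: coprime_dvd_mult_right_iff coprime_commute)
  then have cop: "coprime d (int p)" using assms(1) by (meson coprime_divisors dvd_refl)
  have "rat_residue p q * b = a * (d * modular_inverse (int p) d)"
    using nb by (simp add: rat_residue_def nd mult.commute mult.left_commute)
  moreover have "[a * (d * modular_inverse (int p) d) = a * 1] (mod int p)"
    by (intro cong_mult cong_refl cong_modular_inverse1 cop)
  ultimately show ?thesis by simp
qed

lemma rat_residue_unique:
  assumes "coprime b (int p)" and "q * of_int b = of_int a" and "[x * b = a] (mod int p)"
  shows "[rat_residue p q = x] (mod int p)"
proof -
  have "[rat_residue p q * b = x * b] (mod int p)"
    using rat_residue_cong[OF assms(1,2)] assms(3) by (meson cong_sym cong_trans)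
  then show ?thesis using assms(1) by (simp add: cong_mult_rcancel)
qed

lemma eventually_coprime_prime:
  assumes "(b :: int) \<noteq> 0"
  shows "\<forall>\<^sub>F p in cofinite. prime p \<longrightarrow> coprime b (int p)"
proof -
  have "p dvd nat \<bar>b\<bar>" if "prime p" "\<not> coprime b (int p)" for p
  proof -
    have "prime (int p)" using that(1) by simp
    then have "int p dvd b" using that(2) prime_imp_coprime coprime_commute by blast
    then show ?thesis by (simp add: nat_dvd_iff dvd_abs_iff flip: int_dvd_int_iff)
  qed
  then have "{p. prime p \<and> \<not> coprime b (int p)} \<subseteq> {p. p dvd nat \<bar>b\<bar>}" by auto
  moreover have "finite {p. p dvd nat \<bar>b\<bar>}" using assms by (intro finite_divisors_nat) simp
  ultimately have "finite {p. prime p \<and> \<not> coprime b (int p)}" by (rule finite_subset)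
  then show ?thesis by (simp add: eventually_cofinite)
qed

lemma common_denominator:
  fixes q q' :: rat
  obtains b a c :: int where "b \<noteq> 0" "q * of_int b = of_int a" "q' * of_int b = of_int c"
proof -
  obtain n d where nd: "quotient_of q = (n, d)" by (cases "quotient_of q")
  obtain n' d' where nd': "quotient_of q' = (n', d')" by (cases "quotient_of q'")
  have d0: "d > 0" "d' > 0" using nd nd' quotient_of_denom_pos by blast+
  show thesis
  proof (rule that[of "d * d'" "n * d'" "n' * d"])
    show "d * d' \<noteq> 0" using d0 by simp
    show "q * of_int (d * d') = of_int (n * d')" "q' * of_int (d * d') = of_int (n' * d)"
      using d0 by (simp_all add: quotient_of_div[OF nd] quotient_of_div[OF nd'])
  qed
qed

lemma rat_residue_add:
  "\<forall>\<^sub>F p in cofinite. prime p \<longrightarrow>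
     [rat_residue p (q + q') = rat_residue p q + rat_residue p q'] (mod int p)"
proof -
  obtain b a c :: int where b: "b \<noteq> 0" and a: "q * of_int b = of_int a" and c: "q' * of_int b = of_int c"
    by (rule common_denominator)
  show ?thesis using eventually_coprime_prime[OF b]
  proof eventually_elim
    case (elim p)
    show ?case
    proof
      assume "prime p"
      with elim have cop: "coprime b (int p)" by simp
      show "[rat_residue p (q + q') = rat_residue p q + rat_residue p q'] (mod int p)"
      proof (rule rat_residue_unique[OF cop])
        show "(q + q') * of_int b = of_int (a + c)" by (simp add: a c distrib_right)
        show "[(rat_residue p q + rat_residue p q') * b = a + c] (mod int p)"
          unfolding distrib_right by (intro cong_add rat_residue_cong cop a c)
      qed
    qed
  qed
qed

lemma rat_residue_mult:
  "\<forall>\<^sub>F p in cofinite. prime p \<longrightarrow>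
     [rat_residue p (q * q') = rat_residue p q * rat_residue p q'] (mod int p)"
proof -
  obtain b a c :: int where b: "b \<noteq> 0" and a: "q * of_int b = of_int a" and c: "q' * of_int b = of_int c"
    by (rule common_denominator)
  show ?thesis using eventually_coprime_prime[OF b]
  proof eventually_elim
    case (elim p)
    show ?case
    proof
      assume "prime p"
      with elim have cop: "coprime b (int p)" by simp
      show "[rat_residue p (q * q') = rat_residue p q * rat_residue p q'] (mod int p)"
      proof (rule rat_residue_unique[where b = "b * b"])
        show "coprime (b * b) (int p)" using cop by simp
        have "q * q' * of_int (b * b) = (q * of_int b) * (q' * of_int b)" by simp
        then show "q * q' * of_int (b * b) = of_int (a * c)" by (simp only: a c of_int_mult)
        have "[(rat_residue p q * b) * (rat_residue p q' * b) = a * c] (mod int p)"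
          by (intro cong_mult rat_residue_cong cop a c)
        then show "[rat_residue p q * rat_residue p q' * (b * b) = a * c] (mod int p)"
          by (simp add: ac_simps)
      qed
    qed
  qed
qed

lemma rat_residue_one: "[rat_residue p 1 = 1] (mod int p)"
  by (rule rat_residue_unique[where b = 1 and a = 1]) simp_all

lemma almost_cong_add:
  "almost_cong f f' \<Longrightarrow> almost_cong g g' \<Longrightarrow> almost_cong (\<lambda>p. f p + g p) (\<lambda>p. f' p + g' p)"
  unfolding almost_cong_def by (erule (1) eventually_elim2) (auto intro: cong_add)

lemma almost_cong_diff:
  "almost_cong f f' \<Longrightarrow> almost_cong g g' \<Longrightarrow> almost_cong (\<lambda>p. f p - g p) (\<lambda>p. f' p - g' p)"
  unfolding almost_cong_def by (erule (1) eventually_elim2) (auto intro: cong_diff)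

lemma almost_cong_mult:
  "almost_cong f f' \<Longrightarrow> almost_cong g g' \<Longrightarrow> almost_cong (\<lambda>p. f p * g p) (\<lambda>p. f' p * g' p)"
  unfolding almost_cong_def by (erule (1) eventually_elim2) (auto intro: cong_mult)

lemma almost_cong_uminus:
  "almost_cong f f' \<Longrightarrow> almost_cong (\<lambda>p. - f p) (\<lambda>p. - f' p)"
  unfolding almost_cong_def by (erule eventually_mono) (simp add: cong_minus_minus_iff)

lemma almost_cong_refl: "almost_cong f f"
  by (simp add: almost_cong_def)

instantiation poor_adele :: comm_ring_1
begin

lift_definition zero_poor_adele :: poor_adele is "\<lambda>_. 0" .

lift_definition one_poor_adele :: poor_adele is "\<lambda>_. 1" .

lift_definition plus_poor_adele :: "poor_adele \<Rightarrow> poor_adele \<Rightarrow> poor_adele" is "\<lambda>f g p. f p + g p"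
  by (rule almost_cong_add)

lift_definition uminus_poor_adele :: "poor_adele \<Rightarrow> poor_adele" is "\<lambda>f p. - f p"
  by (rule almost_cong_uminus)

lift_definition minus_poor_adele :: "poor_adele \<Rightarrow> poor_adele \<Rightarrow> poor_adele" is "\<lambda>f g p. f p - g p"
  by (rule almost_cong_diff)

lift_definition times_poor_adele :: "poor_adele \<Rightarrow> poor_adele \<Rightarrow> poor_adele" is "\<lambda>f g p. f p * g p"
  by (rule almost_cong_mult)

instance
proof
  show "(0 :: poor_adele) \<noteq> 1"
  proof (transfer, unfold almost_cong_def, rule notI)
    assume "\<forall>\<^sub>F p in cofinite. prime p \<longrightarrow> [0 = 1] (mod int p)"
    then have "\<forall>\<^sub>F p in cofinite. \<not> prime (p::nat)"
      by eventually_elim (auto simp: cong_iff_dvd_diff dest: prime_gt_1_nat)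
    then have "finite {p::nat. prime p}" by (simp add: eventually_cofinite)
    then show False using primes_infinite by simp
  qed
qed (transfer; simp add: almost_cong_def algebra_simps)+

end

instantiation poor_adele :: rat_vector
begin

lift_definition scaleQ_poor_adele :: "rat \<Rightarrow> poor_adele \<Rightarrow> poor_adele"
  is "\<lambda>q f p. rat_residue p q * f p"
  by (rule almost_cong_mult[OF almost_cong_refl])

instance
proof
  fix a b :: rat and x y :: poor_adele
  show "a *\<^sub>Q (x + y) = a *\<^sub>Q x + a *\<^sub>Q y"
    by transfer (simp add: almost_cong_def algebra_simps)
  show "(a + b) *\<^sub>Q x = a *\<^sub>Q x + b *\<^sub>Q x"
  proof (transfer, unfold almost_cong_def)
    fix a b :: rat and x :: "nat \<Rightarrow> int"
    show "\<forall>\<^sub>F p in cofinite. prime p \<longrightarrow>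
        [rat_residue p (a + b) * x p = rat_residue p a * x p + rat_residue p b * x p] (mod int p)"
      using rat_residue_add[of a b]
      by eventually_elim (auto simp flip: distrib_right intro: cong_mult)
  qed
  show "a *\<^sub>Q b *\<^sub>Q x = (a * b) *\<^sub>Q x"
  proof (transfer, unfold almost_cong_def)
    fix a b :: rat and x :: "nat \<Rightarrow> int"
    show "\<forall>\<^sub>F p in cofinite. prime p \<longrightarrow>
        [rat_residue p a * (rat_residue p b * x p) = rat_residue p (a * b) * x p] (mod int p)"
      using rat_residue_mult[of a b]
      by eventually_elim (auto simp flip: mult.assoc intro: cong_mult cong_sym)
  qed
  show "1 *\<^sub>Q x = x"
  proof (transfer, unfold almost_cong_def)
    fix x :: "nat \<Rightarrow> int"
    have "[rat_residue p 1 * x p = 1 * x p] (mod int p)" for p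
      by (intro cong_mult rat_residue_one cong_refl)
    then show "\<forall>\<^sub>F p in cofinite. prime p \<longrightarrow> [rat_residue p 1 * x p = x p] (mod int p)"
      by simp
  qed
qed

end

lift_definition poor_adele_of_rats :: "(nat \<Rightarrow> rat) \<Rightarrow> poor_adele"
  is "\<lambda>q p. rat_residue p (q p)" .

definition zeta_A :: "nat list \<Rightarrow> poor_adele"
  where "zeta_A ks = poor_adele_of_rats
    (\<lambda>p. \<Sum>ms\<in>{ms \<in> strict_tuples (length ks). \<forall>m\<in>set ms. m < p}. zeta_term ks ms)"

definition zeta_star_A :: "nat list \<Rightarrow> poor_adele"
  where "zeta_star_A ks = poor_adele_of_rats
    (\<lambda>p. \<Sum>ms\<in>{ms \<in> weak_tuples (length ks). \<forall>m\<in>set ms. m < p}. zeta_term ks ms)"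

text \<open>The generating function is \<open>t / (e^t - 1)\<close>, so that \<open>B\<^sub>1 = - 1/2\<close>.\<close>

definition bernoulli :: "nat \<Rightarrow> rat"
  where "bernoulli n = fact n * fps_nth (fps_X / (fps_exp 1 - 1)) n"

text \<open>The truncated subtraction \<open>p - k\<close> only affects the finitely many primes \<open>p < k\<close>.\<close>

definition Z_A :: "nat \<Rightarrow> poor_adele"
  where "Z_A k = poor_adele_of_rats (\<lambda>p. bernoulli (p - k) / of_nat k)"


section \<open>Multiple zeta values and their regularisation\<close>

definition mzv :: "nat list \<Rightarrow> real"
  where "mzv ks = (\<Sum>\<^sub>\<infinity>ms\<in>strict_tuples (length ks). zeta_term ks ms)"

definition mzsv :: "nat list \<Rightarrow> real"
  where "mzsv ks = (\<Sum>\<^sub>\<infinity>ms\<in>weak_tuples (length ks). zeta_term ks ms)"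

definition mzv_space :: "real set"
  where "mzv_space = rat_vector.span (mzv ` {ks. admissible ks})"

text \<open>
  The terms of the harmonic (stuffle) product of two indices, with multiplicity.
\<close>

fun stuffle :: "nat list \<Rightarrow> nat list \<Rightarrow> nat list list" where
  "stuffle [] ls = [ls]"
| "stuffle (k # ks) [] = [k # ks]"
| "stuffle (k # ks) (l # ls) =
     map ((#) k) (stuffle ks (l # ls)) @
     map ((#) l) (stuffle (k # ks) ls) @
     map ((#) (k + l)) (stuffle ks ls)"

text \<open>
  The last conjunct fixes the values at lists that are not indices, so that uniqueness holds
  for functions on all lists.
\<close>

definition is_harmonic_regularisation :: "(nat list \<Rightarrow> real) \<Rightarrow> bool"
  where "is_harmonic_regularisation Z \<longleftrightarrow>
    (\<forall>ks. admissible ks \<longrightarrow> Z ks = mzv ks) \<and>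
    (\<forall>ks ls. is_index ks \<longrightarrow> is_index ls \<longrightarrow> Z ks * Z ls = (\<Sum>w\<leftarrow>stuffle ks ls. Z w)) \<and>
    Z [1] = 0 \<and>
    (\<forall>ks. \<not> is_index ks \<longrightarrow> Z ks = 0)"

definition zeta_reg :: "nat list \<Rightarrow> real"
  where "zeta_reg = (THE Z. is_harmonic_regularisation Z)"

text \<open>
  All indices obtained by replacing some of the commas of \<open>(k\<^sub>1, \<dots>, k\<^sub>r)\<close> by plus signs.
\<close>

fun merges :: "nat list \<Rightarrow> nat list list" where
  "merges [] = [[]]"
| "merges [k] = [[k]]"
| "merges (k # l # ks) = map ((#) k) (merges (l # ks)) @ merges ((k + l) # ks)"

text \<open>
  On admissible indices the series \<open>mzsv\<close> agrees with the sum over \<open>merges\<close>; the first branch keeps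
  the definition of convergent values as series.
\<close>

definition zeta_star_reg :: "nat list \<Rightarrow> real"
  where "zeta_star_reg ks =
    (if admissible ks then mzsv ks else (\<Sum>ls\<leftarrow>merges ks. zeta_reg ls))"


section \<open>The quotient \<open>\<Z>/\<zeta>(2)\<Z>\<close> and symmetric multiple zeta values\<close>

definition zeta2_cong :: "real \<Rightarrow> real \<Rightarrow> bool"
  where "zeta2_cong x y \<longleftrightarrow>
    x \<in> mzv_space \<and> y \<in> mzv_space \<and> x - y \<in> (\<lambda>z. mzv [2] * z) ` mzv_space"

lemma mzv_space_closed:
  "0 \<in> mzv_space"
  "x \<in> mzv_space \<Longrightarrow> y \<in> mzv_space \<Longrightarrow> x + y \<in> mzv_space"
  "x \<in> mzv_space \<Longrightarrow> y \<in> mzv_space \<Longrightarrow> x - y \<in> mzv_space"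
  "x \<in> mzv_space \<Longrightarrow> - x \<in> mzv_space"
  "x \<in> mzv_space \<Longrightarrow> q *\<^sub>Q x \<in> mzv_space"
  unfolding mzv_space_def
  by (rule rat_vector.span_zero rat_vector.span_add rat_vector.span_diff rat_vector.span_neg
      rat_vector.span_scale; assumption)+

lemma zeta2_cong_zero: "zeta2_cong 0 0"
  by (auto simp: zeta2_cong_def mzv_space_closed intro!: image_eqI[where x = 0])

lemma zeta2_cong_add:
  assumes "zeta2_cong x x'" "zeta2_cong y y'"
  shows "zeta2_cong (x + y) (x' + y')"
proof -
  obtain u v where "u \<in> mzv_space" "x - x' = mzv [2] * u" "v \<in> mzv_space" "y - y' = mzv [2] * v"
    using assms by (auto simp: zeta2_cong_def)
  then have "x + y - (x' + y') = mzv [2] * (u + v)" "u + v \<in> mzv_space"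
    by (simp_all add: mzv_space_closed distrib_left)
  then show ?thesis using assms by (auto simp: zeta2_cong_def mzv_space_closed)
qed

lemma zeta2_cong_scaleQ:
  assumes "zeta2_cong x x'"
  shows "zeta2_cong (q *\<^sub>Q x) (q *\<^sub>Q x')"
proof -
  obtain u where "u \<in> mzv_space" "x - x' = mzv [2] * u"
    using assms by (auto simp: zeta2_cong_def)
  moreover from this have "q *\<^sub>Q x - q *\<^sub>Q x' = mzv [2] * (q *\<^sub>Q u)"
    by (simp add: scaleQ_real_def flip: right_diff_distrib)
  ultimately show ?thesis using assms by (auto simp: zeta2_cong_def mzv_space_closed)
qed

lemma zeta2_cong_uminus: "zeta2_cong x x' \<Longrightarrow> zeta2_cong (- x) (- x')"
  using zeta2_cong_scaleQ[of x x' "- 1"] by (simp add: scaleQ_real_def of_rat_minus)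

lemma zeta2_cong_part_equivp: "part_equivp zeta2_cong"
proof (rule part_equivpI)
  show "\<exists>x. zeta2_cong x x" using zeta2_cong_zero by blast
  show "symp zeta2_cong"
  proof (rule sympI)
    fix x y assume *: "zeta2_cong x y"
    then obtain u where "u \<in> mzv_space" "x - y = mzv [2] * u" by (auto simp: zeta2_cong_def)
    then have "y - x = mzv [2] * (- u)" "- u \<in> mzv_space" by (simp_all add: mzv_space_closed)
    then have "y - x \<in> (\<lambda>z. mzv [2] * z) ` mzv_space" by blast
    then show "zeta2_cong y x" using * by (simp add: zeta2_cong_def)
  qed
  show "transp zeta2_cong"
  proof (rule transpI)
    fix x y z assume *: "zeta2_cong x y" "zeta2_cong y z"
    then obtain u v where "u \<in> mzv_space" "x - y = mzv [2] * u" "v \<in> mzv_space" "y - z = mzv [2] * v"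
      by (auto simp: zeta2_cong_def)
    then have "x - z = mzv [2] * (u + v)" "u + v \<in> mzv_space"
      by (simp_all add: mzv_space_closed distrib_left)
    then show "zeta2_cong x z" using * by (auto simp: zeta2_cong_def)
  qed
qed

text \<open>
  The relation is reflexive exactly on \<open>\<Z>\<close>, so the elements of the quotient type are the cosets in
  \<open>\<Z>/\<zeta>(2)\<Z>\<close>; \<open>mod_zeta2\<close> is only meaningful on elements of \<open>\<Z>\<close>.
\<close>

quotient_type mzv_quot = real / partial: zeta2_cong
  morphisms rep_mzv_quot mod_zeta2
  by (rule zeta2_cong_part_equivp)

instantiation mzv_quot :: rat_vector
begin

lift_definition zero_mzv_quot :: mzv_quot is 0
  by (rule zeta2_cong_zero)

lift_definition plus_mzv_quot :: "mzv_quot \<Rightarrow> mzv_quot \<Rightarrow> mzv_quot" is "(+)"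
  by (rule zeta2_cong_add)

lift_definition uminus_mzv_quot :: "mzv_quot \<Rightarrow> mzv_quot" is uminus
  by (rule zeta2_cong_uminus)

lift_definition minus_mzv_quot :: "mzv_quot \<Rightarrow> mzv_quot \<Rightarrow> mzv_quot" is "(-)"
  using zeta2_cong_add zeta2_cong_uminus by fastforce

lift_definition scaleQ_mzv_quot :: "rat \<Rightarrow> mzv_quot \<Rightarrow> mzv_quot" is scaleQ
  by (rule zeta2_cong_scaleQ)

instance
proof
  fix a b :: rat and x y z :: mzv_quot
  show "x + y + z = x + (y + z)"
    by transfer (metis add.assoc zeta2_cong_add)
  show "x + y = y + x"
    by transfer (metis add.commute zeta2_cong_add)
  show "0 + x = x" by transfer simp
  show "- x + x = 0"
    by transfer (simp add: zeta2_cong_zero)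
  show "x - y = x + - y"
    by transfer (metis diff_conv_add_uminus zeta2_cong_add zeta2_cong_uminus)
  show "a *\<^sub>Q (x + y) = a *\<^sub>Q x + a *\<^sub>Q y"
    by transfer (metis scaleQ_add_right zeta2_cong_add zeta2_cong_scaleQ)
  show "(a + b) *\<^sub>Q x = a *\<^sub>Q x + b *\<^sub>Q x"
    by transfer (metis scaleQ_add_left zeta2_cong_scaleQ)
  show "a *\<^sub>Q b *\<^sub>Q x = (a * b) *\<^sub>Q x"
    by transfer (metis scaleQ_scaleQ zeta2_cong_scaleQ)
  show "1 *\<^sub>Q x = x" by transfer (simp add: scaleQ_one)
qed

end

definition symmetric_sum :: "(nat list \<Rightarrow> real) \<Rightarrow> nat list \<Rightarrow> real"
  where "symmetric_sum Z ks =
    (\<Sum>j\<le>length ks. (- 1) ^ sum_list (take j ks) * Z (rev (take j ks)) * Z (drop j ks))"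

definition zeta_S :: "nat list \<Rightarrow> mzv_quot"
  where "zeta_S ks = mod_zeta2 (symmetric_sum zeta_reg ks)"

definition zeta_star_S :: "nat list \<Rightarrow> mzv_quot"
  where "zeta_star_S ks = mod_zeta2 (symmetric_sum zeta_star_reg ks)"

definition Z_S :: "nat \<Rightarrow> mzv_quot"
  where "Z_S k = mod_zeta2 (mzv [k])"

end

theory Submission
  imports Defs "HOL-Number_Theory.Residues" "HOL-Analysis.Harmonic_Numbers" "HOL-Computational_Algebra.Polynomial"
begin

text \<open>
  The finite and the symmetric values both come from multiple harmonic sums over a finite list that
  reversal turns into its negative: the reciprocals of \<open>1, \<dots>, p - 1\<close> modulo \<open>p\<close>, and those of the
  nonzero integers in \<open>[- N, N]\<close> as \<open>N\<close> tends to infinity. The values at \<open>(1, \<dots>, 1)\<close>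
  vanish (modulo \<open>\<zeta>(2)\<close> in the symmetric case), and multiplying a generating function by the one of these values
  replaces every condition \<open>k\<^sub>i \<ge> d\<close> by \<open>k\<^sub>i = d\<close>, all other entries being 1. This reduces the sums in
  question to the values at \<open>(1, \<dots>, 3, \<dots>, 1)\<close> and \<open>(1, \<dots>, 2, \<dots>, 2, \<dots>, 1)\<close>. The antipode relation
  compares them with the star values up to products, one factor of which is a value of even weight
  at \<open>(1, \<dots>, 2, \<dots>, 1)\<close> and vanishes.

  Modulo \<open>p\<close>, Hoffman's duality turns the remaining values into star values of depth three and odd
  weight, hence into values of depth two, which are multiples of Bernoulli numbers. For the
  symmetric values, a rearrangement of series expresses them by double zeta values of odd weight
  \<open>k\<close>, which the double shuffle relations place in \<open>\<rat> \<zeta>(k)\<close> modulo \<open>\<zeta>(2)\<close>.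
\<close>

section \<open>Multiple harmonic sums over lists\<close>

text \<open>The generating function identity sees all depths at once, whereas the theorem fixes the
  depth and the positions of the large entries. Therefore the entries between marked positions carry
  integer weights: the resulting sums are polynomials in these weights, and membership of all their
  values in a rational vector space passes to the coefficients. The same interpolation later
  separates the coefficients of the rearranged series.

  For the symmetric values the obstacle is divergence: a truncated sum whose index begins with ones
  grows like a polynomial in the harmonic number. It factors into a divergent power series, built
  from ones only, and convergent sums. In the two halves of the symmetric list the divergent factors
  combine to the truncated product of all 1 - X^2 / m^2, whose limit is 1 modulo \<zeta>(2). For the
  convergent sums, summing products of shifted linear factors in two different orders turns runs of
  ones into powers of a single denominator; this takes the place that duality has modulo p.\<close>

fun msum :: "'a::comm_ring_1 list \<Rightarrow> nat list \<Rightarrow> 'a" where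
  "msum xs [] = 1"
| "msum [] (k # ks) = 0"
| "msum (x # xs) (k # ks) = x ^ k * msum xs ks + msum xs (k # ks)"

fun msum_star :: "'a::comm_ring_1 list \<Rightarrow> nat list \<Rightarrow> 'a" where
  "msum_star xs [] = 1"
| "msum_star [] (k # ks) = 0"
| "msum_star (x # xs) (k # ks) = x ^ k * msum_star (x # xs) ks + msum_star xs (k # ks)"

lemma msum_Nil: "msum [] ks = (if ks = [] then 1 else 0)"
  by (cases ks) simp_all

lemma msum_star_Nil: "msum_star [] ks = (if ks = [] then 1 else 0)"
  by (cases ks) simp_all

text \<open>The convolution dual to cutting an index into a prefix and a suffix. It describes
  concatenation of lists of variables, because the variables taken from the first list receive a
  prefix of the index.\<close>

definition deconc :: "('b list \<Rightarrow> 'a::comm_ring_1) \<Rightarrow> ('b list \<Rightarrow> 'a) \<Rightarrow> 'b list \<Rightarrow> 'a"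
  where "deconc f g ks = (\<Sum>j\<le>length ks. f (take j ks) * g (drop j ks))"

lemma deconc_Nil [simp]: "deconc f g [] = f [] * g []"
  by (simp add: deconc_def)

lemma deconc_Cons [simp]:
  "deconc f g (k # ks) = f [] * g (k # ks) + deconc (\<lambda>l. f (k # l)) g ks"
  unfolding deconc_def by (simp add: sum.atMost_Suc_shift del: sum.atMost_Suc)

lemma deconc_add_left: "deconc (\<lambda>l. f l + f' l) g ks = deconc f g ks + deconc f' g ks"
  by (simp add: deconc_def distrib_right sum.distrib)

lemma deconc_scale_left: "deconc (\<lambda>l. c * f l) g ks = c * deconc f g ks"
  by (simp add: deconc_def sum_distrib_left mult.assoc)

lemma deconc_unit_left: "deconc (\<lambda>l. if l = [] then c else 0) g ks = c * g ks"
proof -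
  have "(\<Sum>j\<le>length ks. (if take j ks = [] then c else 0) * g (drop j ks))
      = (\<Sum>j\<le>length ks. if j = 0 then c * g ks else 0)"
    by (intro sum.cong) auto
  then show ?thesis by (simp add: deconc_def)
qed

lemma deconc_assoc: "deconc f (deconc g h) ks = deconc (deconc f g) h ks"
proof (induction ks arbitrary: f g)
  case (Cons k ks)
  have "deconc (\<lambda>l. f [] * g (k # l) + deconc (\<lambda>l. f (k # l)) g l) h ks
      = f [] * deconc (\<lambda>l. g (k # l)) h ks + deconc (\<lambda>l. f (k # l)) (deconc g h) ks"
    by (simp add: deconc_add_left deconc_scale_left Cons.IH)
  then show ?case by (simp add: algebra_simps)
qed (simp add: mult.assoc)

lemma deconc_rev: "deconc f g (rev ks) = deconc (\<lambda>l. g (rev l)) (\<lambda>l. f (rev l)) ks"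
proof -
  have "deconc f g (rev ks) = (\<Sum>j\<le>length ks. f (take (length ks - j) (rev ks)) * g (drop (length ks - j) (rev ks)))"
    unfolding deconc_def by (subst sum.atLeastAtMost_rev[of _ 0, unfolded atMost_atLeast0[symmetric]]) simp
  also have "\<dots> = deconc (\<lambda>l. g (rev l)) (\<lambda>l. f (rev l)) ks"
    unfolding deconc_def by (intro sum.cong) (auto simp: rev_take rev_drop mult.commute)
  finally show ?thesis .
qed

lemma msum_append: "msum (xs @ ys) ks = deconc (msum xs) (msum ys) ks"
proof (induction xs arbitrary: ks)
  case Nil
  have "deconc (msum []) (msum ys) ks = deconc (\<lambda>l. if l = [] then 1 else 0) (msum ys) ks"
    by (rule arg_cong[where f = "\<lambda>f. deconc f _ _"], rule ext, case_tac l) auto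
  then show ?case by (simp add: deconc_unit_left)
next
  case (Cons x xs)
  show ?case
    by (cases ks) (simp_all add: Cons.IH deconc_add_left deconc_scale_left add_ac)
qed

lemma msum_star_append: "msum_star (xs @ ys) ks = deconc (msum_star xs) (msum_star ys) ks"
proof (induction xs ks rule: msum_star.induct)
  case (2 k ks)
  have "deconc (msum_star []) (msum_star ys) (k # ks)
      = deconc (\<lambda>l. if l = [] then 1 else 0) (msum_star ys) (k # ks)"
    by (rule arg_cong[where f = "\<lambda>f. deconc f _ _"], rule ext, case_tac l) auto
  then show ?case by (simp only: deconc_unit_left append_Nil) simp
next
  case (3 x xs k ks)
  then show ?case
    by (simp add: deconc_add_left deconc_scale_left distrib_left add_ac)
qed simp

lemma msum_single: "msum [x] ks = (case ks of [] \<Rightarrow> 1 | [k] \<Rightarrow> x ^ k | _ \<Rightarrow> 0)"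
  by (auto split: list.splits simp: msum_Nil)

lemma msum_single_rev: "msum [x] (rev ks) = msum [x] ks"
proof (cases "length ks \<le> 1")
  case True
  then show ?thesis by (cases ks) auto
next
  case False
  have "msum [x] l = 0" if "length l \<ge> 2" for l
    using that by (auto simp: msum_single split: list.splits)
  with False show ?thesis by simp
qed

lemma msum_star_single: "msum_star [x] ks = x ^ sum_list ks"
  by (induction ks) (auto simp: power_add)

lemma msum_rev: "msum (rev xs) (rev ks) = msum xs ks"
proof (induction xs arbitrary: ks)
  case (Cons x xs)
  have "msum (rev (x # xs)) (rev ks) = deconc (msum (rev xs)) (msum [x]) (rev ks)"
    by (simp add: msum_append)
  also have "\<dots> = deconc (msum [x]) (msum xs) ks"
    by (simp add: deconc_rev msum_single_rev Cons.IH)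
  also have "\<dots> = msum (x # xs) ks" by (simp flip: msum_append)
  finally show ?case .
qed (simp add: msum_Nil)

lemma msum_star_rev: "msum_star (rev xs) (rev ks) = msum_star xs ks"
proof (induction xs arbitrary: ks)
  case (Cons x xs)
  have "msum_star (rev (x # xs)) (rev ks) = deconc (msum_star (rev xs)) (msum_star [x]) (rev ks)"
    by (simp add: msum_star_append)
  also have "\<dots> = deconc (msum_star [x]) (msum_star xs) ks"
    by (simp add: deconc_rev msum_star_single[abs_def] Cons.IH)
  also have "\<dots> = msum_star (x # xs) ks" by (simp flip: msum_star_append)
  finally show ?case .
qed (simp add: msum_star_Nil)

lemma msum_map_uminus: "msum (map uminus xs) ks = (- 1) ^ sum_list ks * msum xs ks"
proof (induction xs ks rule: msum.induct)
  case (3 x xs k ks)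
  then show ?case by (simp add: power_add power_minus[of x] algebra_simps)
qed auto

lemma msum_star_map_uminus: "msum_star (map uminus xs) ks = (- 1) ^ sum_list ks * msum_star xs ks"
proof (induction xs ks rule: msum_star.induct)
  case (3 x xs k ks)
  then show ?case by (simp add: power_add power_minus[of x] algebra_simps)
qed auto

text \<open>Under concatenation of lists both factors are multiplicative for \<open>deconc\<close>,
  in opposite orders. So the convolution for \<open>x # xs\<close> has the one for \<open>xs\<close>
  in its middle, which is the unit by induction. What remains is the case of one variable, where
  only the cuts after 0 and 1 entries contribute, with opposite signs.\<close>

lemma msum_antipode:
  "(\<Sum>j\<le>length ks. (- 1) ^ j * msum xs (take j ks) * msum_star xs (rev (drop j ks)))
     = (if ks = [] then 1 else 0)"
proof -
  define f where "f xs l = (- 1) ^ length l * msum xs l" for xs :: "'a list" and l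
  define g where "g xs l = msum_star xs (rev l)" for xs :: "'a list" and l
  have f_append: "f (xs @ ys) = deconc (f xs) (f ys)" for xs ys
  proof
    fix l :: "nat list"
    have "(- 1) ^ length l = (- 1) ^ j * (- 1 :: 'a) ^ (length l - j)" if "j \<le> length l" for j
      using that by (simp flip: power_add)
    then show "f (xs @ ys) l = deconc (f xs) (f ys) l"
      unfolding f_def msum_append deconc_def sum_distrib_left
      by (intro sum.cong) (auto simp: min_def)
  qed
  have g_append: "g (x # xs) = deconc (g xs) (g [x])" for x xs
  proof
    fix l
    have "g (x # xs) l = deconc (msum_star [x]) (msum_star xs) (rev l)"
      unfolding g_def by (simp flip: msum_star_append)
    then show "g (x # xs) l = deconc (g xs) (g [x]) l"
      by (simp add: deconc_rev g_def[abs_def])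
  qed
  have single: "deconc (f [x]) (g [x]) l = (if l = [] then 1 else 0)" for x l
  proof (cases l)
    case (Cons k l')
    have "f [x] (k # m) = (if m = [] then - (x ^ k) else 0)" for m
      by (cases m) (auto simp: f_def)
    then have "deconc (\<lambda>m. f [x] (k # m)) (g [x]) l' = - (x ^ k) * g [x] l'"
      by (simp add: deconc_unit_left)
    with Cons show ?thesis
      by (simp add: f_def g_def msum_star_single power_add)
  qed (simp add: f_def g_def)
  have "deconc (f xs) (g xs) = (\<lambda>l. if l = [] then 1 else 0)"
  proof (induction xs)
    case Nil
    have "f [] = (\<lambda>l. if l = [] then 1 else 0)" "g [] = (\<lambda>l. if l = [] then 1 else 0)"
      by (auto simp: f_def g_def fun_eq_iff msum_Nil msum_star_Nil)
    then show ?case by (auto simp: deconc_unit_left)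
  next
    case (Cons x xs)
    have assoc: "deconc p (deconc q h) = deconc (deconc p q) h"
      for p q h :: "nat list \<Rightarrow> 'a"
      by (rule ext) (rule deconc_assoc)
    have "deconc (f (x # xs)) (g (x # xs)) = deconc (f ([x] @ xs)) (deconc (g xs) (g [x]))"
      by (simp only: g_append[of x xs] append.simps)
    also have "\<dots> = deconc (f [x]) (deconc (deconc (f xs) (g xs)) (g [x]))"
      unfolding f_append by (simp only: assoc)
    also have "\<dots> = deconc (f [x]) (g [x])"
      by (simp only: Cons.IH deconc_unit_left[where c = 1, simplified, abs_def])
    finally show ?case by (simp only: single[abs_def])
  qed
  then have "(if ks = [] then 1 else 0) = deconc (f xs) (g xs) ks" by simp
  also have "\<dots> = (\<Sum>j\<le>length ks. (- 1) ^ j * msum xs (take j ks) * msum_star xs (rev (drop j ks)))"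
    unfolding deconc_def f_def g_def by (intro sum.cong) (auto simp: min_def)
  finally show ?thesis by simp
qed

text \<open>This is the recursion that defines \<open>msum_star\<close>: an equality between
  consecutive summation variables adds their exponents, so a weakly ordered sum is the sum of
  strictly ordered ones over all merges.\<close>

lemma msum_merges:
  "(\<Sum>l\<leftarrow>merges (k # ks). msum (x # xs) l) =
     x ^ k * (\<Sum>l\<leftarrow>merges ks. msum (x # xs) l) + (\<Sum>l\<leftarrow>merges (k # ks). msum xs l)"
proof (induction "k # ks" arbitrary: k ks rule: merges.induct)
  case (3 k l ks)
  then show ?case
    by (simp add: o_def sum_list_addf sum_list_const_mult power_add distrib_left mult.assoc add_ac)
qed simp

lemma msum_star_eq_merges: "msum_star xs ks = (\<Sum>l\<leftarrow>merges ks. msum xs l)"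
proof (induction xs ks rule: msum_star.induct)
  case (2 k ks)
  have "(\<Sum>l\<leftarrow>merges (k # ks). msum [] l) = (0 :: 'a)"
    by (induction "k # ks" arbitrary: k ks rule: merges.induct) (simp_all add: o_def)
  then show ?case by simp
next
  case (3 x xs k ks)
  then show ?case by (simp only: msum_merges msum_star.simps)
qed simp

section \<open>Weighted sums over indices\<close>

definition indices :: "nat \<Rightarrow> nat list set"
  where "indices n = {ks. is_index ks \<and> sum_list ks = n}"

lemma length_le_sum_list: "is_index ks \<Longrightarrow> length ks \<le> sum_list ks"
  by (induction ks) (auto simp: is_index_def)

lemma finite_lists_sum_list_le: "finite {ks::nat list. length ks \<le> r \<and> sum_list ks \<le> n}"
proof (rule finite_subset)
  show "finite {ks. set ks \<subseteq> {..n} \<and> length ks \<le> r}" by (rule finite_lists_length_le) simp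
qed (use member_le_sum_list in fastforce)

lemma finite_indices [simp]: "finite (indices n)"
  by (rule finite_subset[OF _ finite_lists_sum_list_le[of n n]])
     (auto simp: indices_def length_le_sum_list)

lemma indices_0: "indices 0 = {[]}"
proof -
  have "ks = []" if "ks \<in> indices 0" for ks
    using that by (cases ks) (auto simp: indices_def is_index_def)
  then show ?thesis by (auto simp: indices_def is_index_def)
qed

lemma indices_decompose:
  assumes "n > 0"
  shows "indices n = (\<Union>k\<in>{1..n}. (#) k ` indices (n - k))"
proof (intro equalityI subsetI)
  fix ks assume "ks \<in> indices n"
  then show "ks \<in> (\<Union>k\<in>{1..n}. (#) k ` indices (n - k))"
  proof (cases ks)
    case (Cons k l)
    with \<open>ks \<in> indices n\<close> have "k \<in> {1..n}" "l \<in> indices (n - k)"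
      by (auto simp: indices_def is_index_def)
    with Cons show ?thesis by blast
  qed (use assms in \<open>auto simp: indices_def\<close>)
qed (auto simp: indices_def is_index_def)

lemma sum_indices:
  assumes "n > 0"
  shows "(\<Sum>ks\<in>indices n. f ks) = (\<Sum>k\<in>{1..n}. \<Sum>ks\<in>indices (n - k). f (k # ks))"
proof -
  have "(\<Sum>ks\<in>indices n. f ks) = (\<Sum>k\<in>{1..n}. \<Sum>ks\<in>(#) k ` indices (n - k). f ks)"
    unfolding indices_decompose[OF assms] by (intro sum.UNION_disjoint) auto
  also have "\<dots> = (\<Sum>k\<in>{1..n}. \<Sum>ks\<in>indices (n - k). f (k # ks))"
    by (intro sum.cong refl sum.reindex_cong[where l = "(#) _"]) (auto simp: inj_on_def)
  finally show ?thesis .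
qed

text \<open>
  \<open>marked l ts ks\<close> sums, over all ways of marking \<open>length ts\<close> entries of \<open>ks\<close>, the product of the
  weights of the entries: unmarked entries are weighted by \<open>l\<close> until the first marked entry, which
  is weighted by the first component of the head of \<open>ts\<close>, and so on. \<open>marked_gf\<close> is
  the corresponding generating function of the sums \<open>msum xs ks\<close>.
\<close>

fun marked :: "(nat \<Rightarrow> int) \<Rightarrow> ((nat \<Rightarrow> int) \<times> (nat \<Rightarrow> int)) list \<Rightarrow> nat list \<Rightarrow> int" where
  "marked l [] [] = 1"
| "marked l (t # ts) [] = 0"
| "marked l [] (k # ks) = l k * marked l [] ks"
| "marked l ((t, l') # ts) (k # ks) = l k * marked l ((t, l') # ts) ks + t k * marked l' ts ks"

definition letter_gf :: "(nat \<Rightarrow> int) \<Rightarrow> 'a::comm_ring_1 \<Rightarrow> 'a fps"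
  where "letter_gf l x = Abs_fps (\<lambda>k. if k = 0 then 0 else of_int (l k) * x ^ k)"

fun marked_gf :: "(nat \<Rightarrow> int) \<Rightarrow> ((nat \<Rightarrow> int) \<times> (nat \<Rightarrow> int)) list \<Rightarrow> 'a::comm_ring_1 list \<Rightarrow> 'a fps" where
  "marked_gf l [] [] = 1"
| "marked_gf l (t # ts) [] = 0"
| "marked_gf l [] (x # xs) = (1 + letter_gf l x) * marked_gf l [] xs"
| "marked_gf l ((t, l') # ts) (x # xs) =
     (1 + letter_gf l x) * marked_gf l ((t, l') # ts) xs + letter_gf t x * marked_gf l' ts xs"

lemma fps_nth_letter_gf_mult:
  "fps_nth (letter_gf l x * F) n = (\<Sum>k\<in>{1..n}. of_int (l k) * x ^ k * fps_nth F (n - k))"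
proof -
  have "fps_nth (letter_gf l x * F) n = (\<Sum>k\<in>{0..n}. fps_nth (letter_gf l x) k * fps_nth F (n - k))"
    by (simp add: fps_mult_nth)
  also have "\<dots> = (\<Sum>k\<in>{1..n}. of_int (l k) * x ^ k * fps_nth F (n - k))"
    by (intro sum.mono_neutral_cong_right) (auto simp: letter_gf_def)
  finally show ?thesis .
qed

text \<open>Each list entry \<open>x\<close> is either skipped, which is the summand 1, or raised to
  the first exponent of the index, which is then unmarked (weight \<open>l\<close>) or the next
  marked one (weight \<open>t\<close>).\<close>

lemma fps_nth_marked_gf:
  "fps_nth (marked_gf l ts xs) n = (\<Sum>ks\<in>indices n. of_int (marked l ts ks) * msum xs ks)"
proof (induction l ts xs arbitrary: n rule: marked_gf.induct)
  case (1 l)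
  have "(\<Sum>ks\<in>indices n. of_int (marked l [] ks) * msum [] ks) = (if n = 0 then 1 else (0::'a))"
  proof (cases "n = 0")
    case False
    then have "[] \<notin> indices n" by (auto simp: indices_def)
    with False show ?thesis by (auto simp: msum_Nil intro!: sum.neutral)
  qed (simp add: indices_0)
  then show ?case by simp
next
  case (2 l t ts)
  have "of_int (marked l (t # ts) ks) * msum [] ks = (0::'a)" for ks
    by (cases ks) auto
  then show ?case by simp
next
  case (3 l x xs)
  show ?case
  proof (cases "n = 0")
    case False
    then have n: "n > 0" by simp
    have "(\<Sum>ks\<in>indices n. of_int (marked l [] ks) * msum (x # xs) ks)
        = (\<Sum>ks\<in>indices n. of_int (marked l [] ks) * msum xs ks)
        + (\<Sum>k\<in>{1..n}. of_int (l k) * x ^ k * (\<Sum>ks\<in>indices (n - k). of_int (marked l [] ks) * msum xs ks))"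
      by (simp add: sum_indices[OF n] sum_distrib_left sum.distrib[symmetric] algebra_simps)
    then show ?thesis
      by (simp add: distrib_right "3.IH" fps_nth_letter_gf_mult)
  qed (simp add: indices_0 3 letter_gf_def)
next
  case (4 l t l' ts x xs)
  show ?case
  proof (cases "n = 0")
    case False
    then have n: "n > 0" by simp
    have "(\<Sum>ks\<in>indices n. of_int (marked l ((t, l') # ts) ks) * msum (x # xs) ks)
        = (\<Sum>ks\<in>indices n. of_int (marked l ((t, l') # ts) ks) * msum xs ks)
        + (\<Sum>k\<in>{1..n}. of_int (l k) * x ^ k * (\<Sum>ks\<in>indices (n - k). of_int (marked l ((t, l') # ts) ks) * msum xs ks))
        + (\<Sum>k\<in>{1..n}. of_int (t k) * x ^ k * (\<Sum>ks\<in>indices (n - k). of_int (marked l' ts ks) * msum xs ks))"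
      by (simp add: sum_indices[OF n] sum_distrib_left sum.distrib[symmetric] algebra_simps)
    then show ?thesis
      by (simp add: distrib_right "4.IH" fps_nth_letter_gf_mult)
  qed (simp add: indices_0 4 letter_gf_def)
qed

section \<open>Turning lower bounds on entries into equalities\<close>

definition eq_wt :: "nat \<Rightarrow> int \<Rightarrow> nat \<Rightarrow> int"
  where "eq_wt d c k = (if k = d then c else 0)"

definition geq_wt :: "nat \<Rightarrow> nat \<Rightarrow> int"
  where "geq_wt d k = (if k \<ge> d then 1 else 0)"

lemma letter_gf_only: "d > 0 \<Longrightarrow> letter_gf (eq_wt d c) x = fps_const (of_int c * x ^ d) * fps_X ^ d"
  by (rule fps_ext) (auto simp: letter_gf_def eq_wt_def fps_X_power_nth)

text \<open>The left factor is 1 - x X, which collapses the geometric series of all x^k X^k with k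
  \<ge> d to its first term.\<close>

lemma letter_gf_from:
  assumes "d > 0"
  shows "(1 + letter_gf (eq_wt 1 (- 1)) x) * letter_gf (geq_wt d) x = letter_gf (eq_wt d 1) x"
proof (rule fps_ext)
  fix n
  show "fps_nth ((1 + letter_gf (eq_wt 1 (- 1)) x) * letter_gf (geq_wt d) x) n
      = fps_nth (letter_gf (eq_wt d 1) x) n"
  proof (cases n)
    case (Suc m)
    have "fps_nth (letter_gf (eq_wt 1 (- 1)) x * letter_gf (geq_wt d) x) n
        = - x * fps_nth (letter_gf (geq_wt d) x) m"
      by (simp add: letter_gf_only Suc fps_mult_fps_X_commute mult.assoc)
    then show ?thesis
      using assms by (auto simp: distrib_right letter_gf_def Suc eq_wt_def geq_wt_def le_Suc_eq)
  qed (simp add: letter_gf_def)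
qed

lemma letter_gf_const:
  "(1 + letter_gf (eq_wt 1 (- 1)) x) * (1 + letter_gf (\<lambda>_. c) x) = 1 + letter_gf (eq_wt 1 (c - 1)) x"
proof -
  have "letter_gf (\<lambda>_. c) x = fps_const (of_int c) * letter_gf (geq_wt 1) x"
    by (rule fps_ext) (auto simp: letter_gf_def geq_wt_def)
  then have "(1 + letter_gf (eq_wt 1 (- 1)) x) * (1 + letter_gf (\<lambda>_. c) x)
      = 1 + letter_gf (eq_wt 1 (- 1)) x + fps_const (of_int c) * ((1 + letter_gf (eq_wt 1 (- 1)) x) * letter_gf (geq_wt 1) x)"
    by (simp add: algebra_simps)
  also have "\<dots> = 1 + letter_gf (eq_wt 1 (c - 1)) x"
    unfolding letter_gf_from[OF zero_less_one]
    by (rule fps_ext) (auto simp: letter_gf_def eq_wt_def algebra_simps)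
  finally show ?thesis .
qed

text \<open>
  Multiplying each factor \<open>1 + c x / (1 - x)\<close> by \<open>1 - x\<close> turns the unrestricted entries
  into ones; the entries \<open>\<ge> d\<close> turn into entries \<open>d\<close>.
\<close>

lemma marked_gf_from:
  assumes "\<forall>(d, c)\<in>set ts. d > 0"
  shows "marked_gf (eq_wt 1 (- 1)) [] xs * marked_gf (\<lambda>_. c) (map (\<lambda>(d, c). (geq_wt d, \<lambda>_. c)) ts) xs
    = marked_gf (eq_wt 1 (c - 1)) (map (\<lambda>(d, c). (eq_wt d 1, eq_wt 1 (c - 1))) ts) xs"
  using assms
proof (induction xs arbitrary: c ts)
  case Nil
  then show ?case by (cases ts) auto
next
  case (Cons x xs)
  let ?a = "1 + letter_gf (eq_wt 1 (- 1)) x"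
  let ?E = "marked_gf (eq_wt 1 (- 1)) [] xs"
  show ?case
  proof (cases ts)
    case Nil
    have "?a * ?E * ((1 + letter_gf (\<lambda>_. c) x) * marked_gf (\<lambda>_. c) [] xs)
      = (?a * (1 + letter_gf (\<lambda>_. c) x)) * (?E * marked_gf (\<lambda>_. c) [] xs)"
      by (simp only: ac_simps)
    also have "\<dots> = (1 + letter_gf (eq_wt 1 (c - 1)) x) * marked_gf (eq_wt 1 (c - 1)) [] xs"
      using Cons.IH[of "[]" c] by (simp add: letter_gf_const[unfolded One_nat_def])
    finally show ?thesis using Nil by simp
  next
    case (Cons t ts')
    obtain d c' where t: "t = (d, c')" by (cases t)
    let ?G = "marked_gf (\<lambda>_. c) (map (\<lambda>(d, c). (geq_wt d, \<lambda>_. c)) ts) xs"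
    let ?G' = "marked_gf (\<lambda>_. c') (map (\<lambda>(d, c). (geq_wt d, \<lambda>_. c)) ts') xs"
    have d: "d > 0" using Cons.prems Cons t by auto
    have distrib: "a * e * (b * g + t * h) = (a * b) * (e * g) + (a * t) * (e * h)"
      for a b e g h t :: "'a fps"
      by (simp add: algebra_simps)
    have "?a * ?E * ((1 + letter_gf (\<lambda>_. c) x) * ?G + letter_gf (geq_wt d) x * ?G')
      = (?a * (1 + letter_gf (\<lambda>_. c) x)) * (?E * ?G) + (?a * letter_gf (geq_wt d) x) * (?E * ?G')"
      by (rule distrib)
    also have "\<dots> = (1 + letter_gf (eq_wt 1 (c - 1)) x)
          * marked_gf (eq_wt 1 (c - 1)) (map (\<lambda>(d, c). (eq_wt d 1, eq_wt 1 (c - 1))) ts) xs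
        + letter_gf (eq_wt d 1) x
          * marked_gf (eq_wt 1 (c' - 1)) (map (\<lambda>(d, c). (eq_wt d 1, eq_wt 1 (c - 1))) ts') xs"
      using Cons.IH[of ts c] Cons.IH[of ts' c'] Cons.prems
      by (simp only: letter_gf_const letter_gf_from[OF d]) (simp add: Cons)
    finally show ?thesis by (simp add: Cons t)
  qed
qed

definition weighted_sum :: "(nat list \<Rightarrow> 'a::comm_ring_1) \<Rightarrow> (nat list \<Rightarrow> int) \<Rightarrow> nat \<Rightarrow> 'a"
  where "weighted_sum Z w n = (\<Sum>ks\<in>indices n. of_int (w ks) * Z ks)"

lemma weighted_sum_from:
  assumes "\<forall>(d, c)\<in>set ts. d > 0"
  shows "(\<Sum>m\<le>n. weighted_sum (msum xs) (marked (eq_wt 1 (- 1)) []) m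
        * weighted_sum (msum xs) (marked (\<lambda>_. c) (map (\<lambda>(d, c). (geq_wt d, \<lambda>_. c)) ts)) (n - m))
    = weighted_sum (msum xs) (marked (eq_wt 1 (c - 1)) (map (\<lambda>(d, c). (eq_wt d 1, eq_wt 1 (c - 1))) ts)) n"
  using arg_cong[OF marked_gf_from[OF assms, of xs c], where f = "\<lambda>F. fps_nth F n"]
  by (simp add: fps_mult_nth fps_nth_marked_gf weighted_sum_def atLeast0AtMost)

lemma marked_only_1: "marked (eq_wt 1 c) [] ks = (if set ks \<subseteq> {1} then c ^ length ks else 0)"
  by (induction ks) (auto simp: eq_wt_def)

lemma indices_ones: "set ks \<subseteq> {1} \<Longrightarrow> ks = replicate (sum_list ks) 1"
  by (induction ks) auto

lemma weighted_sum_ones: "weighted_sum Z (marked (eq_wt 1 c) []) n = of_int (c ^ n) * Z (replicate n 1)"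
proof -
  have "weighted_sum Z (marked (eq_wt 1 c) []) n = (\<Sum>ks\<in>{replicate n 1}. of_int (marked (eq_wt 1 c) [] ks) * Z ks)"
    unfolding weighted_sum_def
  proof (intro sum.mono_neutral_right)
    show "{replicate n 1} \<subseteq> indices n" by (auto simp: indices_def is_index_def sum_list_replicate)
    show "\<forall>ks\<in>indices n - {replicate n 1}. of_int (marked (eq_wt 1 c) [] ks) * Z ks = 0"
    proof
      fix ks assume ks: "ks \<in> indices n - {replicate n 1}"
      then have "\<not> set ks \<subseteq> {1}" using indices_ones[of ks] by (auto simp: indices_def)
      then show "of_int (marked (eq_wt 1 c) [] ks) * Z ks = 0" by (simp only: marked_only_1 if_False) simp
    qed
  qed simp
  moreover have "set (replicate n (1::nat)) \<subseteq> {1}" by auto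
  ultimately show ?thesis by (simp only: sum.insert sum.empty marked_only_1 length_replicate if_True) simp
qed

text \<open>For a constant weight \<open>c\<close> the exponent of \<open>c\<close> counts the
  entries before the first mark. Varying \<open>c\<close> over the natural numbers therefore
  isolates the position of the mark.\<close>

lemma marked_Cons_const:
  "marked (\<lambda>_. c) ((t, l) # ts) ks = (\<Sum>i<length ks. c ^ i * t (ks ! i) * marked l ts (drop (Suc i) ks))"
  by (induction ks) (auto simp: sum.lessThan_Suc_shift sum_distrib_left mult.assoc simp del: sum.lessThan_Suc)

lemma marked_Nil_const: "marked (\<lambda>_. c) [] ks = c ^ length ks"
  by (induction ks) auto

text \<open>Newton's identities, read off from the logarithmic derivative of the product of all 1 +
  x X.\<close>

lemma newton_msum:
  "of_nat (Suc n) * msum xs (replicate (Suc n) 1)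
     = (\<Sum>j\<le>n. (- 1) ^ j * msum xs [Suc j] * msum xs (replicate (n - j) 1))"
proof -
  define E where "E = (\<lambda>xs::'a list. marked_gf (eq_wt 1 1) [] xs)"
  define P where "P = (\<lambda>xs::'a list. Abs_fps (\<lambda>j. (- 1) ^ j * msum xs [Suc j]))"
  \<comment> \<open>The expansion of x / (1 + x X), the contribution of one variable to the
    logarithmic derivative.\<close>
  have fac: "fps_const x = (1 + fps_const x * fps_X) * Abs_fps (\<lambda>j. (- 1) ^ j * x ^ Suc j)" for x :: 'a
  proof (rule fps_ext)
    fix n show "fps_nth (fps_const x) n = fps_nth ((1 + fps_const x * fps_X) * Abs_fps (\<lambda>j. (- 1) ^ j * x ^ Suc j)) n"
      by (cases n) (simp_all add: distrib_right mult.assoc algebra_simps)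
  qed
  have "fps_deriv (E xs) = E xs * P xs"
  proof (induction xs)
    case Nil
    show ?case by (simp add: E_def P_def) (rule fps_ext, simp)
  next
    case (Cons x xs)
    have E: "E (x # xs) = (1 + fps_const x * fps_X) * E xs"
      by (simp add: E_def letter_gf_only)
    have P: "P (x # xs) = Abs_fps (\<lambda>j. (- 1) ^ j * x ^ Suc j) + P xs"
      unfolding P_def by (rule fps_ext) (simp add: algebra_simps)
    have "fps_deriv (E (x # xs)) = fps_const x * E xs + (1 + fps_const x * fps_X) * fps_deriv (E xs)"
      by (simp add: E)
    also have "\<dots> = E (x # xs) * P (x # xs)"
      unfolding E P Cons.IH
      by (subst (1) fac) (simp add: algebra_simps)
    finally show ?case .
  qed
  then have "fps_nth (fps_deriv (E xs)) n = fps_nth (P xs * E xs) n" by (simp add: mult.commute)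
  moreover have "fps_nth (E xs) m = msum xs (replicate m 1)" for m
    using weighted_sum_ones[of "msum xs" 1 m]
    by (simp add: E_def fps_nth_marked_gf weighted_sum_def)
  ultimately show ?thesis
    by (simp add: fps_mult_nth P_def atLeast0AtMost)
qed

section \<open>Reduction of the sum formulas to indices consisting mostly of ones\<close>

lemma of_nat_mult_eq_scaleQ: "of_nat m * (x :: 'a::{comm_ring_1,rat_vector}) = of_nat m *\<^sub>Q x"
  by (induction m) (simp_all add: distrib_right scaleQ_add_left scaleQ_one add.commute)

lemma subspace_of_nat_mult:
  "rat_vector.subspace V \<Longrightarrow> (x :: 'a::{comm_ring_1,rat_vector}) \<in> V \<Longrightarrow> of_nat m * x \<in> V"
  by (simp add: of_nat_mult_eq_scaleQ rat_vector.subspace_scale)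

lemma subspace_of_int_mult:
  assumes "rat_vector.subspace V" "(x :: 'a::{comm_ring_1,rat_vector}) \<in> V"
  shows "of_int m * x \<in> V"
  using subspace_of_nat_mult[OF assms]
  by (cases m rule: int_cases2) (auto intro: rat_vector.subspace_neg[OF assms(1)])

lemma subspace_of_nat_mult_cancel:
  assumes "rat_vector.subspace V" "of_nat m * (x :: 'a::{comm_ring_1,rat_vector}) \<in> V" "m > 0"
  shows "x \<in> V"
proof -
  have "(1 / of_nat m) *\<^sub>Q (of_nat m * x) = x"
    using assms(3) by (simp add: of_nat_mult_eq_scaleQ scaleQ_scaleQ scaleQ_one)
  then show ?thesis using rat_vector.subspace_scale[OF assms(1,2)] by metis
qed

text \<open>Interpolation with natural nodes: the coefficients are rational combinations of the
  values. This is what recovers sums of fixed depth and fixed marked positions from weighted sums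
  over all indices.\<close>

lemma subspace_polynomial_coeffs:
  fixes c :: "nat \<Rightarrow> 'a::{comm_ring_1,rat_vector}"
  assumes V: "rat_vector.subspace V"
    and "\<And>n::nat. (\<Sum>i\<le>d. of_nat n ^ i * c i) \<in> V" and "i \<le> d"
  shows "c i \<in> V"
  using assms(2,3)
proof (induction d arbitrary: c i)
  case 0
  then show ?case using "0.prems"(1)[of 0] by simp
next
  case (Suc d)
  text \<open>The polynomial \<open>p(2n) - 2\<^sup>d\<^sup>+\<^sup>1 p(n)\<close> has smaller degree.\<close>
  define m where "m i = (2 ^ Suc d - 2 ^ i :: nat)" for i
  have m: "m i > 0" "(2::'a) ^ Suc d = of_nat (m i) + 2 ^ i" if "i \<le> d" for i
  proof -
    have "(2::nat) ^ i < 2 ^ Suc d" using that by (intro power_strict_increasing) auto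
    then have "m i > 0" "2 ^ Suc d = m i + 2 ^ i" by (auto simp: m_def)
    then show "m i > 0" "(2::'a) ^ Suc d = of_nat (m i) + 2 ^ i"
      by (auto dest!: arg_cong[where f = "of_nat :: nat \<Rightarrow> 'a"])
  qed
  have "of_nat (m i) * c i \<in> V" if "i \<le> d" for i
  proof (rule Suc.IH[of "\<lambda>i. of_nat (m i) * c i", OF _ that])
    fix n
    have "of_nat (2 ^ Suc d) * (\<Sum>i\<le>Suc d. of_nat n ^ i * c i) - (\<Sum>i\<le>Suc d. of_nat (2 * n) ^ i * c i)
      = (\<Sum>i\<le>d. ((2 ^ Suc d - 2 ^ i) * of_nat n ^ i) * c i)"
      by (simp add: sum_distrib_left sum_subtractf[symmetric] algebra_simps power_mult_distrib)
    also have "\<dots> = (\<Sum>i\<le>d. of_nat n ^ i * (of_nat (m i) * c i))"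
    proof (intro sum.cong refl)
      fix i assume "i \<in> {..d}"
      then have "(2::'a) ^ Suc d - 2 ^ i = of_nat (m i)" using m(2)[of i] by (simp del: power_Suc)
      then show "(2 ^ Suc d - 2 ^ i) * of_nat n ^ i * c i = of_nat n ^ i * (of_nat (m i) * c i)"
        by (simp only: mult_ac)
    qed
    finally show "(\<Sum>i\<le>d. of_nat n ^ i * (of_nat (m i) * c i)) \<in> V"
      using rat_vector.subspace_diff[OF V subspace_of_nat_mult[OF V Suc.prems(1)[of n]]
          Suc.prems(1)[of "2 * n"], of "2 ^ Suc d"]
      by simp
  qed
  then have le: "c i \<in> V" if "i \<le> d" for i
    using that m(1) V subspace_of_nat_mult_cancel by blast
  have "(\<Sum>i\<le>Suc d. of_nat 1 ^ i * c i) - (\<Sum>i\<le>d. c i) \<in> V"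
    by (rule rat_vector.subspace_diff[OF V Suc.prems(1) rat_vector.subspace_sum[OF V]]) (simp add: le)
  then have "c (Suc d) \<in> V" by simp
  with le Suc.prems(2) show ?case by (cases "i = Suc d") auto
qed

section \<open>Indices with lower bounds on the entries\<close>

definition bounded_indices :: "nat list \<Rightarrow> nat \<Rightarrow> nat list set"
  where "bounded_indices ms k = {ks. list_all2 (\<le>) ms ks \<and> sum_list ks = k}"

lemma finite_bounded_indices [simp]: "finite (bounded_indices ms k)"
  by (rule finite_subset[OF _ finite_lists_sum_list_le[of "length ms" k]])
     (auto simp: bounded_indices_def list_all2_lengthD)

lemma bounded_indices_Nil: "bounded_indices [] k = (if k = 0 then {[]} else {})"
  by (auto simp: bounded_indices_def)

lemma bounded_indices_is_index:
  assumes "ks \<in> bounded_indices ms k" "is_index ms"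
  shows "is_index ks"
  using assms
  by (auto simp: bounded_indices_def is_index_def list_all2_conv_all_nth all_set_conv_all_nth intro: order_trans)

text \<open>At the smallest possible weight a sum over bounded indices is a single value, so that
  relations between such sums apply to individual values.\<close>

lemma bounded_indices_tight: "bounded_indices ms (sum_list ms) = {ms}"
proof -
  have "ms = ks" if "list_all2 (\<le>) ms ks" "sum_list ks = sum_list ms" for ks
    using that
  proof (induction ms ks rule: list_all2_induct)
    case (Cons x xs y ys)
    have "sum_list xs \<le> sum_list ys" using Cons(2) by (induction rule: list_all2_induct) auto
    with Cons show ?case by simp
  qed simp
  moreover have "list_all2 (\<le>) ms ms" by (simp add: list_all2_refl)
  ultimately show ?thesis by (auto simp: bounded_indices_def)
qed

text \<open>The bounds restrict prefix and suffix independently; only the total weight couples them.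
  Summing over the weight \<open>w\<close> of the prefix decouples the two.\<close>

lemma bounded_indices_split:
  fixes f g :: "nat list \<Rightarrow> 'a::comm_ring_1"
  assumes j: "j \<le> length ms"
  shows "(\<Sum>ks\<in>bounded_indices ms k. f (take j ks) * g (drop j ks)) =
    (\<Sum>w\<le>k. (\<Sum>ks\<in>bounded_indices (take j ms) w. f ks) * (\<Sum>ks\<in>bounded_indices (drop j ms) (k - w). g ks))"
proof -
  have "(\<Sum>w\<le>k. (\<Sum>ks\<in>bounded_indices (take j ms) w. f ks) * (\<Sum>ks\<in>bounded_indices (drop j ms) (k - w). g ks))
    = (\<Sum>w\<le>k. \<Sum>(us, vs)\<in>bounded_indices (take j ms) w \<times> bounded_indices (drop j ms) (k - w). f us * g vs)"
    by (simp add: sum_product sum.cartesian_product)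
  also have "\<dots> = (\<Sum>(w, us, vs)\<in>(SIGMA w:{..k}. bounded_indices (take j ms) w \<times> bounded_indices (drop j ms) (k - w)). f us * g vs)"
    by (subst sum.Sigma) auto
  also have "\<dots> = (\<Sum>ks\<in>bounded_indices ms k. f (take j ks) * g (drop j ks))"
  proof (rule sum.reindex_bij_witness[where j = "\<lambda>(w, us, vs). us @ vs"
        and i = "\<lambda>ks. (sum_list (take j ks), take j ks, drop j ks)"], goal_cases)
    case (1 a)
    then show ?case using j by (auto simp: bounded_indices_def dest!: list_all2_lengthD)
  next
    case (2 a)
    then show ?case using j
      by (auto simp: bounded_indices_def min_def dest: list_all2_lengthD)
         (metis append_take_drop_id list_all2_appendI)
  next
    case (4 ks)
    have "sum_list (take j ks) + sum_list (drop j ks) = sum_list ks"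
      by (metis append_take_drop_id sum_list_append)
    with 4 show ?case
      by (auto simp: bounded_indices_def list_all2_takeI list_all2_dropI)
  next
    case (5 a)
    then show ?case using j by (auto simp: bounded_indices_def dest!: list_all2_lengthD)
  qed auto
  finally show ?thesis ..
qed

lemma bounded_indices_single:
  assumes "d > 0"
  shows "bounded_indices (replicate i 1 @ d # replicate j 1) n
    = {ks \<in> indices n. length ks = i + j + 1 \<and> d \<le> ks ! i}"
proof -
  let ?ms = "replicate i 1 @ d # replicate j 1"
  have "?ms ! m = (if m = i then d else 1)" if "m < i + j + 1" for m
    using that by (auto simp: nth_append nth_Cons')
  then have "list_all2 (\<le>) ?ms ks \<longleftrightarrow>
      length ks = i + j + 1 \<and> (\<forall>m<i + j + 1. (if m = i then d else 1) \<le> ks ! m)" for ks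
    by (auto simp: list_all2_conv_all_nth)
  also have "\<dots> ks \<longleftrightarrow> length ks = i + j + 1 \<and> is_index ks \<and> d \<le> ks ! i" for ks
  proof (cases "length ks = i + j + 1")
    case True
    let ?f = "\<lambda>m. if m = i then d else 1"
    have bound: "1 \<le> ks ! m \<and> d \<le> ks ! i"
      if "\<forall>m<i + j + 1. ?f m \<le> ks ! m" "m < i + j + 1" for m
    proof -
      have "1 \<le> ?f m" using assms by auto
      also have "?f m \<le> ks ! m" using that by blast
      finally show ?thesis using spec[OF that(1), of i] by simp
    qed
    have "(\<forall>m<i + j + 1. ?f m \<le> ks ! m) \<longleftrightarrow> (\<forall>m<i + j + 1. 1 \<le> ks ! m) \<and> d \<le> ks ! i"
      (is "?A \<longleftrightarrow> ?B")
    proof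
      assume ?A
      have "i < i + j + 1" by simp
      with bound[OF \<open>?A\<close>] show ?B by blast
    next
      assume ?B
      then show ?A by simp
    qed
    with True show ?thesis by (auto simp: is_index_def all_set_conv_all_nth)
  qed simp
  finally show ?thesis by (auto simp: bounded_indices_def indices_def)
qed

lemma bounded_indices_ones:
  "bounded_indices (replicate r 1) n = {ks \<in> indices n. length ks = r}"
  by (auto simp: bounded_indices_def indices_def is_index_def list_all2_conv_all_nth all_set_conv_all_nth)

lemma bounded_indices_double:
  assumes "d > 0" "e > 0"
  shows "bounded_indices (replicate i 1 @ d # replicate h 1 @ e # replicate j 1) n
    = {ks \<in> indices n. length ks = i + h + j + 2 \<and> d \<le> ks ! i \<and> e \<le> ks ! (i + h + 1)}"
proof -
  let ?ms = "replicate i 1 @ d # replicate h 1 @ e # replicate j 1"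
  have "?ms ! m = (if m = i then d else if m = i + h + 1 then e else 1)" if "m < i + h + j + 2" for m
    using that by (auto simp: nth_append nth_Cons')
  then have "list_all2 (\<le>) ?ms ks \<longleftrightarrow> length ks = i + h + j + 2 \<and>
      (\<forall>m<i + h + j + 2. (if m = i then d else if m = i + h + 1 then e else 1) \<le> ks ! m)" for ks
    by (auto simp: list_all2_conv_all_nth)
  also have "\<dots> ks \<longleftrightarrow> length ks = i + h + j + 2 \<and> is_index ks \<and> d \<le> ks ! i \<and> e \<le> ks ! (i + h + 1)" for ks
  proof (cases "length ks = i + h + j + 2")
    case True
    let ?f = "\<lambda>m. if m = i then d else if m = i + h + 1 then e else 1"
    have bound: "1 \<le> ks ! m \<and> d \<le> ks ! i \<and> e \<le> ks ! (i + h + 1)"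
      if "\<forall>m<i + h + j + 2. ?f m \<le> ks ! m" "m < i + h + j + 2" for m
    proof -
      have "1 \<le> ?f m" using assms by auto
      also have "?f m \<le> ks ! m" using that by blast
      finally have "1 \<le> ks ! m" .
      moreover have "d \<le> ks ! i" using spec[OF that(1), of i] by simp
      moreover have "e \<le> ks ! (i + h + 1)" using spec[OF that(1), of "i + h + 1"] by simp
      ultimately show ?thesis by blast
    qed
    have "(\<forall>m<i + h + j + 2. ?f m \<le> ks ! m) \<longleftrightarrow>
        (\<forall>m<i + h + j + 2. 1 \<le> ks ! m) \<and> d \<le> ks ! i \<and> e \<le> ks ! (i + h + 1)"
      (is "?A \<longleftrightarrow> ?B")
    proof
      assume ?A
      have "i < i + h + j + 2" by simp
      with bound[OF \<open>?A\<close>] show ?B by blast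
    next
      assume ?B
      then show ?A by simp
    qed
    with True show ?thesis by (auto simp: is_index_def all_set_conv_all_nth)
  qed simp
  finally show ?thesis by (auto simp: bounded_indices_def indices_def)
qed

lemma marked_only_nonzero:
  assumes "marked (eq_wt 1 c) ((eq_wt d 1, l) # ts) ks \<noteq> 0"
  shows "\<exists>i ks'. ks = replicate i 1 @ d # ks' \<and> marked l ts ks' \<noteq> 0"
  using assms
proof (induction ks)
  case (Cons k ks)
  show ?case
  proof (cases "k = 1 \<and> marked (eq_wt 1 c) ((eq_wt d 1, l) # ts) ks \<noteq> 0")
    case True
    with Cons.IH obtain i ks' where "ks = replicate i 1 @ d # ks'" "marked l ts ks' \<noteq> 0" by blast
    with True have "k # ks = replicate (Suc i) 1 @ d # ks'" by simp
    with \<open>marked l ts ks' \<noteq> 0\<close> show ?thesis by blast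
  next
    case False
    moreover have "eq_wt 1 c k * marked (eq_wt 1 c) ((eq_wt d 1, l) # ts) ks + eq_wt d 1 k * marked l ts ks \<noteq> 0"
      using Cons.prems by simp
    moreover have "eq_wt 1 c k = 0" if "k \<noteq> 1" using that by (simp add: eq_wt_def)
    ultimately have "eq_wt d 1 k \<noteq> 0" "marked l ts ks \<noteq> 0" by auto
    then have "k = d" "marked l ts ks \<noteq> 0" by (auto simp: eq_wt_def split: if_splits)
    then show ?thesis by (intro exI[of _ 0] exI[of _ ks]) simp
  qed
qed simp

text \<open>\<open>R\<close> is an algebra containing the values and \<open>J\<close> the ideal
  modulo which they are considered: 0 for the finite values, the multiples of \<zeta>(2) for the
  symmetric ones. The assumption \<open>weighted\<close> states the identity of generating functions
  without reference to a list of variables, because the symmetric values satisfy it only as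
  limits.\<close>

locale zeta_values =
  fixes Z Zs :: "nat list \<Rightarrow> 'a::{comm_ring_1,rat_vector}" and R J :: "'a set"
  assumes R: "rat_vector.subspace R" and J: "rat_vector.subspace J"
    and J_mult: "x \<in> R \<Longrightarrow> y \<in> J \<Longrightarrow> x * y \<in> J"
    and Z_R: "is_index ks \<Longrightarrow> Z ks \<in> R" and Zs_R: "is_index ks \<Longrightarrow> Zs ks \<in> R"
    and Z_Nil: "Z [] = 1" and Zs_Nil: "Zs [] = 1"
    and Z_single: "k > 0 \<Longrightarrow> Z [k] \<in> J"
    and antipode: "is_index ks \<Longrightarrow> ks \<noteq> [] \<Longrightarrow>
      (\<Sum>j\<le>length ks. (- 1) ^ j * Z (take j ks) * Zs (rev (drop j ks))) = 0"
    and Zs_rev: "is_index ks \<Longrightarrow> Zs (rev ks) = (- 1) ^ sum_list ks * Zs ks"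
    and newton: "of_nat (Suc n) * Z (replicate (Suc n) 1)
      = (\<Sum>j\<le>n. (- 1) ^ j * Z [Suc j] * Z (replicate (n - j) 1))"
    and weighted: "\<forall>(d, c)\<in>set ts. d > 0 \<Longrightarrow>
      (\<Sum>m\<le>n. weighted_sum Z (marked (eq_wt 1 (- 1)) []) m
        * weighted_sum Z (marked (\<lambda>_. c) (map (\<lambda>(d, c). (geq_wt d, \<lambda>_. c)) ts)) (n - m))
      = weighted_sum Z (marked (eq_wt 1 (c - 1)) (map (\<lambda>(d, c). (eq_wt d 1, eq_wt 1 (c - 1))) ts)) n"
begin

lemmas R_sum = rat_vector.subspace_sum[OF R]
lemmas J_sum = rat_vector.subspace_sum[OF J]

lemma J_mult': "x \<in> J \<Longrightarrow> y \<in> R \<Longrightarrow> x * y \<in> J"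
  using J_mult[of y x] by (simp add: mult.commute)

lemma sign_J: "x \<in> J \<Longrightarrow> (- 1) ^ n * x \<in> J"
  using subspace_of_int_mult[OF J, of x "(- 1) ^ n"] by simp

lemma sign_R: "x \<in> R \<Longrightarrow> (- 1) ^ n * x \<in> R"
  using subspace_of_int_mult[OF R, of x "(- 1) ^ n"] by simp

lemma is_index_ones: "is_index (replicate n 1)"
  by (simp add: is_index_def)

text \<open>Every term of Newton's identity contains a value of depth one, and the positive integer
  factor on the left can be divided out in a rational subspace.\<close>

lemma ones_J: "n > 0 \<Longrightarrow> Z (replicate n 1) \<in> J"
proof -
  assume "n > 0"
  then obtain m where n: "n = Suc m" by (cases n) auto
  have "of_nat (Suc m) * Z (replicate (Suc m) 1) \<in> J"
    unfolding newton
    by (intro J_sum J_mult' sign_J Z_single Z_R is_index_ones) simp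
  then show ?thesis unfolding n by (rule subspace_of_nat_mult_cancel[OF J]) simp
qed

lemma weighted_sum_R: "weighted_sum Z w n \<in> R"
  unfolding weighted_sum_def
  by (intro R_sum subspace_of_int_mult R Z_R) (simp add: indices_def)

text \<open>In the convolution identity \<open>weighted\<close> every term with \<open>m > 0\<close>
  has a multiple of the value at m ones as a factor and so lies in \<open>J\<close>. Hence modulo
  \<open>J\<close> the sum with lower bounds equals the sum in which the marked entries are exactly
  \<open>d\<close> and all others are 1.\<close>

lemma weighted_sum_subspace:
  assumes V: "rat_vector.subspace V" "J \<subseteq> V" and ts: "\<forall>(d, c)\<in>set ts. d > 0"
    and only: "\<And>ks. ks \<in> indices n \<Longrightarrow>
      marked (eq_wt 1 (c - 1)) (map (\<lambda>(d, c). (eq_wt d 1, eq_wt 1 (c - 1))) ts) ks \<noteq> 0 \<Longrightarrow> Z ks \<in> V"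
  shows "weighted_sum Z (marked (\<lambda>_. c) (map (\<lambda>(d, c). (geq_wt d, \<lambda>_. c)) ts)) n \<in> V"
proof -
  let ?E = "weighted_sum Z (marked (eq_wt 1 (- 1)) [])"
  let ?G = "weighted_sum Z (marked (\<lambda>_. c) (map (\<lambda>(d, c). (geq_wt d, \<lambda>_. c)) ts))"
  have "weighted_sum Z (marked (eq_wt 1 (c - 1)) (map (\<lambda>(d, c). (eq_wt d 1, eq_wt 1 (c - 1))) ts)) n \<in> V"
    unfolding weighted_sum_def
  proof (intro rat_vector.subspace_sum[OF V(1)])
    fix ks assume ks: "ks \<in> indices n"
    show "of_int (marked (eq_wt 1 (c - 1)) (map (\<lambda>(d, c). (eq_wt d 1, eq_wt 1 (c - 1))) ts) ks) * Z ks \<in> V"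
      (is "of_int ?m * _ \<in> _")
      using only[OF ks] subspace_of_int_mult[OF V(1), of "Z ks" ?m] rat_vector.subspace_0[OF V(1)]
      by (cases "?m = 0") auto
  qed
  then have "(\<Sum>m\<le>n. ?E m * ?G (n - m)) \<in> V" by (simp only: weighted[OF ts])
  moreover have "(\<Sum>m\<le>n. ?E m * ?G (n - m)) = ?G n + (\<Sum>m\<in>{1..n}. ?E m * ?G (n - m))"
    using weighted_sum_ones[of Z "- 1" 0]
    by (subst sum.atMost_shift) (simp add: sum.atLeast1_atMost_eq Z_Nil)
  moreover have "(\<Sum>m\<in>{1..n}. ?E m * ?G (n - m)) \<in> J"
  proof (intro J_sum J_mult' weighted_sum_R)
    fix m assume "m \<in> {1..n}"
    then show "?E m \<in> J"
      using subspace_of_int_mult[OF J ones_J, of m "(- 1) ^ m"] by (simp add: weighted_sum_ones[unfolded One_nat_def])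
  qed
  ultimately show ?thesis
    using rat_vector.subspace_diff[OF V(1)] V(2) by (metis (no_types, lifting) add_diff_cancel_right' subsetD)
qed

section \<open>Sums over bounded indices and their comparison with star values\<close>

definition ZB :: "nat list \<Rightarrow> nat \<Rightarrow> 'a"
  where "ZB ms k = (\<Sum>ks\<in>bounded_indices ms k. Z ks)"

definition ZsB :: "nat list \<Rightarrow> nat \<Rightarrow> 'a"
  where "ZsB ms k = (\<Sum>ks\<in>bounded_indices ms k. Zs ks)"

lemma ZB_R: "is_index ms \<Longrightarrow> ZB ms k \<in> R"
  unfolding ZB_def by (intro R_sum Z_R) (rule bounded_indices_is_index)

lemma ZsB_R: "is_index ms \<Longrightarrow> ZsB ms k \<in> R"
  unfolding ZsB_def by (intro R_sum Zs_R) (rule bounded_indices_is_index)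

lemma ZB_Nil: "ZB [] k = (if k = 0 then 1 else 0)" and ZsB_Nil: "ZsB [] k = (if k = 0 then 1 else 0)"
  by (simp_all add: ZB_def ZsB_def bounded_indices_Nil Z_Nil Zs_Nil)

text \<open>Without marks the reduction leaves only the index (1, ..., 1), whose value is in
  \<open>J\<close>; the depth \<open>r\<close> is then the exponent of the constant weight.\<close>

lemma ZB_ones: "r > 0 \<Longrightarrow> ZB (replicate r 1) n \<in> J"
proof -
  assume r: "r > 0"
  show ?thesis
  proof (cases "r \<le> n")
    case True
    with r have n: "n > 0" by simp
    have "(\<Sum>ks\<in>{ks \<in> indices n. length ks = r}. Z ks) \<in> J"
    proof (rule subspace_polynomial_coeffs[OF J _ True])
      fix c :: nat
      have "(\<Sum>r\<le>n. of_nat c ^ r * (\<Sum>ks\<in>{ks \<in> indices n. length ks = r}. Z ks))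
          = (\<Sum>r\<le>n. \<Sum>ks\<in>{ks \<in> indices n. length ks = r}. of_int (marked (\<lambda>_. int c) [] ks) * Z ks)"
        by (simp add: sum_distrib_left marked_Nil_const)
      also have "\<dots> = weighted_sum Z (marked (\<lambda>_. int c) []) n"
        unfolding weighted_sum_def
        by (rule sum.group) (auto simp: indices_def length_le_sum_list intro: finite_indices[unfolded indices_def])
      also have "\<dots> \<in> J"
      proof -
        have "Z ks \<in> J" if "ks \<in> indices n" "marked (eq_wt 1 (int c - 1)) [] ks \<noteq> 0" for ks
        proof -
          have "set ks \<subseteq> {1}" using that(2) by (metis marked_only_1)
          then have "ks = replicate n 1" using that(1) indices_ones[of ks] by (simp add: indices_def)
          then show ?thesis using ones_J n by simp
        qed
        then show ?thesis using weighted_sum_subspace[OF J, of "[]" n "int c"] by simp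
      qed
      finally show "(\<Sum>r\<le>n. of_nat c ^ r * (\<Sum>ks\<in>{ks \<in> indices n. length ks = r}. Z ks)) \<in> J" .
    qed
    then show ?thesis by (simp add: ZB_def bounded_indices_ones[unfolded One_nat_def])
  next
    case False
    then have "{ks \<in> indices n. length ks = r} = {}" by (auto simp: indices_def dest: length_le_sum_list)
    then show ?thesis using rat_vector.subspace_0[OF J]
      by (simp only: ZB_def bounded_indices_ones sum.empty)
  qed
qed

text \<open>Different weights before and after the mark make the weighted sum a polynomial in two
  variables. Extracting the coefficient in the first fixes the position \<open>i\<close> of the mark
  (the family \<open>c\<close>), extracting it in the second fixes the number \<open>j\<close> of
  entries behind it (the family \<open>c'\<close>).\<close>

lemma ZB_single:
  assumes V: "rat_vector.subspace V" "J \<subseteq> V" and d: "d > 0"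
    and Z: "\<And>i j. i + j + d = n \<Longrightarrow> Z (replicate i 1 @ d # replicate j 1) \<in> V"
  shows "ZB (replicate i 1 @ d # replicate j 1) n \<in> V"
proof (cases "i \<le> n \<and> j \<le> n")
  case True
  define c where "c i s = (\<Sum>ks\<in>{ks \<in> indices n. i < length ks}. of_int (geq_wt d (ks ! i) * s ^ (length ks - Suc i)) * Z ks)" for i s
  define c' where "c' j = (\<Sum>ks\<in>{ks \<in> indices n. length ks = i + j + 1}. of_int (geq_wt d (ks ! i)) * Z ks)" for j
  have wt: "weighted_sum Z (marked (\<lambda>_. s) [(geq_wt d, \<lambda>_. s')]) n \<in> V" for s s'
  proof -
    have "Z ks \<in> V" if ks: "ks \<in> indices n"
      "marked (eq_wt 1 (s - 1)) [(eq_wt d 1, eq_wt 1 (s' - 1))] ks \<noteq> 0" for ks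
    proof -
      obtain i ks' where i: "ks = replicate i 1 @ d # ks'" "marked (eq_wt 1 (s' - 1)) [] ks' \<noteq> 0"
        using marked_only_nonzero[OF ks(2)] by blast
      then have "set ks' \<subseteq> {1}" by (metis marked_only_1)
      then have "ks' = replicate (sum_list ks') 1" by (rule indices_ones)
      then show ?thesis using Z[of i "sum_list ks'"] i(1) ks(1)
        by (simp add: indices_def sum_list_replicate)
    qed
    then show ?thesis using weighted_sum_subspace[OF V, of "[(d, s')]" n s] d by simp
  qed
  have "c i (int s) \<in> V" for s
  proof (rule subspace_polynomial_coeffs[OF V(1), where d = n and c = "\<lambda>i. c i (int s)"])
    fix a :: nat
    have "(\<Sum>i\<le>n. of_nat a ^ i * c i (int s)) = (\<Sum>i\<le>n. \<Sum>ks\<in>indices n.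
        if i < length ks then of_int (int a ^ i * geq_wt d (ks ! i) * int s ^ (length ks - Suc i)) * Z ks else 0)"
      unfolding c_def sum_distrib_left sum.inter_filter[OF finite_indices]
      by (intro sum.cong refl) (simp add: mult.assoc)
    also have "\<dots> = (\<Sum>ks\<in>indices n. \<Sum>i\<le>n.
        if i < length ks then of_int (int a ^ i * geq_wt d (ks ! i) * int s ^ (length ks - Suc i)) * Z ks else 0)"
      by (rule sum.swap)
    also have "\<dots> = (\<Sum>ks\<in>indices n. \<Sum>i<length ks.
        of_int (int a ^ i * geq_wt d (ks ! i) * int s ^ (length ks - Suc i)) * Z ks)"
      by (intro sum.cong refl sum.mono_neutral_cong_right)
         (auto simp: indices_def dest: length_le_sum_list)
    also have "\<dots> = weighted_sum Z (marked (\<lambda>_. int a) [(geq_wt d, \<lambda>_. int s)]) n"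
      by (simp add: weighted_sum_def marked_Cons_const marked_Nil_const sum_distrib_right)
    finally show "(\<Sum>i\<le>n. of_nat a ^ i * c i (int s)) \<in> V" using wt by simp
  qed (use True in simp)
  have "c' j \<in> V"
  proof (rule subspace_polynomial_coeffs[OF V(1), where d = n])
    fix s :: nat
    have "(\<Sum>j\<le>n. of_nat s ^ j * c' j) = (\<Sum>j\<le>n. \<Sum>ks\<in>indices n.
        if length ks = i + j + 1 then of_int (geq_wt d (ks ! i) * int s ^ (length ks - Suc i)) * Z ks else 0)"
      unfolding c'_def sum_distrib_left sum.inter_filter[OF finite_indices]
      by (intro sum.cong refl) (simp add: mult_ac)
    also have "\<dots> = (\<Sum>ks\<in>indices n. \<Sum>j\<le>n.
        if length ks = i + j + 1 then of_int (geq_wt d (ks ! i) * int s ^ (length ks - Suc i)) * Z ks else 0)"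
      by (rule sum.swap)
    also have "\<dots> = (\<Sum>ks\<in>indices n. if i < length ks then of_int (geq_wt d (ks ! i) * int s ^ (length ks - Suc i)) * Z ks else 0)"
    proof (intro sum.cong refl)
      fix ks assume ks: "ks \<in> indices n"
      have "(\<Sum>j\<le>n. if length ks = i + j + 1 then of_int (geq_wt d (ks ! i) * int s ^ (length ks - Suc i)) * Z ks else 0)
        = (\<Sum>j\<le>n. if j = length ks - Suc i then
             (if i < length ks then of_int (geq_wt d (ks ! i) * int s ^ (length ks - Suc i)) * Z ks else 0) else 0)"
        by (intro sum.cong) auto
      then show "(\<Sum>j\<le>n. if length ks = i + j + 1 then of_int (geq_wt d (ks ! i) * int s ^ (length ks - Suc i)) * Z ks else 0)
        = (if i < length ks then of_int (geq_wt d (ks ! i) * int s ^ (length ks - Suc i)) * Z ks else 0)"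
        using ks by (auto simp: indices_def dest: length_le_sum_list)
    qed
    also have "\<dots> = c i (int s)" unfolding c_def sum.inter_filter[OF finite_indices] ..
    finally show "(\<Sum>j\<le>n. of_nat s ^ j * c' j) \<in> V" using \<open>\<And>s. c i (int s) \<in> V\<close> by simp
  qed (use True in simp)
  also have "c' j = ZB (replicate i 1 @ d # replicate j 1) n"
    unfolding ZB_def bounded_indices_single[OF d] c'_def
    by (rule sum.mono_neutral_cong_right) (auto simp: geq_wt_def)
  finally show ?thesis .
next
  case False
  then have empty: "{ks \<in> indices n. length ks = i + j + 1 \<and> d \<le> ks ! i} = {}"
    by (auto simp: indices_def dest: length_le_sum_list)
  show ?thesis using rat_vector.subspace_0[OF V(1)]
    by (simp only: ZB_def bounded_indices_single[OF d] empty sum.empty)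
qed

lemma ZB_double:
  assumes V: "rat_vector.subspace V" "J \<subseteq> V" and d: "d > 0" "e > 0"
    and Z: "\<And>i h j. i + h + j + d + e = n \<Longrightarrow> Z (replicate i 1 @ d # replicate h 1 @ e # replicate j 1) \<in> V"
  shows "ZB (replicate i 1 @ d # replicate h 1 @ e # replicate j 1) n \<in> V"
proof (cases "i \<le> n \<and> h \<le> n \<and> j \<le> n")
  case True
  define t where "t i h ks = geq_wt d (ks ! i) * geq_wt e (ks ! (i + h + 1))" for i h ks
  \<comment> \<open>Three weights have to be removed one after the other: \<open>c\<close> fixes the
    position of the first mark, \<open>c'\<close> the distance to the second, \<open>c''\<close> the
    number of remaining entries.\<close>
  define c where "c i a s = (\<Sum>ks\<in>{ks \<in> indices n. i < length ks}.
      of_int (geq_wt d (ks ! i) * marked (\<lambda>_. int a) [(geq_wt e, \<lambda>_. int s)] (drop (Suc i) ks)) * Z ks)" for i a s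
  define c' where "c' h s = (\<Sum>ks\<in>{ks \<in> indices n. i + h + 1 < length ks}.
      of_int (t i h ks * int s ^ (length ks - i - h - 2)) * Z ks)" for h s
  define c'' where "c'' j = (\<Sum>ks\<in>{ks \<in> indices n. length ks = i + h + j + 2}. of_int (t i h ks) * Z ks)" for j
  have wt: "weighted_sum Z (marked (\<lambda>_. s) [(geq_wt d, \<lambda>_. s'), (geq_wt e, \<lambda>_. s'')]) n \<in> V" for s s' s''
  proof -
    have "Z ks \<in> V" if ks: "ks \<in> indices n"
      "marked (eq_wt 1 (s - 1)) [(eq_wt d 1, eq_wt 1 (s' - 1)), (eq_wt e 1, eq_wt 1 (s'' - 1))] ks \<noteq> 0" for ks
    proof -
      obtain i ks' where i: "ks = replicate i 1 @ d # ks'"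
        "marked (eq_wt 1 (s' - 1)) [(eq_wt e 1, eq_wt 1 (s'' - 1))] ks' \<noteq> 0"
        using marked_only_nonzero[OF ks(2)] by blast
      obtain h ks'' where h: "ks' = replicate h 1 @ e # ks''" "marked (eq_wt 1 (s'' - 1)) [] ks'' \<noteq> 0"
        using marked_only_nonzero[OF i(2)] by blast
      then have "set ks'' \<subseteq> {1}" by (metis marked_only_1)
      then have "ks'' = replicate (sum_list ks'') 1" by (rule indices_ones)
      then show ?thesis using Z[of i h "sum_list ks''"] i(1) h(1) ks(1)
        by (simp add: indices_def sum_list_replicate add_ac)
    qed
    then show ?thesis using weighted_sum_subspace[OF V, of "[(d, s'), (e, s'')]" n s] d by simp
  qed
  have c_V: "c i a s \<in> V" for a s
  proof (rule subspace_polynomial_coeffs[OF V(1), where d = n and c = "\<lambda>i. c i a s"])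
    fix b :: nat
    have "(\<Sum>i\<le>n. of_nat b ^ i * c i a s) = (\<Sum>i\<le>n. \<Sum>ks\<in>indices n.
        if i < length ks then of_int (int b ^ i * geq_wt d (ks ! i)
          * marked (\<lambda>_. int a) [(geq_wt e, \<lambda>_. int s)] (drop (Suc i) ks)) * Z ks else 0)"
      unfolding c_def sum_distrib_left sum.inter_filter[OF finite_indices]
      by (intro sum.cong refl) (simp add: mult.assoc)
    also have "\<dots> = (\<Sum>ks\<in>indices n. \<Sum>i\<le>n.
        if i < length ks then of_int (int b ^ i * geq_wt d (ks ! i)
          * marked (\<lambda>_. int a) [(geq_wt e, \<lambda>_. int s)] (drop (Suc i) ks)) * Z ks else 0)"
      by (rule sum.swap)
    also have "\<dots> = (\<Sum>ks\<in>indices n. \<Sum>i<length ks. of_int (int b ^ i * geq_wt d (ks ! i)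
          * marked (\<lambda>_. int a) [(geq_wt e, \<lambda>_. int s)] (drop (Suc i) ks)) * Z ks)"
      by (intro sum.cong refl sum.mono_neutral_cong_right)
         (auto simp: indices_def dest: length_le_sum_list)
    also have "\<dots> = weighted_sum Z (marked (\<lambda>_. int b) [(geq_wt d, \<lambda>_. int a), (geq_wt e, \<lambda>_. int s)]) n"
      unfolding weighted_sum_def
      unfolding marked_Cons_const[of "int b" "geq_wt d"] by (simp only: of_int_sum sum_distrib_right)
    finally show "(\<Sum>i\<le>n. of_nat b ^ i * c i a s) \<in> V" using wt by simp
  qed (use True in simp)
  have c'_V: "c' h s \<in> V" for s
  proof (rule subspace_polynomial_coeffs[OF V(1), where d = n and c = "\<lambda>h. c' h s"])
    fix a :: nat
    have "(\<Sum>h\<le>n. of_nat a ^ h * c' h s) = (\<Sum>h\<le>n. \<Sum>ks\<in>indices n.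
        if i + h + 1 < length ks then of_int (int a ^ h * t i h ks * int s ^ (length ks - i - h - 2)) * Z ks else 0)"
      unfolding c'_def sum_distrib_left sum.inter_filter[OF finite_indices]
      by (intro sum.cong refl) (simp add: mult.assoc)
    also have "\<dots> = (\<Sum>ks\<in>indices n. \<Sum>h\<le>n.
        if i + h + 1 < length ks then of_int (int a ^ h * t i h ks * int s ^ (length ks - i - h - 2)) * Z ks else 0)"
      by (rule sum.swap)
    also have "\<dots> = (\<Sum>ks\<in>indices n. \<Sum>h<length ks - Suc i.
        of_int (int a ^ h * t i h ks * int s ^ (length ks - i - h - 2)) * Z ks)"
      by (intro sum.cong refl sum.mono_neutral_cong_right)
         (auto simp: indices_def dest!: length_le_sum_list)
    also have "\<dots> = (\<Sum>ks\<in>indices n. if i < length ks then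
        of_int (geq_wt d (ks ! i) * marked (\<lambda>_. int a) [(geq_wt e, \<lambda>_. int s)] (drop (Suc i) ks)) * Z ks else 0)"
    proof (intro sum.cong refl)
      fix ks assume "ks \<in> indices n"
      have "geq_wt d (ks ! i) * marked (\<lambda>_. int a) [(geq_wt e, \<lambda>_. int s)] (drop (Suc i) ks)
          = (\<Sum>h<length ks - Suc i. int a ^ h * t i h ks * int s ^ (length ks - i - h - 2))"
        unfolding marked_Cons_const sum_distrib_left
        by (intro sum.cong) (auto simp: t_def marked_Nil_const add_ac diff_diff_left)
      then show "(\<Sum>h<length ks - Suc i. of_int (int a ^ h * t i h ks * int s ^ (length ks - i - h - 2)) * Z ks)
        = (if i < length ks then
            of_int (geq_wt d (ks ! i) * marked (\<lambda>_. int a) [(geq_wt e, \<lambda>_. int s)] (drop (Suc i) ks)) * Z ks else 0)"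
        by (simp only: of_int_sum sum_distrib_right) auto
    qed
    also have "\<dots> = c i a s"
      unfolding c_def sum.inter_filter[OF finite_indices] ..
    finally show "(\<Sum>h\<le>n. of_nat a ^ h * c' h s) \<in> V" using c_V by simp
  qed (use True in simp)
  have "c'' j \<in> V"
  proof (rule subspace_polynomial_coeffs[OF V(1), where d = n])
    fix s :: nat
    have "(\<Sum>j\<le>n. of_nat s ^ j * c'' j) = (\<Sum>j\<le>n. \<Sum>ks\<in>indices n.
        if length ks = i + h + j + 2 then of_int (t i h ks * int s ^ (length ks - i - h - 2)) * Z ks else 0)"
      unfolding c''_def sum_distrib_left sum.inter_filter[OF finite_indices]
      by (intro sum.cong refl) (simp add: mult_ac)
    also have "\<dots> = (\<Sum>ks\<in>indices n. \<Sum>j\<le>n.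
        if length ks = i + h + j + 2 then of_int (t i h ks * int s ^ (length ks - i - h - 2)) * Z ks else 0)"
      by (rule sum.swap)
    also have "\<dots> = (\<Sum>ks\<in>indices n. if i + h + 1 < length ks then
        of_int (t i h ks * int s ^ (length ks - i - h - 2)) * Z ks else 0)"
    proof (intro sum.cong refl)
      fix ks assume ks: "ks \<in> indices n"
      let ?x = "of_int (t i h ks * int s ^ (length ks - i - h - 2)) * Z ks"
      have "(\<Sum>j\<le>n. if length ks = i + h + j + 2 then ?x else 0)
        = (\<Sum>j\<le>n. if j = length ks - i - h - 2 then (if i + h + 1 < length ks then ?x else 0) else 0)"
        by (intro sum.cong) auto
      then show "(\<Sum>j\<le>n. if length ks = i + h + j + 2 then ?x else 0) = (if i + h + 1 < length ks then ?x else 0)"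
        using ks by (auto simp: indices_def dest: length_le_sum_list)
    qed
    also have "\<dots> = c' h s"
      unfolding c'_def sum.inter_filter[OF finite_indices] ..
    finally show "(\<Sum>j\<le>n. of_nat s ^ j * c'' j) \<in> V" using c'_V by simp
  qed (use True in simp)
  also have "c'' j = ZB (replicate i 1 @ d # replicate h 1 @ e # replicate j 1) n"
    unfolding ZB_def bounded_indices_double[OF d] c''_def
    by (rule sum.mono_neutral_cong_right) (auto simp: geq_wt_def t_def)
  finally show ?thesis .
next
  case False
  then have empty: "{ks \<in> indices n. length ks = i + h + j + 2 \<and> d \<le> ks ! i \<and> e \<le> ks ! (i + h + 1)} = {}"
    by (auto simp: indices_def dest: length_le_sum_list)
  show ?thesis using rat_vector.subspace_0[OF V(1)]
    by (simp only: ZB_def bounded_indices_double[OF d] empty sum.empty)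
qed

text \<open>Sum the antipode relation over all bounded indices of weight \<open>k\<close>. The cut
  after \<open>j\<close> entries becomes a sum over the weight \<open>w\<close> of the prefix, with
  the sign of weight \<open>k - w\<close> from reversing the star value. The two extreme cuts give
  the terms of the conclusion, all others lie in \<open>J\<close> by \<open>middle\<close>.\<close>

lemma star_transfer:
  assumes ms: "is_index ms" "ms \<noteq> []"
    and middle: "\<And>j w. 0 < j \<Longrightarrow> j < length ms \<Longrightarrow> w \<le> k \<Longrightarrow>
      ZB (take j ms) w \<in> J \<or> ZsB (drop j ms) (k - w) \<in> J"
  shows "(- 1) ^ k * ZsB ms k + (- 1) ^ length ms * ZB ms k \<in> J"
proof -
  let ?r = "length ms"
  define S where "S j = (\<Sum>w\<le>k. ((- 1) ^ j * ZB (take j ms) w) * ((- 1) ^ (k - w) * ZsB (drop j ms) (k - w)))" for j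
  have ix: "is_index (take j ms)" "is_index (drop j ms)" for j
    using ms(1) by (auto simp: is_index_def dest: in_set_takeD in_set_dropD)
  have "0 = (\<Sum>ks\<in>bounded_indices ms k. \<Sum>j\<le>?r. (- 1) ^ j * Z (take j ks) * Zs (rev (drop j ks)))"
  proof (rule sum.neutral[symmetric], rule ballI)
    fix ks assume ks: "ks \<in> bounded_indices ms k"
    then have "length ks = ?r" "is_index ks" using bounded_indices_is_index[OF _ ms(1)]
      by (auto simp: bounded_indices_def dest: list_all2_lengthD)
    moreover from this have "ks \<noteq> []" using ms(2) by auto
    ultimately show "(\<Sum>j\<le>?r. (- 1) ^ j * Z (take j ks) * Zs (rev (drop j ks))) = 0"
      using antipode[of ks] by simp
  qed
  also have "\<dots> = (\<Sum>j\<le>?r. \<Sum>ks\<in>bounded_indices ms k. (- 1) ^ j * Z (take j ks) * Zs (rev (drop j ks)))"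
    by (rule sum.swap)
  also have "\<dots> = (\<Sum>j\<le>?r. S j)"
  proof (intro sum.cong refl)
    fix j assume "j \<in> {..?r}"
    then have j: "j \<le> ?r" by simp
    have "(\<Sum>ks\<in>bounded_indices (drop j ms) l. Zs (rev ks)) = (- 1) ^ l * ZsB (drop j ms) l" for l
      unfolding ZsB_def sum_distrib_left
    proof (intro sum.cong refl)
      fix ks assume ks: "ks \<in> bounded_indices (drop j ms) l"
      show "Zs (rev ks) = (- 1) ^ l * Zs ks"
        using Zs_rev[OF bounded_indices_is_index[OF ks ix(2)]] ks by (simp add: bounded_indices_def)
    qed
    then show "(\<Sum>ks\<in>bounded_indices ms k. (- 1) ^ j * Z (take j ks) * Zs (rev (drop j ks))) = S j"
      using bounded_indices_split[OF j, of "\<lambda>ks. (- 1) ^ j * Z ks" "\<lambda>ks. Zs (rev ks)" k]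
      by (simp add: S_def ZB_def sum_distrib_left)
  qed
  also have "\<dots> = S 0 + (\<Sum>j\<in>{1..<?r}. S j) + S ?r"
  proof -
    obtain r where r: "?r = Suc r" using ms(2) by (cases ms) auto
    have "(\<Sum>j\<le>Suc r. S j) = S 0 + (\<Sum>j\<in>{1..r}. S j) + S (Suc r)"
      by (simp add: sum.atMost_shift sum.atLeast1_atMost_eq del: sum.atMost_Suc)
    then show ?thesis unfolding r by (simp add: atLeastLessThanSuc_atLeastAtMost)
  qed
  also have "S 0 = (- 1) ^ k * ZsB ms k"
  proof -
    have "S 0 = (\<Sum>w\<le>k. if w = 0 then (- 1) ^ k * ZsB ms k else 0)"
      unfolding S_def by (intro sum.cong) (auto simp: ZB_Nil)
    then show ?thesis by simp
  qed
  also have "S ?r = (- 1) ^ ?r * ZB ms k"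
  proof -
    have "S ?r = (\<Sum>w\<le>k. if w = k then (- 1) ^ ?r * ZB ms k else 0)"
      unfolding S_def by (intro sum.cong) (auto simp: ZsB_Nil)
    then show ?thesis by simp
  qed
  finally have "(- 1) ^ k * ZsB ms k + (- 1) ^ ?r * ZB ms k = - (\<Sum>j\<in>{1..<?r}. S j)"
    by (simp add: algebra_simps eq_neg_iff_add_eq_0)
  moreover have "S j \<in> J" if "j \<in> {1..<?r}" for j
    unfolding S_def
  proof (intro J_sum)
    fix w assume "w \<in> {..k}"
    with middle[of j w] that show "((- 1) ^ j * ZB (take j ms) w) * ((- 1) ^ (k - w) * ZsB (drop j ms) (k - w)) \<in> J"
      using J_mult J_mult' sign_J sign_R ZB_R[OF ix(1)] ZsB_R[OF ix(2)] by auto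
  qed
  then have "(\<Sum>j\<in>{1..<?r}. S j) \<in> J" by (rule J_sum)
  ultimately show ?thesis
    using rat_vector.subspace_neg[OF J] by simp
qed

lemma ZsB_ones: "r > 0 \<Longrightarrow> ZsB (replicate r 1) n \<in> J"
proof -
  assume r: "r > 0"
  have "(- 1) ^ n * ZsB (replicate r 1) n + (- 1) ^ r * ZB (replicate r 1) n \<in> J"
    using star_transfer[of "replicate r 1" n] r ZB_ones
    by (simp add: is_index_ones[unfolded One_nat_def])
  from rat_vector.subspace_diff[OF J this sign_J[OF ZB_ones[OF r, of n], of r]]
  have "(- 1) ^ n * ZsB (replicate r 1) n \<in> J" by simp
  then have "(- 1) ^ n * ((- 1) ^ n * ZsB (replicate r 1) n) \<in> J" by (rule sign_J)
  moreover have "(- 1) ^ n * ((- 1) ^ n * x) = x" for x :: 'a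
    by (simp flip: power_add mult.assoc)
  ultimately show ?thesis by simp
qed

text \<open>Every proper cut leaves \<open>d\<close> on one side, so the bounds on the other side
  are all 1 and its sum lies in \<open>J\<close>.\<close>

lemma star_transfer_single:
  assumes "d > 0"
  shows "(- 1) ^ k * ZsB (replicate i 1 @ d # replicate j 1) k
    + (- 1) ^ (i + j + 1) * ZB (replicate i 1 @ d # replicate j 1) k \<in> J"
proof -
  let ?ms = "replicate i 1 @ d # replicate j 1"
  have "(- 1) ^ k * ZsB ?ms k + (- 1) ^ length ?ms * ZB ?ms k \<in> J"
  proof (rule star_transfer)
    fix l w assume l: "0 < l" "l < length ?ms"
    show "ZB (take l ?ms) w \<in> J \<or> ZsB (drop l ?ms) (k - w) \<in> J"
    proof (cases "l \<le> i")
      case True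
      then have "take l ?ms = replicate l 1" by simp
      then show ?thesis using ZB_ones l(1) by metis
    next
      case False
      then have "drop l ?ms = replicate (i + j + 1 - l) 1" by (simp add: drop_Cons')
      then show ?thesis using ZsB_ones[of "i + j + 1 - l"] l(2) by simp
    qed
  qed (use assms in \<open>auto simp: is_index_def\<close>)
  then show ?thesis by simp
qed

text \<open>Only a cut between \<open>d\<close> and \<open>e\<close> leaves a large bound on both
  sides; these products are the subject of the hypothesis \<open>mid\<close>.\<close>

lemma star_transfer_double:
  assumes "d > 0" "e > 0"
    and mid: "\<And>i j h h' w. w \<le> k \<Longrightarrow> ZB (replicate i 1 @ d # replicate h 1) w \<in> J
      \<or> ZsB (replicate h' 1 @ e # replicate j 1) (k - w) \<in> J"
  shows "(- 1) ^ k * ZsB (replicate i 1 @ d # replicate h 1 @ e # replicate j 1) k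
    + (- 1) ^ (i + h + j + 2) * ZB (replicate i 1 @ d # replicate h 1 @ e # replicate j 1) k \<in> J"
proof -
  let ?ms = "replicate i 1 @ d # replicate h 1 @ e # replicate j 1"
  have "(- 1) ^ k * ZsB ?ms k + (- 1) ^ length ?ms * ZB ?ms k \<in> J"
  proof (rule star_transfer)
    fix l w assume l: "0 < l" "l < length ?ms" and w: "w \<le> k"
    consider "l \<le> i" | "i < l" "l \<le> i + h + 1" | "i + h + 1 < l" by linarith
    then show "ZB (take l ?ms) w \<in> J \<or> ZsB (drop l ?ms) (k - w) \<in> J"
    proof cases
      case 1
      then have "take l ?ms = replicate l 1" by simp
      then show ?thesis using ZB_ones l(1) by metis
    next
      case 2
      then have "take l ?ms = replicate i 1 @ d # replicate (l - i - 1) 1"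
        "drop l ?ms = replicate (i + h + 1 - l) 1 @ e # replicate j 1"
        by (auto simp: take_Cons' drop_Cons')
      then show ?thesis using mid[OF w] by metis
    next
      case 3
      then have "drop l ?ms = replicate (i + h + j + 2 - l) 1" by (simp add: drop_Cons')
      then show ?thesis using ZsB_ones[of "i + h + j + 2 - l"] l(2) by simp
    qed
  qed (use assms in \<open>auto simp: is_index_def\<close>)
  then show ?thesis by (simp add: add_ac)
qed

lemma star_difference:
  assumes "(- 1) ^ k * ZsB ms k + (- 1) ^ r * ZB ms k \<in> J" "odd k"
  shows "ZB ms k - (- 1) ^ r * ZsB ms k \<in> J"
proof -
  have "(- 1) ^ r * ((- 1) ^ k * ZsB ms k + (- 1) ^ r * ZB ms k) \<in> J"
    using assms(1) by (rule sign_J)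
  also have "(- 1) ^ r * ((- 1) ^ k * ZsB ms k + (- 1) ^ r * ZB ms k) = ZB ms k - (- 1) ^ r * ZsB ms k"
    using assms(2) by (simp add: right_diff_distrib flip: mult.assoc power_add)
  finally show ?thesis .
qed

text \<open>For even weight the values with a single bounded entry vanish, which makes the products
  in the antipode relation vanish for odd weight.\<close>

lemma ZB_2_even:
  assumes "\<And>i j n. even n \<Longrightarrow> i + j + 2 = n \<Longrightarrow> Z (replicate i 1 @ 2 # replicate j 1) \<in> J" and "even n"
  shows "ZB (replicate i 1 @ 2 # replicate j 1) n \<in> J"
    and "ZsB (replicate i 1 @ 2 # replicate j 1) n \<in> J"
proof -
  show *: "ZB (replicate i 1 @ 2 # replicate j 1) n \<in> J"
    by (rule ZB_single[OF J order_refl]) (use assms in auto)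
  from rat_vector.subspace_diff[OF J star_transfer_single[of 2 n i j] sign_J[OF *, of "i + j + 1"]]
  show "ZsB (replicate i 1 @ 2 # replicate j 1) n \<in> J" using \<open>even n\<close> by simp
qed

lemma star_transfer_2_2:
  assumes "\<And>i j n. even n \<Longrightarrow> i + j + 2 = n \<Longrightarrow> Z (replicate i 1 @ 2 # replicate j 1) \<in> J" and "odd k"
  shows "(- 1) ^ k * ZsB (replicate i 1 @ 2 # replicate h 1 @ 2 # replicate j 1) k
    + (- 1) ^ (i + h + j + 2) * ZB (replicate i 1 @ 2 # replicate h 1 @ 2 # replicate j 1) k \<in> J"
proof (rule star_transfer_double)
  fix i j h h' w assume "w \<le> k"
  show "ZB (replicate i 1 @ 2 # replicate h 1) w \<in> J \<or> ZsB (replicate h' 1 @ 2 # replicate j 1) (k - w) \<in> J"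
    using ZB_2_even[OF assms(1)] \<open>odd k\<close> \<open>w \<le> k\<close> by (cases "even w") auto
qed auto

text \<open>\<open>V\<close> stands for the preimage of the line spanned by the single zeta value of
  weight \<open>k\<close>. The hypotheses \<open>Z2\<close>, \<open>Z3\<close> and
  \<open>Z22\<close> about indices with one or two entries different from 1 are the only information
  that the finite and the symmetric case have to supply separately.\<close>

theorem sum_formulas:
  assumes k: "odd k" and V: "rat_vector.subspace V" "J \<subseteq> V"
    and Z2: "\<And>i j n. even n \<Longrightarrow> i + j + 2 = n \<Longrightarrow> Z (replicate i 1 @ 2 # replicate j 1) \<in> J"
    and Z3: "\<And>i j. i + j + 3 = k \<Longrightarrow> Z (replicate i 1 @ 3 # replicate j 1) \<in> V"
    and Z22: "\<And>i h j. i + h + j + 4 = k \<Longrightarrow> Z (replicate i 1 @ 2 # replicate h 1 @ 2 # replicate j 1) \<in> V"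
  shows "1 \<le> i \<Longrightarrow> i \<le> r \<Longrightarrow>
      (\<Sum>ks | ks \<in> compositions k r \<and> 3 \<le> ks ! (i - 1). Z ks)
        - (- 1) ^ r * (\<Sum>ks | ks \<in> compositions k r \<and> 3 \<le> ks ! (i - 1). Zs ks) \<in> J"
    and "1 \<le> i \<Longrightarrow> i \<le> r \<Longrightarrow> (\<Sum>ks | ks \<in> compositions k r \<and> 3 \<le> ks ! (i - 1). Z ks) \<in> V"
    and "1 \<le> i \<Longrightarrow> i < j \<Longrightarrow> j \<le> r \<Longrightarrow>
      (\<Sum>ks | ks \<in> compositions k r \<and> 2 \<le> ks ! (i - 1) \<and> 2 \<le> ks ! (j - 1). Z ks)
        - (- 1) ^ r * (\<Sum>ks | ks \<in> compositions k r \<and> 2 \<le> ks ! (i - 1) \<and> 2 \<le> ks ! (j - 1). Zs ks) \<in> J"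
    and "1 \<le> i \<Longrightarrow> i < j \<Longrightarrow> j \<le> r \<Longrightarrow>
      (\<Sum>ks | ks \<in> compositions k r \<and> 2 \<le> ks ! (i - 1) \<and> 2 \<le> ks ! (j - 1). Z ks) \<in> V"
proof -
  assume i: "1 \<le> i" "i \<le> r"
  \<comment> \<open>Positions are counted from 1, so \<open>i - 1\<close> entries precede the marked
    one.\<close>
  let ?ms = "replicate (i - 1) 1 @ 3 # replicate (r - i) 1"
  have eq: "{ks. ks \<in> compositions k r \<and> 3 \<le> ks ! (i - 1)} = bounded_indices ?ms k"
    unfolding bounded_indices_single[OF zero_less_numeral] using i by (auto simp: compositions_def indices_def)
  have "ZB ?ms k - (- 1) ^ r * ZsB ?ms k \<in> J"
    using star_difference[OF star_transfer_single[of 3 k "i - 1" "r - i"] k] i by simp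
  then show "(\<Sum>ks | ks \<in> compositions k r \<and> 3 \<le> ks ! (i - 1). Z ks)
        - (- 1) ^ r * (\<Sum>ks | ks \<in> compositions k r \<and> 3 \<le> ks ! (i - 1). Zs ks) \<in> J"
    unfolding eq ZB_def ZsB_def .
  have "ZB ?ms k \<in> V" by (rule ZB_single[OF V]) (use Z3 in auto)
  then show "(\<Sum>ks | ks \<in> compositions k r \<and> 3 \<le> ks ! (i - 1). Z ks) \<in> V"
    unfolding eq ZB_def .
next
  assume ij: "1 \<le> i" "i < j" "j \<le> r"
  let ?ms = "replicate (i - 1) 1 @ 2 # replicate (j - i - 1) 1 @ 2 # replicate (r - j) 1"
  have "i - 1 + (j - i - 1) + 1 = j - 1" "i - 1 + (j - i - 1) + (r - j) + 2 = r" using ij by auto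
  note arith = this
  have eq: "{ks. ks \<in> compositions k r \<and> 2 \<le> ks ! (i - 1) \<and> 2 \<le> ks ! (j - 1)} = bounded_indices ?ms k"
    unfolding bounded_indices_double[OF zero_less_numeral zero_less_numeral] arith
    by (auto simp: compositions_def indices_def)
  have "ZB ?ms k - (- 1) ^ r * ZsB ?ms k \<in> J"
    using star_difference[OF star_transfer_2_2[where i = "i - 1" and h = "j - i - 1" and j = "r - j", OF Z2 k] k]
    unfolding arith .
  then show "(\<Sum>ks | ks \<in> compositions k r \<and> 2 \<le> ks ! (i - 1) \<and> 2 \<le> ks ! (j - 1). Z ks)
        - (- 1) ^ r * (\<Sum>ks | ks \<in> compositions k r \<and> 2 \<le> ks ! (i - 1) \<and> 2 \<le> ks ! (j - 1). Zs ks) \<in> J"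
    unfolding eq ZB_def ZsB_def .
  have "ZB ?ms k \<in> V" by (rule ZB_double[OF V]) (use Z22 in auto)
  then show "(\<Sum>ks | ks \<in> compositions k r \<and> 2 \<le> ks ! (i - 1) \<and> 2 \<le> ks ! (j - 1). Z ks) \<in> V"
    unfolding eq ZB_def .
qed

end

section \<open>Sums over tuples\<close>

lemma zeta_term_Cons: "zeta_term (k # ks) (m # ms) = 1 / of_nat m ^ k * (zeta_term ks ms :: 'a::field)"
  unfolding zeta_term_def by (simp add: prod.lessThan_Suc_shift del: prod.lessThan_Suc)

definition strict_below :: "nat \<Rightarrow> nat \<Rightarrow> nat list set"
  where "strict_below p r = {ms \<in> strict_tuples r. \<forall>m\<in>set ms. m < p}"

definition weak_below :: "nat \<Rightarrow> nat \<Rightarrow> nat list set"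
  where "weak_below p r = {ms \<in> weak_tuples r. \<forall>m\<in>set ms. m < p}"

text \<open>Largest denominators come first, so that the order of the list agrees with decreasing
  summation variables.\<close>

definition reciprocals :: "nat \<Rightarrow> 'a::field list"
  where "reciprocals p = map (\<lambda>m. 1 / of_nat m) (rev [1..<p])"

lemma reciprocals_Suc: "p \<ge> 1 \<Longrightarrow> reciprocals (Suc p) = 1 / of_nat p # reciprocals p"
  by (simp add: reciprocals_def)

lemma reciprocals_1: "p \<le> 1 \<Longrightarrow> reciprocals p = []"
  by (simp add: reciprocals_def)

lemma finite_below: "finite (strict_below p r)" "finite (weak_below p r)"
  by (rule finite_subset[OF _ finite_lists_length_eq[of "{..<p}" r]];
      force simp: strict_below_def weak_below_def strict_tuples_def weak_tuples_def)+

lemma below_0: "strict_below p 0 = {[]}" "weak_below p 0 = {[]}"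
  by (auto simp: strict_below_def weak_below_def strict_tuples_def weak_tuples_def)

lemma below_1:
  assumes "p \<le> 1" "r > 0"
  shows "strict_below p r = {}" "weak_below p r = {}"
proof -
  have "\<not> (\<forall>m\<in>set ms. 1 \<le> m) \<or> \<not> (\<forall>m\<in>set ms. m < p)" if "length ms = r" for ms
    using that assms by (cases ms) auto
  then show "strict_below p r = {}" "weak_below p r = {}"
    by (auto simp: strict_below_def weak_below_def strict_tuples_def weak_tuples_def)
qed

lemma strict_below_Suc:
  assumes "p \<ge> 1"
  shows "strict_below (Suc p) (Suc r) = strict_below p (Suc r) \<union> (#) p ` strict_below p r"
proof (intro equalityI subsetI)
  fix ms assume ms: "ms \<in> strict_below (Suc p) (Suc r)"
  then obtain m ms' where m: "ms = m # ms'" by (cases ms) (auto simp: strict_below_def strict_tuples_def)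
  show "ms \<in> strict_below p (Suc r) \<union> (#) p ` strict_below p r"
  proof (cases "m = p")
    case True
    with ms m have "ms' \<in> strict_below p r" by (auto simp: strict_below_def strict_tuples_def)
    with True m show ?thesis by blast
  next
    case False
    with ms m have "ms \<in> strict_below p (Suc r)" by (fastforce simp: strict_below_def strict_tuples_def)
    then show ?thesis ..
  qed
qed (use assms in \<open>auto simp: strict_below_def strict_tuples_def less_Suc_eq\<close>)

text \<open>After a first entry \<open>p\<close> the remaining entries may equal \<open>p\<close>
  again, hence the bound \<open>Suc p\<close> in the second part. This mirrors the recursion of
  \<open>msum_star\<close>, which keeps the head of its list.\<close>

lemma weak_below_Suc:
  assumes "p \<ge> 1"
  shows "weak_below (Suc p) (Suc r) = weak_below p (Suc r) \<union> (#) p ` weak_below (Suc p) r"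
proof (intro equalityI subsetI)
  fix ms assume ms: "ms \<in> weak_below (Suc p) (Suc r)"
  then obtain m ms' where m: "ms = m # ms'" by (cases ms) (auto simp: weak_below_def weak_tuples_def)
  show "ms \<in> weak_below p (Suc r) \<union> (#) p ` weak_below (Suc p) r"
  proof (cases "m = p")
    case True
    with ms m have "ms' \<in> weak_below (Suc p) r" by (auto simp: weak_below_def weak_tuples_def)
    with True m show ?thesis by blast
  next
    case False
    with ms m have "ms \<in> weak_below p (Suc r)" by (fastforce simp: weak_below_def weak_tuples_def)
    then show ?thesis ..
  qed
qed (use assms in \<open>auto simp: weak_below_def weak_tuples_def less_Suc_eq_le\<close>)

lemma sum_strict_below:
  "(\<Sum>ms\<in>strict_below p (length ks). zeta_term ks ms) = (msum (reciprocals p) ks :: 'a::field)"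
proof (induction p arbitrary: ks)
  case 0
  then show ?case
    by (cases ks) (auto simp: below_0 below_1 reciprocals_1 zeta_term_def)
next
  case (Suc p)
  show ?case
  proof (cases ks)
    case (Cons k l)
    show ?thesis
    proof (cases "p \<ge> 1")
      case True
      have "(\<Sum>ms\<in>strict_below (Suc p) (length ks). zeta_term ks ms)
          = (\<Sum>ms\<in>strict_below p (Suc (length l)). zeta_term ks ms) + (\<Sum>ms\<in>(#) p ` strict_below p (length l). zeta_term ks ms :: 'a)"
        unfolding Cons length_Cons strict_below_Suc[OF True]
        by (rule sum.union_disjoint) (use finite_below in \<open>auto simp: strict_below_def\<close>)
      also have "(\<Sum>ms\<in>(#) p ` strict_below p (length l). zeta_term ks ms :: 'a)
          = 1 / of_nat p ^ k * (\<Sum>ms\<in>strict_below p (length l). zeta_term l ms)"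
        by (subst sum.reindex) (auto simp: Cons zeta_term_Cons sum_distrib_left inj_on_def)
      also have "(\<Sum>ms\<in>strict_below p (Suc (length l)). zeta_term ks ms) = (msum (reciprocals p) ks :: 'a)"
        using Suc.IH[of ks] Cons by simp
      finally show ?thesis using True Suc.IH[of l]
        by (simp add: reciprocals_Suc Cons power_divide)
    next
      case False
      then show ?thesis using Cons by (simp add: below_1 reciprocals_1)
    qed
  qed (simp add: below_0 zeta_term_def)
qed

lemma sum_weak_below:
  "(\<Sum>ms\<in>weak_below p (length ks). zeta_term ks ms) = (msum_star (reciprocals p) ks :: 'a::field)"
proof (induction p arbitrary: ks)
  case 0
  then show ?case
    by (cases ks) (auto simp: below_0 below_1 reciprocals_1 zeta_term_def)
next
  case (Suc p)
  show ?case
  \<comment> \<open>The recursion shortens the index without lowering the bound, so a second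
    induction inside the one on \<open>p\<close> is required.\<close>
  proof (induction ks)
    case (Cons k l)
    show ?case
    proof (cases "p \<ge> 1")
      case True
      have "(\<Sum>ms\<in>weak_below (Suc p) (length (k # l)). zeta_term (k # l) ms)
          = (\<Sum>ms\<in>weak_below p (Suc (length l)). zeta_term (k # l) ms) + (\<Sum>ms\<in>(#) p ` weak_below (Suc p) (length l). zeta_term (k # l) ms :: 'a)"
        unfolding length_Cons weak_below_Suc[OF True]
        by (rule sum.union_disjoint) (use finite_below in \<open>auto simp: weak_below_def\<close>)
      also have "(\<Sum>ms\<in>(#) p ` weak_below (Suc p) (length l). zeta_term (k # l) ms :: 'a)
          = 1 / of_nat p ^ k * (\<Sum>ms\<in>weak_below (Suc p) (length l). zeta_term l ms)"
        by (subst sum.reindex) (auto simp: zeta_term_Cons sum_distrib_left inj_on_def)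
      also have "(\<Sum>ms\<in>weak_below p (Suc (length l)). zeta_term (k # l) ms) = (msum_star (reciprocals p) (k # l) :: 'a)"
        using Suc.IH[of "k # l"] by simp
      finally show ?thesis using True Cons.IH
        by (simp add: reciprocals_Suc power_divide)
    next
      case False
      then show ?thesis by (simp add: below_1 reciprocals_1)
    qed
  qed (simp add: below_0 zeta_term_def)
qed

section \<open>Finite multiple zeta values\<close>

text \<open>\<open>q\<close> is integral at \<open>p\<close> with residue \<open>x\<close>. Any
  denominator prime to \<open>p\<close> may serve as witness, not only the reduced one, which makes
  closure under sums and products immediate. In contrast to \<open>rat_residue\<close>, integrality
  is part of the notion.\<close>

definition reduces :: "nat \<Rightarrow> rat \<Rightarrow> int \<Rightarrow> bool"
  where "reduces p q x \<longleftrightarrow>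
    (\<exists>a b. coprime b (int p) \<and> q * of_int b = of_int a \<and> [x * b = a] (mod int p))"

lemma reduces_imp_cong: "reduces p q x \<Longrightarrow> [rat_residue p q = x] (mod int p)"
  unfolding reduces_def using rat_residue_unique by blast

lemma reduces_unique: "reduces p q x \<Longrightarrow> reduces p q y \<Longrightarrow> [x = y] (mod int p)"
  using reduces_imp_cong by (meson cong_sym cong_trans)

lemma reduces_cong: "reduces p q x \<Longrightarrow> [x = y] (mod int p) \<Longrightarrow> reduces p q y"
  unfolding reduces_def by (meson cong_scalar_right cong_sym cong_trans)

lemma reduces_rat_residue: "reduces p q x \<Longrightarrow> reduces p q (rat_residue p q)"
  using reduces_cong reduces_imp_cong cong_sym by blast

lemma reduces_of_int: "reduces p (of_int n) n"
  unfolding reduces_def by (intro exI[of _ n] exI[of _ 1]) simp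

lemma reduces_of_nat: "reduces p (of_nat n) (int n)"
  using reduces_of_int[of p "int n"] by simp

lemma reduces_add:
  assumes "reduces p q x" "reduces p q' x'" shows "reduces p (q + q') (x + x')"
proof -
  obtain a b a' b' where *: "coprime b (int p)" "q * of_int b = of_int a" "[x * b = a] (mod int p)"
    "coprime b' (int p)" "q' * of_int b' = of_int a'" "[x' * b' = a'] (mod int p)"
    using assms by (auto simp: reduces_def)
  show ?thesis unfolding reduces_def
  proof (intro exI conjI)
    show "coprime (b * b') (int p)" using * by simp
    have "(q + q') * of_int (b * b') = (q * of_int b) * of_int b' + (q' * of_int b') * of_int b"
      by (simp add: algebra_simps)
    then show "(q + q') * of_int (b * b') = of_int (a * b' + a' * b)" by (simp only: * of_int_add of_int_mult)
    have "[(x * b) * b' + (x' * b') * b = a * b' + a' * b] (mod int p)"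
      by (intro cong_add cong_mult cong_refl *)
    then show "[(x + x') * (b * b') = a * b' + a' * b] (mod int p)" by (simp add: algebra_simps)
  qed
qed

lemma reduces_mult:
  assumes "reduces p q x" "reduces p q' x'" shows "reduces p (q * q') (x * x')"
proof -
  obtain a b a' b' where *: "coprime b (int p)" "q * of_int b = of_int a" "[x * b = a] (mod int p)"
    "coprime b' (int p)" "q' * of_int b' = of_int a'" "[x' * b' = a'] (mod int p)"
    using assms by (auto simp: reduces_def)
  show ?thesis unfolding reduces_def
  proof (intro exI conjI)
    show "coprime (b * b') (int p)" using * by simp
    have "(q * q') * of_int (b * b') = (q * of_int b) * (q' * of_int b')"
      by (simp add: algebra_simps)
    then show "(q * q') * of_int (b * b') = of_int (a * a')" by (simp only: * of_int_mult)
    have "[(x * b) * (x' * b') = a * a'] (mod int p)"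
      by (intro cong_mult *)
    then show "[(x * x') * (b * b') = a * a'] (mod int p)" by (simp add: algebra_simps)
  qed
qed

lemma reduces_0: "reduces p 0 0" and reduces_1: "reduces p 1 1"
  using reduces_of_int[of p 0] reduces_of_int[of p 1] by simp_all

lemma reduces_uminus: "reduces p q x \<Longrightarrow> reduces p (- q) (- x)"
  using reduces_mult[OF reduces_of_int[of p "- 1"], of q x] by simp

lemma reduces_power: "reduces p q x \<Longrightarrow> reduces p (q ^ n) (x ^ n)"
  by (induction n) (auto simp: reduces_1 reduces_mult)

lemma reduces_sum: "(\<And>i. i \<in> A \<Longrightarrow> reduces p (f i) (g i)) \<Longrightarrow> reduces p (sum f A) (sum g A)"
  by (induction A rule: infinite_finite_induct) (auto simp: reduces_0 reduces_add)

lemma coprime_less_prime: "prime p \<Longrightarrow> 0 < m \<Longrightarrow> m < p \<Longrightarrow> coprime (int m) (int p)"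
  by (metis coprime_commute coprime_int_iff nat_dvd_not_less prime_imp_coprime)

lemma reduces_reciprocal:
  assumes "prime p" "0 < m" "m < p"
  shows "reduces p (1 / of_nat m) (modular_inverse (int p) (int m))"
  unfolding reduces_def
proof (intro exI conjI)
  show "coprime (int m) (int p)" using assms by (rule coprime_less_prime)
  then show "[modular_inverse (int p) (int m) * int m = 1] (mod int p)"
    by (metis cong_modular_inverse1 mult.commute)
qed (use assms in simp)

lemma reduces_msum: "list_all2 (reduces p) xs ys \<Longrightarrow> reduces p (msum xs ks) (msum ys ks)"
proof (induction xs ks arbitrary: ys rule: msum.induct)
  case (3 x xs k ks)
  then obtain y ys' where "ys = y # ys'" "reduces p x y" "list_all2 (reduces p) xs ys'"
    by (auto simp: list_all2_Cons1)
  with 3 show ?case by (auto intro!: reduces_add reduces_mult reduces_power)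
qed (auto simp: reduces_0 reduces_1)

lemma reduces_msum_star: "list_all2 (reduces p) xs ys \<Longrightarrow> reduces p (msum_star xs ks) (msum_star ys ks)"
proof (induction xs ks arbitrary: ys rule: msum_star.induct)
  case (3 x xs k ks)
  then obtain y ys' where "ys = y # ys'" "reduces p x y" "list_all2 (reduces p) xs ys'"
    by (auto simp: list_all2_Cons1)
  with 3 show ?case by (auto intro!: reduces_add reduces_mult reduces_power)
qed (auto simp: reduces_0 reduces_1)

definition inverses :: "nat \<Rightarrow> int list"
  where "inverses p = map (\<lambda>m. modular_inverse (int p) (int m)) (rev [1..<p])"

lemma reduces_inverses: "prime p \<Longrightarrow> list_all2 (reduces p) (reciprocals p) (inverses p)"
  unfolding inverses_def reciprocals_def
  by (auto simp: list_all2_map1 list_all2_map2 list_all2_same intro: reduces_reciprocal)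

lemma abs_poor_adele_eqI:
  assumes "\<And>p. prime p \<Longrightarrow> p > n \<Longrightarrow> [f p = g p] (mod int p)"
  shows "abs_poor_adele f = abs_poor_adele g"
proof -
  have "{p. \<not> (prime p \<longrightarrow> [f p = g p] (mod int p))} \<subseteq> {..n}"
    using assms by (auto simp: not_less[symmetric])
  then have "finite {p. \<not> (prime p \<longrightarrow> [f p = g p] (mod int p))}" by (rule finite_subset) simp
  then show ?thesis by (simp add: poor_adele.abs_eq_iff almost_cong_def eventually_cofinite)
qed

lemma zeta_A_eq: "zeta_A ks = abs_poor_adele (\<lambda>p. msum (inverses p) ks)"
proof -
  have "zeta_A ks = abs_poor_adele (\<lambda>p. rat_residue p (msum (reciprocals p) ks))"
    by (simp add: zeta_A_def poor_adele_of_rats.abs_eq sum_strict_below[symmetric] strict_below_def)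
  also have "\<dots> = abs_poor_adele (\<lambda>p. msum (inverses p) ks)"
    by (rule abs_poor_adele_eqI[of 0]) (intro reduces_imp_cong reduces_msum reduces_inverses)
  finally show ?thesis .
qed

lemma zeta_star_A_eq: "zeta_star_A ks = abs_poor_adele (\<lambda>p. msum_star (inverses p) ks)"
proof -
  have "zeta_star_A ks = abs_poor_adele (\<lambda>p. rat_residue p (msum_star (reciprocals p) ks))"
    by (simp add: zeta_star_A_def poor_adele_of_rats.abs_eq sum_weak_below[symmetric] weak_below_def)
  also have "\<dots> = abs_poor_adele (\<lambda>p. msum_star (inverses p) ks)"
    by (rule abs_poor_adele_eqI[of 0]) (intro reduces_imp_cong reduces_msum_star reduces_inverses)
  finally show ?thesis .
qed

lemma abs_poor_adele_plus: "abs_poor_adele f + abs_poor_adele g = abs_poor_adele (\<lambda>p. f p + g p)"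
  by (rule plus_poor_adele.abs_eq)

lemma abs_poor_adele_mult: "abs_poor_adele f * abs_poor_adele g = abs_poor_adele (\<lambda>p. f p * g p)"
  by (rule times_poor_adele.abs_eq)

lemma abs_poor_adele_0: "0 = abs_poor_adele (\<lambda>_. 0)" and abs_poor_adele_1: "1 = abs_poor_adele (\<lambda>_. 1)"
  by (simp_all add: zero_poor_adele_def one_poor_adele_def)

lemma abs_poor_adele_uminus: "- abs_poor_adele f = abs_poor_adele (\<lambda>p. - f p)"
  by (rule uminus_poor_adele.abs_eq)

lemma abs_poor_adele_sum: "(\<Sum>i\<in>A. abs_poor_adele (f i)) = abs_poor_adele (\<lambda>p. \<Sum>i\<in>A. f i p)"
  by (induction A rule: infinite_finite_induct) (simp_all add: abs_poor_adele_0 abs_poor_adele_plus)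

lemma abs_poor_adele_power: "abs_poor_adele f ^ n = abs_poor_adele (\<lambda>p. f p ^ n)"
  by (induction n) (simp_all add: abs_poor_adele_1 abs_poor_adele_mult)

lemma of_nat_poor_adele: "of_nat n = abs_poor_adele (\<lambda>_. int n)"
  by (induction n) (simp_all add: abs_poor_adele_0 abs_poor_adele_1 abs_poor_adele_plus)

lemma of_int_poor_adele: "of_int n = abs_poor_adele (\<lambda>_. n)"
  by (cases n rule: int_cases2) (simp_all add: of_nat_poor_adele abs_poor_adele_uminus)

lemmas abs_poor_adele_hom = abs_poor_adele_plus abs_poor_adele_mult abs_poor_adele_uminus
  abs_poor_adele_sum abs_poor_adele_power of_nat_poor_adele of_int_poor_adele

lemma zeta_A_antipode:
  assumes "ks \<noteq> []"
  shows "(\<Sum>j\<le>length ks. (- 1) ^ j * zeta_A (take j ks) * zeta_star_A (rev (drop j ks))) = 0"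
  using assms msum_antipode[where ks = ks and xs = "inverses _"]
  by (simp only: zeta_A_eq zeta_star_A_eq abs_poor_adele_hom abs_poor_adele_0 abs_poor_adele_1 if_False)

lemma zeta_A_newton:
  "of_nat (Suc n) * zeta_A (replicate (Suc n) 1)
     = (\<Sum>j\<le>n. (- 1) ^ j * zeta_A [Suc j] * zeta_A (replicate (n - j) 1))"
  unfolding zeta_A_eq abs_poor_adele_hom abs_poor_adele_1 newton_msum ..

lemma zeta_A_weighted:
  assumes "\<forall>(d, c)\<in>set ts. d > 0"
  shows "(\<Sum>m\<le>n. weighted_sum zeta_A (marked (eq_wt 1 (- 1)) []) m
        * weighted_sum zeta_A (marked (\<lambda>_. c) (map (\<lambda>(d, c). (geq_wt d, \<lambda>_. c)) ts)) (n - m))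
    = weighted_sum zeta_A (marked (eq_wt 1 (c - 1)) (map (\<lambda>(d, c). (eq_wt d 1, eq_wt 1 (c - 1))) ts)) n"
proof -
  have "weighted_sum zeta_A w m = abs_poor_adele (\<lambda>p. weighted_sum (msum (inverses p)) w m)" for w m
    unfolding weighted_sum_def zeta_A_eq abs_poor_adele_hom by simp
  then show ?thesis
    by (simp only: abs_poor_adele_hom weighted_sum_from[OF assms])
qed

text \<open>Reversing the list exchanges m and p - m, and p - m is -m modulo p.\<close>

lemma inverses_rev:
  assumes "prime p"
  shows "list_all2 (\<lambda>x y. [x = y] (mod int p)) (rev (inverses p)) (map uminus (inverses p))"
proof (rule list_all2_all_nthI)
  show "length (rev (inverses p)) = length (map uminus (inverses p))" by simp
  fix i assume "i < length (rev (inverses p))"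
  then have i: "Suc i < p" by (simp add: inverses_def)
  have upt: "[1..<p] ! i = Suc i" using i by simp
  have "rev (inverses p) ! i = map (\<lambda>m. modular_inverse (int p) (int m)) [1..<p] ! i"
    by (simp add: inverses_def rev_map)
  also have "\<dots> = modular_inverse (int p) (int ([1..<p] ! i))" using i by (intro nth_map) simp
  finally have eq: "rev (inverses p) ! i = modular_inverse (int p) (int (Suc i))" unfolding upt .
  have "rev [1..<p] ! i = p - Suc i" using i by (simp add: rev_nth Suc_diff_Suc)
  then have eq': "map uminus (inverses p) ! i = - modular_inverse (int p) (int (p - Suc i))"
    using i by (simp add: inverses_def del: of_nat_diff)
  have "reduces p (1 / of_nat (Suc i)) (- modular_inverse (int p) (int (p - Suc i)))"
    unfolding reduces_def
  proof (intro exI conjI)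
    show "coprime (int (Suc i)) (int p)" using i assms coprime_less_prime by blast
    have "[int (p - Suc i) * modular_inverse (int p) (int (p - Suc i)) = 1] (mod int p)"
      using i assms by (intro cong_modular_inverse1 coprime_less_prime) auto
    then have "[(int p - int (Suc i)) * modular_inverse (int p) (int (p - Suc i)) = 1] (mod int p)"
      using i by (simp add: of_nat_diff)
    moreover have "[(int p - int (Suc i)) * modular_inverse (int p) (int (p - Suc i))
        = (0 - int (Suc i)) * modular_inverse (int p) (int (p - Suc i))] (mod int p)"
      by (intro cong_mult cong_diff cong_refl) (simp add: cong_def)
    ultimately show "[- modular_inverse (int p) (int (p - Suc i)) * int (Suc i) = 1] (mod int p)"
      by (metis (no_types, lifting) cong_sym cong_trans diff_0 minus_mult_commute mult.commute)
  qed simp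
  then show "[rev (inverses p) ! i = map uminus (inverses p) ! i] (mod int p)"
    unfolding eq eq' using reduces_reciprocal[OF assms, of "Suc i"] i reduces_unique by blast
qed

lemma cong_msum_star:
  "list_all2 (\<lambda>x y. [x = y] (mod m)) xs ys \<Longrightarrow> [msum_star xs ks = msum_star ys ks] (mod (m::int))"
proof (induction xs ks arbitrary: ys rule: msum_star.induct)
  case (3 x xs k ks)
  then obtain y ys' where "ys = y # ys'" "[x = y] (mod m)" "list_all2 (\<lambda>x y. [x = y] (mod m)) xs ys'"
    by (auto simp: list_all2_Cons1)
  with 3 show ?case by (auto intro!: cong_add cong_mult cong_pow)
qed auto

lemma zeta_star_A_rev: "zeta_star_A (rev ks) = (- 1) ^ sum_list ks * zeta_star_A ks"
proof -
  have "[msum_star (inverses p) (rev ks) = (- 1) ^ sum_list ks * msum_star (inverses p) ks] (mod int p)"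
    if "prime p" for p
  proof -
    have "msum_star (inverses p) (rev ks) = msum_star (rev (inverses p)) ks"
      using msum_star_rev[of "rev (inverses p)" ks] by simp
    also have "[\<dots> = msum_star (map uminus (inverses p)) ks] (mod int p)"
      by (intro cong_msum_star inverses_rev that)
    finally show ?thesis by (simp add: msum_star_map_uminus)
  qed
  then show ?thesis
    unfolding zeta_star_A_eq abs_poor_adele_hom abs_poor_adele_1
    by (intro abs_poor_adele_eqI)
qed

section \<open>Bernoulli numbers and power sums modulo p\<close>

lemma bernoulli_fps:
  "Abs_fps (\<lambda>n. bernoulli n / fact n) * (fps_exp 1 - 1) = (fps_X :: rat fps)"
proof -
  have "fps_exp 1 - (1 :: rat fps) \<noteq> 0"
    using fps_nonzeroI[of "fps_exp 1 - (1 :: rat fps)" 1] by simp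
  moreover have "subdegree (fps_exp 1 - (1 :: rat fps)) = 1"
    by (rule subdegreeI) auto
  \<comment> \<open>Numerator and denominator both have subdegree 1, so the quotient that defines
    the Bernoulli numbers is exact.\<close>
  ultimately have "fps_exp 1 - 1 dvd (fps_X :: rat fps)"
    by (simp add: fps_dvd_iff)
  then have "fps_X / (fps_exp 1 - 1) * (fps_exp 1 - 1) = (fps_X :: rat fps)"
    by simp
  moreover have "Abs_fps (\<lambda>n. bernoulli n / fact n) = (fps_X / (fps_exp 1 - 1) :: rat fps)"
    by (rule fps_ext) (simp add: bernoulli_def)
  ultimately show ?thesis by simp
qed

text \<open>The exponentials exp(n X) with n < m form a geometric sum, which telescopes against
  exp(X) - 1. Multiplying by the Bernoulli series and comparing coefficients of X^(s + 1) gives the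
  formula.\<close>

lemma faulhaber:
  assumes "s \<ge> 1"
  shows "of_nat (Suc s) * (\<Sum>n<m. of_nat n ^ s :: rat)
    = (\<Sum>j\<le>s. of_nat (Suc s choose j) * bernoulli j * of_nat m ^ (Suc s - j))"
proof -
  let ?B = "Abs_fps (\<lambda>n. bernoulli n / fact n)"
  have "(\<Sum>n<m. fps_exp (of_nat n)) * (fps_exp 1 - 1) = fps_exp (of_nat m) - (1 :: rat fps)"
  proof (induction m)
    case (Suc m)
    have "fps_exp (of_nat m) * fps_exp 1 = (fps_exp (of_nat (Suc m)) :: rat fps)"
      by (simp add: add.commute flip: fps_exp_add_mult)
    with Suc show ?case by (simp add: algebra_simps)
  qed simp
  then have "fps_X * (\<Sum>n<m. fps_exp (of_nat n)) = ?B * (fps_exp (of_nat m) - (1 :: rat fps))"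
    by (metis (no_types) bernoulli_fps mult.assoc mult.commute)
  then have "fps_nth (fps_X * (\<Sum>n<m. fps_exp (of_nat n))) (Suc s) = fps_nth (?B * (fps_exp (of_nat m) - (1 :: rat fps))) (Suc s)"
    by simp
  moreover have "fps_nth (fps_X * (\<Sum>n<m. fps_exp (of_nat n :: rat))) (Suc s) = (\<Sum>n<m. of_nat n ^ s / fact s)"
    by (simp only: fps_X_mult_nth fps_sum_nth fps_exp_def fps_nth_Abs_fps) simp
  moreover have "fps_nth (?B * (fps_exp (of_nat m) - (1 :: rat fps))) (Suc s)
      = (\<Sum>j\<le>s. bernoulli j / fact j * (of_nat m ^ (Suc s - j) / fact (Suc s - j)))"
  proof -
    \<comment> \<open>The constant coefficient vanishes, which removes the term
      \<open>j = Suc s\<close> from the Cauchy product.\<close>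
    have "fps_nth (fps_exp c - 1) n = (if n = 0 then 0 else c ^ n / fact n)" for c :: rat and n
      by simp
    then show ?thesis
      unfolding fps_mult_nth atLeast0AtMost sum.atMost_Suc[of _ s] by (simp del: fact_Suc power_Suc)
  qed
  ultimately have "(\<Sum>n<m. of_nat n ^ s / fact s :: rat)
      = (\<Sum>j\<le>s. bernoulli j / fact j * (of_nat m ^ (Suc s - j) / fact (Suc s - j)))"
    by (simp only:)
  then have "fact (Suc s) * (\<Sum>n<m. of_nat n ^ s / fact s :: rat)
      = (\<Sum>j\<le>s. fact (Suc s) * (bernoulli j / fact j * (of_nat m ^ (Suc s - j) / fact (Suc s - j))))"
    by (simp add: sum_distrib_left)
  moreover have "fact (Suc s) * (bernoulli j / fact j * (of_nat m ^ (Suc s - j) / fact (Suc s - j)))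
      = of_nat (Suc s choose j) * bernoulli j * (of_nat m ^ (Suc s - j) :: rat)" if "j \<le> s" for j
    using that by (subst binomial_fact) auto
  moreover have "fact (Suc s) * (\<Sum>n<m. of_nat n ^ s / fact s :: rat) = of_nat (Suc s) * (\<Sum>n<m. of_nat n ^ s)"
    by (simp add: sum_divide_distrib[symmetric] fact_Suc)
  ultimately show ?thesis by simp
qed

text \<open>Faulhaber's formula with \<open>m = 1\<close>, where the power sum consists of the
  single term 0.\<close>

lemma bernoulli_rec:
  assumes "n \<ge> 1"
  shows "of_nat (Suc n) * bernoulli n = - (\<Sum>j<n. of_nat (Suc n choose j) * bernoulli j)"
proof -
  have "0 = (\<Sum>j\<le>n. of_nat (Suc n choose j) * bernoulli j)"
    using faulhaber[OF assms, of 1] assms by (simp add: power_0_left)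
  also have "\<dots> = (\<Sum>j<n. of_nat (Suc n choose j) * bernoulli j) + of_nat (Suc n) * bernoulli n"
    by (subst lessThan_Suc_atMost[symmetric]) (simp only: sum.lessThan_Suc binomial_Suc_n)
  finally show ?thesis by simp
qed

lemma reduces_divide:
  assumes "prime p" "0 < m" "m < p" "\<exists>x. reduces p (of_nat m * q) x"
  shows "\<exists>x. reduces p q x"
proof -
  obtain x where "reduces p (of_nat m * q) x" using assms by blast
  from reduces_mult[OF reduces_reciprocal[OF assms(1-3)] this] assms(2)
  show ?thesis by (auto simp flip: mult.assoc)
qed

text \<open>The recursion for the n-th Bernoulli number divides only by n + 1, which is smaller than
  p; this is the easy half of the theorem of von Staudt and Clausen.\<close>

lemma reduces_bernoulli:
  assumes "prime p" "Suc n < p"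
  shows "\<exists>x. reduces p (bernoulli n) x"
  using assms(2)
proof (induction n rule: less_induct)
  case (less n)
  show ?case
  proof (cases "n = 0")
    case True
    have "fps_nth (Abs_fps (\<lambda>n. bernoulli n / fact n) * (fps_exp 1 - 1)) 1 = (fps_nth fps_X 1 :: rat)"
      by (simp only: bernoulli_fps)
    then have "bernoulli 0 = 1" by (simp add: fps_mult_nth)
    with True show ?thesis using reduces_1 by auto
  next
    case False
    have "\<exists>x. reduces p (bernoulli j) x" if "j < n" for j using less that by simp
    then obtain f where f: "\<And>j. j < n \<Longrightarrow> reduces p (bernoulli j) (f j)" by metis
    have "reduces p (- (\<Sum>j<n. of_nat (Suc n choose j) * bernoulli j)) (- (\<Sum>j<n. int (Suc n choose j) * f j))"
      by (intro reduces_uminus reduces_sum reduces_mult reduces_of_nat f) simp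
    moreover have "of_nat (Suc n) * bernoulli n = - (\<Sum>j<n. of_nat (Suc n choose j) * bernoulli j)"
      using False by (intro bernoulli_rec) simp
    ultimately have "\<exists>x. reduces p (of_nat (Suc n) * bernoulli n) x" by metis
    then show ?thesis by (rule reduces_divide[OF assms(1) zero_less_Suc less.prems])
  qed
qed

lemma fermat_cong:
  assumes "prime p" "0 < m" "m < p"
  shows "[int m ^ (p - 1) = 1] (mod int p)"
  using fermat_theorem[of p m] assms by (auto simp: nat_dvd_not_less cong_int_iff[symmetric])

text \<open>In Faulhaber's formula at \<open>m = p\<close> every term has a positive power of p and
  a Bernoulli number integral at p, and the factor s + 1 on the left is invertible.\<close>

lemma power_sum_cong_0:
  assumes "prime p" "0 < s" "s < p - 1"
  shows "[(\<Sum>n\<in>{1..<p}. int n ^ s) = 0] (mod int p)"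
proof -
  have p: "Suc s < p" using assms by simp
  define f where "f j = rat_residue p (bernoulli j)" for j
  have f: "reduces p (bernoulli j) (f j)" if "j \<le> s" for j
    unfolding f_def using reduces_bernoulli[OF assms(1), of j] reduces_rat_residue that p by auto
  have "reduces p (\<Sum>j\<le>s. of_nat (Suc s choose j) * bernoulli j * of_nat p ^ (Suc s - j))
      (\<Sum>j\<le>s. int (Suc s choose j) * f j * int p ^ (Suc s - j))"
    by (intro reduces_sum reduces_mult reduces_of_nat reduces_power f) simp
  moreover have "(\<Sum>j\<le>s. of_nat (Suc s choose j) * bernoulli j * of_nat p ^ (Suc s - j)) = of_nat (Suc s) * (\<Sum>n<p. of_nat n ^ s)"
    using assms(2) by (subst faulhaber) auto
  moreover have "[(\<Sum>j\<le>s. int (Suc s choose j) * f j * int p ^ (Suc s - j)) = 0] (mod int p)"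
    by (auto simp: cong_0_iff intro!: dvd_sum)
  ultimately have "reduces p (of_nat (Suc s) * (\<Sum>n<p. of_nat n ^ s)) 0" by (metis reduces_cong)
  moreover have "reduces p (of_nat (Suc s) * (\<Sum>n<p. of_nat n ^ s)) (int (Suc s) * (\<Sum>n<p. int n ^ s))"
    by (intro reduces_mult reduces_sum reduces_power reduces_of_nat)
  ultimately have "[int (Suc s) * (\<Sum>n<p. int n ^ s) = int (Suc s) * 0] (mod int p)"
    using reduces_unique by simp
  then have "[(\<Sum>n<p. int n ^ s) = 0] (mod int p)"
    using coprime_less_prime[OF assms(1), of "Suc s"] p
    by (simp only: cong_mult_lcancel zero_less_Suc)
  moreover have "(\<Sum>n<p. int n ^ s) = (\<Sum>n\<in>{1..<p}. int n ^ s)"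
    using assms(2) by (intro sum.mono_neutral_right) auto
  ultimately show ?thesis by simp
qed

text \<open>Exponents beyond p - 1 are lowered once by Fermat's theorem. The stated range covers the
  exponents arising in depth two.\<close>

lemma power_sum_cong:
  assumes "prime p" "0 < e" "e < 2 * (p - 1)"
  shows "[(\<Sum>n\<in>{1..<p}. int n ^ e) = (if e = p - 1 then - 1 else 0)] (mod int p)"
proof -
  consider "e < p - 1" | "e = p - 1" | "e > p - 1" by linarith
  then show ?thesis
  proof cases
    case 1
    then show ?thesis using power_sum_cong_0[OF assms(1,2)] by simp
  next
    case 2
    have "[(\<Sum>n\<in>{1..<p}. int n ^ e) = (\<Sum>n\<in>{1..<p}. 1)] (mod int p)"
      unfolding 2 by (intro cong_sum fermat_cong assms) auto
    also have "(\<Sum>n\<in>{1..<p}. 1) = int p - 1" using prime_gt_0_nat[OF assms(1)] by (simp add: of_nat_diff)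
    also have "[int p - 1 = 0 - 1] (mod int p)" by (intro cong_diff) (auto simp: cong_def)
    finally show ?thesis using 2 by simp
  next
    case 3
    have "[(\<Sum>n\<in>{1..<p}. int n ^ e) = (\<Sum>n\<in>{1..<p}. int n ^ (e - (p - 1)))] (mod int p)"
    proof (intro cong_sum)
      fix n assume "n \<in> {1..<p}"
      then have "[int n ^ (p - 1) * int n ^ (e - (p - 1)) = 1 * int n ^ (e - (p - 1))] (mod int p)"
        by (intro cong_mult fermat_cong assms cong_refl) auto
      with 3 show "[int n ^ e = int n ^ (e - (p - 1))] (mod int p)" by (simp flip: power_add)
    qed
    also have "[(\<Sum>n\<in>{1..<p}. int n ^ (e - (p - 1))) = 0] (mod int p)"
      by (rule power_sum_cong_0) (use assms 3 in auto)
    finally show ?thesis using 3 by simp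
  qed
qed

lemma inverse_power_cong:
  assumes "prime p" "0 < m" "m < p" "k \<le> p - 1"
  shows "[modular_inverse (int p) (int m) ^ k = int m ^ (p - 1 - k)] (mod int p)"
proof -
  let ?i = "modular_inverse (int p) (int m)"
  have cop: "coprime (int m) (int p)" using assms coprime_less_prime by blast
  have "[(int m * ?i) ^ k = 1 ^ k] (mod int p)" by (intro cong_pow cong_modular_inverse1 cop)
  then have "[int m ^ k * ?i ^ k = 1] (mod int p)" by (simp add: power_mult_distrib)
  also have "[1 = int m ^ (p - 1)] (mod int p)" using fermat_cong[OF assms(1-3)] by (rule cong_sym)
  also have "int m ^ (p - 1) = int m ^ k * int m ^ (p - 1 - k)" using assms(4) by (metis le_add_diff_inverse power_add)
  finally have "[int m ^ k * ?i ^ k = int m ^ k * int m ^ (p - 1 - k)] (mod int p)" .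
  then show ?thesis using cop by (simp add: cong_mult_lcancel)
qed

lemma msum_map_single: "msum (map f (rev [1..<p])) [k] = (\<Sum>m\<in>{1..<p}. f m ^ k)"
  by (induction p) (auto simp: atLeastLessThanSuc)

lemma msum_map_pair:
  "msum (map f (rev [1..<p])) [a, b] = (\<Sum>m\<in>{1..<p}. f m ^ a * (\<Sum>n\<in>{1..<m}. f n ^ b))"
  by (induction p) (auto simp: atLeastLessThanSuc msum_map_single[unfolded One_nat_def] algebra_simps)

lemma zeta_A_single:
  assumes "k > 0"
  shows "zeta_A [k] = 0"
  unfolding zeta_A_eq abs_poor_adele_0
proof (rule abs_poor_adele_eqI)
  \<comment> \<open>The bound keeps the exponent p - 1 - k positive.\<close>
  fix p :: nat assume p: "prime p" "p > Suc k"
  have "msum (inverses p) [k] = (\<Sum>m\<in>{1..<p}. modular_inverse (int p) (int m) ^ k)"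
    unfolding inverses_def by (rule msum_map_single)
  also have "[\<dots> = (\<Sum>m\<in>{1..<p}. int m ^ (p - 1 - k))] (mod int p)"
    by (intro cong_sum inverse_power_cong) (use p in auto)
  also have "[(\<Sum>m\<in>{1..<p}. int m ^ (p - 1 - k)) = 0] (mod int p)"
    by (intro power_sum_cong_0) (use p assms in auto)
  finally show "[msum (inverses p) [k] = 0] (mod int p)" .
qed

interpretation A: zeta_values zeta_A zeta_star_A UNIV "{0}"
proof
  show "zeta_A [] = 1" "zeta_star_A [] = 1"
    by (simp_all add: zeta_A_eq zeta_star_A_eq abs_poor_adele_1)
  show "zeta_A [k] \<in> {0}" if "k > 0" for k using zeta_A_single[OF that] by simp
  show "rat_vector.subspace (UNIV :: poor_adele set)" by (rule rat_vector.subspace_UNIV)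
  show "rat_vector.subspace {0 :: poor_adele}" by (rule rat_vector.subspace_single_0)
  show "zeta_star_A (rev ks) = (- 1) ^ sum_list ks * zeta_star_A ks" for ks by (rule zeta_star_A_rev)
  show "of_nat (Suc n) * zeta_A (replicate (Suc n) 1)
     = (\<Sum>j\<le>n. (- 1) ^ j * zeta_A [Suc j] * zeta_A (replicate (n - j) 1))" for n
    by (rule zeta_A_newton)
qed (use zeta_A_antipode zeta_A_weighted in auto)

lemma scaleQ_abs_poor_adele: "q *\<^sub>Q abs_poor_adele f = abs_poor_adele (\<lambda>p. rat_residue p q * f p)"
  by (rule scaleQ_poor_adele.abs_eq)

text \<open>Fermat's theorem replaces inverses by powers and Faulhaber's formula evaluates the inner
  sum. The outer power sums then vanish except at the exponent p - 1, that is at j = p - k, which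
  leaves one Bernoulli number. Its binomial coefficient is congruent to a rational number
  independent of p.\<close>

lemma zeta_A_double:
  assumes ab: "a > 0" "b > 0" and k: "k = a + b"
  shows "\<exists>q. zeta_A [a, b] = q *\<^sub>Q Z_A k"
proof -
  \<comment> \<open>\<open>P\<close> divided by \<open>fact a\<close> is the binomial coefficient of
    -b over a, to which p - b over a is congruent. In \<open>q\<close> the factor 1/b comes from s +
    1 = p - b, and k cancels the denominator in \<open>Z_A\<close>.\<close>
  define P where "P = (\<Prod>i<a. - int b - int i)"
  define q where "q = of_int (int k * P) / (of_int (int b * fact a) :: rat)"
  have q: "q * of_int (int b * fact a) = of_int (int k * P)"
    using ab by (simp add: q_def)
  have "zeta_A [a, b] = q *\<^sub>Q Z_A k"
    unfolding zeta_A_eq Z_A_def poor_adele_of_rats.abs_eq scaleQ_abs_poor_adele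
  proof (rule abs_poor_adele_eqI)
    fix p :: nat assume p: "prime p" "p > k + 2"
    define s where "s = p - 1 - b"
    define B where "B j = rat_residue p (bernoulli j)" for j
    have B: "reduces p (bernoulli j) (B j)" if "Suc j < p" for j
      unfolding B_def using reduces_bernoulli[OF p(1) that] reduces_rat_residue by blast
    have s: "s \<ge> 1" "Suc s = p - b" "Suc s < p" using p ab k by (auto simp: s_def)
    have "[msum (inverses p) [a, b] = (\<Sum>m\<in>{1..<p}. int m ^ (p - 1 - a) * (\<Sum>n\<in>{1..<m}. int n ^ s))] (mod int p)"
      unfolding inverses_def msum_map_pair s_def
      by (intro cong_sum cong_mult inverse_power_cong) (use p k in auto)
    then have "[int (Suc s) * msum (inverses p) [a, b]
        = int (Suc s) * (\<Sum>m\<in>{1..<p}. int m ^ (p - 1 - a) * (\<Sum>n\<in>{1..<m}. int n ^ s))] (mod int p)"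
      by (intro cong_mult cong_refl)
    also have "int (Suc s) * (\<Sum>m\<in>{1..<p}. int m ^ (p - 1 - a) * (\<Sum>n\<in>{1..<m}. int n ^ s))
        = (\<Sum>m\<in>{1..<p}. int m ^ (p - 1 - a) * (int (Suc s) * (\<Sum>n\<in>{1..<m}. int n ^ s)))"
      by (simp add: sum_distrib_left mult_ac)
    also have "[\<dots> = (\<Sum>m\<in>{1..<p}. int m ^ (p - 1 - a) * (\<Sum>j\<le>s. int (Suc s choose j) * B j * int m ^ (Suc s - j)))] (mod int p)"
    proof (intro cong_sum cong_mult cong_refl)
      fix m assume "m \<in> {1..<p}"
      have "reduces p (\<Sum>j\<le>s. of_nat (Suc s choose j) * bernoulli j * of_nat m ^ (Suc s - j))
        (\<Sum>j\<le>s. int (Suc s choose j) * B j * int m ^ (Suc s - j))"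
        by (intro reduces_sum reduces_mult reduces_of_nat reduces_power B) (use s in auto)
      moreover have "reduces p (of_nat (Suc s) * (\<Sum>n<m. of_nat n ^ s)) (int (Suc s) * (\<Sum>n<m. int n ^ s))"
        by (intro reduces_mult reduces_sum reduces_power reduces_of_nat)
      moreover have "(\<Sum>n<m. int n ^ s) = (\<Sum>n\<in>{1..<m}. int n ^ s)"
        using s(1) by (intro sum.mono_neutral_right) auto
      ultimately show "[int (Suc s) * (\<Sum>n\<in>{1..<m}. int n ^ s)
          = (\<Sum>j\<le>s. int (Suc s choose j) * B j * int m ^ (Suc s - j))] (mod int p)"
        using reduces_unique faulhaber[OF s(1)] by metis
    qed
    also have "(\<Sum>m\<in>{1..<p}. int m ^ (p - 1 - a) * (\<Sum>j\<le>s. int (Suc s choose j) * B j * int m ^ (Suc s - j)))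
      = (\<Sum>j\<le>s. int (Suc s choose j) * B j * (\<Sum>m\<in>{1..<p}. int m ^ (p - 1 - a + (Suc s - j))))"
      by (simp only: sum_distrib_left power_add, subst sum.swap) (intro sum.cong refl, simp add: mult_ac)
    \<comment> \<open>The largest exponent is 2 p - 1 - k, which is below 2 (p - 1) because k \<ge>
      2.\<close>
    also have "[\<dots> = (\<Sum>j\<le>s. int (Suc s choose j) * B j * (if p - 1 - a + (Suc s - j) = p - 1 then - 1 else 0))] (mod int p)"
      by (intro cong_sum cong_mult cong_refl power_sum_cong p) (use p k ab s in auto)
    also have "(\<Sum>j\<le>s. int (Suc s choose j) * B j * (if p - 1 - a + (Suc s - j) = p - 1 then - 1 else 0))
       = (\<Sum>j\<le>s. if j = p - k then - (int (Suc s choose (p - k)) * B (p - k)) else 0)"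
      by (intro sum.cong refl) (use p k ab s in auto)
    also have "\<dots> = - (int (Suc s choose (p - k)) * B (p - k))"
      using p k ab s by (simp add: s_def)
    finally have main: "[int (Suc s) * msum (inverses p) [a, b] = - (int (p - b choose a) * B (p - k))] (mod int p)"
      using binomial_symmetric[of a "p - b"] p k s(2) by (simp add: add.commute)
    define y where "y = rat_residue p (bernoulli (p - k) / of_nat k)"
    have y: "[B (p - k) = int k * y] (mod int p)"
    proof -
      have Bk: "reduces p (bernoulli (p - k)) (B (p - k))" using B p k ab by simp
      have "\<exists>x. reduces p (bernoulli (p - k) / of_nat k) x"
        by (rule reduces_divide[OF p(1), of k]) (use p k ab Bk in auto)
      then have "reduces p (bernoulli (p - k) / of_nat k) y" unfolding y_def using reduces_rat_residue by blast
      from reduces_mult[OF reduces_of_nat this, of k] have "reduces p (bernoulli (p - k)) (int k * y)"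
        using k ab by simp
      with Bk show ?thesis by (rule reduces_unique)
    qed
    have fact_cop: "coprime (fact a :: int) (int p)"
    proof -
      have "\<not> p dvd fact a" using prime_dvd_fact_iff[OF p(1)] p k by auto
      then have "coprime p (fact a)" using p(1) prime_imp_coprime by blast
      then have "coprime (int (fact a)) (int p)" by (metis coprime_commute coprime_int_iff)
      then show ?thesis by (simp only: of_nat_fact)
    qed
    have chooseP: "[int (p - b choose a) * fact a = P] (mod int p)"
    proof -
      have "int (p - b choose a) * fact a = (\<Prod>i<a. int (p - b) - int i)"
      proof -
        have "of_nat (p - b choose a) * fact a = (\<Prod>i<a. of_nat (p - b) - of_nat i :: rat)"
          unfolding binomial_gbinomial gbinomial_prod_rev by (simp add: atLeast0LessThan)
        then have "of_int (int (p - b choose a) * fact a) = (of_int (\<Prod>i<a. int (p - b) - int i) :: rat)" by simp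
        then show ?thesis by (simp only: of_int_eq_iff)
      qed
      also have "\<dots> = (\<Prod>i<a. int p - int b - int i)" using p k by (simp add: of_nat_diff)
      also have "[\<dots> = (\<Prod>i<a. 0 - int b - int i)] (mod int p)"
        by (intro cong_prod cong_diff cong_refl) (simp add: cong_def)
      finally show ?thesis by (simp add: P_def)
    qed
    have cop: "coprime (int b * fact a) (int p)"
      using coprime_less_prime[OF p(1), of b] fact_cop p k ab by simp
    have "int (Suc s) = int p - int b" using s(2) p k by (simp add: of_nat_diff)
    then have "[int (Suc s) = 0 - int b] (mod int p)"
      by (auto intro!: cong_diff simp: cong_def)
    then have b_cong: "[- int b = int (Suc s)] (mod int p)" by (simp add: cong_sym)
    have "[(- int b) * msum (inverses p) [a, b] * - fact a = int (Suc s) * msum (inverses p) [a, b] * - fact a] (mod int p)"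
      by (intro cong_mult cong_refl b_cong)
    also have "[int (Suc s) * msum (inverses p) [a, b] * - fact a = - (int (p - b choose a) * B (p - k)) * - fact a] (mod int p)"
      by (intro cong_mult cong_refl main)
    also have "- (int (p - b choose a) * B (p - k)) * - fact a = (int (p - b choose a) * fact a) * B (p - k)" by simp
    also have "[int (p - b choose a) * fact a * B (p - k) = P * (int k * y)] (mod int p)" by (intro cong_mult chooseP y)
    also have "P * (int k * y) = int k * P * y" by simp
    also have "[\<dots> = rat_residue p q * (int b * fact a) * y] (mod int p)"
      by (intro cong_mult cong_refl cong_sym[OF rat_residue_cong[OF cop q]])
    finally have "[msum (inverses p) [a, b] * (int b * fact a) = rat_residue p q * y * (int b * fact a)] (mod int p)"
      by (simp add: mult_ac)
    then show "[msum (inverses p) [a, b] = rat_residue p q * rat_residue p (bernoulli (p - k) / of_nat k)] (mod int p)"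
      using cop by (simp add: cong_mult_rcancel y_def)
  qed
  then show ?thesis ..
qed

text \<open>
  Hoffman's duality: an index is encoded by a word whose letters \<open>True\<close> and \<open>False\<close> stand for
  the operations on sequences below, and the binomial transform interchanges the two operations.
\<close>

fun word_seq :: "bool list \<Rightarrow> nat \<Rightarrow> rat" where
  "word_seq [] n = 1 / of_nat n"
| "word_seq (True # w) n = word_seq w n / of_nat n"
| "word_seq (False # w) n = (\<Sum>m\<in>{1..n}. word_seq w m) / of_nat n"

fun index_word :: "nat list \<Rightarrow> bool list" where
  "index_word [] = []"
| "index_word [k] = replicate (k - 1) True"
| "index_word (k # ks) = replicate (k - 1) True @ False # index_word ks"

definition binomial_transform :: "(nat \<Rightarrow> rat) \<Rightarrow> nat \<Rightarrow> rat"
  where "binomial_transform f n = (\<Sum>m\<in>{1..n}. (- 1) ^ (m - 1) * of_nat (n - 1 choose (m - 1)) * f m)"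

lemma word_seq_replicate: "word_seq (replicate k True @ w) n = word_seq w n / of_nat n ^ k"
  by (induction k) auto

lemma choose_div: "1 \<le> m \<Longrightarrow> m \<le> n \<Longrightarrow> of_nat (n - 1 choose (m - 1)) / of_nat m = (of_nat (n choose m) / of_nat n :: rat)"
  using binomial_absorption[of "m - 1" n]
  by (simp add: field_simps flip: of_nat_mult) 

lemma choose_sum: "1 \<le> m \<Longrightarrow> (\<Sum>l\<in>{m..n}. (l - 1 choose (m - 1))) = (n choose m)"
proof (induction n)
  case (Suc n)
  show ?case
  proof (cases "m \<le> Suc n")
    case True
    then have "{m..Suc n} = insert (Suc n) {m..n}" by auto
    then show ?thesis using Suc by (cases m) simp_all
  qed auto
qed auto

lemma choose_alternating_tail:
  "1 \<le> l \<Longrightarrow> l \<le> n \<Longrightarrow>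
    (\<Sum>m\<in>{l..n}. (- 1) ^ (m - 1) * of_nat (n choose m)) = (- 1) ^ (l - 1) * (of_nat (n - 1 choose (l - 1)) :: rat)"
proof -
  assume l: "1 \<le> l" "l \<le> n"
  \<comment> \<open>By Pascal's rule the summand is the difference of consecutive values of
    \<open>g\<close>.\<close>
  define g where "g m = - ((- 1) ^ (m - 1) * (of_nat (n - 1 choose (m - 1)) :: rat))" for m
  have "(\<Sum>m\<in>{l..n}. (- 1) ^ (m - 1) * of_nat (n choose m)) = (\<Sum>m\<in>{l..n}. g (Suc m) - g m)"
  proof (intro sum.cong refl)
    fix m assume "m \<in> {l..n}"
    then obtain m' n' where "m = Suc m'" "n = Suc n'" using l by (cases m; cases n) auto
    then show "(- 1) ^ (m - 1) * of_nat (n choose m) = g (Suc m) - g m"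
      by (simp add: g_def distrib_left)
  qed
  also have "\<dots> = g (Suc n) - g l" using l by (intro sum_Suc_diff) simp
  also have "g (Suc n) = 0" using l by (simp add: g_def)
  finally show ?thesis by (simp add: g_def)
qed

text \<open>Dividing the binomial coefficient of n - 1 over m - 1 by m yields the one of n over m
  divided by n. For the letter \<open>True\<close> the latter is expanded over l \<le> n by the
  hockey-stick identity, which produces a partial sum; for \<open>False\<close> the partial sum is
  exchanged with the transform and its alternating tail is evaluated.\<close>

lemma binomial_transform_word_seq:
  "n \<ge> 1 \<Longrightarrow> binomial_transform (word_seq w) n = word_seq (map Not w) n"
proof (induction w arbitrary: n)
  case Nil
  have "binomial_transform (word_seq []) n = (\<Sum>m\<in>{1..n}. (- 1) ^ (m - 1) * of_nat (n choose m)) / of_nat n"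
    unfolding binomial_transform_def sum_divide_distrib
  proof (intro sum.cong refl)
    fix m assume "m \<in> {1..n}"
    then have "of_nat (n - 1 choose (m - 1)) / of_nat m = (of_nat (n choose m) / of_nat n :: rat)"
      using choose_div[of m n] by simp
    then show "(- 1) ^ (m - 1) * of_nat (n - 1 choose (m - 1)) * word_seq [] m
        = (- 1) ^ (m - 1) * of_nat (n choose m) / of_nat n"
      by (simp only: word_seq.simps mult.assoc times_divide_eq_right mult_1_right)
         (simp only: times_divide_eq_right[symmetric])
  qed
  also have "(\<Sum>m\<in>{1..n}. (- 1) ^ (m - 1) * of_nat (n choose m)) = (1 :: rat)"
    using choose_alternating_tail[of 1 n] Nil by simp
  finally show ?case by simp
next
  case (Cons b w)
  show ?case
  proof (cases b)
    case True
    have "binomial_transform (word_seq (True # w)) n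
        = (\<Sum>m\<in>{1..n}. (- 1) ^ (m - 1) * of_nat (n choose m) * word_seq w m) / of_nat n"
      unfolding binomial_transform_def sum_divide_distrib
    proof (intro sum.cong refl)
      fix m assume "m \<in> {1..n}"
      then show "(- 1) ^ (m - 1) * of_nat (n - 1 choose (m - 1)) * word_seq (True # w) m
          = (- 1) ^ (m - 1) * of_nat (n choose m) * word_seq w m / of_nat n"
        using choose_div[of m n] by (simp add: field_simps)
    qed
    also have "(\<Sum>m\<in>{1..n}. (- 1) ^ (m - 1) * of_nat (n choose m) * word_seq w m)
        = (\<Sum>m\<in>{1..n}. \<Sum>l\<in>{m..n}. (- 1) ^ (m - 1) * of_nat (l - 1 choose (m - 1)) * word_seq w m)"
      by (intro sum.cong refl) (simp add: choose_sum[symmetric] sum_distrib_left sum_distrib_right)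
    also have "\<dots> = (\<Sum>l\<in>{1..n}. \<Sum>m\<in>{1..l}. (- 1) ^ (m - 1) * of_nat (l - 1 choose (m - 1)) * word_seq w m)"
      by (subst sum.Sigma, simp, simp, subst sum.Sigma, simp, simp)
         (intro sum.reindex_bij_witness[where i = "\<lambda>(a, b). (b, a)" and j = "\<lambda>(a, b). (b, a)"], auto)
    also have "\<dots> = (\<Sum>l\<in>{1..n}. word_seq (map Not w) l)"
      by (intro sum.cong refl) (simp add: Cons.IH[symmetric] binomial_transform_def)
    finally show ?thesis using True by simp
  next
    case False
    have "binomial_transform (word_seq (False # w)) n
        = (\<Sum>m\<in>{1..n}. (- 1) ^ (m - 1) * of_nat (n choose m) * (\<Sum>l\<in>{1..m}. word_seq w l)) / of_nat n"
      unfolding binomial_transform_def sum_divide_distrib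
    proof (intro sum.cong refl)
      fix m assume "m \<in> {1..n}"
      then show "(- 1) ^ (m - 1) * of_nat (n - 1 choose (m - 1)) * word_seq (False # w) m
          = (- 1) ^ (m - 1) * of_nat (n choose m) * (\<Sum>l\<in>{1..m}. word_seq w l) / of_nat n"
        using choose_div[of m n] by (simp add: field_simps)
    qed
    also have "(\<Sum>m\<in>{1..n}. (- 1) ^ (m - 1) * of_nat (n choose m) * (\<Sum>l\<in>{1..m}. word_seq w l))
        = (\<Sum>m\<in>{1..n}. \<Sum>l\<in>{1..m}. (- 1) ^ (m - 1) * of_nat (n choose m) * word_seq w l)"
      by (simp add: sum_distrib_left)
    also have "\<dots> = (\<Sum>l\<in>{1..n}. \<Sum>m\<in>{l..n}. (- 1) ^ (m - 1) * of_nat (n choose m) * word_seq w l)"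
      by (subst sum.Sigma, simp, simp, subst sum.Sigma, simp, simp)
         (intro sum.reindex_bij_witness[where i = "\<lambda>(a, b). (b, a)" and j = "\<lambda>(a, b). (b, a)"], auto)
    also have "\<dots> = binomial_transform (word_seq w) n"
      unfolding binomial_transform_def sum_distrib_right[symmetric]
      by (intro sum.cong refl) (simp add: choose_alternating_tail[unfolded One_nat_def])
    finally show ?thesis using False Cons by simp
  qed
qed

text \<open>The value of \<open>word_seq\<close> at m is the part of the star sum whose largest
  variable equals m.\<close>

lemma msum_star_word_seq:
  "ks \<noteq> [] \<Longrightarrow> is_index ks \<Longrightarrow> msum_star (reciprocals (Suc n)) ks = (\<Sum>m\<in>{1..n}. word_seq (index_word ks) m)"
proof (induction ks arbitrary: n rule: index_word.induct)
  case (2 k)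
  show ?case
  proof (induction n)
    case (Suc n)
    have "word_seq (replicate (k - 1) True) (Suc n) = 1 / of_nat (Suc n) ^ k"
      using word_seq_replicate[of "k - 1" "[]" "Suc n"] 2 by (cases k) (auto simp: is_index_def)
    with Suc show ?case by (simp add: reciprocals_Suc power_divide del: of_nat_Suc)
  qed (simp add: reciprocals_1)
next
  case (3 k l ks)
  show ?case
  proof (induction n)
    case (Suc n)
    have "word_seq (index_word (k # l # ks)) (Suc n)
        = msum_star (reciprocals (Suc (Suc n))) (l # ks) / of_nat (Suc n) ^ k"
      using 3 by (cases k) (auto simp: is_index_def word_seq_replicate)
    with Suc show ?case by (simp add: reciprocals_Suc power_divide del: of_nat_Suc)
  qed (simp add: reciprocals_1)
qed simp

lemma choose_prime_minus_1: "prime p \<Longrightarrow> m < p \<Longrightarrow> [int (p - 1 choose m) = (- 1) ^ m] (mod int p)"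
proof (induction m)
  case (Suc m)
  obtain p' where p': "p = Suc p'" using Suc.prems by (cases p) auto
  have "p dvd (p choose Suc m)" using Suc.prems by (intro dvd_choose_prime) auto
  then have "[int (p choose Suc m) = 0] (mod int p)" by (simp add: cong_0_iff)
  moreover have "int (p choose Suc m) = int (p - 1 choose m) + int (p - 1 choose Suc m)"
    unfolding p' by simp
  ultimately have "[int (p - 1 choose m) + int (p - 1 choose Suc m) - int (p - 1 choose m) = 0 - (- 1) ^ m] (mod int p)"
    using Suc by (intro cong_diff) auto
  then show ?case by simp
qed simp

text \<open>Summing the binomial transform up to p - 1 gives the alternating binomial coefficients
  of p - 1 over m, and these are (-1)^m modulo p. Together with the sign (-1)^(m - 1) every term
  acquires the factor -1.\<close>

lemma zeta_star_A_duality: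
  assumes ks: "ks \<noteq> []" "is_index ks" and ls: "ls \<noteq> []" "is_index ls"
    and dual: "index_word ls = map Not (index_word ks)"
  shows "zeta_star_A ls = - zeta_star_A ks"
  unfolding zeta_star_A_eq abs_poor_adele_hom
proof (rule abs_poor_adele_eqI)
  fix p :: nat assume p: "prime p"
  then obtain n where n: "p = Suc n" by (cases p) auto
  let ?w = "word_seq (index_word ks)"
  have red: "reduces p (msum_star (reciprocals p) ks) (msum_star (inverses p) ks)" for ks
    by (intro reduces_msum_star reduces_inverses p)
  \<comment> \<open>Integrality at p of each term follows by writing it as a difference of two star
    sums whose denominators are smaller than p.\<close>
  have "\<exists>x. reduces p (?w m) x" if m: "m \<in> {1..n}" for m
  proof -
    have list: "list_all2 (reduces p) (reciprocals q) (map (\<lambda>m. modular_inverse (int p) (int m)) (rev [1..<q]))" if "q \<le> p" for q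
      using that p unfolding reciprocals_def
      by (auto simp: list_all2_map1 list_all2_map2 list_all2_same intro: reduces_reciprocal)
    have "?w m = msum_star (reciprocals (Suc m)) ks - msum_star (reciprocals m) ks"
    proof -
      obtain m' where "m = Suc m'" using m by (cases m) auto
      then show ?thesis using msum_star_word_seq[OF ks, of m] msum_star_word_seq[OF ks, of m'] by simp
    qed
    moreover have "\<exists>x. reduces p (msum_star (reciprocals q) ks) x" if "q \<le> p" for q
      using reduces_msum_star[OF list[OF that]] by blast
    ultimately show ?thesis using m n
      by (metis atLeastAtMost_iff diff_conv_add_uminus le_SucI not_less_eq_eq reduces_add reduces_uminus)
  qed
  then obtain f where f: "\<And>m. m \<in> {1..n} \<Longrightarrow> reduces p (?w m) (f m)" by metis
  have "msum_star (reciprocals p) ls = (\<Sum>l\<in>{1..n}. binomial_transform ?w l)"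
    unfolding n msum_star_word_seq[OF ls] dual by (intro sum.cong refl) (simp add: binomial_transform_word_seq)
  also have "\<dots> = (\<Sum>m\<in>{1..n}. \<Sum>l\<in>{m..n}. (- 1) ^ (m - 1) * of_nat (l - 1 choose (m - 1)) * ?w m)"
    unfolding binomial_transform_def
    by (subst sum.Sigma, simp, simp, subst sum.Sigma, simp, simp)
       (intro sum.reindex_bij_witness[where i = "\<lambda>(a, b). (b, a)" and j = "\<lambda>(a, b). (b, a)"], auto)
  also have "\<dots> = (\<Sum>m\<in>{1..n}. (- 1) ^ (m - 1) * of_nat (n choose m) * ?w m)"
    by (intro sum.cong refl) (simp add: choose_sum[symmetric] sum_distrib_left sum_distrib_right)
  finally have eq: "msum_star (reciprocals p) ls = (\<Sum>m\<in>{1..n}. (- 1) ^ (m - 1) * of_nat (n choose m) * ?w m)" .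
  have "reduces p (- 1) (- 1)" using reduces_of_int[of p "- 1"] by simp
  then have "reduces p (msum_star (reciprocals p) ls) (\<Sum>m\<in>{1..n}. (- 1) ^ (m - 1) * int (n choose m) * f m)"
    unfolding eq by (intro reduces_sum reduces_mult reduces_power reduces_of_nat f)
  then have "[msum_star (inverses p) ls = (\<Sum>m\<in>{1..n}. (- 1) ^ (m - 1) * int (n choose m) * f m)] (mod int p)"
    using red reduces_unique by blast
  also have "[(\<Sum>m\<in>{1..n}. (- 1) ^ (m - 1) * int (n choose m) * f m) = (\<Sum>m\<in>{1..n}. (- 1) ^ (m - 1) * (- 1) ^ m * f m)] (mod int p)"
    using choose_prime_minus_1[OF p] n by (intro cong_sum cong_mult cong_refl) auto
  also have "(\<Sum>m\<in>{1..n}. (- 1) ^ (m - 1) * (- 1) ^ m * f m) = - (\<Sum>m\<in>{1..n}. f m)"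
    unfolding sum_negf[symmetric]
  proof (intro sum.cong refl)
    fix m assume "m \<in> {1..n}"
    then obtain m' where "m = Suc m'" by (cases m) auto
    then show "(- 1) ^ (m - 1) * (- 1) ^ m * f m = - f m" by (simp flip: power_add)
  qed
  also have "[- (\<Sum>m\<in>{1..n}. f m) = - msum_star (inverses p) ks] (mod int p)"
  proof -
    have "reduces p (msum_star (reciprocals p) ks) (\<Sum>m\<in>{1..n}. f m)"
      unfolding n msum_star_word_seq[OF ks] using f by (intro reduces_sum) (simp add: n)
    then show ?thesis using red reduces_unique by (simp add: cong_minus_minus_iff)
  qed
  finally show "[msum_star (inverses p) ls = - msum_star (inverses p) ks] (mod int p)" .
qed

lemma index_word_ones: "ks \<noteq> [] \<Longrightarrow> index_word (replicate i 1 @ ks) = replicate i False @ index_word ks"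
proof (induction i)
  case (Suc i)
  obtain k l where "replicate i 1 @ ks = k # l" using Suc.prems by (cases "replicate i 1 @ ks") auto
  then have "index_word (1 # replicate i 1 @ ks) = False # index_word (replicate i 1 @ ks)" by simp
  then show ?case using Suc by simp
qed simp

lemma index_word_Cons_ones: "index_word (d # replicate j 1) = replicate (d - 1) True @ replicate j False"
proof (cases j)
  case (Suc j')
  have "index_word (replicate j' 1 @ [1]) = replicate j' False"
    by (subst index_word_ones) auto
  moreover have "replicate j' (1::nat) @ [1] = replicate j 1" by (simp add: Suc replicate_append_same)
  ultimately show ?thesis using Suc by simp
qed simp

text \<open>With T and F for the letters, the words are F^i T F^j, F^i T T F^j and F^i T F^(h+1) T
  F^j. Their complements contain at most two letters F, hence encode indices of depth at most
  three.\<close>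

lemma zeta_star_A_duality_instances:
  shows "zeta_star_A (replicate i 1 @ 2 # replicate j 1) = - zeta_star_A [i + 1, j + 1]"
    and "zeta_star_A (replicate i 1 @ 3 # replicate j 1) = - zeta_star_A [i + 1, 1, j + 1]"
    and "zeta_star_A (replicate i 1 @ 2 # replicate h 1 @ 2 # replicate j 1) = - zeta_star_A [i + 1, h + 2, j + 1]"
proof -
  have 1: "index_word (2 # replicate h 1 @ 2 # replicate j 1) = True # replicate (Suc h) False @ True # replicate j False"
  proof -
    obtain k l where kl: "replicate h (1::nat) @ 2 # replicate j 1 = k # l" by (cases "replicate h 1 @ 2 # replicate j (1::nat)") simp_all
    then have "index_word (2 # replicate h 1 @ 2 # replicate j 1) = True # False # index_word (replicate h 1 @ 2 # replicate j 1)"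
      by simp
    then show ?thesis by (simp add: index_word_ones[unfolded One_nat_def] index_word_Cons_ones[unfolded One_nat_def])
  qed
  show "zeta_star_A (replicate i 1 @ 2 # replicate j 1) = - zeta_star_A [i + 1, j + 1]"
    by (rule zeta_star_A_duality)
       (auto simp: is_index_def index_word_ones[unfolded One_nat_def] index_word_Cons_ones[unfolded One_nat_def])
  show "zeta_star_A (replicate i 1 @ 3 # replicate j 1) = - zeta_star_A [i + 1, 1, j + 1]"
    by (rule zeta_star_A_duality)
       (auto simp: is_index_def index_word_ones[unfolded One_nat_def] index_word_Cons_ones[unfolded One_nat_def] numeral_3_eq_3)
  show "zeta_star_A (replicate i 1 @ 2 # replicate h 1 @ 2 # replicate j 1) = - zeta_star_A [i + 1, h + 2, j + 1]"
    by (rule zeta_star_A_duality)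
       (auto simp: is_index_def index_word_ones[unfolded One_nat_def] 1[unfolded One_nat_def])
qed

section \<open>Finite values obtained from star values of depth two and three\<close>

lemma zeta_star_A_merges: "zeta_star_A ks = (\<Sum>l\<leftarrow>merges ks. zeta_A l)"
proof -
  have "(\<Sum>l\<leftarrow>ls. zeta_A l) = abs_poor_adele (\<lambda>p. \<Sum>l\<leftarrow>ls. msum (inverses p) l)" for ls
    by (induction ls) (simp_all add: zeta_A_eq abs_poor_adele_0 abs_poor_adele_plus)
  then show ?thesis by (simp add: zeta_star_A_eq msum_star_eq_merges)
qed

abbreviation (input) "Z_A_multiples k \<equiv> range (\<lambda>q. q *\<^sub>Q Z_A k)"

lemma subspace_Z_A_multiples: "rat_vector.subspace (Z_A_multiples k)"
proof (rule rat_vector.subspaceI)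
  show "0 \<in> Z_A_multiples k" by (intro image_eqI[of _ _ 0]) simp_all
qed (auto simp flip: scaleQ_add_left simp: scaleQ_scaleQ)

text \<open>Values of depth one vanish, so merging identifies star and ordinary value at (a, b),
  while the antipode relation makes the star value at (b, a) the negative of the ordinary value at
  (a, b). In even weight reversal preserves star values, so twice the value is 0.\<close>

lemma zeta_star_A_depth_2_even:
  assumes "a > 0" "b > 0" "even (a + b)"
  shows "zeta_star_A [a, b] = 0"
proof -
  have star: "zeta_star_A [a, b] = zeta_A [a, b] + 0" if "a > 0" "b > 0" for a b
    using that zeta_A_single[of "a + b"] by (simp add: zeta_star_A_merges)
  have s: "zeta_star_A [b] = 0" using assms zeta_A_single by (simp add: zeta_star_A_merges)
  have "zeta_star_A [b, a] + zeta_A [a, b] = 0"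
    using zeta_A_antipode[of "[a, b]"] s assms zeta_A_single[of a]
    by (simp add: A.Zs_Nil A.Z_Nil)
  moreover have "zeta_star_A [b, a] = zeta_star_A [a, b]"
    using zeta_star_A_rev[of "[a, b]"] assms by simp
  ultimately have "of_nat 2 * zeta_star_A [a, b] = 0" using star assms by simp
  then show ?thesis using subspace_of_nat_mult_cancel[OF A.J, of 2 "zeta_star_A [a, b]"] by simp
qed

text \<open>Every product in the antipode relation contains a value of depth one, so the star value
  at (c, b, a) equals the ordinary value at (a, b, c). In odd weight reversal changes the sign;
  inserting this into the merge formula leaves twice the star value equal to two values of depth
  two.\<close>

lemma zeta_star_A_depth_3_odd:
  assumes abc: "a > 0" "b > 0" "c > 0" and k: "k = a + b + c" "odd k"
  shows "zeta_star_A [a, b, c] \<in> Z_A_multiples k"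
proof -
  let ?V = "Z_A_multiples k"
  have single: "zeta_star_A [n] = 0" "zeta_A [n] = 0" if "n > 0" for n
    using that zeta_A_single by (simp_all add: zeta_star_A_merges)
  have "zeta_star_A [c, b, a] - zeta_A [a, b, c] = 0"
    using zeta_A_antipode[of "[a, b, c]"] single abc
    by (simp add: A.Zs_Nil A.Z_Nil eval_nat_numeral)
  moreover have "zeta_star_A [c, b, a] = - zeta_star_A [a, b, c]"
    using zeta_star_A_rev[of "[a, b, c]"] k by (simp add: add.assoc)
  moreover have "zeta_star_A [a, b, c] = zeta_A [a, b, c] + zeta_A [a, b + c] + (zeta_A [a + b, c] + zeta_A [a + b + c])"
    by (simp add: zeta_star_A_merges add.assoc)
  ultimately have *: "zeta_star_A [a, b, c] = - zeta_star_A [a, b, c] + (zeta_A [a, b + c] + zeta_A [a + b, c])"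
    using single[of "a + b + c"] abc by (simp add: add.assoc)
  have "zeta_star_A [a, b, c] + zeta_star_A [a, b, c]
      = zeta_star_A [a, b, c] + (- zeta_star_A [a, b, c] + (zeta_A [a, b + c] + zeta_A [a + b, c]))"
    by (rule arg_cong[OF *])
  then have "of_nat 2 * zeta_star_A [a, b, c] = zeta_A [a, b + c] + zeta_A [a + b, c]" by simp
  moreover have "zeta_A [a, b + c] \<in> ?V" "zeta_A [a + b, c] \<in> ?V"
    using zeta_A_double[of a "b + c" k] zeta_A_double[of "a + b" c k] abc k by auto
  ultimately show ?thesis
    using rat_vector.subspace_add[OF subspace_Z_A_multiples]
      subspace_of_nat_mult_cancel[OF subspace_Z_A_multiples, of 2 "zeta_star_A [a, b, c]" k]
    by simp
qed

lemma A_ZB_tight: "A.ZB ms (sum_list ms) = zeta_A ms" "A.ZsB ms (sum_list ms) = zeta_star_A ms"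
  by (simp_all add: A.ZB_def A.ZsB_def bounded_indices_tight)

text \<open>Duality leads to a star value of depth two and even weight; the comparison of bounded
  sums at the smallest weight carries its vanishing back.\<close>

lemma zeta_A_2_even:
  assumes "even n" "i + j + 2 = n"
  shows "zeta_A (replicate i 1 @ 2 # replicate j 1) = 0"
proof -
  let ?ms = "replicate i 1 @ 2 # replicate j 1"
  have n: "n = sum_list ?ms" using assms by (simp add: sum_list_replicate)
  have "zeta_star_A ?ms = 0"
    using assms by (simp only: zeta_star_A_duality_instances) (subst zeta_star_A_depth_2_even, auto)
  then show ?thesis
    using A.star_transfer_single[of 2 n i j] unfolding n A_ZB_tight by (auto simp: minus_one_power_iff split: if_splits)
qed

lemma zeta_A_3_odd:
  assumes "odd k" "i + j + 3 = k"
  shows "zeta_A (replicate i 1 @ 3 # replicate j 1) \<in> Z_A_multiples k"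
proof -
  let ?ms = "replicate i 1 @ 3 # replicate j 1"
  have n: "k = sum_list ?ms" using assms by (simp add: sum_list_replicate)
  have "zeta_star_A [i + 1, 1, j + 1] \<in> Z_A_multiples k"
    by (rule zeta_star_A_depth_3_odd) (use assms in auto)
  then have "zeta_star_A ?ms \<in> Z_A_multiples k"
    unfolding zeta_star_A_duality_instances by (rule rat_vector.subspace_neg[OF subspace_Z_A_multiples])
  moreover have "zeta_A ?ms = (- 1) ^ (i + j + 1) * zeta_star_A ?ms"
    using A.star_difference[OF A.star_transfer_single[of 3 k i j] assms(1)]
    unfolding n A_ZB_tight by (simp add: eq_neg_iff_add_eq_0)
  ultimately show ?thesis
    using subspace_of_int_mult[OF subspace_Z_A_multiples, of "zeta_star_A ?ms" k "(- 1) ^ (i + j + 1)"] by simp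
qed

lemma zeta_A_2_2_odd:
  assumes "odd k" "i + h + j + 4 = k"
  shows "zeta_A (replicate i 1 @ 2 # replicate h 1 @ 2 # replicate j 1) \<in> Z_A_multiples k"
proof -
  let ?ms = "replicate i 1 @ 2 # replicate h 1 @ 2 # replicate j 1"
  have n: "k = sum_list ?ms" using assms by (simp add: sum_list_replicate)
  have "zeta_star_A [i + 1, h + 2, j + 1] \<in> Z_A_multiples k"
    by (rule zeta_star_A_depth_3_odd) (use assms in auto)
  then have "zeta_star_A ?ms \<in> Z_A_multiples k"
    unfolding zeta_star_A_duality_instances by (rule rat_vector.subspace_neg[OF subspace_Z_A_multiples])
  moreover have "zeta_A ?ms = (- 1) ^ (i + h + j + 2) * zeta_star_A ?ms"
    using A.star_difference[OF A.star_transfer_2_2[where i = i and h = h and j = j and k = k] assms(1)]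
      zeta_A_2_even assms(1)
    unfolding n A_ZB_tight by simp
  ultimately show ?thesis
    using subspace_of_int_mult[OF subspace_Z_A_multiples, of "zeta_star_A ?ms" k "(- 1) ^ (i + h + j + 2)"] by simp
qed

section \<open>Asymptotics of multiple harmonic sums\<close>

definition mhs :: "nat list \<Rightarrow> nat \<Rightarrow> real"
  where "mhs ks N = msum (reciprocals (Suc N)) ks"

lemma mhs_Nil [simp]: "mhs [] N = 1"
  by (simp add: mhs_def)

lemma mhs_0: "mhs (k # ks) 0 = 0"
  by (simp add: mhs_def reciprocals_1)

lemma mhs_Suc: "mhs (k # ks) (Suc N) = mhs (k # ks) N + mhs ks N / real (Suc N) ^ k"
  by (simp add: mhs_def reciprocals_Suc power_divide del: of_nat_Suc)

lemma mhs_Cons: "mhs (k # ks) N = (\<Sum>m<N. mhs ks m / real (Suc m) ^ k)"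
  by (induction N) (simp_all add: mhs_0 mhs_Suc del: of_nat_Suc)

lemma mhs_harm: "mhs [1] N = harm N"
  by (simp add: mhs_Cons harm_altdef divide_inverse)

lemma mhs_nonneg: "mhs ks N \<ge> 0"
  by (induction ks arbitrary: N) (auto simp: mhs_Cons intro!: sum_nonneg)

text \<open>The exponent 1/2 leaves room to absorb powers of the harmonic number, and the tail of a
  series with terms of order N^(-3/2) is again of this order.\<close>

definition small :: "(nat \<Rightarrow> real) \<Rightarrow> bool"
  where "small f \<longleftrightarrow> (\<exists>C. \<forall>N. \<bar>f N\<bar> \<le> C * real (Suc N) powr (- 1 / 2))"

lemma small_0: "small (\<lambda>_. 0)"
  unfolding small_def by (intro exI[of _ 0]) simp

lemma small_add:
  assumes "small f" "small g" shows "small (\<lambda>N. f N + g N)"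
proof -
  obtain C D where "\<And>N. \<bar>f N\<bar> \<le> C * real (Suc N) powr (- 1 / 2)" "\<And>N. \<bar>g N\<bar> \<le> D * real (Suc N) powr (- 1 / 2)"
    using assms by (auto simp: small_def)
  then have "\<bar>f N + g N\<bar> \<le> (C + D) * real (Suc N) powr (- 1 / 2)" for N
    by (smt (verit) distrib_right)
  then show ?thesis unfolding small_def by blast
qed

lemma small_sum_list: "(\<And>x. x \<in> set xs \<Longrightarrow> small (f x)) \<Longrightarrow> small (\<lambda>N. \<Sum>x\<leftarrow>xs. f x N)"
  by (induction xs) (auto simp: small_0 small_add)

lemma small_tendsto_0:
  assumes "small f" shows "f \<longlonglongrightarrow> 0"
proof -
  obtain C where C: "\<And>N. \<bar>f N\<bar> \<le> C * real (Suc N) powr (- 1 / 2)" using assms by (auto simp: small_def)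
  have "(\<lambda>N. real (Suc N) powr (- 1 / 2)) \<longlonglongrightarrow> 0"
    by (intro tendsto_neg_powr filterlim_compose[OF filterlim_real_sequentially filterlim_Suc]) simp
  from tendsto_mult_right_zero[OF this] have "(\<lambda>N. C * real (Suc N) powr (- 1 / 2)) \<longlonglongrightarrow> 0" .
  then show ?thesis by (rule Lim_null_comparison[rotated]) (rule always_eventually, use C in simp)
qed

text \<open>The margin 1 admits intermediate points between consecutive harmonic numbers, as the
  mean value theorem produces them. Each Horner step costs one factor of logarithmic growth, for
  which half of the exponent is reserved.\<close>

lemma poly_harm_growth:
  assumes "e > 0"
  shows "\<exists>C\<ge>0. \<forall>N. \<forall>y::real. \<bar>y\<bar> \<le> harm N + 1 \<longrightarrow> \<bar>poly P y\<bar> \<le> C * real (Suc N) powr e"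
  using assms
proof (induction P arbitrary: e)
  case 0
  then show ?case by (intro exI[of _ 0]) simp
next
  case (pCons a P)
  obtain C where C: "C \<ge> 0" "\<And>N y::real. \<bar>y\<bar> \<le> harm N + 1 \<Longrightarrow> \<bar>poly P y\<bar> \<le> C * real (Suc N) powr (e / 2)"
    using pCons.IH[of "e / 2"] pCons.prems by auto
  have harm: "(harm N :: real) + 1 \<le> (2 + 2 / e) * real (Suc N) powr (e / 2)" for N
  proof -
    have "(harm N :: real) \<le> 1 + ln (real (Suc N))"
    proof (cases "N = 0")
      case False
      then have "harm N - ln (real N) \<le> (harm 1 - ln (real 1) :: real)"
        by (intro euler_mascheroni_sequence_decreasing) auto
      moreover have "ln (real N) \<le> ln (real (Suc N))" using False by simp
      ultimately show ?thesis by (simp add: harm_def)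
    qed (simp add: harm_def)
    moreover have "ln (real (Suc N)) \<le> (2 / e) * real (Suc N) powr (e / 2)"
      using ln_powr_bound[of "real (Suc N)" "e / 2"] pCons.prems by (simp add: mult.commute del: of_nat_Suc)
    moreover have "1 \<le> real (Suc N) powr (e / 2)" using pCons.prems by (intro ge_one_powr_ge_zero) auto
    ultimately have "harm N + 1 \<le> 2 * real (Suc N) powr (e / 2) + (2 / e) * real (Suc N) powr (e / 2)" by linarith
    then show ?thesis by (simp only: distrib_right)
  qed
  have "\<bar>poly (pCons a P) y\<bar> \<le> (\<bar>a\<bar> + (2 + 2 / e) * C) * real (Suc N) powr e"
    if y: "\<bar>y\<bar> \<le> harm N + 1" for N y
  proof -
    have sq: "real (Suc N) powr (e / 2) * real (Suc N) powr (e / 2) = real (Suc N) powr e"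
      by (simp flip: powr_add)
    have "\<bar>poly (pCons a P) y\<bar> \<le> \<bar>a\<bar> + \<bar>y\<bar> * \<bar>poly P y\<bar>"
      by (simp add: abs_mult[symmetric] abs_triangle_ineq)
    also have "\<bar>y\<bar> * \<bar>poly P y\<bar> \<le> ((2 + 2 / e) * real (Suc N) powr (e / 2)) * (C * real (Suc N) powr (e / 2))"
      using y harm[of N] C pCons.prems by (intro mult_mono) auto
    also have "\<dots> = (2 + 2 / e) * C * real (Suc N) powr e" using sq by (simp add: mult_ac)
    also have "\<bar>a\<bar> \<le> \<bar>a\<bar> * real (Suc N) powr e"
      using ge_one_powr_ge_zero[of "real (Suc N)" e] pCons.prems by (simp add: mult_le_cancel_left1)
    finally show ?thesis by (simp add: algebra_simps)
  qed
  moreover have "\<bar>a\<bar> + (2 + 2 / e) * C \<ge> 0" using C pCons.prems by simp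
  ultimately show ?case by blast
qed

lemma small_mult_poly_harm:
  assumes "small f" shows "(\<lambda>N. f N * poly P (harm N)) \<longlonglongrightarrow> 0"
proof -
  obtain C where C: "\<And>N. \<bar>f N\<bar> \<le> C * real (Suc N) powr (- 1 / 2)" using assms by (auto simp: small_def)
  obtain D where D: "D \<ge> 0" "\<And>N y::real. \<bar>y\<bar> \<le> harm N + 1 \<Longrightarrow> \<bar>poly P y\<bar> \<le> D * real (Suc N) powr (1 / 4)"
    using poly_harm_growth[of "1 / 4" P] by auto
  have bound: "\<bar>f N * poly P (harm N)\<bar> \<le> (C * D) * real (Suc N) powr (- 1 / 4)" for N
  proof -
    have "\<bar>f N * poly P (harm N)\<bar> \<le> (C * real (Suc N) powr (- 1 / 2)) * (D * real (Suc N) powr (1 / 4))"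
      unfolding abs_mult using C[of N] D(2)[of "harm N" N] abs_ge_zero[of "f N"]
      by (intro mult_mono) (auto intro: order_trans[OF abs_ge_zero])
    also have "\<dots> = (C * D) * (real (Suc N) powr (- 1 / 2) * real (Suc N) powr (1 / 4))" by simp
    also have "real (Suc N) powr (- 1 / 2) * real (Suc N) powr (1 / 4) = real (Suc N) powr (- 1 / 4)"
      by (simp flip: powr_add)
    finally show ?thesis .
  qed
  have "(\<lambda>N. real (Suc N) powr (- 1 / 4)) \<longlonglongrightarrow> 0"
    by (intro tendsto_neg_powr filterlim_compose[OF filterlim_real_sequentially filterlim_Suc]) simp
  from tendsto_mult_right_zero[OF this]
  have lim: "(\<lambda>N. (C * D) * real (Suc N) powr (- 1 / 4)) \<longlonglongrightarrow> 0" .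
  show ?thesis
    by (rule Lim_null_comparison[OF _ lim], rule always_eventually, rule allI) (simp only: real_norm_def bound)
qed

lemma poly_harm_tendsto_0:
  assumes "(\<lambda>N. poly P (harm N)) \<longlonglongrightarrow> (0::real)" shows "P = 0"
proof (cases "degree P = 0")
  case True
  then obtain c where "P = [:c:]" by (metis degree_eq_zeroE)
  with assms show ?thesis by (simp add: LIMSEQ_const_iff)
next
  case False
  have "filterlim (poly P) at_infinity at_infinity" using False by (intro filterlim_poly_at_infinity) simp
  moreover have "filterlim (harm :: nat \<Rightarrow> real) at_infinity sequentially"
    by (rule filterlim_at_top_imp_at_infinity[OF harm_at_top])
  ultimately have "filterlim (\<lambda>N. poly P (harm N)) at_infinity sequentially" by (rule filterlim_compose)
  then show ?thesis using assms not_tendsto_and_filterlim_at_infinity sequentially_bot by blast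
qed

lemma small_tail:
  assumes "\<And>m. \<bar>f m\<bar> \<le> C * real (Suc m) powr (- 3 / 2)"
  shows "\<exists>L. small (\<lambda>N. (\<Sum>m<N. f m) - L)"
proof -
  define g where "g m = real (Suc m) powr (- 1 / 2)" for m
  have C0: "C \<ge> 0"
    using order_trans[OF abs_ge_zero assms[of 0]] by simp
  \<comment> \<open>With a and b the consecutive square roots, 1/a - 1/b equals 1/(a b (a + b)).
    Since b \<le> 2 a, this is at least 1/(a * 2 a * 3 a), whence the constant 6.\<close>
  have step: "real (Suc m) powr (- 3 / 2) \<le> 6 * (g m - g (Suc m))" for m
  proof -
    define a where "a = sqrt (real (Suc m))"
    define b where "b = sqrt (real (Suc (Suc m)))"
    have ab: "a > 0" "b > 0" "b^2 - a^2 = 1" "b \<le> 2 * a" "a \<le> b"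
      by (auto simp: a_def b_def real_le_lsqrt power_mult_distrib)
    have "1 / a - 1 / b = (b - a) / (a * b)" using ab by (simp add: field_simps)
    also have "\<dots> = 1 / (a * b * (a + b))"
    proof -
      have "(b - a) * (a + b) = 1" using ab(3) by (simp add: power2_eq_square algebra_simps)
      then have "b - a = 1 / (a + b)" using ab by (simp add: eq_divide_eq)
      then show ?thesis by simp
    qed
    also have "\<dots> \<ge> 1 / (a * (2 * a) * (a + 2 * a))"
      using ab by (intro divide_left_mono mult_mono) auto
    finally have *: "1 / a ^ 3 \<le> 6 * (1 / a - 1 / b)" using ab by (simp add: power3_eq_cube field_simps)
    have pw: "x powr (- 1 / 2) = 1 / sqrt x" "x powr (- 3 / 2) = 1 / sqrt x ^ 3" if "x > 0" for x :: real
    proof -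
      have s: "sqrt x = x powr (1 / 2)" using that by (simp add: powr_half_sqrt)
      show "x powr (- 1 / 2) = 1 / sqrt x" unfolding s using that by (simp add: powr_minus_divide)
      have "sqrt x ^ 3 = x powr (3 / 2)" unfolding s using that by (simp add: powr_power)
      then show "x powr (- 3 / 2) = 1 / sqrt x ^ 3" using that by (simp add: powr_minus_divide)
    qed
    have "g m = 1 / a" "g (Suc m) = 1 / b" "real (Suc m) powr (- 3 / 2) = 1 / a ^ 3"
      unfolding g_def a_def b_def by (rule pw, simp)+
    then show ?thesis using * by (simp only:)
  qed
  have g0: "g \<longlonglongrightarrow> 0" unfolding g_def
    by (intro tendsto_neg_powr filterlim_compose[OF filterlim_real_sequentially filterlim_Suc]) simp
  have bound: "\<bar>f m\<bar> \<le> 6 * C * (g m - g (Suc m))" for m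
    using order_trans[OF assms[of m] mult_left_mono[OF step C0]] by (simp add: mult_ac)
  have tele: "(\<lambda>m. 6 * C * (g (m + N) - g (Suc (m + N)))) sums (6 * C * (g N - 0))" for N
    using telescope_sums'[OF LIMSEQ_ignore_initial_segment[OF g0, of N]] by (intro sums_mult) simp
  have "summable (\<lambda>m. 6 * C * (g m - g (Suc m)))" using sums_summable[OF tele[of 0]] by simp
  then have "summable (\<lambda>m. \<bar>f m\<bar>)"
    by (rule summable_comparison_test'[where N = 0]) (simp only: real_norm_def abs_abs bound)
  then have summ: "summable (\<lambda>m. \<bar>f (m + N)\<bar>)" for N by (rule summable_ignore_initial_segment)
  have f: "summable f" using summ[of 0] by (simp add: summable_rabs_cancel)
  have "\<bar>(\<Sum>m<N. f m) - suminf f\<bar> \<le> 6 * C * real (Suc N) powr (- 1 / 2)" for N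
  proof -
    have "\<bar>(\<Sum>m<N. f m) - suminf f\<bar> = \<bar>\<Sum>m. f (m + N)\<bar>"
      using suminf_minus_initial_segment[OF f, of N] by simp
    also have "\<dots> \<le> (\<Sum>m. \<bar>f (m + N)\<bar>)" by (rule summable_rabs[OF summ])
    also have "\<dots> \<le> (\<Sum>m. 6 * C * (g (m + N) - g (Suc (m + N))))"
      using bound summ tele by (intro suminf_le) (auto simp: sums_iff)
    also have "\<dots> = 6 * C * g N" using tele by (simp add: sums_iff)
    finally show ?thesis by (simp add: g_def)
  qed
  then show ?thesis unfolding small_def by blast
qed

lemma poly_antiderivative: "\<exists>Q. pderiv Q = (P :: real poly)"
proof
  have "pderiv (\<Sum>i\<le>n. f i) = (\<Sum>i\<le>n. pderiv (f i))" for n and f :: "nat \<Rightarrow> real poly"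
    by (induction n) (simp_all add: pderiv_add)
  then show "pderiv (\<Sum>i\<le>degree P. Polynomial.monom (poly.coeff P i / of_nat (Suc i)) (Suc i)) = P"
    by (simp add: pderiv_monom poly_as_sum_of_monoms del: of_nat_Suc)
qed

text \<open>Dividing by m + 1 and summing is approximately integration with respect to the harmonic
  number. Two applications of the mean value theorem bound the error in each step by a multiple of
  m^(-3/2), so that the errors have a sum with small tails.\<close>

lemma mhs_asymptotics_1:
  assumes "small (\<lambda>N. mhs ks N - poly P (harm N))"
  shows "\<exists>Q. pderiv Q = P \<and> small (\<lambda>N. mhs (1 # ks) N - poly Q (harm N))"
proof -
  obtain C where C: "\<And>N. \<bar>mhs ks N - poly P (harm N)\<bar> \<le> C * real (Suc N) powr (- 1 / 2)"
    using assms by (auto simp: small_def)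
  obtain D where D: "D \<ge> 0" "\<And>N y::real. \<bar>y\<bar> \<le> harm N + 1 \<Longrightarrow> \<bar>poly (pderiv P) y\<bar> \<le> D * real (Suc N) powr (1 / 2)"
    using poly_harm_growth[of "1 / 2" "pderiv P"] by auto
  obtain Q where Q: "pderiv Q = P" using poly_antiderivative by blast
  define f where "f m = mhs ks m / real (Suc m) - (poly Q (harm (Suc m)) - poly Q (harm m))" for m
  have "\<bar>f m\<bar> \<le> (C + D) * real (Suc m) powr (- 3 / 2)" for m
  proof -
    let ?h = "1 / real (Suc m)"
    have h: "?h > 0" "?h \<le> 1" by auto
    have Suc: "harm (Suc m) = harm m + ?h" by (simp add: harm_Suc divide_inverse)
    have pw: "?h * real (Suc m) powr a = real (Suc m) powr (a - 1)" for a
      by (simp add: powr_diff del: of_nat_Suc)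
    obtain x where x: "harm m < x" "x < harm m + ?h" "poly Q (harm m + ?h) - poly Q (harm m) = ?h * poly P x"
      using poly_MVT[of "harm m" "harm m + ?h" Q] h Q by auto
    obtain z where z: "harm m < z" "z < x" "poly P x - poly P (harm m) = (x - harm m) * poly (pderiv P) z"
      using poly_MVT[of "harm m" x P] x by auto
    have "\<bar>poly P x - poly P (harm m)\<bar> \<le> ?h * (D * real (Suc m) powr (1 / 2))"
    proof -
      have "\<bar>z\<bar> \<le> harm m + 1" using x z h harm_nonneg[of m, where 'a = real] by linarith
      then show ?thesis unfolding z(3) abs_mult using D(2)[of z m] x z by (intro mult_mono) auto
    qed
    also have "\<dots> = D * (?h * real (Suc m) powr (1 / 2))" by (rule mult.left_commute)
    also have "?h * real (Suc m) powr (1 / 2) = real (Suc m) powr (- 1 / 2)"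
      using pw[of "1 / 2"] by (simp del: of_nat_Suc)
    finally have d: "\<bar>poly P x - poly P (harm m)\<bar> \<le> D * real (Suc m) powr (- 1 / 2)" .
    have "f m = ?h * ((mhs ks m - poly P (harm m)) - (poly P x - poly P (harm m)))"
      unfolding f_def Suc x(3) by (simp add: algebra_simps)
    then have "\<bar>f m\<bar> = ?h * \<bar>(mhs ks m - poly P (harm m)) - (poly P x - poly P (harm m))\<bar>"
      by (simp add: abs_mult)
    also have "\<dots> \<le> ?h * (C * real (Suc m) powr (- 1 / 2) + D * real (Suc m) powr (- 1 / 2))"
      using C[of m] d by (intro mult_left_mono) auto
    also have "\<dots> = (C + D) * (?h * real (Suc m) powr (- 1 / 2))" by (simp add: algebra_simps add_divide_distrib)
    also have "?h * real (Suc m) powr (- 1 / 2) = real (Suc m) powr (- 3 / 2)"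
      using pw[of "- 1 / 2"] by (simp del: of_nat_Suc)
    finally show ?thesis .
  qed
  from small_tail[OF this] obtain L where L: "small (\<lambda>N. (\<Sum>m<N. f m) - L)" by blast
  have "(\<Sum>m<N. f m) = mhs (1 # ks) N - (poly Q (harm N) - poly Q 0)" for N
    using sum_lessThan_telescope[of "\<lambda>m. poly Q (harm m)" N]
    by (simp add: f_def sum_subtractf mhs_Cons harm_def[of 0])
  \<comment> \<open>The total error fixes the constant of integration.\<close>
  then have "(\<lambda>N. (\<Sum>m<N. f m) - L) = (\<lambda>N. mhs (1 # ks) N - poly (Q + [:L - poly Q 0:]) (harm N))"
    by (simp add: fun_eq_iff)
  with L Q show ?thesis by (intro exI[of _ "Q + [:L - poly Q 0:]"]) (simp add: pderiv_add pderiv_pCons)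
qed

lemma mhs_asymptotics_2:
  assumes "small (\<lambda>N. mhs ks N - poly P (harm N))" and k: "k \<ge> 2"
  shows "\<exists>L. small (\<lambda>N. mhs (k # ks) N - L)"
proof -
  obtain C where C: "\<And>N. \<bar>mhs ks N - poly P (harm N)\<bar> \<le> C * real (Suc N) powr (- 1 / 2)"
    using assms by (auto simp: small_def)
  obtain D where D: "D \<ge> 0" "\<And>N y::real. \<bar>y\<bar> \<le> harm N + 1 \<Longrightarrow> \<bar>poly P y\<bar> \<le> D * real (Suc N) powr (1 / 2)"
    using poly_harm_growth[of "1 / 2" P] by auto
  have C0: "C \<ge> 0" using order_trans[OF abs_ge_zero C[of 0]] by simp
  have "\<bar>mhs ks m / real (Suc m) ^ k\<bar> \<le> (C + D) * real (Suc m) powr (- 3 / 2)" for m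
  proof -
    have "C * real (Suc m) powr (- 1 / 2) \<le> C * real (Suc m) powr (1 / 2)"
      using C0 by (intro mult_left_mono powr_mono) auto
    then have "\<bar>mhs ks m\<bar> \<le> (C + D) * real (Suc m) powr (1 / 2)"
      using C[of m] D(2)[of "harm m" m] harm_nonneg[of m, where 'a = real] by (simp add: distrib_right)
    moreover have "real (Suc m) ^ k \<ge> real (Suc m) ^ 2" using k by (intro power_increasing) auto
    ultimately have "\<bar>mhs ks m\<bar> / real (Suc m) ^ k \<le> ((C + D) * real (Suc m) powr (1 / 2)) / real (Suc m) ^ 2"
      using C0 D(1) by (intro frac_le) auto
    also have "\<dots> = (C + D) * real (Suc m) powr (- 3 / 2)"
    proof -
      have "real (Suc m) powr (1 / 2 - 2) = real (Suc m) powr (1 / 2) / real (Suc m) powr 2"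
        by (rule powr_diff)
      moreover have "real (Suc m) powr 2 = real (Suc m) ^ 2" by (rule powr_numeral) simp
      ultimately show ?thesis by (simp del: of_nat_Suc)
    qed
    finally show ?thesis by (simp add: abs_mult abs_divide)
  qed
  from small_tail[OF this] show ?thesis by (simp add: mhs_Cons)
qed

text \<open>The regularisation polynomial, with the harmonic number itself as variable. Its value at
  0 thus corresponds to the normalisation \<zeta>(1) = 0. The choice is unambiguous, since a
  polynomial in the harmonic number that tends to 0 is zero.\<close>

definition reg_poly :: "nat list \<Rightarrow> real poly"
  where "reg_poly ks = (SOME P. small (\<lambda>N. mhs ks N - poly P (harm N)))"

lemma small_unique:
  assumes "small (\<lambda>N. f N - poly P (harm N))" "small (\<lambda>N. f N - poly Q (harm N))"
  shows "P = Q"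
proof -
  have "(\<lambda>N. (f N - poly Q (harm N)) - (f N - poly P (harm N))) \<longlonglongrightarrow> 0 - 0"
    by (intro tendsto_diff small_tendsto_0 assms)
  then have "P - Q = 0" by (intro poly_harm_tendsto_0) simp
  then show ?thesis by simp
qed

lemma mhs_asymptotics: "is_index ks \<Longrightarrow> \<exists>P. small (\<lambda>N. mhs ks N - poly P (harm N))"
proof (induction ks)
  case Nil
  show ?case by (intro exI[of _ 1]) (simp add: small_0)
next
  case (Cons k ks)
  then obtain P where P: "small (\<lambda>N. mhs ks N - poly P (harm N))" by (auto simp: is_index_def)
  show ?case
  proof (cases "k = 1")
    case True
    then show ?thesis using mhs_asymptotics_1[OF P] by auto
  next
    case False
    with Cons.prems have "k \<ge> 2" by (auto simp: is_index_def)
    then obtain L where "small (\<lambda>N. mhs (k # ks) N - L)" using mhs_asymptotics_2[OF P] by blast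
    then show ?thesis by (intro exI[of _ "[:L:]"]) simp
  qed
qed

lemma reg_poly: "is_index ks \<Longrightarrow> small (\<lambda>N. mhs ks N - poly (reg_poly ks) (harm N))"
  unfolding reg_poly_def by (rule someI_ex) (rule mhs_asymptotics)

lemma reg_poly_eqI: "is_index ks \<Longrightarrow> small (\<lambda>N. mhs ks N - poly P (harm N)) \<Longrightarrow> reg_poly ks = P"
  using reg_poly small_unique by blast

lemma reg_poly_Nil: "reg_poly [] = 1"
  by (rule reg_poly_eqI) (simp_all add: is_index_def small_0)

lemma reg_poly_1: "reg_poly [1] = [:0, 1:]"
  by (rule reg_poly_eqI) (simp_all add: is_index_def small_0 mhs_harm[unfolded One_nat_def])

lemma pderiv_reg_poly:
  assumes "is_index (k # ks)"
  shows "pderiv (reg_poly (k # ks)) = (if k = 1 then reg_poly ks else 0)"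
proof (cases "k = 1")
  case True
  have "is_index ks" using assms by (simp add: is_index_def)
  then obtain Q where "pderiv Q = reg_poly ks" "small (\<lambda>N. mhs (1 # ks) N - poly Q (harm N))"
    using mhs_asymptotics_1[OF reg_poly] by blast
  then show ?thesis using reg_poly_eqI[of "1 # ks" Q] assms True by simp
next
  case False
  with assms have k: "k \<ge> 2" "is_index ks" by (auto simp: is_index_def)
  then obtain L where "small (\<lambda>N. mhs (k # ks) N - L)" using mhs_asymptotics_2[OF reg_poly] by blast
  then have "reg_poly (k # ks) = [:L:]" using assms by (intro reg_poly_eqI) auto
  with False show ?thesis by (simp add: pderiv_pCons)
qed

lemma mhs_tendsto_admissible:
  assumes "admissible ks"
  shows "mhs ks \<longlonglongrightarrow> poly (reg_poly ks) 0"
proof -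
  have ix: "is_index ks" using assms by (simp add: admissible_def)
  have "pderiv (reg_poly ks) = 0"
    using assms pderiv_reg_poly by (cases ks) (auto simp: admissible_def reg_poly_Nil)
  then obtain c where c: "reg_poly ks = [:c:]" by (metis pderiv_eq_0_iff degree_eq_zeroE)
  have "(\<lambda>N. (mhs ks N - c) + c) \<longlonglongrightarrow> 0 + c"
    using small_tendsto_0[OF reg_poly[OF ix]] c by (intro tendsto_add tendsto_const) simp
  then show ?thesis by (simp add: c)
qed

section \<open>Convergent series as limits of truncated sums\<close>

lemma infsum_eq_lim:
  fixes f :: "'b \<Rightarrow> real"
  assumes nonneg: "\<And>x. x \<in> A \<Longrightarrow> f x \<ge> 0" and fin: "\<And>N. finite (B N)" and sub: "\<And>N. B N \<subseteq> A"
    and mono: "\<And>M N. M \<le> N \<Longrightarrow> B M \<subseteq> B N" and cover: "A \<subseteq> (\<Union>N. B N)"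
    and lim: "(\<lambda>N. sum f (B N)) \<longlonglongrightarrow> L"
  shows "infsum f A = L"
proof -
  have incseq: "incseq (\<lambda>N. sum f (B N))"
  proof (intro incseq_SucI sum_mono2 mono fin)
    fix N x assume "x \<in> B (Suc N) - B N"
    then show "f x \<ge> 0" using sub nonneg by blast
  qed simp
  have le: "sum f F \<le> L" if F: "finite F" "F \<subseteq> A" for F
  proof -
    obtain g where g: "\<And>x. x \<in> F \<Longrightarrow> x \<in> B (g x)" using cover F(2) by (metis UN_E subset_iff)
    have "F \<subseteq> B (Max (g ` F))"
    proof
      fix x assume "x \<in> F"
      then show "x \<in> B (Max (g ` F))" using g[of x] mono[of "g x" "Max (g ` F)"] F(1) by auto
    qed
    then have "sum f F \<le> sum f (B (Max (g ` F)))"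
      using sub[of "Max (g ` F)"] nonneg by (intro sum_mono2 fin) blast+
    also have "\<dots> \<le> L" by (rule incseq_le[OF incseq lim])
    finally show ?thesis .
  qed
  have summ: "f summable_on A"
    by (rule nonneg_bdd_above_summable_on) (use nonneg le in \<open>auto intro!: bdd_aboveI2[of _ _ L]\<close>)
  have "infsum f A \<le> L" by (rule infsum_le_finite_sums[OF summ]) (rule le)
  moreover have "L \<le> infsum f A"
    by (rule LIMSEQ_le_const2[OF lim]) (use finite_sum_le_infsum[OF summ fin sub] nonneg in auto)
  ultimately show ?thesis by simp
qed

lemma zeta_term_nonneg: "zeta_term ks ms \<ge> (0 :: real)"
  by (simp add: zeta_term_def prod_nonneg)

lemma Union_below:
  "strict_tuples r \<subseteq> (\<Union>N. strict_below (Suc N) r)" "weak_tuples r \<subseteq> (\<Union>N. weak_below (Suc N) r)"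
proof -
  have "\<forall>m\<in>set ms. m < Suc (sum_list ms)" for ms :: "nat list"
    by (auto simp: less_Suc_eq_le intro: member_le_sum_list)
  then show "strict_tuples r \<subseteq> (\<Union>N. strict_below (Suc N) r)" "weak_tuples r \<subseteq> (\<Union>N. weak_below (Suc N) r)"
    unfolding strict_below_def weak_below_def by blast+
qed

lemma mzv_eq: "admissible ks \<Longrightarrow> mzv ks = poly (reg_poly ks) 0"
  unfolding mzv_def
proof (rule infsum_eq_lim[where B = "\<lambda>N. strict_below (Suc N) (length ks)"])
  assume "admissible ks"
  then show "(\<lambda>N. sum (zeta_term ks) (strict_below (Suc N) (length ks))) \<longlonglongrightarrow> poly (reg_poly ks) 0"
    using mhs_tendsto_admissible by (simp add: sum_strict_below mhs_def[abs_def])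
  show "strict_tuples (length ks) \<subseteq> (\<Union>N. strict_below (Suc N) (length ks))" by (rule Union_below)
  show "strict_below (Suc M) (length ks) \<subseteq> strict_below (Suc N) (length ks)" if "M \<le> N" for M N
    using that by (fastforce simp: strict_below_def)
qed (auto simp: zeta_term_nonneg finite_below, auto simp: strict_below_def)

lemma merges_index: "is_index ks \<Longrightarrow> l \<in> set (merges ks) \<Longrightarrow> is_index l"
proof (induction ks arbitrary: l rule: merges.induct)
  case (3 a b ks)
  have ix: "a \<ge> 1" "is_index (b # ks)" "is_index ((a + b) # ks)" using "3.prems"(1) by (auto simp: is_index_def)
  from "3.prems"(2) have "l \<in> (#) a ` set (merges (b # ks)) \<or> l \<in> set (merges ((a + b) # ks))" by simp
  then show ?case
  proof
    assume "l \<in> (#) a ` set (merges (b # ks))"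
    then obtain w where w: "l = a # w" "w \<in> set (merges (b # ks))" by blast
    have "is_index w" by (rule "3.IH"(1)[OF ix(2) w(2)])
    then show ?thesis using w(1) ix(1) by (simp add: is_index_def)
  next
    assume "l \<in> set (merges ((a + b) # ks))"
    then show ?thesis by (rule "3.IH"(2)[OF ix(3)])
  qed
qed auto

lemma merges_hd: "l \<in> set (merges (k # ks)) \<Longrightarrow> l \<noteq> [] \<and> hd l \<ge> k"
proof (induction ks arbitrary: k)
  case (Cons a ks)
  from Cons.prems have "l \<in> (#) k ` set (merges (a # ks)) \<or> l \<in> set (merges ((k + a) # ks))" by simp
  then show ?case
  proof
    assume "l \<in> set (merges ((k + a) # ks))"
    then show ?thesis using Cons.IH[of "k + a"] by simp
  qed (elim imageE, simp)
qed simp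

lemma merges_admissible:
  assumes "admissible ks" "l \<in> set (merges ks)" shows "admissible l"
proof (cases ks)
  case (Cons k ks')
  have "is_index l" using merges_index[OF _ assms(2)] assms(1) by (simp add: admissible_def)
  moreover have "l \<noteq> []" "hd l \<ge> k" using merges_hd assms Cons by blast+
  moreover have "k \<ge> 2" using assms Cons by (simp add: admissible_def)
  ultimately show ?thesis by (simp add: admissible_def)
qed (use assms in simp)

lemma mzsv_eq: "admissible ks \<Longrightarrow> mzsv ks = (\<Sum>l\<leftarrow>merges ks. poly (reg_poly l) 0)"
  unfolding mzsv_def
proof (rule infsum_eq_lim[where B = "\<lambda>N. weak_below (Suc N) (length ks)"])
  assume ks: "admissible ks"
  have "(\<lambda>N. \<Sum>l\<leftarrow>ls. mhs l N) \<longlonglongrightarrow> (\<Sum>l\<leftarrow>ls. poly (reg_poly l) 0)"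
    if "\<forall>l\<in>set ls. admissible l" for ls
    using that by (induction ls) (auto intro!: tendsto_add mhs_tendsto_admissible)
  then show "(\<lambda>N. sum (zeta_term ks) (weak_below (Suc N) (length ks))) \<longlonglongrightarrow> (\<Sum>l\<leftarrow>merges ks. poly (reg_poly l) 0)"
    using merges_admissible[OF ks] by (simp add: sum_weak_below msum_star_eq_merges mhs_def)
  show "weak_tuples (length ks) \<subseteq> (\<Union>N. weak_below (Suc N) (length ks))" by (rule Union_below)
  show "weak_below (Suc M) (length ks) \<subseteq> weak_below (Suc N) (length ks)" if "M \<le> N" for M N
    using that by (fastforce simp: weak_below_def)
qed (auto simp: zeta_term_nonneg finite_below, auto simp: weak_below_def)

section \<open>Harmonic regularisation\<close>

lemma msum_stuffle: "msum xs ks * msum xs ls = (\<Sum>w\<leftarrow>stuffle ks ls. msum xs w)"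
proof (induction xs arbitrary: ks ls)
  case Nil
  have "(\<Sum>w\<leftarrow>stuffle ks ls. msum [] w) = (if ks = [] \<and> ls = [] then 1 else (0::'a))"
    by (induction ks ls rule: stuffle.induct) (auto simp: o_def msum_Nil)
  then show ?case by (auto simp: msum_Nil)
next
  case (Cons x xs)
  show ?case
  proof (cases "ks = [] \<or> ls = []")
    case True
    then show ?thesis by (cases ks) auto
  next
    case False
    then obtain k ks' l ls' where eq: "ks = k # ks'" "ls = l # ls'" by (auto simp: neq_Nil_conv)
    have "(\<Sum>w\<leftarrow>stuffle ks ls. msum (x # xs) w)
      = (x ^ k * (\<Sum>w\<leftarrow>stuffle ks' ls. msum xs w) + x ^ l * (\<Sum>w\<leftarrow>stuffle ks ls'. msum xs w)
        + x ^ (k + l) * (\<Sum>w\<leftarrow>stuffle ks' ls'. msum xs w)) + (\<Sum>w\<leftarrow>stuffle ks ls. msum xs w)"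
      by (simp add: eq o_def sum_list_addf sum_list_const_mult add_ac)
    also have "\<dots> = msum (x # xs) ks * msum (x # xs) ls"
      unfolding Cons.IH[symmetric] by (simp add: eq power_add algebra_simps)
    finally show ?thesis ..
  qed
qed

lemma stuffle_index: "is_index ks \<Longrightarrow> is_index ls \<Longrightarrow> w \<in> set (stuffle ks ls) \<Longrightarrow> is_index w"
proof (induction ks ls arbitrary: w rule: stuffle.induct)
  case (3 k ks l ls)
  have ix: "k \<ge> 1" "l \<ge> 1" "is_index ks" "is_index ls" using "3.prems"(1,2) by (auto simp: is_index_def)
  from "3.prems"(3) consider u where "w = k # u" "u \<in> set (stuffle ks (l # ls))"
    | u where "w = l # u" "u \<in> set (stuffle (k # ks) ls)" | u where "w = (k + l) # u" "u \<in> set (stuffle ks ls)"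
    by auto
  then show ?case
  proof cases
    case 1
    then show ?thesis using "3.IH"(1)[OF ix(3) "3.prems"(2)] ix by (simp add: is_index_def)
  next
    case 2
    then show ?thesis using "3.IH"(2)[OF "3.prems"(1) ix(4)] ix by (simp add: is_index_def)
  next
    case 3
    then show ?thesis using "3.IH"(3)[OF ix(3) ix(4)] ix by (simp add: is_index_def)
  qed
qed auto

lemma small_product:
  assumes "small (\<lambda>N. f N - poly P (harm N))" "small (\<lambda>N. g N - poly Q (harm N))"
  shows "(\<lambda>N. f N * g N - poly (P * Q) (harm N)) \<longlonglongrightarrow> 0"
proof -
  have "(\<lambda>N. (f N - poly P (harm N)) * poly Q (harm N) + (g N - poly Q (harm N)) * poly P (harm N)
      + (f N - poly P (harm N)) * (g N - poly Q (harm N))) \<longlonglongrightarrow> 0 + 0 + 0 * 0"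
    by (intro tendsto_add tendsto_mult small_mult_poly_harm small_tendsto_0 assms)
  then show ?thesis by (simp add: algebra_simps)
qed

lemma poly_sum_list: "poly (\<Sum>x\<leftarrow>xs. f x) y = (\<Sum>x\<leftarrow>xs. poly (f x) y)"
  by (induction xs) auto

lemma pderiv_sum_list: "pderiv (\<Sum>x\<leftarrow>xs. f x) = (\<Sum>x\<leftarrow>xs. pderiv (f x))"
  by (induction xs) (auto simp: pderiv_add)

lemma small_sum_list_poly:
  assumes "\<And>l. l \<in> set ls \<Longrightarrow> is_index l"
  shows "small (\<lambda>N. (\<Sum>l\<leftarrow>ls. mhs l N) - poly (\<Sum>l\<leftarrow>ls. reg_poly l) (harm N))"
proof -
  have "small (\<lambda>N. \<Sum>l\<leftarrow>ls. mhs l N - poly (reg_poly l) (harm N))"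
    using assms by (intro small_sum_list reg_poly)
  then show ?thesis by (simp add: poly_sum_list sum_list_subtractf)
qed

lemma reg_poly_mult:
  assumes "is_index ks" "is_index ls"
  shows "reg_poly ks * reg_poly ls = (\<Sum>w\<leftarrow>stuffle ks ls. reg_poly w)"
proof -
  let ?S = "\<Sum>w\<leftarrow>stuffle ks ls. reg_poly w"
  have "small (\<lambda>N. (\<Sum>w\<leftarrow>stuffle ks ls. mhs w N) - poly ?S (harm N))"
    using stuffle_index[OF assms] by (rule small_sum_list_poly)
  then have "(\<lambda>N. mhs ks N * mhs ls N - poly ?S (harm N)) \<longlonglongrightarrow> 0"
    using small_tendsto_0 by (simp add: mhs_def msum_stuffle)
  moreover have "(\<lambda>N. mhs ks N * mhs ls N - poly (reg_poly ks * reg_poly ls) (harm N)) \<longlonglongrightarrow> 0"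
    using small_product reg_poly assms by blast
  ultimately have "(\<lambda>N. (mhs ks N * mhs ls N - poly ?S (harm N))
      - (mhs ks N * mhs ls N - poly (reg_poly ks * reg_poly ls) (harm N))) \<longlonglongrightarrow> 0 - 0"
    by (rule tendsto_diff)
  then have "reg_poly ks * reg_poly ls - ?S = 0" by (intro poly_harm_tendsto_0) simp
  then show ?thesis by simp
qed

fun leading_ones :: "nat list \<Rightarrow> nat" where
  "leading_ones [] = 0"
| "leading_ones (k # ks) = (if k = 1 then Suc (leading_ones ks) else 0)"

lemma leading_ones_0: "is_index ks \<Longrightarrow> leading_ones ks = 0 \<longleftrightarrow> admissible ks"
  by (cases ks) (auto simp: is_index_def admissible_def)

text \<open>Inserting 1 before, between or after the leading ones of \<open>us\<close> always gives
  \<open>1 # us\<close>; inserting it later, or adding it to an entry, never creates a further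
  leading one. Quantifying over \<open>f\<close> expresses an equality of multisets of
  indices.\<close>

lemma stuffle_1:
  assumes "is_index us"
  shows "\<exists>rest. (\<forall>f::nat list \<Rightarrow> real. (\<Sum>w\<leftarrow>stuffle [1] us. f w)
      = real (Suc (leading_ones us)) * f (1 # us) + (\<Sum>w\<leftarrow>rest. f w))
    \<and> (\<forall>w\<in>set rest. is_index w \<and> leading_ones w \<le> leading_ones us)"
  using assms
proof (induction us)
  case Nil
  show ?case by (intro exI[of _ "[]"]) simp
next
  case (Cons l ls)
  then have ix: "l \<ge> 1" "is_index ls" by (auto simp: is_index_def)
  show ?case
  proof (cases "l = 1")
    case True
    obtain rest where rest:
      "\<And>f::nat list \<Rightarrow> real. (\<Sum>w\<leftarrow>stuffle [1] ls. f w) = real (Suc (leading_ones ls)) * f (1 # ls) + (\<Sum>w\<leftarrow>rest. f w)"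
      "\<And>w. w \<in> set rest \<Longrightarrow> is_index w \<and> leading_ones w \<le> leading_ones ls"
      using Cons.IH[OF ix(2)] by blast
    show ?thesis
    proof (intro exI[of _ "map ((#) 1) rest @ [2 # ls]"] conjI allI ballI)
      fix f :: "nat list \<Rightarrow> real"
      show "(\<Sum>w\<leftarrow>stuffle [1] (l # ls). f w)
        = real (Suc (leading_ones (l # ls))) * f (1 # l # ls) + (\<Sum>w\<leftarrow>map ((#) 1) rest @ [2 # ls]. f w)"
        using rest(1)[of "\<lambda>w. f (1 # w)"] True by (simp add: o_def algebra_simps numeral_2_eq_2)
    qed (use rest(2) True ix in \<open>auto simp: is_index_def\<close>)
  next
    case False
    with ix have l: "l \<ge> 2" by simp
    show ?thesis
    proof (intro exI[of _ "map ((#) l) (stuffle [1] ls) @ [Suc l # ls]"] conjI allI ballI)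
      fix f :: "nat list \<Rightarrow> real"
      show "(\<Sum>w\<leftarrow>stuffle [1] (l # ls). f w)
        = real (Suc (leading_ones (l # ls))) * f (1 # l # ls) + (\<Sum>w\<leftarrow>map ((#) l) (stuffle [1] ls) @ [Suc l # ls]. f w)"
        using False by (simp add: o_def)
      fix w assume "w \<in> set (map ((#) l) (stuffle [1] ls) @ [Suc l # ls])"
      then consider w' where "w = l # w'" "w' \<in> set (stuffle [1] ls)" | "w = Suc l # ls" by auto
      then have "is_index w \<and> leading_ones w = 0"
      proof cases
        case 1
        then show ?thesis using stuffle_index[of "[1]" ls w'] ix l by (simp add: is_index_def)
      next
        case 2
        then show ?thesis using ix l by (simp add: is_index_def)
      qed
      then show "is_index w" "leading_ones w \<le> leading_ones (l # ls)" by simp_all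
    qed
  qed
qed

text \<open>The stuffle product with (1) can be solved for the value at \<open>1 # us\<close>, in
  terms of indices with fewer leading ones. Uniqueness of the regularisation and its values lying in
  \<open>mzv_space\<close> both follow by this induction.\<close>

lemma leading_ones_induct [consumes 1, case_names admissible Cons_1]:
  assumes "is_index ks"
    and adm: "\<And>ks. admissible ks \<Longrightarrow> P ks"
    and step: "\<And>us rest. is_index us \<Longrightarrow> P us \<Longrightarrow>
      (\<And>f::nat list \<Rightarrow> real. (\<Sum>w\<leftarrow>stuffle [1] us. f w) = real (Suc (leading_ones us)) * f (1 # us) + (\<Sum>w\<leftarrow>rest. f w)) \<Longrightarrow>
      (\<And>w. w \<in> set rest \<Longrightarrow> is_index w \<and> P w) \<Longrightarrow> P (1 # us)"
  shows "P ks"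
  using assms(1)
proof (induction "leading_ones ks" arbitrary: ks rule: less_induct)
  case less
  show ?case
  proof (cases "leading_ones ks")
    case 0
    then show ?thesis using adm leading_ones_0[OF less.prems] by blast
  next
    case (Suc n)
    then obtain us where us: "ks = 1 # us" "leading_ones us = n" by (cases ks) (auto split: if_splits)
    have ix: "is_index us" using less.prems us by (simp add: is_index_def)
    obtain rest where rest:
      "\<And>f::nat list \<Rightarrow> real. (\<Sum>w\<leftarrow>stuffle [1] us. f w) = real (Suc (leading_ones us)) * f (1 # us) + (\<Sum>w\<leftarrow>rest. f w)"
      "\<And>w. w \<in> set rest \<Longrightarrow> is_index w \<and> leading_ones w \<le> leading_ones us"
      using stuffle_1[OF ix] by blast
    show ?thesis unfolding us(1)
    proof (rule step[OF ix _ rest(1)])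
      show "P us" using less.hyps[of us] Suc us(2) ix by simp
      show "is_index w \<and> P w" if "w \<in> set rest" for w
        using less.hyps[of w] rest(2)[OF that] Suc us(2) by simp
    qed
  qed
qed

definition regularised :: "nat list \<Rightarrow> real"
  where "regularised ks = (if is_index ks then poly (reg_poly ks) 0 else 0)"

lemma harmonic_regularisation_regularised: "is_harmonic_regularisation regularised"
  unfolding is_harmonic_regularisation_def
proof (intro conjI allI impI)
  fix ks assume "admissible ks"
  then show "regularised ks = mzv ks" by (simp add: mzv_eq regularised_def admissible_def)
next
  fix ks ls assume ix: "is_index ks" "is_index ls"
  have eq: "map regularised (stuffle ks ls) = map (\<lambda>w. poly (reg_poly w) 0) (stuffle ks ls)"
    using stuffle_index[OF ix] by (auto simp: regularised_def)
  have "regularised ks * regularised ls = poly (reg_poly ks * reg_poly ls) 0" by (simp add: regularised_def ix)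
  then show "regularised ks * regularised ls = (\<Sum>w\<leftarrow>stuffle ks ls. regularised w)"
    by (simp only: eq reg_poly_mult[OF ix] poly_sum_list)
next
  show "regularised [1] = 0" using reg_poly_1 by (simp add: regularised_def is_index_def)
qed (simp add: regularised_def)

lemma harmonic_regularisation_unique:
  assumes "is_harmonic_regularisation Z" "is_harmonic_regularisation Z'"
  shows "Z = Z'"
proof
  fix ks
  show "Z ks = Z' ks"
  proof (cases "is_index ks")
    case True
    then show ?thesis
    proof (induction rule: leading_ones_induct)
      case (admissible ks)
      then show ?case using assms by (simp add: is_harmonic_regularisation_def)
    next
      case (Cons_1 us rest)
      have "(\<Sum>w\<leftarrow>stuffle [1] us. Z w) = 0" if "is_harmonic_regularisation Z" for Z
      proof -
        have "is_index [1]" by (simp add: is_index_def)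
        then have "(\<Sum>w\<leftarrow>stuffle [1] us. Z w) = Z [1] * Z us"
          using that Cons_1.hyps(1) unfolding is_harmonic_regularisation_def by metis
        then show ?thesis using that by (simp add: is_harmonic_regularisation_def)
      qed
      from this[OF assms(1)] this[OF assms(2)]
      have "real (Suc (leading_ones us)) * Z (1 # us) + (\<Sum>w\<leftarrow>rest. Z w)
        = real (Suc (leading_ones us)) * Z' (1 # us) + (\<Sum>w\<leftarrow>rest. Z' w)"
        by (simp only: Cons_1.hyps(2))
      moreover have "map Z rest = map Z' rest" using Cons_1.IH(2) by simp
      ultimately show ?case by simp
    qed
  next
    case False
    then show ?thesis using assms by (simp add: is_harmonic_regularisation_def)
  qed
qed

lemma zeta_reg_eq: "zeta_reg = regularised"
  unfolding zeta_reg_def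
  by (rule the_equality, rule harmonic_regularisation_regularised)
     (rule harmonic_regularisation_unique[OF _ harmonic_regularisation_regularised])

lemma zeta_reg_mult:
  "is_index ks \<Longrightarrow> is_index ls \<Longrightarrow> zeta_reg ks * zeta_reg ls = (\<Sum>w\<leftarrow>stuffle ks ls. zeta_reg w)"
  using harmonic_regularisation_regularised unfolding zeta_reg_eq is_harmonic_regularisation_def by blast

lemma zeta_reg_1: "zeta_reg [1] = 0"
  using harmonic_regularisation_regularised unfolding zeta_reg_eq is_harmonic_regularisation_def by blast

lemma zeta_reg_poly: "is_index ks \<Longrightarrow> zeta_reg ks = poly (reg_poly ks) 0"
  by (simp add: zeta_reg_eq regularised_def)

lemma zeta_reg_mzv: "admissible ks \<Longrightarrow> zeta_reg ks = mzv ks"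
  by (simp add: zeta_reg_poly mzv_eq admissible_def)

lemma zeta_star_reg_eq: "zeta_star_reg ks = (\<Sum>l\<leftarrow>merges ks. zeta_reg l)"
proof (cases "admissible ks")
  case True
  then have "is_index ks" by (simp add: admissible_def)
  have eq: "map zeta_reg (merges ks) = map (\<lambda>l. poly (reg_poly l) 0) (merges ks)"
    using merges_index[OF \<open>is_index ks\<close>] by (simp add: zeta_reg_poly)
  show ?thesis using True by (simp only: zeta_star_reg_def mzsv_eq if_True eq)
qed (simp add: zeta_star_reg_def)

lemma subspace_mzv_space: "rat_vector.subspace mzv_space"
  unfolding mzv_space_def by (rule rat_vector.subspace_span)

lemma mzv_in_space: "admissible ks \<Longrightarrow> mzv ks \<in> mzv_space"
  unfolding mzv_space_def by (rule rat_vector.span_base) blast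

lemma zeta_reg_in_space: "zeta_reg ks \<in> mzv_space"
proof (cases "is_index ks")
  case True
  then show ?thesis
  proof (induction rule: leading_ones_induct)
    case (admissible ks)
    then show ?case by (simp add: zeta_reg_mzv mzv_in_space)
  next
    case (Cons_1 us rest)
    have "is_index [1]" by (simp add: is_index_def)
    then have "real (Suc (leading_ones us)) * zeta_reg (1 # us) + (\<Sum>w\<leftarrow>rest. zeta_reg w) = 0"
      using zeta_reg_mult[of "[1]" us] Cons_1.hyps(1) zeta_reg_1 by (simp only: Cons_1.hyps(2)) simp
    then have "of_nat (Suc (leading_ones us)) * zeta_reg (1 # us) = - (\<Sum>w\<leftarrow>rest. zeta_reg w)"
      by (simp add: eq_neg_iff_add_eq_0)
    moreover have "(\<Sum>w\<leftarrow>rest. zeta_reg w) \<in> mzv_space"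
      using Cons_1.IH(2) by (induction rest) (auto simp: mzv_space_closed)
    ultimately have "of_nat (Suc (leading_ones us)) * zeta_reg (1 # us) \<in> mzv_space"
      by (simp add: mzv_space_closed)
    then show ?case by (rule subspace_of_nat_mult_cancel[OF subspace_mzv_space]) simp
  qed
next
  case False
  then show ?thesis by (simp add: zeta_reg_eq regularised_def mzv_space_closed)
qed

lemma zeta_star_reg_in_space: "zeta_star_reg ks \<in> mzv_space"
proof -
  have "(\<Sum>l\<leftarrow>ls. zeta_reg l) \<in> mzv_space" for ls
    by (induction ls) (auto simp: mzv_space_closed zeta_reg_in_space)
  then show ?thesis by (simp add: zeta_star_reg_eq)
qed

lemma subspace_real_mult:
  assumes "rat_vector.subspace (V :: real set)" shows "rat_vector.subspace {x. x * y \<in> V}"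
proof (rule rat_vector.subspaceI)
  show "a *\<^sub>Q x \<in> {x. x * y \<in> V}" if "x \<in> {x. x * y \<in> V}" for a x
    using rat_vector.subspace_scale[OF assms, of "x * y" a] that by (simp add: scaleQ_real_def mult.assoc)
qed (use rat_vector.subspace_0[OF assms] rat_vector.subspace_add[OF assms] in \<open>auto simp: distrib_right\<close>)

lemma mzv_space_mult:
  assumes "x \<in> mzv_space" "y \<in> mzv_space" shows "x * y \<in> mzv_space"
proof -
  have 1: "mzv ks * mzv ls \<in> mzv_space" if "admissible ks" "admissible ls" for ks ls
  proof -
    have "mzv ks * mzv ls = (\<Sum>w\<leftarrow>stuffle ks ls. zeta_reg w)"
      using that zeta_reg_mult[of ks ls] by (simp add: zeta_reg_mzv admissible_def)
    moreover have "(\<Sum>w\<leftarrow>ws. zeta_reg w) \<in> mzv_space" for ws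
      by (induction ws) (auto simp: mzv_space_closed zeta_reg_in_space)
    ultimately show ?thesis by simp
  qed
  have 2: "x * mzv ls \<in> mzv_space" if "x \<in> mzv_space" "admissible ls" for x ls
  proof -
    have "mzv ` {ks. admissible ks} \<subseteq> {x. x * mzv ls \<in> mzv_space}"
      using 1[OF _ that(2)] by auto
    then have "rat_vector.span (mzv ` {ks. admissible ks}) \<subseteq> {x. x * mzv ls \<in> mzv_space}"
      by (rule rat_vector.span_minimal) (rule subspace_real_mult[OF subspace_mzv_space])
    then show ?thesis using that(1) by (auto simp: mzv_space_def)
  qed
  have "y \<in> {y. y * x \<in> mzv_space}"
  proof -
    have "mzv ` {ks. admissible ks} \<subseteq> {y. y * x \<in> mzv_space}"
      using 2[OF assms(1)] by (auto simp: mult.commute)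
    then have "rat_vector.span (mzv ` {ks. admissible ks}) \<subseteq> {y. y * x \<in> mzv_space}"
      by (rule rat_vector.span_minimal) (rule subspace_real_mult[OF subspace_mzv_space])
    then show ?thesis using assms(2) by (auto simp: mzv_space_def)
  qed
  then show ?thesis by (simp add: mult.commute)
qed

lemma mzv_space_1: "1 \<in> mzv_space"
  using zeta_reg_in_space[of "[]"] by (simp add: zeta_reg_poly is_index_def reg_poly_Nil)

section \<open>Symmetric multiple zeta values as limits\<close>

text \<open>The reciprocals of the nonzero integers of absolute value at most \<open>N\<close>, in the order
  \<open>-1, -2, \<dots>, -N, N, \<dots>, 2, 1\<close>, which reversal turns into the order of the negatives.\<close>

definition symmetric_reciprocals :: "nat \<Rightarrow> real list"
  where "symmetric_reciprocals N = map uminus (rev (reciprocals (Suc N))) @ reciprocals (Suc N)"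

lemma rev_symmetric_reciprocals:
  "rev (symmetric_reciprocals N) = map uminus (symmetric_reciprocals N)"
  by (simp add: symmetric_reciprocals_def rev_map o_def)

lemma msum_symmetric_reciprocals:
  "msum (symmetric_reciprocals N) ks = symmetric_sum (\<lambda>ks. mhs ks N) ks"
proof -
  have "msum (map uminus (rev (reciprocals (Suc N)))) l = (- 1) ^ sum_list l * mhs (rev l) N" for l
    unfolding msum_map_uminus mhs_def using msum_rev[of "reciprocals (Suc N)" "rev l"] by simp
  then show ?thesis
    by (simp add: symmetric_reciprocals_def msum_append deconc_def symmetric_sum_def mhs_def)
qed

lemma msum_star_symmetric_reciprocals:
  "msum_star (symmetric_reciprocals N) ks = symmetric_sum (\<lambda>ks. \<Sum>l\<leftarrow>merges ks. mhs l N) ks"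
proof -
  have "msum_star (map uminus (rev (reciprocals (Suc N)))) l = (- 1) ^ sum_list l * (\<Sum>l\<leftarrow>merges (rev l). mhs l N)" for l
    unfolding msum_star_map_uminus mhs_def msum_star_eq_merges[symmetric]
    using msum_star_rev[of "reciprocals (Suc N)" "rev l"] by simp
  then show ?thesis
    by (simp add: symmetric_reciprocals_def msum_star_append deconc_def symmetric_sum_def mhs_def
        msum_star_eq_merges[symmetric])
qed

lemma is_index_take_drop:
  "is_index ks \<Longrightarrow> is_index (take j ks)" "is_index ks \<Longrightarrow> is_index (drop j ks)"
  "is_index (rev ks) \<longleftrightarrow> is_index ks"
  by (auto simp: is_index_def dest: in_set_takeD in_set_dropD)

text \<open>The derivatives with respect to the regularisation parameter of consecutive summands of the
  symmetric sum cancel, so the symmetric sum of the polynomials is constant.\<close>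

lemma symmetric_sum_tendsto:
  fixes F :: "nat list \<Rightarrow> nat \<Rightarrow> real" and Q :: "nat list \<Rightarrow> real poly"
  assumes F: "\<And>ks. is_index ks \<Longrightarrow> small (\<lambda>N. F ks N - poly (Q ks) (harm N))"
    and Q: "\<And>k ks. is_index (k # ks) \<Longrightarrow> pderiv (Q (k # ks)) = (if k = 1 then Q ks else 0)"
    and Nil: "pderiv (Q []) = 0" and ks: "is_index ks"
  shows "(\<lambda>N. symmetric_sum (\<lambda>ks. F ks N) ks) \<longlonglongrightarrow> symmetric_sum (\<lambda>ks. poly (Q ks) 0) ks"
proof -
  let ?r = "length ks"
  define S where "S = (\<Sum>j\<le>?r. (- 1) ^ sum_list (take j ks) * (Q (rev (take j ks)) * Q (drop j ks)))"
  have poly_S: "poly S x = symmetric_sum (\<lambda>ks. poly (Q ks) x) ks" for x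
    by (simp add: S_def poly_sum symmetric_sum_def mult.assoc)
  have "pderiv S = 0"
  proof -
    \<comment> \<open>An entry 1 at position \<open>j\<close> is the first entry of the right factor
      for the cut before it, and the first entry of the reversed left factor for the cut after it.
      The signs of these two cuts differ, as the prefix weight grows by 1.\<close>
    define A where "A j = (if ks ! j = 1 then (- 1) ^ sum_list (take j ks) * (Q (rev (take j ks)) * Q (drop (Suc j) ks)) else 0)" for j
    have der: "pderiv (\<Sum>j\<in>X. f j) = (\<Sum>j\<in>X. pderiv (f j))" for X and f :: "nat \<Rightarrow> real poly"
      by (induction X rule: infinite_finite_induct) (auto simp: pderiv_add)
    have sign: "pderiv ((- 1) ^ n * (p * q)) = (- 1) ^ n * (pderiv p * q) + (- 1) ^ n * (p * pderiv q)"
      for n and p q :: "real poly"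
      by (induction n) (simp_all add: pderiv_minus pderiv_mult)
    have right: "(- 1) ^ sum_list (take j ks) * (Q (rev (take j ks)) * pderiv (Q (drop j ks))) = A j" if "j < ?r" for j
    proof -
      have d: "drop j ks = ks ! j # drop (Suc j) ks" using that by (simp add: Cons_nth_drop_Suc)
      have "is_index (ks ! j # drop (Suc j) ks)" using is_index_take_drop(2)[OF ks, of j] d by simp
      from Q[OF this] show ?thesis unfolding d A_def by simp
    qed
    have left: "(- 1) ^ sum_list (take (Suc j) ks) * (pderiv (Q (rev (take (Suc j) ks))) * Q (drop (Suc j) ks)) = - A j"
      if "j < ?r" for j
    proof -
      have t: "take (Suc j) ks = take j ks @ [ks ! j]" using that by (simp add: take_Suc_conv_app_nth)
      have "is_index (rev (take (Suc j) ks))" using is_index_take_drop(1)[OF ks] is_index_take_drop(3) by blast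
      then have "is_index (ks ! j # rev (take j ks))" unfolding t by simp
      from Q[OF this] show ?thesis unfolding t A_def by simp
    qed
    have "pderiv S = (\<Sum>j\<le>?r. (- 1) ^ sum_list (take j ks) * (pderiv (Q (rev (take j ks))) * Q (drop j ks)))
      + (\<Sum>j\<le>?r. (- 1) ^ sum_list (take j ks) * (Q (rev (take j ks)) * pderiv (Q (drop j ks))))"
      unfolding S_def der sign sum.distrib ..
    also have "(\<Sum>j\<le>?r. (- 1) ^ sum_list (take j ks) * (pderiv (Q (rev (take j ks))) * Q (drop j ks))) = (\<Sum>j<?r. - A j)"
      unfolding sum.atMost_shift by (simp add: Nil left)
    also have "(\<Sum>j\<le>?r. (- 1) ^ sum_list (take j ks) * (Q (rev (take j ks)) * pderiv (Q (drop j ks)))) = (\<Sum>j<?r. A j)"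
      unfolding lessThan_Suc_atMost[symmetric] sum.lessThan_Suc by (simp add: Nil right)
    finally show ?thesis by (simp add: sum_negf)
  qed
  then obtain c where c: "S = [:c:]" by (metis pderiv_eq_0_iff degree_eq_zeroE)
  have "(\<lambda>N. \<Sum>j\<le>?r. (- 1) ^ sum_list (take j ks) *
      (F (rev (take j ks)) N * F (drop j ks) N - poly (Q (rev (take j ks)) * Q (drop j ks)) (harm N)))
      \<longlonglongrightarrow> (\<Sum>j\<le>?r. (- 1) ^ sum_list (take j ks) * 0)"
    by (intro tendsto_sum tendsto_mult tendsto_const small_product F) (simp_all add: is_index_take_drop ks)
  also have "(\<lambda>N. \<Sum>j\<le>?r. (- 1) ^ sum_list (take j ks) *
      (F (rev (take j ks)) N * F (drop j ks) N - poly (Q (rev (take j ks)) * Q (drop j ks)) (harm N)))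
    = (\<lambda>N. symmetric_sum (\<lambda>ks. F ks N) ks - poly S (harm N))"
    unfolding poly_S symmetric_sum_def by (simp add: right_diff_distrib sum_subtractf mult.assoc)
  finally have "(\<lambda>N. symmetric_sum (\<lambda>ks. F ks N) ks - c) \<longlonglongrightarrow> 0" by (simp add: c)
  then have "(\<lambda>N. symmetric_sum (\<lambda>ks. F ks N) ks) \<longlonglongrightarrow> c" by (simp add: LIM_zero_iff)
  moreover have "c = symmetric_sum (\<lambda>ks. poly (Q ks) 0) ks" using poly_S[of 0] by (simp add: c)
  ultimately show ?thesis by simp
qed

lemma symmetric_sum_cong:
  assumes "is_index ks" "\<And>l. is_index l \<Longrightarrow> Z l = Z' l"
  shows "symmetric_sum Z ks = symmetric_sum Z' ks"
  unfolding symmetric_sum_def using assms by (intro sum.cong refl) (simp add: is_index_take_drop)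

lemma msum_tendsto_symmetric:
  assumes "is_index ks"
  shows "(\<lambda>N. msum (symmetric_reciprocals N) ks) \<longlonglongrightarrow> symmetric_sum zeta_reg ks"
proof -
  have "symmetric_sum zeta_reg ks = symmetric_sum (\<lambda>ks. poly (reg_poly ks) 0) ks"
    by (rule symmetric_sum_cong[OF assms zeta_reg_poly])
  moreover have "(\<lambda>N. symmetric_sum (\<lambda>ks. mhs ks N) ks) \<longlonglongrightarrow> symmetric_sum (\<lambda>ks. poly (reg_poly ks) 0) ks"
    by (rule symmetric_sum_tendsto[OF reg_poly pderiv_reg_poly _ assms]) (simp_all add: reg_poly_Nil)
  ultimately show ?thesis by (simp only: msum_symmetric_reciprocals)
qed

lemma msum_star_tendsto_symmetric:
  assumes "is_index ks"
  shows "(\<lambda>N. msum_star (symmetric_reciprocals N) ks) \<longlonglongrightarrow> symmetric_sum zeta_star_reg ks"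
proof -
  define Q where "Q ks = (\<Sum>l\<leftarrow>merges ks. reg_poly l)" for ks
  have star: "zeta_star_reg l = poly (Q l) 0" if "is_index l" for l
  proof -
    have eq: "map zeta_reg (merges l) = map (\<lambda>l. poly (reg_poly l) 0) (merges l)"
      using merges_index[OF that] zeta_reg_poly by simp
    show ?thesis by (simp only: zeta_star_reg_eq Q_def poly_sum_list eq)
  qed
  have "pderiv (Q (k # ks)) = (if k = 1 then Q ks else 0)" if "is_index (k # ks)" for k ks
    using that
  proof (induction ks arbitrary: k)
    case Nil
    then show ?case by (simp add: Q_def pderiv_reg_poly)
  next
    case (Cons l ks)
    have ix: "is_index (l # ks)" "k \<ge> 1" "l \<ge> 1" "is_index ((k + l) # ks)" using Cons.prems by (auto simp: is_index_def)
    have "pderiv (Q (k # l # ks)) = (\<Sum>w\<leftarrow>merges (l # ks). pderiv (reg_poly (k # w))) + pderiv (Q ((k + l) # ks))"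
      by (simp add: Q_def pderiv_add pderiv_sum_list o_def)
    \<comment> \<open>A merge that joins the first entry to the next starts with an entry of at
      least 2 and contributes no derivative.\<close>
    also have "pderiv (Q ((k + l) # ks)) = 0" using Cons.IH[OF ix(4)] ix by simp
    also have "(\<Sum>w\<leftarrow>merges (l # ks). pderiv (reg_poly (k # w))) = (\<Sum>w\<leftarrow>merges (l # ks). if k = 1 then reg_poly w else 0)"
    proof -
      have "pderiv (reg_poly (k # w)) = (if k = 1 then reg_poly w else 0)" if "w \<in> set (merges (l # ks))" for w
        using merges_index[OF ix(1) that] ix(2) by (intro pderiv_reg_poly) (simp add: is_index_def)
      then show ?thesis by (simp cong: map_cong)
    qed
    finally show ?case by (simp add: Q_def)
  qed
  moreover have "small (\<lambda>N. (\<Sum>l\<leftarrow>merges ks. mhs l N) - poly (Q ks) (harm N))" if "is_index ks" for ks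
    unfolding Q_def using merges_index[OF that] by (rule small_sum_list_poly)
  moreover have "pderiv (Q []) = 0" by (simp add: Q_def reg_poly_Nil)
  ultimately have "(\<lambda>N. symmetric_sum (\<lambda>ks. \<Sum>l\<leftarrow>merges ks. mhs l N) ks) \<longlonglongrightarrow> symmetric_sum (\<lambda>ks. poly (Q ks) 0) ks"
    using symmetric_sum_tendsto[of "\<lambda>ks N. \<Sum>l\<leftarrow>merges ks. mhs l N" Q ks] assms by blast
  moreover have "symmetric_sum zeta_star_reg ks = symmetric_sum (\<lambda>ks. poly (Q ks) 0) ks"
    by (rule symmetric_sum_cong[OF assms star])
  ultimately show ?thesis by (simp only: msum_star_symmetric_reciprocals)
qed

lemma symmetric_sum_in_space:
  assumes "\<And>ks. Z ks \<in> mzv_space" shows "symmetric_sum Z ks \<in> mzv_space"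
  unfolding symmetric_sum_def
proof (intro rat_vector.subspace_sum[OF subspace_mzv_space])
  fix j
  show "(- 1) ^ sum_list (take j ks) * Z (rev (take j ks)) * Z (drop j ks) \<in> mzv_space"
    using subspace_of_int_mult[OF subspace_mzv_space mzv_space_mult[OF assms assms], of "(- 1) ^ sum_list (take j ks)"]
    by (simp add: mult.assoc)
qed

section \<open>Double zeta values\<close>

text \<open>The expansion of 1/(m - x X), whose coefficients collect the powers of 1/m.\<close>

definition geom :: "real \<Rightarrow> real \<Rightarrow> real fps"
  where "geom m x = Abs_fps (\<lambda>i. x ^ i / m ^ Suc i)"

lemma geom_inverse: "m \<noteq> 0 \<Longrightarrow> (fps_const m - fps_const x * fps_X) * geom m x = 1"
proof (rule fps_ext)
  fix n assume "m \<noteq> 0"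
  then show "fps_nth ((fps_const m - fps_const x * fps_X) * geom m x) n = fps_nth 1 n"
    by (cases n) (simp_all add: left_diff_distrib mult.assoc geom_def)
qed

text \<open>The identity 1/(A B) = (1/A + 1/B)/(A + B) for the two linear denominators.\<close>

lemma geom_partial_fractions:
  assumes "m \<noteq> 0" "n \<noteq> 0" "m + n \<noteq> 0"
  shows "geom m x * geom n y = geom (m + n) (x + y) * geom m x + geom (m + n) (x + y) * geom n y"
proof -
  let ?A = "fps_const m - fps_const x * fps_X" and ?B = "fps_const n - fps_const y * fps_X"
  have "fps_const (m + n) - fps_const (x + y) * fps_X = ?A + ?B"
    by (simp add: algebra_simps flip: fps_const_add)
  then have C: "(?A + ?B) * geom (m + n) (x + y) = 1" using geom_inverse[OF assms(3), of "x + y"] by simp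
  have "geom m x * geom n y = geom m x * geom n y * ((?A + ?B) * geom (m + n) (x + y))" by (simp only: C mult_1_right)
  also have "\<dots> = geom (m + n) (x + y) * ((?A * geom m x) * geom n y + (?B * geom n y) * geom m x)"
    by (simp only: algebra_simps)
  also have "\<dots> = geom (m + n) (x + y) * (1 * geom n y + 1 * geom m x)"
    by (simp only: geom_inverse assms not_False_eq_True)
  finally show ?thesis by (simp add: distrib_left add.commute)
qed

lemma fps_nth_geom_mult:
  "fps_nth (geom m x * geom n y) d = (\<Sum>i\<le>d. x ^ i * y ^ (d - i) * (1 / (m ^ Suc i * n ^ Suc (d - i))))"
  by (simp add: fps_mult_nth geom_def atLeast0AtMost)

text \<open>The sum over positive m, n with m + n \<le> N. For this triangular truncation, unlike
  for a square, the partial fraction form of the shuffle product is exact.\<close>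

definition convolution_sum :: "nat \<Rightarrow> nat \<Rightarrow> nat \<Rightarrow> real"
  where "convolution_sum N a b = (\<Sum>q<N. \<Sum>n<q. 1 / (real (q - n) ^ a * real (Suc n) ^ b))"

lemma mhs_pair: "mhs [a, b] N = (\<Sum>q<N. \<Sum>n<q. 1 / (real (Suc q) ^ a * real (Suc n) ^ b))"
  by (simp add: mhs_Cons sum_divide_distrib mult.commute)

lemma shuffle_truncated:
  "(\<Sum>i\<le>d. x ^ i * y ^ (d - i) * convolution_sum N (Suc i) (Suc (d - i)))
   = (\<Sum>i\<le>d. (x + y) ^ i * x ^ (d - i) * mhs [Suc i, Suc (d - i)] N)
   + (\<Sum>i\<le>d. (x + y) ^ i * y ^ (d - i) * mhs [Suc i, Suc (d - i)] N)"
proof -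
  have swap: "(\<Sum>i\<le>d. c i * (\<Sum>q<N. \<Sum>n<q. f i q n)) = (\<Sum>q<N. \<Sum>n<q. \<Sum>i\<le>d. c i * f i q n)" for c :: "nat \<Rightarrow> real" and f :: "nat \<Rightarrow> nat \<Rightarrow> nat \<Rightarrow> real"
    unfolding sum_distrib_left by (rule trans[OF sum.swap], rule sum.cong[OF refl], rule sum.swap)
  have D: "(\<Sum>i\<le>d. u ^ i * v ^ (d - i) * mhs [Suc i, Suc (d - i)] N)
      = (\<Sum>q<N. \<Sum>n<q. fps_nth (geom (real (Suc q)) u * geom (real (Suc n)) v) d)" for u v
    unfolding mhs_pair fps_nth_geom_mult by (rule swap)
  have "(\<Sum>i\<le>d. x ^ i * y ^ (d - i) * convolution_sum N (Suc i) (Suc (d - i)))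
      = (\<Sum>q<N. \<Sum>n<q. fps_nth (geom (real (q - n)) x * geom (real (Suc n)) y) d)"
    unfolding convolution_sum_def fps_nth_geom_mult by (rule swap)
  also have "\<dots> = (\<Sum>q<N. \<Sum>n<q. fps_nth (geom (real (Suc q)) (x + y) * geom (real (q - n)) x) d
      + fps_nth (geom (real (Suc q)) (x + y) * geom (real (Suc n)) y) d)"
  proof (intro sum.cong refl)
    fix q n :: nat assume "n \<in> {..<q}"
    then have q: "real (q - n) + real (Suc n) = real (Suc q)" "real (q - n) \<noteq> 0" "real (Suc n) \<noteq> 0" "real (Suc q) \<noteq> 0"
      by auto
    show "fps_nth (geom (real (q - n)) x * geom (real (Suc n)) y) d
      = fps_nth (geom (real (Suc q)) (x + y) * geom (real (q - n)) x) d
      + fps_nth (geom (real (Suc q)) (x + y) * geom (real (Suc n)) y) d"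
      using geom_partial_fractions[OF q(2,3), of x y] q(4) by (simp only: q(1) fps_add_nth not_False_eq_True simp_thms)
  qed
  also have "\<dots> = (\<Sum>q<N. \<Sum>n<q. fps_nth (geom (real (Suc q)) (x + y) * geom (real (q - n)) x) d)
      + (\<Sum>q<N. \<Sum>n<q. fps_nth (geom (real (Suc q)) (x + y) * geom (real (Suc n)) y) d)"
    by (simp only: sum.distrib)
  \<comment> \<open>Reversing the inner range exchanges q - n and n + 1, which brings this part into
    the form of a double harmonic sum.\<close>
  also have "(\<Sum>q<N. \<Sum>n<q. fps_nth (geom (real (Suc q)) (x + y) * geom (real (q - n)) x) d)
     = (\<Sum>q<N. \<Sum>n<q. fps_nth (geom (real (Suc q)) (x + y) * geom (real (Suc n)) x) d)"
  proof (rule sum.cong[OF refl])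
    fix q :: nat
    have "(\<Sum>n<q. fps_nth (geom (real (Suc q)) (x + y) * geom (real (Suc n)) x) d)
      = (\<Sum>n<q. fps_nth (geom (real (Suc q)) (x + y) * geom (real (Suc (q - Suc n))) x) d)"
      by (rule sum.nat_diff_reindex[symmetric])
    also have "\<dots> = (\<Sum>n<q. fps_nth (geom (real (Suc q)) (x + y) * geom (real (q - n)) x) d)"
      by (intro sum.cong refl) (simp add: Suc_diff_Suc del: of_nat_Suc)
    finally show "(\<Sum>n<q. fps_nth (geom (real (Suc q)) (x + y) * geom (real (q - n)) x) d)
      = (\<Sum>n<q. fps_nth (geom (real (Suc q)) (x + y) * geom (real (Suc n)) x) d)" ..
  qed
  finally show ?thesis by (simp only: D)
qed

lemma harm_convolution: "(\<Sum>m<N. 1 / (real (Suc m) * real (N - m))) = 2 * harm N / real (Suc N)"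
proof -
  have gen: "1 / (s * t) = (1 / s + 1 / t) / (s + t)" if "s > 0" "t > 0" for s t :: real
  proof -
    have "1 / s + 1 / t = (s + t) / (s * t)" "s + t \<noteq> 0" using that by (simp_all add: field_simps)
    then show ?thesis by simp
  qed
  have "(\<Sum>m<N. 1 / (real (Suc m) * real (N - m))) = (\<Sum>m<N. (1 / real (Suc m) + 1 / real (N - m)) / real (Suc N))"
  proof (intro sum.cong refl)
    fix m assume "m \<in> {..<N}"
    then have "real (N - m) > 0" "real (Suc m) > 0" "real (Suc N) = real (Suc m) + real (N - m)" by auto
    then show "1 / (real (Suc m) * real (N - m)) = (1 / real (Suc m) + 1 / real (N - m)) / real (Suc N)"
      using gen by metis
  qed
  also have "\<dots> = ((\<Sum>m<N. 1 / real (Suc m)) + (\<Sum>m<N. 1 / real (N - m))) / real (Suc N)"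
    by (simp only: sum_divide_distrib[symmetric] sum.distrib)
  also have "(\<Sum>m<N. 1 / real (N - m)) = (\<Sum>m<N. 1 / real (Suc (N - Suc m)))"
    by (intro sum.cong refl) (simp add: Suc_diff_Suc del: of_nat_Suc)
  also have "\<dots> = (\<Sum>m<N. 1 / real (Suc m))" by (rule sum.nat_diff_reindex)
  finally show ?thesis by (simp add: harm_altdef divide_inverse del: of_nat_Suc)
qed

lemma convolution_sum_commute: "convolution_sum N a b = convolution_sum N b a"
  unfolding convolution_sum_def
proof (rule sum.cong[OF refl])
  fix q :: nat
  have "(\<Sum>n<q. 1 / (real (q - n) ^ b * real (Suc n) ^ a))
      = (\<Sum>n<q. 1 / (real (q - (q - Suc n)) ^ b * real (Suc (q - Suc n)) ^ a))"
    by (rule sum.nat_diff_reindex[symmetric])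
  also have "\<dots> = (\<Sum>n<q. 1 / (real (q - n) ^ a * real (Suc n) ^ b))"
    by (intro sum.cong refl) (simp add: Suc_diff_Suc mult.commute del: of_nat_Suc)
  finally show "(\<Sum>n<q. 1 / (real (q - n) ^ a * real (Suc n) ^ b)) = (\<Sum>n<q. 1 / (real (q - n) ^ b * real (Suc n) ^ a))" ..
qed

text \<open>The difference is the part of the square above the antidiagonal. In terms of the shifted
  variable m there are \<open>Suc m\<close> values of n, and the exponent \<open>a \<ge> 2\<close>
  pays for their number, leaving a convolution of reciprocals.\<close>

lemma convolution_sum_bound:
  assumes "a \<ge> 2" "b \<ge> 1"
  shows "\<bar>mhs [a] N * mhs [b] N - convolution_sum N a b\<bar> \<le> 2 * harm N / real (Suc N)"
proof -
  define f where "f m n = 1 / (real (Suc m) ^ a * real (Suc n) ^ b)" for m n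
  have "convolution_sum N a b = (\<Sum>(q, n)\<in>(SIGMA q:{..<N}. {..<q}). 1 / (real (q - n) ^ a * real (Suc n) ^ b))"
    unfolding convolution_sum_def by (subst sum.Sigma) auto
  also have "\<dots> = (\<Sum>(m, n)\<in>(SIGMA m:{..<N}. {..<N - Suc m}). f m n)"
    by (rule sum.reindex_bij_witness[where i = "\<lambda>(m, n). (Suc (m + n), n)" and j = "\<lambda>(q, n). (q - Suc n, n)"])
       (auto simp: f_def Suc_diff_Suc)
  also have "\<dots> = (\<Sum>m<N. \<Sum>n<N - Suc m. f m n)" by (subst sum.Sigma) auto
  finally have conv: "convolution_sum N a b = (\<Sum>m<N. \<Sum>n<N - Suc m. f m n)" .
  have prod: "mhs [a] N * mhs [b] N = (\<Sum>m<N. \<Sum>n<N. f m n)"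
    by (simp add: mhs_Cons sum_product f_def)
  have "mhs [a] N * mhs [b] N - convolution_sum N a b = (\<Sum>m<N. \<Sum>n\<in>{N - Suc m..<N}. f m n)"
    unfolding conv prod sum_subtractf[symmetric]
  proof (rule sum.cong[OF refl])
    fix m
    show "(\<Sum>n<N. f m n) - (\<Sum>n<N - Suc m. f m n) = (\<Sum>n\<in>{N - Suc m..<N}. f m n)"
      using sum.atLeastLessThan_concat[of 0 "N - Suc m" N "f m"] by (simp add: lessThan_atLeast0)
  qed
  moreover have "0 \<le> (\<Sum>m<N. \<Sum>n\<in>{N - Suc m..<N}. f m n)" by (intro sum_nonneg) (simp add: f_def)
  moreover have "(\<Sum>m<N. \<Sum>n\<in>{N - Suc m..<N}. f m n) \<le> (\<Sum>m<N. 1 / (real (Suc m) * real (N - m)))"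
  proof (rule sum_mono)
    fix m assume m: "m \<in> {..<N}"
    have "(\<Sum>n\<in>{N - Suc m..<N}. f m n) \<le> (\<Sum>n\<in>{N - Suc m..<N}. 1 / (real (Suc m) ^ 2 * real (N - m)))"
    proof (rule sum_mono)
      fix n assume n: "n \<in> {N - Suc m..<N}"
      have "real (Suc m) ^ 2 \<le> real (Suc m) ^ a" using assms by (intro power_increasing) auto
      moreover have "real (N - m) \<le> real (Suc n) ^ b"
      proof -
        have "real (N - m) \<le> real (Suc n) ^ 1" using n m by auto
        also have "\<dots> \<le> real (Suc n) ^ b" using assms by (intro power_increasing) auto
        finally show ?thesis .
      qed
      ultimately show "f m n \<le> 1 / (real (Suc m) ^ 2 * real (N - m))"
        unfolding f_def using m by (intro divide_left_mono mult_mono mult_pos_pos) auto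
    qed
    also have "\<dots> = real (Suc m) * (1 / (real (Suc m) ^ 2 * real (N - m)))" using m by simp
    also have "\<dots> = 1 / (real (Suc m) * real (N - m))" by (simp add: power2_eq_square del: of_nat_Suc)
    finally show "(\<Sum>n\<in>{N - Suc m..<N}. f m n) \<le> 1 / (real (Suc m) * real (N - m))" .
  qed
  ultimately show ?thesis using harm_convolution[of N] by simp
qed

lemma convolution_sum_tendsto:
  assumes "a \<ge> 1" "b \<ge> 1" "a + b \<ge> 3"
  shows "(\<lambda>N. mhs [a] N * mhs [b] N - convolution_sum N a b) \<longlonglongrightarrow> 0"
proof -
  have lim: "(\<lambda>N. 2 * harm N / real (Suc N)) \<longlonglongrightarrow> 0"
  proof -
    have "small (\<lambda>N. 1 / real (Suc N))"
      unfolding small_def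
    proof (intro exI[of _ 1] allI)
      fix N
      have "real (Suc N) powr (- 1) \<le> real (Suc N) powr (- 1 / 2)" by (intro powr_mono) auto
      then show "\<bar>1 / real (Suc N)\<bar> \<le> 1 * real (Suc N) powr (- 1 / 2)"
        by (simp add: powr_minus_divide del: of_nat_Suc)
    qed
    from small_mult_poly_harm[OF this, of "[:0, 2:]"] show ?thesis by (simp add: mult.commute)
  qed
  have "\<bar>mhs [a] N * mhs [b] N - convolution_sum N a b\<bar> \<le> 2 * harm N / real (Suc N)" for N
  proof (cases "a \<ge> 2")
    case True
    then show ?thesis using convolution_sum_bound assms by blast
  next
    case False
    then have "b \<ge> 2" using assms by simp
    then show ?thesis
      using convolution_sum_bound[of b a N] assms by (simp add: mult.commute convolution_sum_commute[of N a b])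
  qed
  then show ?thesis
    by (intro Lim_null_comparison[OF _ lim] always_eventually) (simp only: real_norm_def, blast)
qed

section \<open>Double shuffle relations\<close>

definition double_gf :: "nat \<Rightarrow> real \<Rightarrow> real \<Rightarrow> real"
  where "double_gf d x y = (\<Sum>i\<le>d. x ^ i * y ^ (d - i) * zeta_reg [Suc i, Suc (d - i)])"

definition product_gf :: "nat \<Rightarrow> real \<Rightarrow> real \<Rightarrow> real"
  where "product_gf d x y = (\<Sum>i\<le>d. x ^ i * y ^ (d - i) * (zeta_reg [Suc i] * zeta_reg [Suc (d - i)]))"

text \<open>Only the products with both arguments 1 fail to satisfy the shuffle relation after
  harmonic regularisation, which is why weight 2 is excluded.\<close>

lemma double_shuffle:
  assumes "d \<ge> 1"
  shows "double_gf d (x + y) x + double_gf d (x + y) y = product_gf d x y"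
proof -
  define P where "P = (\<Sum>i\<le>d. [:x ^ i * y ^ (d - i):] * (reg_poly [Suc i] * reg_poly [Suc (d - i)]))"
  define D where "D v = (\<Sum>i\<le>d. [:(x + y) ^ i * v ^ (d - i):] * reg_poly [Suc i, Suc (d - i)])" for v
  have ix: "is_index [Suc a]" "is_index [Suc a, Suc b]" for a b by (auto simp: is_index_def)
  have "(\<lambda>N. \<Sum>i\<le>d. x ^ i * y ^ (d - i) * ((mhs [Suc i] N * mhs [Suc (d - i)] N - convolution_sum N (Suc i) (Suc (d - i)))
        - (mhs [Suc i] N * mhs [Suc (d - i)] N - poly (reg_poly [Suc i] * reg_poly [Suc (d - i)]) (harm N))))
      \<longlonglongrightarrow> (\<Sum>i\<le>d. x ^ i * y ^ (d - i) * (0 - 0))"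
    by (intro tendsto_sum tendsto_mult tendsto_const tendsto_diff convolution_sum_tendsto small_product reg_poly ix)
       (use assms in auto)
  also have "(\<lambda>N. \<Sum>i\<le>d. x ^ i * y ^ (d - i) * ((mhs [Suc i] N * mhs [Suc (d - i)] N - convolution_sum N (Suc i) (Suc (d - i)))
        - (mhs [Suc i] N * mhs [Suc (d - i)] N - poly (reg_poly [Suc i] * reg_poly [Suc (d - i)]) (harm N))))
     = (\<lambda>N. poly P (harm N) - (\<Sum>i\<le>d. x ^ i * y ^ (d - i) * convolution_sum N (Suc i) (Suc (d - i))))"
    by (simp add: P_def poly_sum right_diff_distrib sum_subtractf)
  finally have 1: "(\<lambda>N. poly P (harm N) - (\<Sum>i\<le>d. x ^ i * y ^ (d - i) * convolution_sum N (Suc i) (Suc (d - i)))) \<longlonglongrightarrow> 0"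
    by simp
  have 2: "(\<lambda>N. (\<Sum>i\<le>d. (x + y) ^ i * v ^ (d - i) * mhs [Suc i, Suc (d - i)] N) - poly (D v) (harm N)) \<longlonglongrightarrow> 0" for v
  proof -
    have "(\<lambda>N. \<Sum>i\<le>d. (x + y) ^ i * v ^ (d - i) * (mhs [Suc i, Suc (d - i)] N - poly (reg_poly [Suc i, Suc (d - i)]) (harm N)))
       \<longlonglongrightarrow> (\<Sum>i\<le>d. (x + y) ^ i * v ^ (d - i) * 0)"
      by (intro tendsto_sum tendsto_mult tendsto_const small_tendsto_0 reg_poly ix)
    then show ?thesis by (simp add: D_def poly_sum right_diff_distrib sum_subtractf)
  qed
  have "(\<lambda>N. poly P (harm N) - (\<Sum>i\<le>d. x ^ i * y ^ (d - i) * convolution_sum N (Suc i) (Suc (d - i)))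
      + ((\<Sum>i\<le>d. (x + y) ^ i * x ^ (d - i) * mhs [Suc i, Suc (d - i)] N) - poly (D x) (harm N))
      + ((\<Sum>i\<le>d. (x + y) ^ i * y ^ (d - i) * mhs [Suc i, Suc (d - i)] N) - poly (D y) (harm N))) \<longlonglongrightarrow> 0 + 0 + 0"
    by (intro tendsto_add 1 2)
  moreover have "poly (P - D x - D y) (harm N) = poly P (harm N) - (\<Sum>i\<le>d. x ^ i * y ^ (d - i) * convolution_sum N (Suc i) (Suc (d - i)))
      + ((\<Sum>i\<le>d. (x + y) ^ i * x ^ (d - i) * mhs [Suc i, Suc (d - i)] N) - poly (D x) (harm N))
      + ((\<Sum>i\<le>d. (x + y) ^ i * y ^ (d - i) * mhs [Suc i, Suc (d - i)] N) - poly (D y) (harm N))" for N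
    unfolding shuffle_truncated poly_diff by linarith
  ultimately have "(\<lambda>N. poly (P - D x - D y) (harm N)) \<longlonglongrightarrow> 0" by (simp only: add_0)
  then have "P - D x - D y = 0" by (rule poly_harm_tendsto_0)
  then have "poly P 0 = poly (D x) 0 + poly (D y) 0" by (metis diff_diff_add eq_iff_diff_eq_0 poly_add)
  then show ?thesis
    by (simp add: P_def D_def poly_sum double_gf_def product_gf_def zeta_reg_poly ix)
qed

lemma double_stuffle:
  "double_gf d x y + double_gf d y x + zeta_reg [Suc (Suc d)] * (\<Sum>i\<le>d. x ^ i * y ^ (d - i)) = product_gf d x y"
proof -
  have ix: "is_index [Suc a]" for a by (auto simp: is_index_def)
  have "double_gf d y x = (\<Sum>i\<le>d. x ^ i * y ^ (d - i) * zeta_reg [Suc (d - i), Suc i])"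
    unfolding double_gf_def
    by (subst sum.atLeastAtMost_rev[of _ 0 d, unfolded atMost_atLeast0[symmetric]], intro sum.cong) auto
  moreover have "zeta_reg [Suc i] * zeta_reg [Suc (d - i)]
      = zeta_reg [Suc i, Suc (d - i)] + zeta_reg [Suc (d - i), Suc i] + zeta_reg [Suc (Suc d)]" if "i \<le> d" for i
    using zeta_reg_mult[OF ix ix, of i "d - i"] that by simp
  ultimately show ?thesis
    by (simp add: double_gf_def product_gf_def sum_distrib_left sum.distrib[symmetric] algebra_simps)
qed

abbreviation (input) "zeta2_ideal \<equiv> (\<lambda>z. mzv [2] * z) ` mzv_space"

lemma subspace_zeta2_ideal: "rat_vector.subspace zeta2_ideal"
proof (rule rat_vector.subspaceI)
  show "0 \<in> zeta2_ideal" by (rule image_eqI[of _ _ 0]) (simp_all add: mzv_space_closed)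
  show "a *\<^sub>Q x \<in> zeta2_ideal" if x: "x \<in> zeta2_ideal" for a x
  proof -
    obtain z where "x = mzv [2] * z" "z \<in> mzv_space" using x by blast
    then show ?thesis by (intro image_eqI[of _ _ "a *\<^sub>Q z"]) (simp_all add: mzv_space_closed, simp add: scaleQ_real_def)
  qed
  show "x + y \<in> zeta2_ideal" if xy: "x \<in> zeta2_ideal" "y \<in> zeta2_ideal" for x y
  proof -
    obtain z w where "x = mzv [2] * z" "z \<in> mzv_space" "y = mzv [2] * w" "w \<in> mzv_space" using xy by blast
    then show ?thesis by (intro image_eqI[of _ _ "z + w"]) (simp_all add: distrib_left mzv_space_closed)
  qed
qed

lemma zeta2_ideal_mult: "x \<in> mzv_space \<Longrightarrow> y \<in> zeta2_ideal \<Longrightarrow> x * y \<in> zeta2_ideal"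
  by (auto simp: mult.left_commute intro!: imageI mzv_space_mult)

lemma admissible_2: "admissible [2]"
  by (simp add: admissible_def is_index_def)

lemma zeta2_ideal_subset: "zeta2_ideal \<subseteq> mzv_space"
  using mzv_space_mult[OF mzv_in_space[OF admissible_2]] by blast

text \<open>The shuffle relation at (1, -1), where x + y = 0, isolates the double value at (1, k -
  1); at (1, 0) it isolates the one at (k - 1, 1). Combined with the stuffle relations these give (k
  + 1) times the zeta value as a combination of products of zeta values of smaller even
  weights.\<close>

lemma zeta_even_in_ideal: "even k \<Longrightarrow> k \<ge> 2 \<Longrightarrow> zeta_reg [k] \<in> zeta2_ideal"
proof (induction k rule: less_induct)
  case (less k)
  show ?case
  proof (cases "k = 2")
    case True
    then have "zeta_reg [k] = mzv [2] * 1" by (simp add: zeta_reg_mzv admissible_2)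
    then show ?thesis using mzv_space_1 by blast
  next
    case False
    define d where "d = k - 2"
    have d: "k = Suc (Suc d)" "even d" "d \<ge> 1" using less.prems False by (auto simp: d_def)
    have single: "(\<Sum>i\<le>d. 0 ^ i * f i) = f 0" "(\<Sum>i\<le>d. 0 ^ (d - i) * f i) = f d" for f :: "nat \<Rightarrow> real"
    proof -
      have "(\<Sum>i\<le>d. 0 ^ i * f i) = (\<Sum>i\<le>d. if i = 0 then f 0 else 0)" by (intro sum.cong) auto
      then show "(\<Sum>i\<le>d. 0 ^ i * f i) = f 0" by simp
      have "(\<Sum>i\<le>d. 0 ^ (d - i) * f i) = (\<Sum>i\<le>d. if i = d then f d else 0)" by (intro sum.cong) auto
      then show "(\<Sum>i\<le>d. 0 ^ (d - i) * f i) = f d" by simp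
    qed
    have e1: "2 * zeta_reg [1, Suc d] = product_gf d 1 (- 1)"
      using double_shuffle[OF d(3), of 1 "- 1"] single(1)[of "\<lambda>i. 1 ^ (d - i) * zeta_reg [Suc i, Suc (d - i)]"]
        single(1)[of "\<lambda>i. (- 1) ^ (d - i) * zeta_reg [Suc i, Suc (d - i)]"] d(2)
      by (simp add: double_gf_def mult.assoc)
    have e2: "double_gf d 1 1 + zeta_reg [Suc d, 1] = 0"
      using double_shuffle[OF d(3), of 1 0] single(2)[of "\<lambda>i. zeta_reg [Suc i, Suc (d - i)]"]
        single(2)[of "\<lambda>i. zeta_reg [Suc i] * zeta_reg [Suc (d - i)]"] zeta_reg_1
      by (simp add: double_gf_def[of d 1 0] product_gf_def mult.assoc)
    have e3: "2 * double_gf d 1 1 + (real d + 1) * zeta_reg [k] = product_gf d 1 1"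
      using double_stuffle[of d 1 1] d(1) by (simp add: algebra_simps)
    have e4: "zeta_reg [1, Suc d] + zeta_reg [Suc d, 1] + zeta_reg [k] = 0"
      using zeta_reg_mult[of "[1]" "[Suc d]"] zeta_reg_1 d(1) by (simp add: is_index_def)
    have "(real k + 1) * zeta_reg [k] = product_gf d 1 1 - product_gf d 1 (- 1)"
      using e1 e2 e3 e4 by (simp add: d(1) algebra_simps)
    also have "\<dots> = (\<Sum>i\<le>d. (1 - (- 1) ^ (d - i)) * (zeta_reg [Suc i] * zeta_reg [Suc (d - i)]))"
      by (simp add: product_gf_def sum_subtractf[symmetric] left_diff_distrib)
    also have "\<dots> \<in> zeta2_ideal"
    proof (intro rat_vector.subspace_sum[OF subspace_zeta2_ideal])
      fix i assume i: "i \<in> {..d}"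
      show "(1 - (- 1) ^ (d - i)) * (zeta_reg [Suc i] * zeta_reg [Suc (d - i)]) \<in> zeta2_ideal"
      proof (cases "even (d - i)")
        case True
        then show ?thesis using rat_vector.subspace_0[OF subspace_zeta2_ideal] by simp
      next
        case False
        then have "d - i \<noteq> 0" "i \<noteq> 0" using d(2) by (auto simp: odd_pos)
        with False i d have "even (Suc (d - i))" "Suc (d - i) \<ge> 2" "Suc (d - i) < k" by auto
        then have "zeta_reg [Suc (d - i)] \<in> zeta2_ideal" using less.IH by blast
        from zeta2_ideal_mult[OF zeta_reg_in_space this] False show ?thesis
          using subspace_of_nat_mult[OF subspace_zeta2_ideal, of _ 2] by simp
      qed
    qed
    finally have "of_nat (Suc k) * zeta_reg [k] \<in> zeta2_ideal" by (simp add: add.commute)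
    then show ?thesis by (rule subspace_of_nat_mult_cancel[OF subspace_zeta2_ideal]) simp
  qed
qed

section \<open>Double zeta values of odd weight modulo \<zeta>(2)\<close>

definition zeta_span :: "nat \<Rightarrow> real set"
  where "zeta_span k = {q *\<^sub>Q mzv [k] + j |q j. j \<in> zeta2_ideal}"

lemma subspace_zeta_span: "rat_vector.subspace (zeta_span k)"
proof (rule rat_vector.subspaceI)
  show "0 \<in> zeta_span k"
    unfolding zeta_span_def using rat_vector.subspace_0[OF subspace_zeta2_ideal]
    by (auto intro!: exI[of _ 0])
  show "x + y \<in> zeta_span k" if xy: "x \<in> zeta_span k" "y \<in> zeta_span k" for x y
  proof -
    obtain q j q' j' where *: "x = q *\<^sub>Q mzv [k] + j" "j \<in> zeta2_ideal" "y = q' *\<^sub>Q mzv [k] + j'" "j' \<in> zeta2_ideal"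
      using xy unfolding zeta_span_def by blast
    then have "x + y = (q + q') *\<^sub>Q mzv [k] + (j + j')" by (simp add: scaleQ_add_left)
    moreover have "j + j' \<in> zeta2_ideal" using * rat_vector.subspace_add[OF subspace_zeta2_ideal] by blast
    ultimately show ?thesis unfolding zeta_span_def by blast
  qed
  show "a *\<^sub>Q x \<in> zeta_span k" if x: "x \<in> zeta_span k" for a x
  proof -
    obtain q j where *: "x = q *\<^sub>Q mzv [k] + j" "j \<in> zeta2_ideal" using x unfolding zeta_span_def by blast
    then have "a *\<^sub>Q x = (a * q) *\<^sub>Q mzv [k] + a *\<^sub>Q j" by (simp add: scaleQ_add_right scaleQ_scaleQ)
    moreover have "a *\<^sub>Q j \<in> zeta2_ideal" using * rat_vector.subspace_scale[OF subspace_zeta2_ideal] by blast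
    ultimately show ?thesis unfolding zeta_span_def by blast
  qed
qed

lemma zeta2_ideal_zeta_span: "zeta2_ideal \<subseteq> zeta_span k"
proof
  fix j assume "j \<in> zeta2_ideal"
  moreover have "j = 0 *\<^sub>Q mzv [k] + j" by simp
  ultimately show "j \<in> zeta_span k" unfolding zeta_span_def by blast
qed

lemma zeta_in_zeta_span: "k \<ge> 2 \<Longrightarrow> zeta_reg [k] \<in> zeta_span k"
proof -
  assume "k \<ge> 2"
  then have "zeta_reg [k] = 1 *\<^sub>Q mzv [k] + 0"
    by (simp add: zeta_reg_mzv admissible_def is_index_def scaleQ_one)
  then show ?thesis unfolding zeta_span_def using rat_vector.subspace_0[OF subspace_zeta2_ideal] by blast
qed

lemma product_odd_in_ideal:
  assumes "odd (a + b)" "a \<ge> 1" "b \<ge> 1"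
  shows "zeta_reg [a] * zeta_reg [b] \<in> zeta2_ideal"
proof (cases "even a")
  case True
  then have "a \<ge> 2" using assms(2) by (cases "a = 1") auto
  then show ?thesis using zeta2_ideal_mult[OF zeta_reg_in_space zeta_even_in_ideal[OF True], of "[b]"]
    by (simp add: mult.commute)
next
  case False
  then have "even b" using assms(1) by simp
  then have "b \<ge> 2" using assms(3) by (cases "b = 1") auto
  then show ?thesis using zeta2_ideal_mult[OF zeta_reg_in_space zeta_even_in_ideal[OF \<open>even b\<close>]] by simp
qed

text \<open>
  Modulo \<open>zeta_span\<close>, the function \<open>double_gf\<close> is antisymmetric under \<open>(x, y) \<mapsto> (y, x)\<close> and under
  \<open>(x, y) \<mapsto> (x, x - y)\<close>. The product of these maps has order 6 and its cube is \<open>-1\<close>.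
\<close>

lemma double_gf_in_zeta_span:
  assumes d: "odd d"
  shows "double_gf d (of_int x) (of_int y) \<in> zeta_span (Suc (Suc d))"
proof -
  let ?V = "zeta_span (Suc (Suc d))"
  let ?f = "\<lambda>x y. double_gf d (of_int x) (of_int y)"
  have d1: "d \<ge> 1" using d by (simp add: odd_pos Suc_leI)
  note V = subspace_zeta_span[of "Suc (Suc d)"]
  have prod: "product_gf d (of_int x) (of_int y) \<in> ?V" for x y
    unfolding product_gf_def
  proof (intro rat_vector.subspace_sum[OF V])
    fix i assume i: "i \<in> {..d}"
    have "zeta_reg [Suc i] * zeta_reg [Suc (d - i)] \<in> ?V"
      using product_odd_in_ideal[of "Suc i" "Suc (d - i)"] zeta2_ideal_zeta_span d i by auto
    from subspace_of_int_mult[OF V this, of "x ^ i * y ^ (d - i)"]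
    show "of_int x ^ i * of_int y ^ (d - i) * (zeta_reg [Suc i] * zeta_reg [Suc (d - i)]) \<in> ?V" by simp
  qed
  have S: "?f x y + ?f y x \<in> ?V" for x y
  proof -
    have "?f x y + ?f y x = product_gf d (of_int x) (of_int y)
        - of_int (\<Sum>i\<le>d. x ^ i * y ^ (d - i)) * zeta_reg [Suc (Suc d)]"
      using double_stuffle[of d "of_int x" "of_int y"] by (simp add: algebra_simps)
    moreover have "of_int (\<Sum>i\<le>d. x ^ i * y ^ (d - i)) * zeta_reg [Suc (Suc d)] \<in> ?V"
      by (intro subspace_of_int_mult V zeta_in_zeta_span) simp
    ultimately show ?thesis using rat_vector.subspace_diff[OF V prod[of x y]] by (simp only:)
  qed
  have T: "?f x y + ?f x (x - y) \<in> ?V" for x y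
    using double_shuffle[OF d1, of "of_int (x - y)" "of_int y"] prod[of "x - y" y]
    by (simp add: add.commute)
  have neg: "?f (- x) (- y) = - ?f x y"
  proof -
    have "(- of_int x) ^ i * (- of_int y) ^ (d - i) = - (of_int x ^ i * of_int y ^ (d - i) :: real)" if "i \<le> d" for i
    proof -
      have "(- of_int x) ^ i * (- of_int y) ^ (d - i) = ((- 1) ^ i * (- 1) ^ (d - i)) * (of_int x ^ i * of_int y ^ (d - i) :: real)"
        by (subst (1 2) power_minus) (simp only: ac_simps)
      then show ?thesis using d that by (simp flip: power_add)
    qed
    then show ?thesis by (simp add: double_gf_def sum_negf[symmetric])
  qed
  \<comment> \<open>The six relations telescope to f(x, y) - f(-x, -y), which is 2 f(x, y) because
    the degree d is odd.\<close>
  have "(?f x y + ?f y x) - (?f y x + ?f y (y - x)) + (?f y (y - x) + ?f (y - x) y)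
      - (?f (y - x) y + ?f (y - x) ((y - x) - y)) + (?f (y - x) (- x) + ?f (- x) (y - x))
      - (?f (- x) (y - x) + ?f (- x) (- x - (y - x))) \<in> ?V"
    by (intro rat_vector.subspace_add[OF V] rat_vector.subspace_diff[OF V] S T)
  then have "of_nat 2 * ?f x y \<in> ?V" using neg by simp
  then show ?thesis by (rule subspace_of_nat_mult_cancel[OF V]) simp
qed

lemma double_zeta_in_zeta_span:
  assumes "odd k" "a + b = k" "a \<ge> 1" "b \<ge> 1"
  shows "zeta_reg [a, b] \<in> zeta_span k"
proof -
  obtain i j where ij: "a = Suc i" "b = Suc j" using assms by (cases a; cases b) auto
  define d where "d = i + j"
  have k: "k = Suc (Suc d)" "odd d" using assms ij by (auto simp: d_def)
  have "zeta_reg [Suc i, Suc (d - i)] \<in> zeta_span k"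
  proof (rule subspace_polynomial_coeffs[OF subspace_zeta_span, where d = d and c = "\<lambda>i. zeta_reg [Suc i, Suc (d - i)]"])
    show "(\<Sum>i\<le>d. of_nat n ^ i * zeta_reg [Suc i, Suc (d - i)]) \<in> zeta_span k" for n
      using double_gf_in_zeta_span[OF k(2), of "int n" 1] by (simp add: double_gf_def k(1))
  qed (simp add: d_def)
  then show ?thesis by (simp add: ij d_def)
qed

lemma symmetric_sum_single: "symmetric_sum Z [k] = Z [] * Z [k] + (- 1) ^ k * Z [k] * Z []"
  by (simp add: symmetric_sum_def)

text \<open>Each identity holds for the finite list \<open>symmetric_reciprocals N\<close> and
  passes to the limit. The symmetric value of depth one is 0 in odd weight and twice a zeta value in
  even weight, hence in the ideal.\<close>

interpretation S: zeta_values "symmetric_sum zeta_reg" "symmetric_sum zeta_star_reg" mzv_space zeta2_ideal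
proof
  have lim: "(\<lambda>N. weighted_sum (msum (symmetric_reciprocals N)) w n) \<longlonglongrightarrow> weighted_sum (symmetric_sum zeta_reg) w n" for w n
    unfolding weighted_sum_def
    by (intro tendsto_sum tendsto_mult tendsto_const msum_tendsto_symmetric) (simp add: indices_def)
  show "(\<Sum>m\<le>n. weighted_sum (symmetric_sum zeta_reg) (marked (eq_wt 1 (- 1)) []) m
        * weighted_sum (symmetric_sum zeta_reg) (marked (\<lambda>_. c) (map (\<lambda>(d, c). (geq_wt d, \<lambda>_. c)) ts)) (n - m))
      = weighted_sum (symmetric_sum zeta_reg) (marked (eq_wt 1 (c - 1)) (map (\<lambda>(d, c). (eq_wt d 1, eq_wt 1 (c - 1))) ts)) n"
    if ts: "\<forall>(d, c)\<in>set ts. d > 0" for ts c n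
  proof (rule LIMSEQ_unique)
    show "(\<lambda>N. \<Sum>m\<le>n. weighted_sum (msum (symmetric_reciprocals N)) (marked (eq_wt 1 (- 1)) []) m
        * weighted_sum (msum (symmetric_reciprocals N)) (marked (\<lambda>_. c) (map (\<lambda>(d, c). (geq_wt d, \<lambda>_. c)) ts)) (n - m))
      \<longlonglongrightarrow> (\<Sum>m\<le>n. weighted_sum (symmetric_sum zeta_reg) (marked (eq_wt 1 (- 1)) []) m
        * weighted_sum (symmetric_sum zeta_reg) (marked (\<lambda>_. c) (map (\<lambda>(d, c). (geq_wt d, \<lambda>_. c)) ts)) (n - m))"
      by (intro tendsto_sum tendsto_mult lim)
  qed (simp only: weighted_sum_from[OF ts] lim)
  show "(\<Sum>j\<le>length ks. (- 1) ^ j * symmetric_sum zeta_reg (take j ks) * symmetric_sum zeta_star_reg (rev (drop j ks))) = 0"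
    if ks: "is_index ks" "ks \<noteq> []" for ks
  proof (rule LIMSEQ_unique)
    show "(\<lambda>N. \<Sum>j\<le>length ks. (- 1) ^ j * msum (symmetric_reciprocals N) (take j ks)
          * msum_star (symmetric_reciprocals N) (rev (drop j ks)))
      \<longlonglongrightarrow> (\<Sum>j\<le>length ks. (- 1) ^ j * symmetric_sum zeta_reg (take j ks) * symmetric_sum zeta_star_reg (rev (drop j ks)))"
      by (intro tendsto_sum tendsto_mult tendsto_const msum_tendsto_symmetric msum_star_tendsto_symmetric)
         (use ks in \<open>simp_all add: is_index_take_drop\<close>)
  qed (simp add: msum_antipode ks)
  show "symmetric_sum zeta_star_reg (rev ks) = (- 1) ^ sum_list ks * symmetric_sum zeta_star_reg ks"
    if ks: "is_index ks" for ks
  proof (rule LIMSEQ_unique)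
    show "(\<lambda>N. msum_star (symmetric_reciprocals N) (rev ks)) \<longlonglongrightarrow> symmetric_sum zeta_star_reg (rev ks)"
      by (rule msum_star_tendsto_symmetric) (simp add: ks is_index_take_drop)
    have "msum_star (symmetric_reciprocals N) (rev ks) = (- 1) ^ sum_list ks * msum_star (symmetric_reciprocals N) ks" for N
    proof -
      have "msum_star (symmetric_reciprocals N) (rev ks) = msum_star (rev (symmetric_reciprocals N)) ks"
        using msum_star_rev[of "rev (symmetric_reciprocals N)" ks] by simp
      then show ?thesis by (simp only: rev_symmetric_reciprocals msum_star_map_uminus)
    qed
    then show "(\<lambda>N. msum_star (symmetric_reciprocals N) (rev ks)) \<longlonglongrightarrow> (- 1) ^ sum_list ks * symmetric_sum zeta_star_reg ks"
      by (simp only:) (intro tendsto_mult tendsto_const msum_star_tendsto_symmetric ks)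
  qed
  show "of_nat (Suc n) * symmetric_sum zeta_reg (replicate (Suc n) 1)
     = (\<Sum>j\<le>n. (- 1) ^ j * symmetric_sum zeta_reg [Suc j] * symmetric_sum zeta_reg (replicate (n - j) 1))" for n
  proof (rule LIMSEQ_unique)
    show "(\<lambda>N. of_nat (Suc n) * msum (symmetric_reciprocals N) (replicate (Suc n) 1))
      \<longlonglongrightarrow> of_nat (Suc n) * symmetric_sum zeta_reg (replicate (Suc n) 1)"
      by (intro tendsto_mult tendsto_const msum_tendsto_symmetric) (simp add: is_index_def)
    show "(\<lambda>N. of_nat (Suc n) * msum (symmetric_reciprocals N) (replicate (Suc n) 1))
      \<longlonglongrightarrow> (\<Sum>j\<le>n. (- 1) ^ j * symmetric_sum zeta_reg [Suc j] * symmetric_sum zeta_reg (replicate (n - j) 1))"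
      unfolding newton_msum
      by (intro tendsto_sum tendsto_mult tendsto_const msum_tendsto_symmetric) (auto simp: is_index_def)
  qed
  have nil: "zeta_reg [] = 1" by (simp add: zeta_reg_poly is_index_def reg_poly_Nil)
  then show "symmetric_sum zeta_reg [] = 1" "symmetric_sum zeta_star_reg [] = 1"
    by (simp_all add: symmetric_sum_def zeta_star_reg_eq)
  show "symmetric_sum zeta_reg [k] \<in> zeta2_ideal" if "k > 0" for k
  proof (cases "even k")
    case True
    with that have "k \<ge> 2" by (cases "k = 1") auto
    then show ?thesis
      using subspace_of_nat_mult[OF subspace_zeta2_ideal zeta_even_in_ideal[OF True], of 2] True
      by (simp add: symmetric_sum_single nil)
  next
    case False
    then show ?thesis using rat_vector.subspace_0[OF subspace_zeta2_ideal] by (simp add: symmetric_sum_single nil)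
  qed
qed (use subspace_mzv_space subspace_zeta2_ideal zeta2_ideal_subset mzv_space_mult zeta2_ideal_mult
      symmetric_sum_in_space zeta_reg_in_space zeta_star_reg_in_space in blast)+

section \<open>Rearrangement of double series\<close>

definition fps_nonneg :: "real fps \<Rightarrow> bool"
  where "fps_nonneg F \<longleftrightarrow> (\<forall>k. fps_nth F k \<ge> 0)"

definition fps_has_sum :: "('b \<Rightarrow> real fps) \<Rightarrow> real fps \<Rightarrow> 'b set \<Rightarrow> bool"
  where "fps_has_sum F S A \<longleftrightarrow> (\<forall>k. ((\<lambda>i. fps_nth (F i) k) has_sum fps_nth S k) A)"

lemma fps_nonneg_mult: "fps_nonneg F \<Longrightarrow> fps_nonneg G \<Longrightarrow> fps_nonneg (F * G)"
  by (auto simp: fps_nonneg_def fps_mult_nth intro!: sum_nonneg)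

lemma fps_nonneg_const: "c \<ge> 0 \<Longrightarrow> fps_nonneg (fps_const c)"
  by (simp add: fps_nonneg_def)

lemma fps_nonneg_1: "fps_nonneg 1"
  by (simp add: fps_nonneg_def)

lemma fps_nonneg_linear: "c \<ge> 0 \<Longrightarrow> g \<ge> 0 \<Longrightarrow> fps_nonneg (fps_const c + fps_const g * fps_X)"
  by (simp add: fps_nonneg_def)

lemma fps_nonneg_geom: "m > 0 \<Longrightarrow> g \<ge> 0 \<Longrightarrow> fps_nonneg (geom m g)"
  by (simp add: fps_nonneg_def geom_def)

lemma fps_nonneg_prod: "(\<And>i. i \<in> A \<Longrightarrow> fps_nonneg (F i)) \<Longrightarrow> fps_nonneg (prod F A)"
  by (induction A rule: infinite_finite_induct) (auto simp: fps_nonneg_1 fps_nonneg_mult)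

lemma fps_has_sum_mult:
  assumes "fps_has_sum F S A" shows "fps_has_sum (\<lambda>i. G * F i) (G * S) A"
  unfolding fps_has_sum_def
proof
  fix k
  have "((\<lambda>i. \<Sum>j\<in>J. fps_nth G j * fps_nth (F i) (k - j)) has_sum (\<Sum>j\<in>J. fps_nth G j * fps_nth S (k - j))) A"
    if "finite J" for J
    using that
  proof (induction J)
    case (insert j J)
    then show ?case
      using assms by (auto simp: fps_has_sum_def intro!: has_sum_add has_sum_cmult_right)
  qed simp
  then show "((\<lambda>i. fps_nth (G * F i) k) has_sum fps_nth (G * S) k) A"
    by (simp add: fps_mult_nth)
qed

lemma fps_has_sum_cong: "(\<And>i. i \<in> A \<Longrightarrow> F i = G i) \<Longrightarrow> fps_has_sum F S A \<longleftrightarrow> fps_has_sum G S A"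
  unfolding fps_has_sum_def by (intro iff_allI has_sum_cong) auto

text \<open>Tonelli's theorem for each coefficient: by nonnegativity the iterated sum already yields
  summability over the pairs.\<close>

lemma fps_has_sum_SigmaI:
  assumes "\<And>x. x \<in> A \<Longrightarrow> fps_has_sum (\<lambda>y. F (x, y)) (g x) (B x)" "fps_has_sum g S A"
    "\<And>x y. x \<in> A \<Longrightarrow> y \<in> B x \<Longrightarrow> fps_nonneg (F (x, y))"
  shows "fps_has_sum F S (Sigma A B)"
  unfolding fps_has_sum_def
proof
  fix k
  have 1: "((\<lambda>y. fps_nth (F (x, y)) k) has_sum fps_nth (g x) k) (B x)" if "x \<in> A" for x
    using assms(1)[OF that] by (simp add: fps_has_sum_def)
  have 2: "((\<lambda>x. fps_nth (g x) k) has_sum fps_nth S k) A" using assms(2) by (simp add: fps_has_sum_def)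
  show "((\<lambda>i. fps_nth (F i) k) has_sum fps_nth S k) (Sigma A B)"
    by (rule has_sum_SigmaI[OF 1 2], assumption, rule summable_on_SigmaI[OF 1], assumption)
       (use 2 assms(3) in \<open>auto simp: summable_on_def fps_nonneg_def\<close>)
qed

lemma fps_has_sum_SigmaD:
  assumes "fps_has_sum F S (Sigma A B)" "\<And>x. x \<in> A \<Longrightarrow> fps_has_sum (\<lambda>y. F (x, y)) (g x) (B x)"
  shows "fps_has_sum g S A"
  unfolding fps_has_sum_def
proof
  fix k
  show "((\<lambda>x. fps_nth (g x) k) has_sum fps_nth S k) A"
    by (rule has_sum_SigmaD[where f = "\<lambda>i. fps_nth (F i) k"]) (use assms in \<open>auto simp: fps_has_sum_def\<close>)
qed

lemma fps_has_sum_reindex: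
  assumes "bij_betw f A B" "fps_has_sum F S B" shows "fps_has_sum (\<lambda>i. F (f i)) S A"
  unfolding fps_has_sum_def
proof
  fix k
  show "((\<lambda>i. fps_nth (F (f i)) k) has_sum fps_nth S k) A"
    using has_sum_reindex_bij_betw[OF assms(1), of "\<lambda>i. fps_nth (F i) k"] assms(2) by (simp add: fps_has_sum_def)
qed

lemma fps_has_sum_finite: "finite A \<Longrightarrow> fps_has_sum F (sum F A) A"
  by (simp add: fps_has_sum_def fps_sum_nth has_sum_finiteI)

lemma fps_has_sum_telescope:
  assumes "\<And>k. (\<lambda>n. fps_nth (h n) k) \<longlonglongrightarrow> 0" "\<And>n. f n = h n - h (Suc n)" "\<And>n. fps_nonneg (f n)"
  shows "fps_has_sum f (h 0) UNIV"
  unfolding fps_has_sum_def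
proof
  fix k
  have "(\<lambda>n. fps_nth (f n) k) sums (fps_nth (h 0) k - 0)"
    unfolding assms(2) fps_sub_nth by (rule telescope_sums'[OF assms(1)])
  then show "((\<lambda>n. fps_nth (f n) k) has_sum fps_nth (h 0) k) UNIV"
    using assms(3) by (intro sums_nonneg_imp_has_sum) (auto simp: fps_nonneg_def)
qed

definition fps_le :: "real fps \<Rightarrow> real fps \<Rightarrow> bool"
  where "fps_le F G \<longleftrightarrow> (\<forall>k. 0 \<le> fps_nth F k \<and> fps_nth F k \<le> fps_nth G k)"

lemma fps_le_mult: "fps_le F F' \<Longrightarrow> fps_le G G' \<Longrightarrow> fps_le (F * G) (F' * G')"
  unfolding fps_le_def fps_mult_nth by (auto intro!: sum_nonneg sum_mono mult_mono intro: order_trans)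

lemma fps_le_prod: "(\<And>i. i \<in> A \<Longrightarrow> fps_le (F i) (G i)) \<Longrightarrow> fps_le (prod F A) (prod G A)"
  by (induction A rule: infinite_finite_induct) (auto simp: fps_le_mult, auto simp: fps_le_def)

lemma fps_le_tendsto_0:
  assumes "\<And>n. fps_le (F n) (G n)" "\<And>k. (\<lambda>n. fps_nth (G n) k) \<longlonglongrightarrow> 0"
  shows "(\<lambda>n. fps_nth (F n) k) \<longlonglongrightarrow> 0"
  by (rule tendsto_sandwich[OF _ _ tendsto_const assms(2)[of k]]) (use assms(1) in \<open>auto simp: fps_le_def\<close>)

lemma geom_le_1:
  assumes "1 \<le> m" "m \<le> n" "0 \<le> g"
  shows "fps_le (geom n g) (fps_const (1 / n) * (fps_const m * geom m g))"
  unfolding fps_le_def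
proof
  fix k
  have "m ^ k \<le> n ^ k" using assms by (intro power_mono) auto
  then show "0 \<le> fps_nth (geom n g) k \<and> fps_nth (geom n g) k \<le> fps_nth (fps_const (1 / n) * (fps_const m * geom m g)) k"
    using assms by (auto simp: geom_def intro!: divide_left_mono mult_left_mono)
qed

text \<open>With \<open>a = - g X\<close> and \<open>b = X\<close>, the two products below are quotients of
  Pochhammer symbols: \<open>(1 - a)\<^sub>p\<^sub>+\<^sub>r / (1 - a)\<^sub>p\<close> and \<open>(1 - b)\<^sub>q / (1 - b)\<^sub>q\<^sub>+\<^sub>r\<close>. The signs
  make all coefficients nonnegative, which justifies the rearrangements.\<close>

definition rising :: "real \<Rightarrow> nat \<Rightarrow> nat \<Rightarrow> real fps"
  where "rising g p r = (\<Prod>j<r. fps_const (real (Suc (p + j))) + fps_const g * fps_X)"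

definition inv_rising :: "nat \<Rightarrow> nat \<Rightarrow> real fps"
  where "inv_rising q r = (\<Prod>j<r. geom (real (Suc (q + j))) 1)"

lemma rising_0: "rising g p 0 = 1" and inv_rising_0: "inv_rising q 0 = 1"
  by (simp_all add: rising_def inv_rising_def)

lemma rising_Suc: "rising g p (Suc r) = rising g p r * (fps_const (real (Suc (p + r))) + fps_const g * fps_X)"
  by (simp add: rising_def)

lemma inv_rising_Suc: "inv_rising q (Suc r) = inv_rising q r * geom (real (Suc (q + r))) 1"
  by (simp add: inv_rising_def)

lemma inv_rising_Suc': "inv_rising q (Suc r) = geom (real (Suc q)) 1 * inv_rising (Suc q) r"
  unfolding inv_rising_def by (subst prod.lessThan_Suc_shift) simp

lemma fps_nonneg_rising: "g \<ge> 0 \<Longrightarrow> fps_nonneg (rising g p r)"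
  unfolding rising_def by (intro fps_nonneg_prod fps_nonneg_linear) auto

lemma fps_nonneg_inv_rising: "fps_nonneg (inv_rising q r)"
  unfolding inv_rising_def by (intro fps_nonneg_prod fps_nonneg_geom) auto

lemma geom_1_inverse: "(fps_const (real (Suc m)) - fps_X) * geom (real (Suc m)) 1 = 1"
  using geom_inverse[of "real (Suc m)" 1] by (simp del: of_nat_Suc)

lemma inv_rising_tendsto_0: "(\<lambda>q. fps_nth (inv_rising q (Suc r)) k) \<longlonglongrightarrow> 0"
proof (rule fps_le_tendsto_0)
  fix q
  have "fps_le (geom (real (Suc q)) 1) (fps_const (1 / real (Suc q)) * (fps_const 1 * geom 1 1))"
    by (rule geom_le_1) auto
  moreover have "fps_le (inv_rising (Suc q) r) (\<Prod>j<r. geom 1 1)"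
    unfolding inv_rising_def
  proof (intro fps_le_prod)
    fix j
    show "fps_le (geom (real (Suc (Suc q + j))) 1) (geom 1 1)"
      by (auto simp: fps_le_def geom_def divide_le_eq_1 simp del: power_Suc of_nat_Suc intro!: one_le_power)
  qed
  ultimately show "fps_le (inv_rising q (Suc r)) (fps_const (1 / real (Suc q)) * (geom 1 1 * (\<Prod>j<r. geom 1 1)))"
    unfolding inv_rising_Suc' using fps_le_mult by (simp add: mult.assoc) (metis mult.assoc)
next
  fix k
  show "(\<lambda>q. fps_nth (fps_const (1 / real (Suc q)) * (geom 1 1 * (\<Prod>j<r. geom 1 1))) k) \<longlonglongrightarrow> 0"
    unfolding fps_mult_left_const_nth
    by (rule tendsto_mult_left_zero) (rule LIMSEQ_Suc[OF lim_1_over_n])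
qed

text \<open>Consecutive products of \<open>Suc r\<close> factors share all but their extreme
  factors; the two extreme linear denominators differ by \<open>Suc r\<close>. So the difference of
  the products is \<open>Suc r\<close> times the product of all factors involved, and the series
  telescopes.\<close>

lemma inv_rising_sum:
  "fps_has_sum (\<lambda>q. inv_rising (p + q) (Suc (Suc r))) (fps_const (1 / real (Suc r)) * inv_rising p (Suc r)) UNIV"
proof -
  define c where "c = fps_const (1 / real (Suc r))"
  have "fps_has_sum (\<lambda>q. inv_rising (p + q) (Suc (Suc r))) (c * inv_rising (p + 0) (Suc r)) UNIV"
  proof (rule fps_has_sum_telescope[where h = "\<lambda>q. c * inv_rising (p + q) (Suc r)"])
    fix k
    show "(\<lambda>q. fps_nth (c * inv_rising (p + q) (Suc r)) k) \<longlonglongrightarrow> 0"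
      unfolding c_def fps_mult_left_const_nth
      using LIMSEQ_ignore_initial_segment[OF inv_rising_tendsto_0[of r k], of p]
      by (intro tendsto_mult_right_zero) (simp add: add.commute)
  next
    fix q
    let ?u = "geom (real (Suc (p + q))) 1" and ?v = "geom (real (Suc (p + q + Suc r))) 1"
    let ?a = "fps_const (real (Suc (p + q))) - fps_X" and ?b = "fps_const (real (Suc (p + q + Suc r))) - fps_X"
    let ?I = "inv_rising (Suc (p + q)) r"
    have ba: "?b - ?a = fps_const (real (Suc r))"
    proof -
      have "(u - x) - (v - x) = u - v" for u v x :: "real fps" by simp
      then have "?b - ?a = fps_const (real (Suc (p + q + Suc r)) - real (Suc (p + q)))" by (simp only: fps_const_sub)
      also have "real (Suc (p + q + Suc r)) - real (Suc (p + q)) = real (Suc r)" by simp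
      finally show ?thesis .
    qed
    have "c * (?b - ?a) = 1" unfolding ba c_def by (simp del: of_nat_Suc)
    have eqs: "inv_rising (p + q) (Suc (Suc r)) = ?u * ?I * ?v" "inv_rising (p + q) (Suc r) = ?u * ?I"
      "inv_rising (p + Suc q) (Suc r) = ?I * ?v"
      using inv_rising_Suc[of "p + q" "Suc r"] inv_rising_Suc[of "Suc (p + q)" r]
      by (simp_all add: inv_rising_Suc'[of "p + q"] del: of_nat_Suc)
    have "?u * ?I - ?I * ?v = ?u * ?I * (?b * ?v) - (?a * ?u) * ?I * ?v"
      by (simp only: geom_1_inverse mult_1_right mult_1_left)
    also have "\<dots> = (?b - ?a) * (?u * ?I * ?v)" by (simp only: algebra_simps)
    finally have "c * (?u * ?I - ?I * ?v) = (c * (?b - ?a)) * (?u * ?I * ?v)" by (simp only: mult.assoc)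
    then have "c * (?u * ?I - ?I * ?v) = ?u * ?I * ?v" unfolding \<open>c * (?b - ?a) = 1\<close> by simp
    then show "inv_rising (p + q) (Suc (Suc r)) = c * inv_rising (p + q) (Suc r) - c * inv_rising (p + Suc q) (Suc r)"
      unfolding eqs by (simp only: right_diff_distrib)
  qed (rule fps_nonneg_inv_rising)
  then show ?thesis by (simp add: c_def)
qed

text \<open>The coefficients are complete homogeneous sums of the numbers c / (j + 1), bounded by
  powers of their sum.\<close>

lemma geom_product_bound:
  assumes "c \<ge> 0"
  shows "0 \<le> fps_nth (\<Prod>j<r. fps_const (real (Suc j)) * geom (real (Suc j)) c) k \<and>
    fps_nth (\<Prod>j<r. fps_const (real (Suc j)) * geom (real (Suc j)) c) k \<le> (c * harm r) ^ k"
proof (induction r arbitrary: k)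
  case 0
  then show ?case by (simp add: harm_def power_0_left)
next
  case (Suc r)
  let ?E = "\<Prod>j<r. fps_const (real (Suc j)) * geom (real (Suc j)) c"
  let ?x = "c / real (Suc r)"
  have f: "fps_nth (fps_const (real (Suc r)) * geom (real (Suc r)) c) i = ?x ^ i" for i
    by (simp add: geom_def power_divide del: of_nat_Suc)
  have eq: "fps_nth (\<Prod>j<Suc r. fps_const (real (Suc j)) * geom (real (Suc j)) c) k = (\<Sum>i\<le>k. fps_nth ?E i * ?x ^ (k - i))"
    unfolding prod.lessThan_Suc fps_mult_nth[of ?E] f atLeast0AtMost ..
  have x: "?x \<ge> 0" using assms by simp
  have "(\<Sum>i\<le>k. fps_nth ?E i * ?x ^ (k - i)) \<le> (\<Sum>i\<le>k. of_nat (k choose i) * (c * harm r) ^ i * ?x ^ (k - i))"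
  proof (rule sum_mono)
    fix i assume "i \<in> {..k}"
    then have "1 \<le> real (k choose i)" by (simp add: Suc_leI)
    moreover have "0 \<le> (c * harm r) ^ i * ?x ^ (k - i)" using assms harm_nonneg[of r, where 'a = real] by simp
    ultimately have "1 * ((c * harm r) ^ i * ?x ^ (k - i)) \<le> real (k choose i) * ((c * harm r) ^ i * ?x ^ (k - i))"
      by (rule mult_right_mono)
    moreover have "fps_nth ?E i * ?x ^ (k - i) \<le> (c * harm r) ^ i * ?x ^ (k - i)"
      using Suc.IH[of i] x by (intro mult_right_mono) auto
    ultimately show "fps_nth ?E i * ?x ^ (k - i) \<le> of_nat (k choose i) * (c * harm r) ^ i * ?x ^ (k - i)"
      by (simp only: mult_1_left mult.assoc)
  qed
  also have "\<dots> = (c * harm r + ?x) ^ k" by (rule binomial_ring[symmetric])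
  also have "c * harm r + ?x = c * harm (Suc r)" by (simp add: harm_Suc divide_inverse algebra_simps)
  finally show ?case unfolding eq using Suc.IH x by (auto intro!: sum_nonneg mult_nonneg_nonneg)
qed

lemma small_inverse: "small (\<lambda>N. 1 / real (Suc N))"
  unfolding small_def
proof (intro exI[of _ 1] allI)
  fix N
  have "real (Suc N) powr (- 1) \<le> real (Suc N) powr (- 1 / 2)" by (intro powr_mono) auto
  then show "\<bar>1 / real (Suc N)\<bar> \<le> 1 * real (Suc N) powr (- 1 / 2)"
    by (simp add: powr_minus_divide del: of_nat_Suc)
qed

text \<open>Pair each numerator factor with a denominator factor: coefficientwise the quotient is at
  most that of l / (l - (1 + g) X) with l = j + 1, so the coefficients of the product grow at most
  like powers of the harmonic number. One more denominator factor is left over and supplies the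
  decay 1/(r + 1).\<close>

lemma rising_inv_rising_tendsto_0:
  assumes g: "g \<ge> 0"
  shows "(\<lambda>r. fps_nth (rising g p r * inv_rising q (Suc (p + r))) k) \<longlonglongrightarrow> 0"
proof (rule fps_le_tendsto_0)
  define E where "E r = (\<Prod>j<r. fps_const (real (Suc j)) * geom (real (Suc j)) (1 + g))" for r
  define G where "G = inv_rising 0 p * geom 1 1"
  show "fps_le (rising g p r * inv_rising q (Suc (p + r))) (fps_const (1 / real (Suc r)) * (G * E r))" for r
  proof -
    have split: "inv_rising q (Suc (p + r)) = inv_rising q p * (\<Prod>j<r. geom (real (Suc (q + (p + j)))) 1) * geom (real (Suc (q + (p + r)))) 1"
    proof -
      have "inv_rising q (p + r) = inv_rising q p * (\<Prod>j<r. geom (real (Suc (q + (p + j)))) 1)"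
        by (induction r) (simp_all add: inv_rising_def mult.assoc)
      then show ?thesis by (simp add: inv_rising_Suc)
    qed
    have 1: "fps_le (inv_rising q p) (inv_rising 0 p)"
      unfolding inv_rising_def
      by (intro fps_le_prod) (auto simp: fps_le_def geom_def intro!: divide_left_mono mult_mono power_mono)
    have 2: "fps_le (rising g p r * (\<Prod>j<r. geom (real (Suc (q + (p + j)))) 1)) (E r)"
      unfolding rising_def E_def prod.distrib[symmetric]
    proof (intro fps_le_prod)
      fix j
      let ?m = "real (Suc (p + j))" and ?n = "real (Suc (q + (p + j)))" and ?l = "real (Suc j)"
      show "fps_le ((fps_const ?m + fps_const g * fps_X) * geom ?n 1) (fps_const ?l * geom ?l (1 + g))"
        unfolding fps_le_def
      proof
        fix k
        have "fps_nth ((fps_const ?m + fps_const g * fps_X) * geom ?n 1) k = (if k = 0 then ?m / ?n else ?m / ?n ^ Suc k + g / ?n ^ k)"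
          by (cases k) (simp_all add: distrib_right mult.assoc geom_def del: of_nat_Suc)
        also have "\<dots> \<le> (1 + g) ^ k / ?l ^ k"
        proof (cases k)
          case (Suc k')
          have "?m / ?n ^ Suc k + g / ?n ^ k \<le> 1 / ?n ^ k + g / ?n ^ k"
            by (intro add_right_mono) (simp add: divide_le_eq)
          also have "\<dots> = (1 + g) / ?n ^ k" by (simp add: add_divide_distrib)
          also have "\<dots> \<le> (1 + g) ^ k / ?l ^ k"
          proof (intro frac_le power_mono)
            show "1 + g \<le> (1 + g) ^ k" using g Suc self_le_power[of "1 + g" k] by simp
          qed (use g in auto)
          finally show ?thesis using Suc by simp
        qed (simp add: divide_le_eq)
        finally show "0 \<le> fps_nth ((fps_const ?m + fps_const g * fps_X) * geom ?n 1) k \<and>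
            fps_nth ((fps_const ?m + fps_const g * fps_X) * geom ?n 1) k \<le> fps_nth (fps_const ?l * geom ?l (1 + g)) k"
          using fps_nonneg_mult[OF fps_nonneg_linear[of ?m g] fps_nonneg_geom[of ?n 1]] g
          by (simp add: fps_nonneg_def geom_def del: of_nat_Suc)
      qed
    qed
    have 3: "fps_le (geom (real (Suc (q + (p + r)))) 1) (fps_const (1 / real (Suc r)) * geom 1 1)"
      unfolding fps_le_def
    proof
      fix k
      have "real (Suc r) \<le> real (Suc (q + (p + r))) ^ Suc k"
      proof -
        have "real (Suc r) \<le> real (Suc (q + (p + r)))" by simp
        also have "\<dots> \<le> real (Suc (q + (p + r))) ^ Suc k" by (intro self_le_power) auto
        finally show ?thesis .
      qed
      then show "0 \<le> fps_nth (geom (real (Suc (q + (p + r)))) 1) k \<and>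
          fps_nth (geom (real (Suc (q + (p + r)))) 1) k \<le> fps_nth (fps_const (1 / real (Suc r)) * geom 1 1) k"
        by (auto simp: geom_def simp del: of_nat_Suc power_Suc intro!: divide_left_mono)
    qed
    have "rising g p r * inv_rising q (Suc (p + r))
      = inv_rising q p * (rising g p r * (\<Prod>j<r. geom (real (Suc (q + (p + j)))) 1)) * geom (real (Suc (q + (p + r)))) 1"
      unfolding split by (simp only: ac_simps)
    moreover have "fps_const (1 / real (Suc r)) * (G * E r) = inv_rising 0 p * E r * (fps_const (1 / real (Suc r)) * geom 1 1)"
      unfolding G_def by (simp only: ac_simps)
    ultimately show ?thesis using fps_le_mult[OF fps_le_mult[OF 1 2] 3] by (simp only:)
  qed
  fix k
  have E0: "(\<lambda>r. 1 / real (Suc r) * fps_nth (E r) i) \<longlonglongrightarrow> 0" for i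
  proof (rule tendsto_sandwich[OF _ _ tendsto_const])
    have "(\<lambda>r. 1 / real (Suc r) * poly (Polynomial.monom ((1 + g) ^ i) i) (harm r)) \<longlonglongrightarrow> 0"
      by (rule small_mult_poly_harm[OF small_inverse])
    then show "(\<lambda>r. 1 / real (Suc r) * ((1 + g) * harm r) ^ i) \<longlonglongrightarrow> 0"
      by (simp add: poly_monom power_mult_distrib)
  qed (use geom_product_bound[of "1 + g"] g in \<open>auto simp: E_def intro!: always_eventually divide_right_mono\<close>)
  have "(\<lambda>r. \<Sum>i\<le>k. fps_nth G i * (1 / real (Suc r) * fps_nth (E r) (k - i))) \<longlonglongrightarrow> (\<Sum>i\<le>k. fps_nth G i * 0)"
    by (intro tendsto_sum tendsto_mult tendsto_const E0)
  then show "(\<lambda>r. fps_nth (fps_const (1 / real (Suc r)) * (G * E r)) k) \<longlonglongrightarrow> 0"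
    by (simp add: fps_mult_nth[of G] atLeast0AtMost sum_distrib_left mult.left_commute del: of_nat_Suc)
qed

text \<open>A case of Gauss's summation at 1. The next denominator factor minus the next numerator
  factor is q + 1 - (1 + g) X, independent of r, so the series telescopes after multiplication by
  the inverse of this difference.\<close>

lemma rising_sum:
  assumes g: "g \<ge> 0"
  shows "fps_has_sum (\<lambda>r. rising g p r * inv_rising q (Suc (Suc (p + r))))
    (inv_rising q (Suc p) * geom (real (Suc q)) (1 + g)) UNIV"
proof -
  let ?c = "geom (real (Suc q)) (1 + g)"
  have "fps_has_sum (\<lambda>r. rising g p r * inv_rising q (Suc (Suc (p + r))))
    (?c * (rising g p 0 * inv_rising q (Suc (p + 0)))) UNIV"
  proof (rule fps_has_sum_telescope[where h = "\<lambda>r. ?c * (rising g p r * inv_rising q (Suc (p + r)))"])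
    fix k
    have "(\<lambda>r. \<Sum>i\<le>k. fps_nth ?c i * fps_nth (rising g p r * inv_rising q (Suc (p + r))) (k - i)) \<longlonglongrightarrow> (\<Sum>i\<le>k. fps_nth ?c i * 0)"
      by (intro tendsto_sum tendsto_mult tendsto_const rising_inv_rising_tendsto_0 g)
    then show "(\<lambda>r. fps_nth (?c * (rising g p r * inv_rising q (Suc (p + r)))) k) \<longlonglongrightarrow> 0"
      unfolding fps_mult_nth[of ?c] atLeast0AtMost by simp
  next
    fix r
    let ?R = "rising g p r" and ?I = "inv_rising q (Suc (p + r))" and ?v = "geom (real (Suc (q + Suc (p + r)))) 1"
    let ?b = "fps_const (real (Suc (q + Suc (p + r)))) - fps_X" and ?a = "fps_const (real (Suc (p + r))) + fps_const g * fps_X"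
    have "(u - fps_X) - (v + fps_const g * fps_X) = (u - v) - (1 + fps_const g) * fps_X" for u v :: "real fps"
      by (simp add: algebra_simps)
    moreover have "fps_const (real (Suc (q + Suc (p + r)))) - fps_const (real (Suc (p + r))) = fps_const (real (Suc q))"
      by simp
    moreover have "1 + fps_const g = fps_const (1 + g)" by (simp flip: fps_const_add)
    ultimately have "?b - ?a = fps_const (real (Suc q)) - fps_const (1 + g) * fps_X" by (simp only:)
    then have c: "?c * (?b - ?a) = 1" using geom_inverse[of "real (Suc q)" "1 + g"] by (simp add: mult.commute)
    have "?R * ?I - ?R * ?a * (?I * ?v) = ?R * ?I * (?b * ?v) - ?R * ?a * (?I * ?v)"
      by (simp only: geom_1_inverse mult_1_right)
    also have "\<dots> = (?b - ?a) * (?R * (?I * ?v))" by (simp only: algebra_simps)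
    finally have "?c * (?R * ?I - ?R * ?a * (?I * ?v)) = (?c * (?b - ?a)) * (?R * (?I * ?v))" by (simp only: mult.assoc)
    then have "?c * (?R * ?I - ?R * ?a * (?I * ?v)) = ?R * (?I * ?v)" unfolding c by simp
    moreover have "inv_rising q (Suc (Suc (p + r))) = ?I * ?v" by (rule inv_rising_Suc)
    moreover have "rising g p (Suc r) = ?R * ?a" by (rule rising_Suc)
    ultimately show "?R * inv_rising q (Suc (Suc (p + r))) = ?c * (?R * ?I) - ?c * (rising g p (Suc r) * inv_rising q (Suc (p + Suc r)))"
      by (simp only: add_Suc_right right_diff_distrib)
  qed (intro fps_nonneg_mult fps_nonneg_rising fps_nonneg_inv_rising g)
  then show ?thesis by (simp add: rising_0 mult.commute)
qed

text \<open>The value of \<open>rising_sum\<close> for \<open>p = 0\<close>. Its coefficients are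
  constants times powers of 1/m, so that its sum over m is known in terms of zeta values; this makes
  it the starting point of the rearrangements.\<close>

definition geom2 :: "real \<Rightarrow> real \<Rightarrow> real fps"
  where "geom2 m g = geom m 1 * geom m (1 + g)"

lemma fps_nth_geom2: "m \<noteq> 0 \<Longrightarrow> fps_nth (geom2 m g) k = (\<Sum>i\<le>k. (1 + g) ^ i) / m ^ (k + 2)"
proof -
  assume m: "m \<noteq> 0"
  have "fps_nth (geom2 m g) k = (\<Sum>i\<le>k. (1 + g) ^ (k - i) / m ^ (k + 2))"
    unfolding geom2_def fps_nth_geom_mult
  proof (intro sum.cong refl)
    fix i assume "i \<in> {..k}"
    then have "m ^ Suc i * m ^ Suc (k - i) = m ^ (k + 2)" by (simp flip: power_add power_Suc)
    then show "1 ^ i * (1 + g) ^ (k - i) * (1 / (m ^ Suc i * m ^ Suc (k - i))) = (1 + g) ^ (k - i) / m ^ (k + 2)" by simp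
  qed
  also have "\<dots> = (\<Sum>i\<le>k. (1 + g) ^ (k - i)) / m ^ (k + 2)" by (simp add: sum_divide_distrib)
  also have "(\<Sum>i\<le>k. (1 + g) ^ (k - i)) = (\<Sum>i\<le>k. (1 + g) ^ i)"
    by (rule sum.reindex_bij_witness[of _ "\<lambda>i. k - i" "\<lambda>i. k - i"]) auto
  finally show ?thesis .
qed

lemma rising_sum_0:
  "g \<ge> 0 \<Longrightarrow> fps_has_sum (\<lambda>l. rising g 0 l * inv_rising q (Suc (Suc l))) (geom2 (real (Suc q)) g) UNIV"
  using rising_sum[of g 0 q] by (simp add: inv_rising_def geom2_def)

text \<open>Expand each \<open>geom2\<close> by \<open>rising_sum_0\<close>, exchange the two
  summations, and sum over n by \<open>inv_rising_sum\<close>.\<close>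

lemma rearrange_single:
  assumes g: "g \<ge> 0" and S: "fps_has_sum (\<lambda>n. geom2 (real (Suc n)) g) S UNIV"
  shows "fps_has_sum (\<lambda>l. fps_const (1 / real (Suc l)) * (rising g 0 l * inv_rising 0 (Suc l))) S UNIV"
proof -
  define f where "f = (\<lambda>(n, l). rising g 0 l * inv_rising n (Suc (Suc l)))"
  have nonneg: "fps_nonneg (f x)" for x
    by (cases x) (auto simp: f_def intro!: fps_nonneg_mult fps_nonneg_rising fps_nonneg_inv_rising g)
  have "fps_has_sum f S (UNIV \<times> UNIV)"
    by (rule fps_has_sum_SigmaI[OF _ S]) (use rising_sum_0[OF g] nonneg in \<open>auto simp: f_def\<close>)
  then have "fps_has_sum (\<lambda>i. f (prod.swap i)) S (UNIV \<times> UNIV)"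
    by (rule fps_has_sum_reindex[rotated]) (auto simp: bij_betw_def inj_on_def)
  then show ?thesis
  proof (rule fps_has_sum_SigmaD)
    fix l
    have "fps_has_sum (\<lambda>n. rising g 0 l * inv_rising (0 + n) (Suc (Suc l)))
        (rising g 0 l * (fps_const (1 / real (Suc l)) * inv_rising 0 (Suc l))) UNIV"
      by (intro fps_has_sum_mult inv_rising_sum)
    then show "fps_has_sum (\<lambda>n. f (prod.swap (l, n)))
        (fps_const (1 / real (Suc l)) * (rising g 0 l * inv_rising 0 (Suc l))) UNIV"
      by (simp add: f_def mult_ac)
  qed
qed

text \<open>After the exchange the sum runs over q > n, and \<open>inv_rising_sum\<close> leaves a
  product whose factors begin at n + 2. The factor \<open>geom (real (Suc n)) 1\<close> supplies the
  one before. The weight \<open>phi\<close> stays arbitrary so that it can later be 1 or be expanded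
  a second time.\<close>

lemma rearrange_double:
  assumes g: "g \<ge> 0" and phi: "\<And>n. fps_nonneg (phi n)"
    and S: "fps_has_sum (\<lambda>(q, n). phi n * (geom (real (Suc n)) 1 * geom2 (real (Suc q)) g)) S (SIGMA q:UNIV. {..<q})"
  shows "fps_has_sum (\<lambda>(l, n). fps_const (1 / real (Suc l)) * (rising g 0 l * (phi n * inv_rising n (Suc (Suc l))))) S UNIV"
proof -
  define f where "f = (\<lambda>((q, n), l). phi n * geom (real (Suc n)) 1 * (rising g 0 l * inv_rising q (Suc (Suc l))))"
  have nonneg: "fps_nonneg (f x)" for x
    by (auto simp: f_def split: prod.splits intro!: fps_nonneg_mult fps_nonneg_rising fps_nonneg_inv_rising fps_nonneg_geom g phi)
  have "fps_has_sum f S (Sigma (SIGMA q:UNIV. {..<q}) (\<lambda>_. UNIV))"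
  proof (rule fps_has_sum_SigmaI[OF _ S nonneg])
    fix x :: "nat \<times> nat"
    show "fps_has_sum (\<lambda>l. f (x, l)) (case x of (q, n) \<Rightarrow> phi n * (geom (real (Suc n)) 1 * geom2 (real (Suc q)) g)) UNIV"
      using fps_has_sum_mult[OF rising_sum_0[OF g], of "phi (snd x) * geom (real (Suc (snd x))) 1" "fst x"]
      by (cases x) (simp add: f_def mult.assoc)
  qed
  then have "fps_has_sum (\<lambda>i. f ((\<lambda>((l, n), q). ((Suc n + q, n), l)) i)) S (Sigma UNIV (\<lambda>_. UNIV))"
  proof (rule fps_has_sum_reindex[rotated])
    show "bij_betw (\<lambda>((l, n), q). ((Suc n + q, n), l)) (Sigma UNIV (\<lambda>_. UNIV)) (Sigma (SIGMA q:UNIV. {..<q}) (\<lambda>_. UNIV))"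
      by (rule bij_betwI[where g = "\<lambda>((q, n), l). ((l, n), q - Suc n)"]) auto
  qed
  then show ?thesis
  proof (rule fps_has_sum_SigmaD)
    fix x :: "nat \<times> nat"
    obtain l n where x: "x = (l, n)" by (cases x)
    let ?c = "phi n * geom (real (Suc n)) 1 * rising g 0 l"
    have "fps_has_sum (\<lambda>q. ?c * inv_rising (Suc n + q) (Suc (Suc l)))
        (?c * (fps_const (1 / real (Suc l)) * inv_rising (Suc n) (Suc l))) UNIV"
      by (intro fps_has_sum_mult inv_rising_sum)
    moreover have eq: "?c * (fps_const (1 / real (Suc l)) * inv_rising (Suc n) (Suc l))
        = fps_const (1 / real (Suc l)) * (rising g 0 l * (phi n * inv_rising n (Suc (Suc l))))"
      unfolding inv_rising_Suc'[of n "Suc l"] by (simp only: ac_simps)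
    ultimately show "fps_has_sum (\<lambda>q. f ((\<lambda>((l, n), q). ((Suc n + q, n), l)) (x, q)))
        (case x of (l, n) \<Rightarrow> fps_const (1 / real (Suc l)) * (rising g 0 l * (phi n * inv_rising n (Suc (Suc l))))) UNIV"
      unfolding eq by (simp only: x f_def prod.case mult.assoc)
  qed
qed

lemma rearrange_double_1:
  assumes g: "g \<ge> 0"
    and S: "fps_has_sum (\<lambda>(q, n). geom (real (Suc n)) 1 * geom2 (real (Suc q)) g) S (SIGMA q:UNIV. {..<q})"
  shows "fps_has_sum (\<lambda>l. fps_const (1 / real (Suc l) ^ 2) * (rising g 0 l * inv_rising 0 (Suc l))) S UNIV"
proof -
  have "fps_has_sum (\<lambda>(l, n). fps_const (1 / real (Suc l)) * (rising g 0 l * (1 * inv_rising n (Suc (Suc l))))) S (UNIV \<times> UNIV)"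
    using rearrange_double[OF g, of "\<lambda>_. 1"] S by (simp add: fps_nonneg_1)
  then show ?thesis
  proof (rule fps_has_sum_SigmaD)
    fix l
    let ?c = "fps_const (1 / real (Suc l)) * rising g 0 l"
    have "fps_has_sum (\<lambda>n. ?c * inv_rising (0 + n) (Suc (Suc l))) (?c * (fps_const (1 / real (Suc l)) * inv_rising 0 (Suc l))) UNIV"
      by (intro fps_has_sum_mult inv_rising_sum)
    moreover have eq: "?c * (fps_const (1 / real (Suc l)) * inv_rising 0 (Suc l))
        = fps_const (1 / real (Suc l) ^ 2) * (rising g 0 l * inv_rising 0 (Suc l))"
    proof -
      have "fps_const (1 / real (Suc l) ^ 2) = fps_const (1 / real (Suc l)) * fps_const (1 / real (Suc l))"
        by (simp add: power2_eq_square del: of_nat_Suc)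
      then show ?thesis by (simp only: ac_simps)
    qed
    ultimately show "fps_has_sum (\<lambda>n. case (l, n) of (l, n) \<Rightarrow> fps_const (1 / real (Suc l)) * (rising g 0 l * (1 * inv_rising n (Suc (Suc l)))))
        (fps_const (1 / real (Suc l) ^ 2) * (rising g 0 l * inv_rising 0 (Suc l))) UNIV"
      unfolding eq by (simp only: prod.case mult_1_left mult.assoc add_0)
  qed
qed

text \<open>Here \<open>rising_sum\<close> expands the remaining factor with parameter
  \<open>c\<close>, starting at \<open>p = Suc l\<close>. The two numerators cover the factors 1,
  ..., l and l + 2, ..., m; the gap at l + 1 is the origin of the inner entry 2.\<close>

lemma rearrange_double_2:
  assumes g: "g \<ge> 0" and c: "c \<ge> 0"
    and S: "fps_has_sum (\<lambda>(q, n). geom2 (real (Suc n)) c * geom2 (real (Suc q)) g) S (SIGMA q:UNIV. {..<q})"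
  shows "fps_has_sum (\<lambda>m. \<Sum>l<m. fps_const (1 / real (Suc l) * (1 / real (Suc m)))
      * (rising g 0 l * rising c (Suc l) (m - Suc l) * inv_rising 0 (Suc m))) S UNIV"
proof -
  let ?phi = "\<lambda>n. geom (real (Suc n)) (1 + c)"
  let ?k = "\<lambda>l. fps_const (1 / real (Suc l)) * rising g 0 l"
  have "(\<lambda>(q, n). geom2 (real (Suc n)) c * geom2 (real (Suc q)) g)
      = (\<lambda>(q, n). ?phi n * (geom (real (Suc n)) 1 * geom2 (real (Suc q)) g))"
    by (auto simp: fun_eq_iff geom2_def mult_ac)
  with S have ln: "fps_has_sum (\<lambda>(l, n). fps_const (1 / real (Suc l)) * (rising g 0 l * (?phi n * inv_rising n (Suc (Suc l))))) S UNIV"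
    using c by (intro rearrange_double g) (auto intro!: fps_nonneg_geom)
  define f where "f = (\<lambda>((l, n), r). ?k l * (rising c (Suc l) r * inv_rising n (Suc (Suc (Suc l + r)))))"
  have nonneg: "fps_nonneg (f x)" for x
    by (auto simp: f_def split: prod.splits
        intro!: fps_nonneg_mult fps_nonneg_rising fps_nonneg_inv_rising fps_nonneg_const g c)
  have "fps_has_sum f S (Sigma UNIV (\<lambda>_. UNIV))"
  proof (rule fps_has_sum_SigmaI[OF _ ln nonneg])
    fix x :: "nat \<times> nat"
    obtain l n where x: "x = (l, n)" by (cases x)
    show "fps_has_sum (\<lambda>r. f (x, r)) (case x of (l, n) \<Rightarrow> fps_const (1 / real (Suc l)) * (rising g 0 l * (?phi n * inv_rising n (Suc (Suc l))))) UNIV"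
      using fps_has_sum_mult[OF rising_sum[OF c, of "Suc l" n], of "?k l"]
      by (simp add: x f_def mult_ac del: of_nat_Suc)
  qed
  then have "fps_has_sum (\<lambda>i. f ((\<lambda>((l, r), n). ((l, n), r)) i)) S (Sigma UNIV (\<lambda>_. UNIV))"
    by (rule fps_has_sum_reindex[rotated]) (auto intro!: bij_betwI[where g = "\<lambda>((l, n), r). ((l, r), n)"])
  then have lr: "fps_has_sum (\<lambda>(l, r). ?k l * rising c (Suc l) r * (fps_const (1 / real (Suc (Suc l + r))) * inv_rising 0 (Suc (Suc l + r)))) S UNIV"
  proof (rule fps_has_sum_SigmaD)
    fix x :: "nat \<times> nat"
    obtain l r where x: "x = (l, r)" by (cases x)
    show "fps_has_sum (\<lambda>n. f ((\<lambda>((l, r), n). ((l, n), r)) (x, n)))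
        (case x of (l, r) \<Rightarrow> ?k l * rising c (Suc l) r * (fps_const (1 / real (Suc (Suc l + r))) * inv_rising 0 (Suc (Suc l + r)))) UNIV"
      using fps_has_sum_mult[OF inv_rising_sum[of 0 "Suc l + r"], of "?k l * rising c (Suc l) r"]
      by (simp add: x f_def mult.assoc del: of_nat_Suc)
  qed
  have "fps_has_sum (\<lambda>i. (\<lambda>(l, r). ?k l * rising c (Suc l) r * (fps_const (1 / real (Suc (Suc l + r))) * inv_rising 0 (Suc (Suc l + r))))
      ((\<lambda>(m, l). (l, m - Suc l)) i)) S (SIGMA m:UNIV. {..<m})"
  proof (rule fps_has_sum_reindex[OF _ lr])
    show "bij_betw (\<lambda>(m, l). (l, m - Suc l)) (SIGMA m:UNIV. {..<m}) UNIV"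
      by (rule bij_betwI[where g = "\<lambda>(l, r). (Suc l + r, l)"]) auto
  qed
  then show ?thesis
  proof (rule fps_has_sum_SigmaD)
    fix m :: nat
    let ?F = "\<lambda>l. fps_const (1 / real (Suc l) * (1 / real (Suc m))) * (rising g 0 l * rising c (Suc l) (m - Suc l) * inv_rising 0 (Suc m))"
    have "(\<lambda>(l, r). ?k l * rising c (Suc l) r * (fps_const (1 / real (Suc (Suc l + r))) * inv_rising 0 (Suc (Suc l + r))))
      ((\<lambda>(m, l). (l, m - Suc l)) (m, l)) = ?F l" if "l \<in> {..<m}" for l
    proof -
      have "Suc l + (m - Suc l) = m" using that by simp
      moreover have "fps_const (1 / real (Suc l) * (1 / real (Suc m))) = fps_const (1 / real (Suc l)) * fps_const (1 / real (Suc m))"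
        by (simp del: of_nat_Suc)
      ultimately show ?thesis by (simp only: prod.case ac_simps)
    qed
    then show "fps_has_sum (\<lambda>l. (\<lambda>(l, r). ?k l * rising c (Suc l) r * (fps_const (1 / real (Suc (Suc l + r))) * inv_rising 0 (Suc (Suc l + r))))
      ((\<lambda>(m, l). (l, m - Suc l)) (m, l))) (\<Sum>l<m. ?F l) {..<m}"
      using fps_has_sum_finite[of "{..<m}" ?F] by (subst fps_has_sum_cong[where G = ?F]) auto
  qed
qed

section \<open>Splitting off the harmonic sums of ones\<close>

definition star_ones :: "nat \<Rightarrow> nat \<Rightarrow> real"
  where "star_ones t m = msum_star (reciprocals (Suc m)) (replicate t 1)"

lemma star_ones_0 [simp]: "star_ones 0 m = 1"
  by (simp add: star_ones_def)

lemma star_ones_Suc_0: "star_ones (Suc t) 0 = 0"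
  by (simp add: star_ones_def reciprocals_1)

lemma star_ones_Suc: "star_ones (Suc t) (Suc m) = star_ones (Suc t) m + star_ones t (Suc m) / real (Suc m)"
  by (simp add: star_ones_def reciprocals_Suc del: of_nat_Suc)

lemma star_ones_nonneg: "star_ones t m \<ge> 0"
proof (induction t arbitrary: m)
  case (Suc t)
  show ?case by (induction m) (auto simp: star_ones_Suc_0 star_ones_Suc Suc.IH)
qed simp

definition mixed_sum :: "nat \<Rightarrow> nat list \<Rightarrow> nat \<Rightarrow> nat \<Rightarrow> real"
  where "mixed_sum d ts t N = (\<Sum>m<N. mhs ts m / real (Suc m) ^ d * star_ones t (Suc m))"

definition ones_gf :: "real \<Rightarrow> nat \<Rightarrow> real fps"
  where "ones_gf s N = Abs_fps (\<lambda>c. s ^ c * mhs (replicate c 1) N)"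

definition star_ones_gf :: "real \<Rightarrow> nat \<Rightarrow> real fps"
  where "star_ones_gf s N = Abs_fps (\<lambda>t. s ^ t * star_ones t N)"

definition mixed_gf :: "real \<Rightarrow> nat \<Rightarrow> nat list \<Rightarrow> nat \<Rightarrow> real fps"
  where "mixed_gf s d ts N = Abs_fps (\<lambda>t. s ^ t * mixed_sum d ts t N)"

lemma ones_gf_0: "ones_gf s 0 = 1"
proof (rule fps_ext)
  fix n show "fps_nth (ones_gf s 0) n = fps_nth 1 n"
    by (cases n) (simp_all add: ones_gf_def mhs_0)
qed

lemma ones_gf_Suc: "ones_gf s (Suc N) = (1 + fps_const (s / real (Suc N)) * fps_X) * ones_gf s N"
proof (rule fps_ext)
  fix n show "fps_nth (ones_gf s (Suc N)) n = fps_nth ((1 + fps_const (s / real (Suc N)) * fps_X) * ones_gf s N) n"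
    by (cases n) (simp_all add: ones_gf_def mhs_Suc distrib_right distrib_left mult.assoc del: of_nat_Suc)
qed

lemma star_ones_gf_0: "star_ones_gf s 0 = 1"
proof (rule fps_ext)
  fix n show "fps_nth (star_ones_gf s 0) n = fps_nth 1 n"
    by (cases n) (simp_all add: star_ones_gf_def star_ones_Suc_0)
qed

lemma star_ones_gf_Suc:
  "(1 + fps_const (- s / real (Suc N)) * fps_X) * star_ones_gf s (Suc N) = star_ones_gf s N"
proof (rule fps_ext)
  fix n show "fps_nth ((1 + fps_const (- s / real (Suc N)) * fps_X) * star_ones_gf s (Suc N)) n = fps_nth (star_ones_gf s N) n"
    by (cases n) (simp_all add: star_ones_gf_def star_ones_Suc distrib_right distrib_left mult.assoc del: of_nat_Suc)
qed

lemma ones_gf_star: "ones_gf s N * star_ones_gf (- s) N = 1"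
proof (induction N)
  case (Suc N)
  have "ones_gf s (Suc N) * star_ones_gf (- s) (Suc N)
      = ones_gf s N * ((1 + fps_const (- (- s) / real (Suc N)) * fps_X) * star_ones_gf (- s) (Suc N))"
    unfolding ones_gf_Suc minus_minus by (simp only: ac_simps)
  then show ?case using Suc.IH by (simp only: star_ones_gf_Suc)
qed (simp add: ones_gf_0 star_ones_gf_0)

lemma mixed_gf_Suc:
  "mixed_gf s d ts (Suc N) = mixed_gf s d ts N + fps_const (mhs ts N / real (Suc N) ^ d) * star_ones_gf s (Suc N)"
  by (rule fps_ext) (simp add: mixed_gf_def mixed_sum_def star_ones_gf_def distrib_left mult_ac)

text \<open>The ones in front of \<open>d\<close> use denominators above the variable of
  \<open>d\<close>, so their generating function is a quotient of two values of
  \<open>ones_gf\<close>. Its numerator no longer depends on that variable and factors out; the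
  inverse of its denominator is a generating function of star sums of ones. All growth caused by
  leading ones is thereby confined to \<open>ones_gf s N\<close>.\<close>

lemma mhs_ones_gf:
  "Abs_fps (\<lambda>j. s ^ j * mhs (replicate j 1 @ d # ts) N) = ones_gf s N * mixed_gf (- s) d ts N"
proof (induction N)
  case 0
  have "mhs (replicate j 1 @ d # ts) 0 = 0" for j by (cases j) (simp_all add: mhs_0)
  then show ?case by (intro fps_ext) (simp add: mixed_gf_def mixed_sum_def fps_mult_nth)
next
  case (Suc N)
  let ?M = "\<lambda>N. Abs_fps (\<lambda>j. s ^ j * mhs (replicate j 1 @ d # ts) N)"
  let ?u = "1 + fps_const (s / real (Suc N)) * fps_X"
  let ?k = "fps_const (mhs ts N / real (Suc N) ^ d)"
  have "?M (Suc N) = ?u * ?M N + ?k"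
  proof (rule fps_ext)
    fix n show "fps_nth (?M (Suc N)) n = fps_nth (?u * ?M N + ?k) n"
      by (cases n) (simp_all add: mhs_Suc distrib_right distrib_left mult.assoc del: of_nat_Suc)
  qed
  also have "\<dots> = ?u * (ones_gf s N * mixed_gf (- s) d ts N) + ?k * (ones_gf s (Suc N) * star_ones_gf (- s) (Suc N))"
    by (simp only: Suc.IH ones_gf_star mult_1_right)
  also have "\<dots> = ones_gf s (Suc N) * mixed_gf (- s) d ts (Suc N)"
    unfolding mixed_gf_Suc ones_gf_Suc by (simp only: algebra_simps)
  finally show ?case .
qed

section \<open>From Pochhammer quotients to sums of ones\<close>

lemma rising_ones_gf: "rising g 0 m = fps_const (fact m) * ones_gf g m"
proof (induction m)
  case (Suc m)
  have "fps_const (real (Suc m)) + fps_const g * fps_X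
      = fps_const (real (Suc m)) * (1 + fps_const (g / real (Suc m)) * fps_X)"
    by (simp add: distrib_left flip: mult.assoc del: of_nat_Suc)
  then have "rising g 0 (Suc m) = (fps_const (fact m) * ones_gf g m) * (fps_const (real (Suc m)) * (1 + fps_const (g / real (Suc m)) * fps_X))"
    by (simp only: rising_Suc Suc.IH add_0)
  also have "\<dots> = (fps_const (fact m) * fps_const (real (Suc m))) * ones_gf g (Suc m)"
    unfolding ones_gf_Suc by (simp only: ac_simps)
  also have "fps_const (fact m) * fps_const (real (Suc m)) = fps_const (fact (Suc m))"
    by (simp add: mult.commute)
  finally show ?case .
qed (simp add: rising_0 ones_gf_0)

lemma inv_rising_star_ones_gf: "fps_const (fact m) * inv_rising 0 m = star_ones_gf 1 m"
proof (induction m)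
  case (Suc m)
  let ?c = "fps_const (real (Suc m))" and ?g = "geom (real (Suc m)) 1"
  let ?u = "1 + fps_const (- 1 / real (Suc m)) * fps_X"
  have u: "?c * ?u = fps_const (real (Suc m)) - fps_const 1 * fps_X"
    unfolding distrib_left mult.assoc[symmetric] fps_const_mult by (simp flip: fps_const_neg del: of_nat_Suc)
  have "fps_const (fact (Suc m)) = ?c * (fps_const (fact m) :: real fps)" by simp
  then have "fps_const (fact (Suc m)) * inv_rising 0 (Suc m) = ?c * ?g * (fps_const (fact m) * inv_rising 0 m)"
    by (simp only: inv_rising_Suc add_0 ac_simps)
  also have "\<dots> = (?c * ?u * ?g) * star_ones_gf 1 (Suc m)"
    unfolding Suc.IH star_ones_gf_Suc[of 1 m, symmetric] by (simp only: ac_simps)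
  also have "\<dots> = star_ones_gf 1 (Suc m)"
    unfolding u using geom_inverse[of "real (Suc m)" 1] by simp
  finally show ?case .
qed (simp add: inv_rising_0 star_ones_gf_0)

definition two_gf :: "real \<Rightarrow> real \<Rightarrow> nat \<Rightarrow> real fps"
  where "two_gf c g m = Abs_fps (\<lambda>k. \<Sum>h\<le>k. c ^ h * g ^ (k - h) * mhs (replicate h 1 @ 2 # replicate (k - h) 1) m)"

lemma two_gf_Suc:
  "two_gf c g (Suc m) = (1 + fps_const (c / real (Suc m)) * fps_X) * two_gf c g m
    + fps_const (1 / real (Suc m) ^ 2) * ones_gf g m"
proof (rule fps_ext)
  fix k
  show "fps_nth (two_gf c g (Suc m)) k = fps_nth ((1 + fps_const (c / real (Suc m)) * fps_X) * two_gf c g m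
    + fps_const (1 / real (Suc m) ^ 2) * ones_gf g m) k"
  proof (cases k)
    case 0
    then show ?thesis by (simp add: two_gf_def ones_gf_def mhs_Suc)
  next
    case (Suc n)
    have "fps_nth (two_gf c g (Suc m)) k
      = (\<Sum>h\<le>k. c ^ h * g ^ (k - h) * mhs (replicate h 1 @ 2 # replicate (k - h) 1) m)
      + (\<Sum>h\<le>k. c ^ h * g ^ (k - h) * (case h of 0 \<Rightarrow> mhs (replicate k 1) m / real (Suc m) ^ 2
          | Suc h' \<Rightarrow> mhs (replicate h' 1 @ 2 # replicate (k - h) 1) m / real (Suc m)))"
      unfolding two_gf_def fps_nth_Abs_fps sum.distrib[symmetric]
      by (intro sum.cong refl) (auto simp: mhs_Suc distrib_left split: nat.split simp del: of_nat_Suc)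
    also have "(\<Sum>h\<le>k. c ^ h * g ^ (k - h) * (case h of 0 \<Rightarrow> mhs (replicate k 1) m / real (Suc m) ^ 2
          | Suc h' \<Rightarrow> mhs (replicate h' 1 @ 2 # replicate (k - h) 1) m / real (Suc m)))
      = g ^ k * mhs (replicate k 1) m / real (Suc m) ^ 2
        + c / real (Suc m) * (\<Sum>h\<le>n. c ^ h * g ^ (n - h) * mhs (replicate h 1 @ 2 # replicate (n - h) 1) m)"
      unfolding Suc by (simp add: sum.atMost_Suc_shift sum_distrib_left mult_ac del: of_nat_Suc sum.atMost_Suc replicate_Suc power_Suc, simp add: mult_ac del: of_nat_Suc)
    finally show ?thesis
      by (simp add: two_gf_def ones_gf_def distrib_right mult.assoc Suc del: of_nat_Suc sum.atMost_Suc replicate_Suc power_Suc)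
  qed
qed

text \<open>After division by m! the missing factor l + 1, together with the given 1/(l + 1),
  becomes 1/(l + 1)^2. The factors below it generate ones weighted by \<open>g\<close> behind the
  entry 2, those above it ones weighted by \<open>c\<close> in front.\<close>

lemma rising_two_gf:
  "(\<Sum>l<m. fps_const (1 / real (Suc l)) * (rising g 0 l * rising c (Suc l) (m - Suc l))) = fps_const (fact m) * two_gf c g m"
proof (induction m)
  case 0
  have "two_gf c g 0 = 0"
  proof (rule fps_ext)
    fix n
    have "mhs (replicate h 1 @ 2 # replicate i 1) 0 = 0" for h i by (cases h) (simp_all add: mhs_0)
    then show "fps_nth (two_gf c g 0) n = fps_nth 0 n" by (simp add: two_gf_def)
  qed
  then show ?case by simp
next
  case (Suc m)
  let ?f = "\<lambda>m l. fps_const (1 / real (Suc l)) * (rising g 0 l * rising c (Suc l) (m - Suc l))"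
  let ?u = "fps_const (real (Suc m)) + fps_const c * fps_X"
  have u: "?u = fps_const (real (Suc m)) * (1 + fps_const (c / real (Suc m)) * fps_X)"
    by (simp add: distrib_left flip: mult.assoc del: of_nat_Suc)
  have "(\<Sum>l<m. ?f (Suc m) l) = (\<Sum>l<m. ?u * ?f m l)"
  proof (rule sum.cong[OF refl])
    fix l assume "l \<in> {..<m}"
    then have "Suc m - Suc l = Suc (m - Suc l)" "Suc (Suc l + (m - Suc l)) = Suc m" by auto
    then show "?f (Suc m) l = ?u * ?f m l" by (simp only: rising_Suc ac_simps)
  qed
  moreover have "?f (Suc m) m = fps_const (1 / real (Suc m)) * (fps_const (fact m) * ones_gf g m)"
    by (simp only: rising_ones_gf[symmetric] diff_self_eq_0 rising_0 mult_1_right)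
  ultimately have "(\<Sum>l<Suc m. ?f (Suc m) l) = ?u * (fps_const (fact m) * two_gf c g m)
      + fps_const (1 / real (Suc m)) * (fps_const (fact m) * ones_gf g m)"
    by (simp only: sum.lessThan_Suc Suc.IH sum_distrib_left[symmetric])
  also have "fps_const (1 / real (Suc m)) = fps_const (real (Suc m)) * fps_const (1 / real (Suc m) ^ 2)"
    by (simp add: power2_eq_square del: of_nat_Suc)
  also have "?u * (fps_const (fact m) * two_gf c g m)
      + fps_const (real (Suc m)) * fps_const (1 / real (Suc m) ^ 2) * (fps_const (fact m) * ones_gf g m)
    = fps_const (real (Suc m)) * fps_const (fact m) * two_gf c g (Suc m)"
    unfolding two_gf_Suc u by (simp only: algebra_simps)
  also have "fps_const (real (Suc m)) * fps_const (fact m) = (fps_const (fact (Suc m)) :: real fps)"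
    by simp
  finally show ?case .
qed

lemma fps_const_divide_fact:
  "fps_const (1 / real (Suc l)) * (fps_const (fact l) * x) * inv_rising 0 (Suc l)
    = fps_const (1 / real (Suc l) ^ 2) * (x * star_ones_gf 1 (Suc l))"
proof -
  have "fps_const (1 / real (Suc l)) * fps_const (fact l) = fps_const (1 / real (Suc l) ^ 2) * fps_const (fact (Suc l))"
    by (simp add: power2_eq_square del: of_nat_Suc)
  then have "fps_const (1 / real (Suc l)) * fps_const (fact l) * (x * inv_rising 0 (Suc l))
      = fps_const (1 / real (Suc l) ^ 2) * fps_const (fact (Suc l)) * (x * inv_rising 0 (Suc l))" by (simp only:)
  then show ?thesis
    unfolding inv_rising_star_ones_gf[symmetric] by (simp only: ac_simps)
qed

lemma fps_nth_const_mult_mult: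
  "fps_nth (fps_const (x::real) * (F * G)) k = (\<Sum>i\<le>k. x * (fps_nth F i * fps_nth G (k - i)))"
  by (simp only: fps_mult_left_const_nth fps_mult_nth[of F G] atLeast0AtMost sum_distrib_left)

text \<open>The rearranged partial sums are polynomials in the auxiliary parameter \<open>g\<close>
  with mixed sums as coefficients. Varying \<open>g\<close> therefore separates the mixed
  sums.\<close>

lemma rearranged_single_nth:
  "(\<Sum>l<N. fps_nth (fps_const (1 / real (Suc l)) * (rising g 0 l * inv_rising 0 (Suc l))) k)
    = (\<Sum>i\<le>k. g ^ i * mixed_sum 2 (replicate i 1) (k - i) N)"
proof -
  have "fps_nth (fps_const (1 / real (Suc l)) * (rising g 0 l * inv_rising 0 (Suc l))) k
      = (\<Sum>i\<le>k. g ^ i * (mhs (replicate i 1) l / real (Suc l) ^ 2 * star_ones (k - i) (Suc l)))" for l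
    unfolding rising_ones_gf mult.assoc[of _ _ "inv_rising _ _", symmetric] fps_const_divide_fact
    unfolding fps_nth_const_mult_mult by (simp add: ones_gf_def star_ones_gf_def mult.assoc del: of_nat_Suc)
  then show ?thesis unfolding mixed_sum_def sum_distrib_left by (simp only: sum.swap[of _ "{..<N}"])
qed

lemma rearranged_double_1_nth:
  "(\<Sum>l<N. fps_nth (fps_const (1 / real (Suc l) ^ 2) * (rising g 0 l * inv_rising 0 (Suc l))) k)
    = (\<Sum>i\<le>k. g ^ i * mixed_sum 3 (replicate i 1) (k - i) N)"
proof -
  have "fps_nth (fps_const (1 / real (Suc l) ^ 2) * (rising g 0 l * inv_rising 0 (Suc l))) k
      = (\<Sum>i\<le>k. g ^ i * (mhs (replicate i 1) l / real (Suc l) ^ 3 * star_ones (k - i) (Suc l)))" for l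
  proof -
    have "fps_const (1 / real (Suc l) ^ 2) * (rising g 0 l * inv_rising 0 (Suc l))
        = fps_const (1 / real (Suc l)) * (fps_const (1 / real (Suc l)) * (fps_const (fact l) * ones_gf g l) * inv_rising 0 (Suc l))"
    proof -
      have "fps_const (1 / real (Suc l) ^ 2) = fps_const (1 / real (Suc l)) * fps_const (1 / real (Suc l))"
        by (simp add: power2_eq_square del: of_nat_Suc)
      then show ?thesis by (simp only: rising_ones_gf mult.assoc)
    qed
    also have "\<dots> = fps_const (1 / real (Suc l) ^ 3) * (ones_gf g l * star_ones_gf 1 (Suc l))"
      unfolding fps_const_divide_fact
      by (simp add: power2_eq_square power3_eq_cube flip: mult.assoc del: of_nat_Suc)
    finally have eq: "fps_const (1 / real (Suc l) ^ 2) * (rising g 0 l * inv_rising 0 (Suc l))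
        = fps_const (1 / real (Suc l) ^ 3) * (ones_gf g l * star_ones_gf 1 (Suc l))" .
    show ?thesis
      unfolding eq fps_nth_const_mult_mult by (simp add: ones_gf_def star_ones_gf_def mult.assoc del: of_nat_Suc)
  qed
  then show ?thesis unfolding mixed_sum_def sum_distrib_left by (simp only: sum.swap[of _ "{..<N}"])
qed

lemma rearranged_double_2_nth:
  "(\<Sum>m<N. fps_nth (\<Sum>l<m. fps_const (1 / real (Suc l) * (1 / real (Suc m)))
      * (rising g 0 l * rising c (Suc l) (m - Suc l) * inv_rising 0 (Suc m))) k)
    = (\<Sum>h\<le>k. c ^ h * (\<Sum>i\<le>k - h. g ^ i * mixed_sum 2 (replicate h 1 @ 2 # replicate i 1) (k - h - i) N))"
proof -
  let ?M = "\<lambda>h i m. mhs (replicate h 1 @ 2 # replicate i 1) m"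
  have "fps_nth (\<Sum>l<m. fps_const (1 / real (Suc l) * (1 / real (Suc m)))
      * (rising g 0 l * rising c (Suc l) (m - Suc l) * inv_rising 0 (Suc m))) k
    = (\<Sum>h\<le>k. c ^ h * (\<Sum>i\<le>k - h. g ^ i * (?M h i m / real (Suc m) ^ 2 * star_ones (k - h - i) (Suc m))))" for m
  proof -
    have "(\<Sum>l<m. fps_const (1 / real (Suc l) * (1 / real (Suc m)))
        * (rising g 0 l * rising c (Suc l) (m - Suc l) * inv_rising 0 (Suc m)))
      = fps_const (1 / real (Suc m)) * (\<Sum>l<m. fps_const (1 / real (Suc l)) * (rising g 0 l * rising c (Suc l) (m - Suc l))) * inv_rising 0 (Suc m)"
      unfolding sum_distrib_left sum_distrib_right
      by (rule sum.cong[OF refl]) (simp only: fps_const_mult[symmetric] ac_simps)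
    also have "\<dots> = fps_const (1 / real (Suc m) ^ 2) * (two_gf c g m * star_ones_gf 1 (Suc m))"
      unfolding rising_two_gf by (rule fps_const_divide_fact)
    finally have eq: "(\<Sum>l<m. fps_const (1 / real (Suc l) * (1 / real (Suc m)))
        * (rising g 0 l * rising c (Suc l) (m - Suc l) * inv_rising 0 (Suc m)))
      = fps_const (1 / real (Suc m) ^ 2) * (two_gf c g m * star_ones_gf 1 (Suc m))" .
    have "fps_nth (\<Sum>l<m. fps_const (1 / real (Suc l) * (1 / real (Suc m)))
        * (rising g 0 l * rising c (Suc l) (m - Suc l) * inv_rising 0 (Suc m))) k
      = (\<Sum>n\<le>k. \<Sum>h\<le>n. c ^ h * (g ^ (n - h) * (?M h (n - h) m / real (Suc m) ^ 2 * star_ones (k - n) (Suc m))))"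
      unfolding eq fps_nth_const_mult_mult
      by (simp add: two_gf_def star_ones_gf_def sum_distrib_right sum_divide_distrib mult.assoc del: of_nat_Suc)
    also have "\<dots> = (\<Sum>(n, h)\<in>(SIGMA n:{..k}. {..n}). c ^ h * (g ^ (n - h) * (?M h (n - h) m / real (Suc m) ^ 2 * star_ones (k - n) (Suc m))))"
      by (rule sum.Sigma) auto
    also have "\<dots> = (\<Sum>(h, i)\<in>(SIGMA h:{..k}. {..k - h}). c ^ h * (g ^ i * (?M h i m / real (Suc m) ^ 2 * star_ones (k - h - i) (Suc m))))"
      by (rule sum.reindex_bij_witness[of _ "\<lambda>(h, i). (h + i, h)" "\<lambda>(n, h). (h, n - h)"]) auto
    also have "\<dots> = (\<Sum>h\<le>k. \<Sum>i\<le>k - h. c ^ h * (g ^ i * (?M h i m / real (Suc m) ^ 2 * star_ones (k - h - i) (Suc m))))"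
      by (rule sum.Sigma[symmetric]) auto
    finally show ?thesis by (simp only: sum_distrib_left)
  qed
  then show ?thesis unfolding mixed_sum_def sum_distrib_left
    by (simp only: sum.swap[of _ "{..<N}"])
qed

section \<open>Limits of the mixed sums\<close>

lemma incseq_mixed_sum: "incseq (mixed_sum d ts t)"
  unfolding mixed_sum_def incseq_def
  by (intro allI impI sum_mono2) (auto intro!: mult_nonneg_nonneg divide_nonneg_nonneg mhs_nonneg star_ones_nonneg)

lemma mixed_sum_nonneg: "mixed_sum d ts t N \<ge> 0"
  unfolding mixed_sum_def by (intro sum_nonneg mult_nonneg_nonneg divide_nonneg_nonneg mhs_nonneg star_ones_nonneg) auto

text \<open>Convergence at \<open>n = 1\<close> bounds the sum of the nonnegative coefficients, so
  each of these monotone sequences converges; interpolation then places the limits in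
  \<open>V\<close>.\<close>

lemma polynomial_limit_coeffs:
  fixes f :: "nat \<Rightarrow> nat \<Rightarrow> real"
  assumes V: "rat_vector.subspace V"
    and inc: "\<And>i. i \<le> d \<Longrightarrow> incseq (f i)" and nonneg: "\<And>i N. i \<le> d \<Longrightarrow> f i N \<ge> 0"
    and lim: "\<And>n::nat. \<exists>s\<in>V. (\<lambda>N. \<Sum>i\<le>d. real n ^ i * f i N) \<longlonglongrightarrow> s" and "i \<le> d"
  shows "\<exists>L\<in>V. f i \<longlonglongrightarrow> L"
proof -
  obtain B where B: "(\<lambda>N. \<Sum>i\<le>d. f i N) \<longlonglongrightarrow> B" using lim[of 1] by auto
  have "incseq (\<lambda>N. \<Sum>i\<le>d. f i N)" using inc by (auto simp: incseq_def intro!: sum_mono)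
  then have bound: "(\<Sum>i\<le>d. f i N) \<le> B" for N using incseq_le[OF _ B] by blast
  have "\<exists>L. f j \<longlonglongrightarrow> L" if "j \<le> d" for j
  proof -
    have "f j N \<le> B" for N
    proof -
      have "f j N \<le> (\<Sum>i\<le>d. f i N)" using that nonneg by (intro member_le_sum) auto
      then show ?thesis using bound[of N] by linarith
    qed
    then show ?thesis using incseq_convergent[OF inc[OF that]] by metis
  qed
  then obtain c where c: "\<And>j. j \<le> d \<Longrightarrow> f j \<longlonglongrightarrow> c j" by metis
  have "(\<Sum>j\<le>d. of_nat n ^ j * c j) \<in> V" for n
  proof -
    obtain s where s: "s \<in> V" "(\<lambda>N. \<Sum>i\<le>d. real n ^ i * f i N) \<longlonglongrightarrow> s" using lim by blast
    have "(\<lambda>N. \<Sum>i\<le>d. real n ^ i * f i N) \<longlonglongrightarrow> (\<Sum>j\<le>d. real n ^ j * c j)"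
      by (intro tendsto_sum tendsto_mult tendsto_const c) auto
    with s show ?thesis using LIMSEQ_unique by metis
  qed
  then have "c i \<in> V" using subspace_polynomial_coeffs[OF V] \<open>i \<le> d\<close> by blast
  with c \<open>i \<le> d\<close> show ?thesis by blast
qed

section \<open>Zeta values as sums of the series to be rearranged\<close>

lemma has_sum_zeta_single:
  assumes "k \<ge> 2" shows "((\<lambda>n. 1 / real (Suc n) ^ k) has_sum zeta_reg [k]) UNIV"
proof (rule sums_nonneg_imp_has_sum)
  have "admissible [k]" using assms by (simp add: admissible_def is_index_def)
  then have "mhs [k] \<longlonglongrightarrow> zeta_reg [k]"
    using mhs_tendsto_admissible[of "[k]"] by (simp add: zeta_reg_mzv mzv_eq)
  then show "(\<lambda>n. 1 / real (Suc n) ^ k) sums zeta_reg [k]"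
    unfolding sums_def by (simp add: mhs_Cons[abs_def] del: of_nat_Suc)
qed simp

lemma has_sum_zeta_double:
  assumes "a \<ge> 2" "b \<ge> 1"
  shows "((\<lambda>(q, n). 1 / (real (Suc q) ^ a * real (Suc n) ^ b)) has_sum zeta_reg [a, b]) (SIGMA q:UNIV. {..<q})"
proof -
  let ?f = "\<lambda>q. \<Sum>n<q. 1 / (real (Suc q) ^ a * real (Suc n) ^ b)"
  have "(?f has_sum zeta_reg [a, b]) UNIV"
  proof (rule sums_nonneg_imp_has_sum)
    have "admissible [a, b]" using assms by (simp add: admissible_def is_index_def)
    then have "mhs [a, b] \<longlonglongrightarrow> zeta_reg [a, b]"
      using mhs_tendsto_admissible[of "[a, b]"] by (simp add: zeta_reg_mzv mzv_eq)
    then show "?f sums zeta_reg [a, b]" unfolding sums_def by (simp add: mhs_pair[abs_def])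
  qed (auto intro!: sum_nonneg)
  moreover have "((\<lambda>n. 1 / (real (Suc q) ^ a * real (Suc n) ^ b)) has_sum ?f q) {..<q}" for q
    by (rule has_sum_finiteI) auto
  ultimately show ?thesis
    by (intro has_sum_SigmaI[where g = ?f] summable_on_SigmaI[where g = ?f]) (auto simp: summable_on_def)
qed

lemma has_sum_zeta_double_sum:
  assumes "\<And>j. j \<in> J \<Longrightarrow> a j \<ge> 2 \<and> b j \<ge> 1" "finite J"
  shows "((\<lambda>(q, n). \<Sum>j\<in>J. w j * (1 / (real (Suc q) ^ a j * real (Suc n) ^ b j)))
    has_sum (\<Sum>j\<in>J. w j * zeta_reg [a j, b j])) (SIGMA q:UNIV. {..<q})"
  using assms(2,1)
proof (induction J)
  case (insert j J)
  have "((\<lambda>x. w j * (case x of (q, n) \<Rightarrow> 1 / (real (Suc q) ^ a j * real (Suc n) ^ b j))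
      + (case x of (q, n) \<Rightarrow> \<Sum>j\<in>J. w j * (1 / (real (Suc q) ^ a j * real (Suc n) ^ b j))))
    has_sum (w j * zeta_reg [a j, b j] + (\<Sum>j\<in>J. w j * zeta_reg [a j, b j]))) (SIGMA q:UNIV. {..<q})"
    using insert by (intro has_sum_add has_sum_cmult_right has_sum_zeta_double) auto
  moreover have "(\<lambda>x. w j * (case x of (q, n) \<Rightarrow> 1 / (real (Suc q) ^ a j * real (Suc n) ^ b j))
      + (case x of (q, n) \<Rightarrow> \<Sum>j\<in>J. w j * (1 / (real (Suc q) ^ a j * real (Suc n) ^ b j))))
    = (\<lambda>(q, n). \<Sum>j\<in>insert j J. w j * (1 / (real (Suc q) ^ a j * real (Suc n) ^ b j)))"
    using insert by (auto simp: fun_eq_iff simp del: of_nat_Suc)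
  ultimately show ?case using insert by simp
qed (simp add: case_prod_unfold)

definition geom_sum :: "nat \<Rightarrow> nat \<Rightarrow> nat"
  where "geom_sum g k = (\<Sum>i\<le>k. (1 + g) ^ i)"

lemma fps_nth_geom2_nat: "m \<noteq> 0 \<Longrightarrow> fps_nth (geom2 m (real g)) k = real (geom_sum g k) / m ^ (k + 2)"
  by (simp add: fps_nth_geom2 geom_sum_def)

lemma fps_has_sum_single:
  "fps_has_sum (\<lambda>n. geom2 (real (Suc n)) (real g)) (Abs_fps (\<lambda>k. real (geom_sum g k) * zeta_reg [k + 2])) UNIV"
  unfolding fps_has_sum_def
proof
  fix k
  have "((\<lambda>n. real (geom_sum g k) * (1 / real (Suc n) ^ (k + 2))) has_sum real (geom_sum g k) * zeta_reg [k + 2]) UNIV"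
    by (intro has_sum_cmult_right has_sum_zeta_single) simp
  then show "((\<lambda>n. fps_nth (geom2 (real (Suc n)) (real g)) k)
      has_sum fps_nth (Abs_fps (\<lambda>k. real (geom_sum g k) * zeta_reg [k + 2])) k) UNIV"
    by (simp add: fps_nth_geom2_nat del: of_nat_Suc power_Suc)
qed

lemma fps_has_sum_double_1:
  "fps_has_sum (\<lambda>(q, n). geom (real (Suc n)) 1 * geom2 (real (Suc q)) (real g))
    (Abs_fps (\<lambda>k. \<Sum>j\<le>k. real (geom_sum g (k - j)) * zeta_reg [k - j + 2, j + 1])) (SIGMA q:UNIV. {..<q})"
  unfolding fps_has_sum_def
proof
  fix k
  have "fps_nth (geom (real (Suc n)) 1 * geom2 (real (Suc q)) (real g)) k
      = (\<Sum>j\<le>k. real (geom_sum g (k - j)) * (1 / (real (Suc q) ^ (k - j + 2) * real (Suc n) ^ (j + 1))))" for n q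
    unfolding fps_mult_nth by (simp add: fps_nth_geom2_nat geom_def atLeast0AtMost mult_ac del: of_nat_Suc)
  then show "((\<lambda>i. fps_nth (case i of (q, n) \<Rightarrow> geom (real (Suc n)) 1 * geom2 (real (Suc q)) (real g)) k)
      has_sum fps_nth (Abs_fps (\<lambda>k. \<Sum>j\<le>k. real (geom_sum g (k - j)) * zeta_reg [k - j + 2, j + 1])) k) (SIGMA q:UNIV. {..<q})"
    using has_sum_zeta_double_sum[of "{..k}" "\<lambda>j. k - j + 2" "\<lambda>j. j + 1" "\<lambda>j. real (geom_sum g (k - j))"]
    by (simp add: case_prod_unfold)
qed

lemma fps_has_sum_double_2:
  "fps_has_sum (\<lambda>(q, n). geom2 (real (Suc n)) (real c) * geom2 (real (Suc q)) (real g))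
    (Abs_fps (\<lambda>k. \<Sum>j\<le>k. real (geom_sum c j * geom_sum g (k - j)) * zeta_reg [k - j + 2, j + 2])) (SIGMA q:UNIV. {..<q})"
  unfolding fps_has_sum_def
proof
  fix k
  have "fps_nth (geom2 (real (Suc n)) (real c) * geom2 (real (Suc q)) (real g)) k
      = (\<Sum>j\<le>k. real (geom_sum c j * geom_sum g (k - j)) * (1 / (real (Suc q) ^ (k - j + 2) * real (Suc n) ^ (j + 2))))" for n q
    unfolding fps_mult_nth by (simp add: fps_nth_geom2_nat atLeast0AtMost mult_ac del: of_nat_Suc)
  then show "((\<lambda>i. fps_nth (case i of (q, n) \<Rightarrow> geom2 (real (Suc n)) (real c) * geom2 (real (Suc q)) (real g)) k)
      has_sum fps_nth (Abs_fps (\<lambda>k. \<Sum>j\<le>k. real (geom_sum c j * geom_sum g (k - j)) * zeta_reg [k - j + 2, j + 2])) k) (SIGMA q:UNIV. {..<q})"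
    using has_sum_zeta_double_sum[of "{..k}" "\<lambda>j. k - j + 2" "\<lambda>j. j + 2" "\<lambda>j. real (geom_sum c j * geom_sum g (k - j))"]
    by (simp add: case_prod_unfold)
qed

lemma fps_has_sum_partial_sums:
  assumes "fps_has_sum F S UNIV" shows "(\<lambda>N. \<Sum>l<N. fps_nth (F l) k) \<longlonglongrightarrow> fps_nth S k"
  using assms has_sum_imp_sums[of "\<lambda>l. fps_nth (F l) k"] unfolding fps_has_sum_def sums_def by blast

lemma mixed_sum_2_limit:
  assumes V: "rat_vector.subspace V" "zeta_reg [i + t + 2] \<in> V"
  shows "\<exists>L\<in>V. mixed_sum 2 (replicate i 1) t \<longlonglongrightarrow> L"
proof -
  let ?k = "i + t"
  have "\<exists>s\<in>V. (\<lambda>N. \<Sum>j\<le>?k. real g ^ j * mixed_sum 2 (replicate j 1) (?k - j) N) \<longlonglongrightarrow> s" for g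
    using fps_has_sum_partial_sums[OF rearrange_single[OF _ fps_has_sum_single[of g]], of ?k]
    unfolding rearranged_single_nth
    by (intro bexI[of _ "real (geom_sum g ?k) * zeta_reg [?k + 2]"]) (use V in \<open>auto intro!: subspace_of_nat_mult\<close>)
  then have "\<exists>L\<in>V. mixed_sum 2 (replicate i 1) (?k - i) \<longlonglongrightarrow> L"
    by (intro polynomial_limit_coeffs[where f = "\<lambda>i. mixed_sum 2 (replicate i 1) (?k - i)" and d = ?k])
       (use V incseq_mixed_sum mixed_sum_nonneg in auto)
  then show ?thesis by simp
qed

lemma mixed_sum_3_limit:
  assumes V: "rat_vector.subspace V" "\<And>a b. a + b = i + t + 3 \<Longrightarrow> a \<ge> 2 \<Longrightarrow> b \<ge> 1 \<Longrightarrow> zeta_reg [a, b] \<in> V"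
  shows "\<exists>L\<in>V. mixed_sum 3 (replicate i 1) t \<longlonglongrightarrow> L"
proof -
  let ?k = "i + t"
  have "\<exists>s\<in>V. (\<lambda>N. \<Sum>j\<le>?k. real g ^ j * mixed_sum 3 (replicate j 1) (?k - j) N) \<longlonglongrightarrow> s" for g
    using fps_has_sum_partial_sums[OF rearrange_double_1[OF _ fps_has_sum_double_1[of g]], of ?k]
    unfolding rearranged_double_1_nth
    by (intro bexI) (auto intro!: rat_vector.subspace_sum subspace_of_nat_mult V)
  then have "\<exists>L\<in>V. mixed_sum 3 (replicate i 1) (?k - i) \<longlonglongrightarrow> L"
    by (intro polynomial_limit_coeffs[where f = "\<lambda>i. mixed_sum 3 (replicate i 1) (?k - i)" and d = ?k])
       (use V incseq_mixed_sum mixed_sum_nonneg in auto)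
  then show ?thesis by simp
qed

text \<open>The polynomial has two parameters. Extraction in \<open>c\<close> fixes the number
  \<open>h\<close> of ones before the inner 2, then extraction in \<open>g\<close> the number
  \<open>i\<close> behind it; the intermediate sums stay nonnegative and increasing because
  \<open>g\<close> is a natural number.\<close>

lemma mixed_sum_2_2_limit:
  assumes V: "rat_vector.subspace V" "\<And>a b. a + b = h + i + t + 4 \<Longrightarrow> a \<ge> 2 \<Longrightarrow> b \<ge> 2 \<Longrightarrow> zeta_reg [a, b] \<in> V"
  shows "\<exists>L\<in>V. mixed_sum 2 (replicate h 1 @ 2 # replicate i 1) t \<longlonglongrightarrow> L"
proof -
  let ?k = "h + i + t"
  let ?F = "\<lambda>g h N. \<Sum>i\<le>?k - h. real g ^ i * mixed_sum 2 (replicate h 1 @ 2 # replicate i 1) (?k - h - i) N"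
  have 1: "\<exists>s\<in>V. (\<lambda>N. \<Sum>h\<le>?k. real c ^ h * ?F g h N) \<longlonglongrightarrow> s" for c g
    using fps_has_sum_partial_sums[OF rearrange_double_2[OF _ _ fps_has_sum_double_2[of c g]], of ?k]
    unfolding rearranged_double_2_nth
    by (intro bexI) (auto intro!: rat_vector.subspace_sum subspace_of_nat_mult V simp flip: of_nat_mult)
  have "\<exists>L\<in>V. ?F g h \<longlonglongrightarrow> L" for g
  proof (rule polynomial_limit_coeffs[where f = "?F g" and d = ?k])
    show "incseq (?F g j)" for j
      using incseq_mixed_sum by (auto simp: incseq_def intro!: sum_mono mult_left_mono)
  qed (use V 1 mixed_sum_nonneg in \<open>auto intro!: sum_nonneg\<close>)
  then have "\<exists>L\<in>V. mixed_sum 2 (replicate h 1 @ 2 # replicate i 1) (?k - h - i) \<longlonglongrightarrow> L"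
    by (intro polynomial_limit_coeffs[where f = "\<lambda>i. mixed_sum 2 (replicate h 1 @ 2 # replicate i 1) (?k - h - i)" and d = "?k - h"])
       (use V incseq_mixed_sum mixed_sum_nonneg in auto)
  then show ?thesis by simp
qed

lemma zeta_span_subset: "k \<ge> 2 \<Longrightarrow> zeta_span k \<subseteq> mzv_space"
  using zeta2_ideal_subset mzv_in_space[of "[k]"]
  by (auto simp: zeta_span_def admissible_def is_index_def intro!: mzv_space_closed)

lemma mixed_sum_2_limit_weight:
  "\<exists>L. mixed_sum 2 (replicate i 1) t \<longlonglongrightarrow> L \<and> L \<in> mzv_space \<and> (even (i + t) \<longrightarrow> L \<in> zeta2_ideal)"
proof (cases "even (i + t)")
  case True
  then show ?thesis
    using mixed_sum_2_limit[OF subspace_zeta2_ideal, of i t] zeta_even_in_ideal[of "i + t + 2"] zeta2_ideal_subset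
    by auto
next
  case False
  then show ?thesis using mixed_sum_2_limit[OF subspace_mzv_space zeta_reg_in_space, of i t] by auto
qed

lemma mixed_sum_3_limit_weight:
  "\<exists>L. mixed_sum 3 (replicate i 1) t \<longlonglongrightarrow> L \<and> L \<in> mzv_space \<and> (even (i + t) \<longrightarrow> L \<in> zeta_span (i + t + 3))"
proof (cases "even (i + t)")
  case True
  then have "zeta_reg [a, b] \<in> zeta_span (i + t + 3)" if "a + b = i + t + 3" "a \<ge> 2" "b \<ge> 1" for a b
    using that by (intro double_zeta_in_zeta_span) auto
  then have "\<exists>L\<in>zeta_span (i + t + 3). mixed_sum 3 (replicate i 1) t \<longlonglongrightarrow> L"
    by (rule mixed_sum_3_limit[OF subspace_zeta_span])
  then show ?thesis using zeta_span_subset[of "i + t + 3"] by auto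
next
  case False
  then show ?thesis using mixed_sum_3_limit[OF subspace_mzv_space zeta_reg_in_space, of i t] by auto
qed

lemma mixed_sum_2_2_limit_weight:
  "\<exists>L. mixed_sum 2 (replicate h 1 @ 2 # replicate i 1) t \<longlonglongrightarrow> L \<and> L \<in> mzv_space
    \<and> (odd (h + i + t) \<longrightarrow> L \<in> zeta_span (h + i + t + 4))"
proof (cases "odd (h + i + t)")
  case True
  then have "zeta_reg [a, b] \<in> zeta_span (h + i + t + 4)" if "a + b = h + i + t + 4" "a \<ge> 2" "b \<ge> 2" for a b
    using that by (intro double_zeta_in_zeta_span) auto
  then have "\<exists>L\<in>zeta_span (h + i + t + 4). mixed_sum 2 (replicate h 1 @ 2 # replicate i 1) t \<longlonglongrightarrow> L"
    by (rule mixed_sum_2_2_limit[OF subspace_zeta_span])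
  then show ?thesis using zeta_span_subset[of "h + i + t + 4"] by auto
next
  case False
  then show ?thesis using mixed_sum_2_2_limit[OF subspace_mzv_space zeta_reg_in_space, of h i t] by auto
qed

section \<open>The symmetric values with few entries different from 1\<close>

lemma deconc_split:
  "deconc f g (us @ d # vs) = deconc f (\<lambda>l. g (l @ d # vs)) us + deconc (\<lambda>l. f (us @ d # l)) g vs"
  by (induction us arbitrary: f) (simp_all add: add.assoc)

lemma deconc_replicate:
  "deconc f g (replicate n x) = fps_nth (Abs_fps (\<lambda>j. f (replicate j x)) * Abs_fps (\<lambda>j. g (replicate j x))) n"
  unfolding deconc_def by (simp add: fps_mult_nth atLeast0AtMost min_def)

definition truncated_symmetric_left :: "nat \<Rightarrow> nat list \<Rightarrow> real"
  where "truncated_symmetric_left N l = (- 1) ^ sum_list l * mhs (rev l) N"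

lemma msum_symmetric_deconc:
  "msum (symmetric_reciprocals N) ks = deconc (truncated_symmetric_left N) (\<lambda>l. mhs l N) ks"
  by (simp add: msum_symmetric_reciprocals symmetric_sum_def deconc_def truncated_symmetric_left_def)

text \<open>The truncated product of all 1 - X^2 / m^2. The factors split off from the negative and
  the positive half of the list diverge separately, and it is in this product that they
  meet.\<close>

definition symmetric_ones_gf :: "nat \<Rightarrow> real fps"
  where "symmetric_ones_gf N = ones_gf (- 1) N * ones_gf 1 N"

lemma left_ones_gf: "Abs_fps (\<lambda>c. truncated_symmetric_left N (replicate c 1)) = ones_gf (- 1) N"
  by (rule fps_ext) (simp add: truncated_symmetric_left_def ones_gf_def sum_list_replicate)

lemma left_mixed_gf:
  "Abs_fps (\<lambda>c. truncated_symmetric_left N (us @ d # replicate c 1))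
    = fps_const ((- 1) ^ (sum_list us + d)) * (ones_gf (- 1) N * mixed_gf 1 d (rev us) N)"
  unfolding mhs_ones_gf[of "- 1", unfolded minus_minus, symmetric]
  by (rule fps_ext) (simp add: truncated_symmetric_left_def sum_list_replicate power_add mult_ac)

lemma right_ones_gf: "Abs_fps (\<lambda>c. mhs (replicate c 1) N) = ones_gf 1 N"
  by (rule fps_ext) (simp add: ones_gf_def)

lemma right_mixed_gf: "Abs_fps (\<lambda>c. mhs (replicate c 1 @ d # vs) N) = ones_gf 1 N * mixed_gf (- 1) d vs N"
  unfolding mhs_ones_gf[symmetric] by simp

lemma msum_symmetric_ones:
  "msum (symmetric_reciprocals N) (replicate n 1) = fps_nth (symmetric_ones_gf N) n"
  unfolding msum_symmetric_deconc deconc_replicate left_ones_gf right_ones_gf symmetric_ones_gf_def ..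

lemma msum_symmetric_one:
  "msum (symmetric_reciprocals N) (replicate j 1 @ d # replicate i 1)
    = fps_nth (symmetric_ones_gf N * mixed_gf (- 1) d (replicate i 1) N) j
    + (- 1) ^ (j + d) * fps_nth (symmetric_ones_gf N * mixed_gf 1 d (replicate j 1) N) i"
  unfolding msum_symmetric_deconc deconc_split deconc_replicate left_ones_gf right_ones_gf
    left_mixed_gf right_mixed_gf symmetric_ones_gf_def
  by (simp add: sum_list_replicate mult.assoc mult.left_commute[of _ "fps_const _"]) (simp add: mult_ac)

lemma msum_symmetric_two:
  "msum (symmetric_reciprocals N) (replicate j 1 @ 2 # replicate h 1 @ 2 # replicate i 1)
    = fps_nth (symmetric_ones_gf N * mixed_gf (- 1) 2 (replicate h 1 @ 2 # replicate i 1) N) j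
    + (- 1) ^ j * fps_nth (symmetric_ones_gf N * (mixed_gf 1 2 (replicate j 1) N * mixed_gf (- 1) 2 (replicate i 1) N)) h
    + (- 1) ^ (j + h) * fps_nth (symmetric_ones_gf N * mixed_gf 1 2 (replicate h 1 @ 2 # replicate j 1) N) i"
proof -
  have left: "Abs_fps (\<lambda>c. truncated_symmetric_left N (replicate j 1 @ 2 # replicate h 1 @ 2 # replicate c 1))
      = fps_const ((- 1) ^ (j + h)) * (ones_gf (- 1) N * mixed_gf 1 2 (replicate h 1 @ 2 # replicate j 1) N)"
    using left_mixed_gf[of N "replicate j 1 @ 2 # replicate h 1" 2] by (simp add: sum_list_replicate)
  show ?thesis
    unfolding msum_symmetric_deconc deconc_split deconc_replicate left_ones_gf right_ones_gf left
      left_mixed_gf right_mixed_gf symmetric_ones_gf_def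
    by (simp add: sum_list_replicate mult.assoc mult.left_commute[of _ "fps_const _"]) (simp add: mult_ac)
qed

definition fps_tendsto :: "(nat \<Rightarrow> real fps) \<Rightarrow> real fps \<Rightarrow> bool"
  where "fps_tendsto F G \<longleftrightarrow> (\<forall>k. (\<lambda>N. fps_nth (F N) k) \<longlonglongrightarrow> fps_nth G k)"

lemma fps_tendstoD: "fps_tendsto F G \<Longrightarrow> (\<lambda>N. fps_nth (F N) k) \<longlonglongrightarrow> fps_nth G k"
  by (simp add: fps_tendsto_def)

lemma fps_tendsto_mult: "fps_tendsto F F' \<Longrightarrow> fps_tendsto G G' \<Longrightarrow> fps_tendsto (\<lambda>N. F N * G N) (F' * G')"
  unfolding fps_tendsto_def fps_mult_nth by (auto intro!: tendsto_sum tendsto_mult)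

lemma fps_tendsto_mixed_gf:
  "(\<And>t. mixed_sum d ts t \<longlonglongrightarrow> L t) \<Longrightarrow> fps_tendsto (mixed_gf s d ts) (Abs_fps (\<lambda>t. s ^ t * L t))"
  unfolding fps_tendsto_def mixed_gf_def by (auto intro!: tendsto_mult)

definition symmetric_ones_limit :: "real fps"
  where "symmetric_ones_limit = Abs_fps (\<lambda>c. symmetric_sum zeta_reg (replicate c 1))"

lemma symmetric_ones_gf_tendsto: "fps_tendsto symmetric_ones_gf symmetric_ones_limit"
  unfolding fps_tendsto_def
proof
  fix k
  have "is_index (replicate k 1)" by (auto simp: is_index_def)
  from msum_tendsto_symmetric[OF this]
  show "(\<lambda>N. fps_nth (symmetric_ones_gf N) k) \<longlonglongrightarrow> fps_nth symmetric_ones_limit k"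
    by (simp add: symmetric_ones_limit_def flip: msum_symmetric_ones)
qed

text \<open>The constant coefficient of \<open>symmetric_ones_limit\<close> is 1 and all others lie
  in the ideal, so modulo \<zeta>(2) multiplication by it changes nothing.\<close>

lemma symmetric_ones_limit_mult:
  assumes V: "rat_vector.subspace V" "zeta2_ideal \<subseteq> V"
    and F: "\<And>k. fps_nth F k \<in> mzv_space" and n: "fps_nth F n \<in> V"
  shows "fps_nth (symmetric_ones_limit * F) n \<in> V"
  unfolding fps_mult_nth
proof (rule rat_vector.subspace_sum[OF V(1)])
  fix c assume "c \<in> {0..n}"
  show "fps_nth symmetric_ones_limit c * fps_nth F (n - c) \<in> V"
  proof (cases "c = 0")
    case True
    then show ?thesis
      using n by (simp add: symmetric_ones_limit_def symmetric_sum_def zeta_reg_poly is_index_def reg_poly_Nil)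
  next
    case False
    then have "fps_nth symmetric_ones_limit c \<in> zeta2_ideal"
      using S.ones_J[of c] by (simp add: symmetric_ones_limit_def)
    from zeta2_ideal_mult[OF F this, of "n - c"] V(2) show ?thesis by (auto simp: mult.commute)
  qed
qed

lemma subspace_sign_mult:
  "rat_vector.subspace V \<Longrightarrow> (x :: real) \<in> V \<Longrightarrow> (- 1) ^ n * x \<in> V"
  using rat_vector.subspace_neg[of V x] by (cases "even n") auto

lemma symmetric_sum_one_mark:
  assumes V: "rat_vector.subspace V" "zeta2_ideal \<subseteq> V" and d: "d > 0"
    and lim: "\<And>i t. mixed_sum d (replicate i 1) t \<longlonglongrightarrow> L i t" "\<And>i t. L i t \<in> mzv_space" and L: "L i j \<in> V" "L j i \<in> V"
  shows "symmetric_sum zeta_reg (replicate j 1 @ d # replicate i 1) \<in> V"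
proof -
  define T where "T s i = Abs_fps (\<lambda>t. s ^ t * L i t)" for s i
  let ?A = symmetric_ones_limit
  have T: "fps_tendsto (mixed_gf s d (replicate i 1)) (T s i)" for s i
    unfolding T_def by (intro fps_tendsto_mixed_gf lim)
  have "(\<lambda>N. msum (symmetric_reciprocals N) (replicate j 1 @ d # replicate i 1)) \<longlonglongrightarrow>
      fps_nth (?A * T (- 1) i) j + (- 1) ^ (j + d) * fps_nth (?A * T 1 j) i"
    unfolding msum_symmetric_one
    by (intro tendsto_add tendsto_mult tendsto_const fps_tendstoD fps_tendsto_mult symmetric_ones_gf_tendsto T)
  moreover have "is_index (replicate j 1 @ d # replicate i 1)" using d by (auto simp: is_index_def)
  ultimately have eq: "symmetric_sum zeta_reg (replicate j 1 @ d # replicate i 1)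
      = fps_nth (?A * T (- 1) i) j + (- 1) ^ (j + d) * fps_nth (?A * T 1 j) i"
    using msum_tendsto_symmetric LIMSEQ_unique by blast
  show ?thesis
    unfolding eq
    by (intro rat_vector.subspace_add[OF V(1)] subspace_sign_mult[OF V(1)] symmetric_ones_limit_mult[OF V])
       (use L lim(2) in \<open>auto simp: T_def intro!: subspace_sign_mult V subspace_mzv_space\<close>)
qed

lemma symmetric_sum_2:
  assumes "even n" "j + i + 2 = n" shows "symmetric_sum zeta_reg (replicate j 1 @ 2 # replicate i 1) \<in> zeta2_ideal"
proof -
  obtain L where L: "\<And>i t. mixed_sum 2 (replicate i 1) t \<longlonglongrightarrow> L i t" "\<And>i t. L i t \<in> mzv_space"
    "\<And>i t. even (i + t) \<Longrightarrow> L i t \<in> zeta2_ideal"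
    using mixed_sum_2_limit_weight by metis
  show ?thesis by (rule symmetric_sum_one_mark[OF subspace_zeta2_ideal _ _ L(1,2)]) (use L(3) assms in auto)
qed

lemma symmetric_sum_3:
  assumes "odd k" "j + i + 3 = k" shows "symmetric_sum zeta_reg (replicate j 1 @ 3 # replicate i 1) \<in> zeta_span k"
proof -
  obtain L where L: "\<And>i t. mixed_sum 3 (replicate i 1) t \<longlonglongrightarrow> L i t" "\<And>i t. L i t \<in> mzv_space"
    "\<And>i t. even (i + t) \<Longrightarrow> L i t \<in> zeta_span (i + t + 3)"
    using mixed_sum_3_limit_weight by metis
  show ?thesis
    by (rule symmetric_sum_one_mark[OF subspace_zeta_span zeta2_ideal_zeta_span _ L(1,2)])
       (use L(3)[of i j] L(3)[of j i] assms in \<open>auto simp: ac_simps\<close>)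
qed

lemma symmetric_sum_2_2:
  assumes "odd k" "j + h + i + 4 = k"
  shows "symmetric_sum zeta_reg (replicate j 1 @ 2 # replicate h 1 @ 2 # replicate i 1) \<in> zeta_span k"
proof -
  obtain L where L: "\<And>i t. mixed_sum 2 (replicate i 1) t \<longlonglongrightarrow> L i t" "\<And>i t. L i t \<in> mzv_space"
    "\<And>i t. even (i + t) \<Longrightarrow> L i t \<in> zeta2_ideal"
    using mixed_sum_2_limit_weight by metis
  obtain M where M: "\<And>h i t. mixed_sum 2 (replicate h 1 @ 2 # replicate i 1) t \<longlonglongrightarrow> M h i t" "\<And>h i t. M h i t \<in> mzv_space"
    "\<And>h i t. odd (h + i + t) \<Longrightarrow> M h i t \<in> zeta_span (h + i + t + 4)"
    using mixed_sum_2_2_limit_weight by metis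
  define T where "T s i = Abs_fps (\<lambda>t. s ^ t * L i t)" for s i
  define U where "U s h i = Abs_fps (\<lambda>t. s ^ t * M h i t)" for s h i
  let ?A = symmetric_ones_limit
  let ?V = "zeta_span k"
  have T: "fps_tendsto (mixed_gf s 2 (replicate i 1)) (T s i)" for s i
    unfolding T_def by (intro fps_tendsto_mixed_gf L)
  have U: "fps_tendsto (mixed_gf s 2 (replicate h 1 @ 2 # replicate i 1)) (U s h i)" for s h i
    unfolding U_def by (intro fps_tendsto_mixed_gf M)
  have "(\<lambda>N. msum (symmetric_reciprocals N) (replicate j 1 @ 2 # replicate h 1 @ 2 # replicate i 1)) \<longlonglongrightarrow>
      fps_nth (?A * U (- 1) h i) j + (- 1) ^ j * fps_nth (?A * (T 1 j * T (- 1) i)) h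
      + (- 1) ^ (j + h) * fps_nth (?A * U 1 h j) i"
    unfolding msum_symmetric_two
    by (intro tendsto_add tendsto_mult tendsto_const fps_tendstoD fps_tendsto_mult symmetric_ones_gf_tendsto T U)
  moreover have "is_index (replicate j 1 @ 2 # replicate h 1 @ 2 # replicate i 1)" by (auto simp: is_index_def)
  ultimately have eq: "symmetric_sum zeta_reg (replicate j 1 @ 2 # replicate h 1 @ 2 # replicate i 1) =
      fps_nth (?A * U (- 1) h i) j + (- 1) ^ j * fps_nth (?A * (T 1 j * T (- 1) i)) h
      + (- 1) ^ (j + h) * fps_nth (?A * U 1 h j) i"
    using msum_tendsto_symmetric LIMSEQ_unique by blast
  have product: "fps_nth (T 1 j * T (- 1) i) n \<in> W"
    if W: "rat_vector.subspace W" and LL: "\<And>b. b \<le> n \<Longrightarrow> L j b * L i (n - b) \<in> W" for n W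
    unfolding fps_mult_nth
  proof (rule rat_vector.subspace_sum[OF W])
    fix b assume "b \<in> {0..n}"
    then show "fps_nth (T 1 j) b * fps_nth (T (- 1) i) (n - b) \<in> W"
      using subspace_sign_mult[OF W LL[of b], of "n - b"] by (simp add: T_def mult_ac)
  qed
  have LL: "L j b * L i (h - b) \<in> ?V" if "b \<le> h" for b
  proof -
    \<comment> \<open>The two numbers add up to k - 4, which is odd, so one of the two factors has
      even weight and lies in the ideal.\<close>
    have "even (j + b) \<or> even (i + (h - b))" using assms that by presburger
    then have "L j b * L i (h - b) \<in> zeta2_ideal"
      using zeta2_ideal_mult[OF L(2)[of j b] L(3)[of i "h - b"]] zeta2_ideal_mult[OF L(2)[of i "h - b"] L(3)[of j b]]
      by (auto simp: mult.commute)
    then show ?thesis using zeta2_ideal_zeta_span by blast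
  qed
  have "M h i j \<in> ?V" "M h j i \<in> ?V" using M(3)[of h i j] M(3)[of h j i] assms by (auto simp: ac_simps)
  moreover have "fps_nth (T 1 j * T (- 1) i) n \<in> mzv_space" for n
    by (intro product subspace_mzv_space mzv_space_mult L(2))
  moreover have "fps_nth (T 1 j * T (- 1) i) h \<in> ?V" by (intro product subspace_zeta_span LL)
  ultimately show ?thesis
    unfolding eq
    by (intro rat_vector.subspace_add[OF subspace_zeta_span] subspace_sign_mult[OF subspace_zeta_span]
        symmetric_ones_limit_mult[OF subspace_zeta_span zeta2_ideal_zeta_span])
       (use M(2) in \<open>auto simp: U_def intro!: subspace_sign_mult subspace_zeta_span subspace_mzv_space\<close>)
qed

section \<open>The sum formulas\<close>

lemma sign_scaleQ: "(- 1) ^ r *\<^sub>Q x = (if even r then x else - x)"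
  by (simp add: scaleQ_one)

lemma zeta2_cong_refl: "x \<in> mzv_space \<Longrightarrow> zeta2_cong x x"
  using rat_vector.subspace_0[OF subspace_zeta2_ideal] by (simp add: zeta2_cong_def)

lemma mod_zeta2_eqI: "x \<in> mzv_space \<Longrightarrow> y \<in> mzv_space \<Longrightarrow> x - y \<in> zeta2_ideal \<Longrightarrow> mod_zeta2 x = mod_zeta2 y"
  by (rule Quotient3_rel_abs[OF Quotient3_mzv_quot]) (simp add: zeta2_cong_def)

lemma mod_zeta2_0: "mod_zeta2 0 = 0"
  by (simp add: zero_mzv_quot_def)

lemma mod_zeta2_add: "x \<in> mzv_space \<Longrightarrow> y \<in> mzv_space \<Longrightarrow> mod_zeta2 (x + y) = mod_zeta2 x + mod_zeta2 y"
  by (simp add: plus_mzv_quot.abs_eq zeta2_cong_refl)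

lemma mod_zeta2_scaleQ: "x \<in> mzv_space \<Longrightarrow> mod_zeta2 (q *\<^sub>Q x) = q *\<^sub>Q mod_zeta2 x"
  by (simp add: scaleQ_mzv_quot.abs_eq zeta2_cong_refl)

lemma mod_zeta2_sum:
  assumes "\<And>i. i \<in> I \<Longrightarrow> f i \<in> mzv_space"
  shows "(\<Sum>i\<in>I. mod_zeta2 (f i)) = mod_zeta2 (\<Sum>i\<in>I. f i)"
  using assms
  by (induction I rule: infinite_finite_induct)
     (simp_all add: mod_zeta2_0 mod_zeta2_add rat_vector.subspace_sum[OF subspace_mzv_space])

lemma mod_zeta2_zeta_span: "k \<ge> 2 \<Longrightarrow> x \<in> zeta_span k \<Longrightarrow> mod_zeta2 x \<in> range (\<lambda>q. q *\<^sub>Q Z_S k)"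
proof -
  assume k: "k \<ge> 2" and x: "x \<in> zeta_span k"
  have mzv: "mzv [k] \<in> mzv_space" using k by (intro mzv_in_space) (simp add: admissible_def is_index_def)
  obtain q j where q: "x = q *\<^sub>Q mzv [k] + j" "j \<in> zeta2_ideal" using x by (auto simp: zeta_span_def)
  then have "mod_zeta2 x = mod_zeta2 (q *\<^sub>Q mzv [k])"
    using zeta2_ideal_subset mzv by (intro mod_zeta2_eqI) (auto intro!: mzv_space_closed)
  then have "mod_zeta2 x = q *\<^sub>Q Z_S k" by (simp only: Z_S_def mod_zeta2_scaleQ[OF mzv])
  then show ?thesis by (rule range_eqI)
qed

lemma sum_zeta_A:
  assumes "(\<Sum>ks\<in>I. zeta_A ks) - (- 1) ^ r * (\<Sum>ks\<in>I. zeta_star_A ks) \<in> {0}"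
  shows "(\<Sum>ks\<in>I. zeta_A ks) = (- 1) ^ r *\<^sub>Q (\<Sum>ks\<in>I. zeta_star_A ks)"
  using assms by (cases "even r") (auto simp: sign_scaleQ eq_neg_iff_add_eq_0)

text \<open>The sums are formed among real numbers and projected once. Since
  \<open>mod_zeta2\<close> respects addition on \<open>mzv_space\<close>, membership of the summands
  is carried along.\<close>

lemma sum_zeta_S:
  assumes k: "k \<ge> 2"
    and diff: "(\<Sum>ks\<in>I. symmetric_sum zeta_reg ks) - (- 1) ^ r * (\<Sum>ks\<in>I. symmetric_sum zeta_star_reg ks) \<in> zeta2_ideal"
    and span: "(\<Sum>ks\<in>I. symmetric_sum zeta_reg ks) \<in> zeta_span k"
  shows "(\<Sum>ks\<in>I. zeta_S ks) = (- 1) ^ r *\<^sub>Q (\<Sum>ks\<in>I. zeta_star_S ks)"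
    and "(\<Sum>ks\<in>I. zeta_S ks) \<in> range (\<lambda>q. q *\<^sub>Q Z_S k)"
proof -
  let ?x = "\<Sum>ks\<in>I. symmetric_sum zeta_reg ks" and ?y = "\<Sum>ks\<in>I. symmetric_sum zeta_star_reg ks"
  have x: "(\<Sum>ks\<in>I. zeta_S ks) = mod_zeta2 ?x"
    unfolding zeta_S_def by (intro mod_zeta2_sum symmetric_sum_in_space zeta_reg_in_space)
  have y: "(\<Sum>ks\<in>I. zeta_star_S ks) = mod_zeta2 ?y"
    unfolding zeta_star_S_def by (intro mod_zeta2_sum symmetric_sum_in_space zeta_star_reg_in_space)
  have space: "?x \<in> mzv_space" "?y \<in> mzv_space"
    by (intro rat_vector.subspace_sum[OF subspace_mzv_space] symmetric_sum_in_space zeta_reg_in_space zeta_star_reg_in_space)+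
  have "(- 1) ^ r *\<^sub>Q ?y = (- 1) ^ r * ?y" by (simp add: sign_scaleQ)
  then have "mod_zeta2 ?x = mod_zeta2 ((- 1) ^ r *\<^sub>Q ?y)"
    using diff space mzv_space_closed(5)[OF space(2), of "(- 1) ^ r"] by (intro mod_zeta2_eqI) simp_all
  then show "(\<Sum>ks\<in>I. zeta_S ks) = (- 1) ^ r *\<^sub>Q (\<Sum>ks\<in>I. zeta_star_S ks)"
    unfolding x y by (simp only: mod_zeta2_scaleQ[OF space(2)])
  show "(\<Sum>ks\<in>I. zeta_S ks) \<in> range (\<lambda>q. q *\<^sub>Q Z_S k)"
    unfolding x by (rule mod_zeta2_zeta_span[OF k span])
qed

theorem theorem1p2:
  fixes k r :: nat
  assumes "odd k" and "k \<ge> 3" and "1 \<le> r" and "r \<le> k - 2"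
  shows
    "(\<forall>i\<in>{1..r}.
        let I = {ks \<in> compositions k r. ks ! (i - 1) \<ge> 3} in
          (\<Sum>ks\<in>I. zeta_A ks) = (- 1) ^ r *\<^sub>Q (\<Sum>ks\<in>I. zeta_star_A ks) \<and>
          (\<Sum>ks\<in>I. zeta_A ks) \<in> range (\<lambda>q. q *\<^sub>Q Z_A k) \<and>
          (\<Sum>ks\<in>I. zeta_S ks) = (- 1) ^ r *\<^sub>Q (\<Sum>ks\<in>I. zeta_star_S ks) \<and>
          (\<Sum>ks\<in>I. zeta_S ks) \<in> range (\<lambda>q. q *\<^sub>Q Z_S k)) \<and>
     (\<forall>i\<in>{1..r}. \<forall>j\<in>{1..r}. i \<noteq> j \<longrightarrow>
       (let I = {ks \<in> compositions k r. ks ! (i - 1) \<ge> 2 \<and> ks ! (j - 1) \<ge> 2} in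
          (\<Sum>ks\<in>I. zeta_A ks) = (- 1) ^ r *\<^sub>Q (\<Sum>ks\<in>I. zeta_star_A ks) \<and>
          (\<Sum>ks\<in>I. zeta_A ks) \<in> range (\<lambda>q. q *\<^sub>Q Z_A k) \<and>
          (\<Sum>ks\<in>I. zeta_S ks) = (- 1) ^ r *\<^sub>Q (\<Sum>ks\<in>I. zeta_star_S ks) \<and>
          (\<Sum>ks\<in>I. zeta_S ks) \<in> range (\<lambda>q. q *\<^sub>Q Z_S k)))"
proof -
  have k2: "k \<ge> 2" using \<open>k \<ge> 3\<close> by simp
  have Z2_A: "zeta_A (replicate i 1 @ 2 # replicate j 1) \<in> {0}" if "even n" "i + j + 2 = n" for i j n
    using zeta_A_2_even[OF that] by simp
  have V_A: "{0} \<subseteq> Z_A_multiples k" using rat_vector.subspace_0[OF subspace_Z_A_multiples] by blast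
  note A = A.sum_formulas[where r = r, OF \<open>odd k\<close> subspace_Z_A_multiples V_A]
  note S = S.sum_formulas[where r = r, OF \<open>odd k\<close> subspace_zeta_span zeta2_ideal_zeta_span]
  note Z_A = Z2_A zeta_A_3_odd[OF \<open>odd k\<close>] zeta_A_2_2_odd[OF \<open>odd k\<close>]
  note Z_S = symmetric_sum_2 symmetric_sum_3[OF \<open>odd k\<close>] symmetric_sum_2_2[OF \<open>odd k\<close>]
  define P where "P I \<longleftrightarrow> (\<Sum>ks\<in>I. zeta_A ks) = (- 1) ^ r *\<^sub>Q (\<Sum>ks\<in>I. zeta_star_A ks) \<and>
          (\<Sum>ks\<in>I. zeta_A ks) \<in> range (\<lambda>q. q *\<^sub>Q Z_A k) \<and>
          (\<Sum>ks\<in>I. zeta_S ks) = (- 1) ^ r *\<^sub>Q (\<Sum>ks\<in>I. zeta_star_S ks) \<and>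
          (\<Sum>ks\<in>I. zeta_S ks) \<in> range (\<lambda>q. q *\<^sub>Q Z_S k)" for I
  have 1: "P {ks \<in> compositions k r. ks ! (i - 1) \<ge> 3}" if "i \<in> {1..r}" for i
  proof -
    have i: "1 \<le> i" "i \<le> r" using that by auto
    show ?thesis
      unfolding P_def
    proof (intro conjI sum_zeta_A sum_zeta_S[OF k2])
    qed (rule A(1,2)[OF _ _ _ i] S(1,2)[OF _ _ _ i]; rule Z_A Z_S; assumption)+
  qed
  have less: "P {ks \<in> compositions k r. ks ! (i - 1) \<ge> 2 \<and> ks ! (j - 1) \<ge> 2}" if "1 \<le> i" "i < j" "j \<le> r" for i j
    unfolding P_def
  proof (intro conjI sum_zeta_A sum_zeta_S[OF k2])
  qed (rule A(3,4)[OF _ _ _ that] S(3,4)[OF _ _ _ that]; rule Z_A Z_S; assumption)+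
  have 2: "P {ks \<in> compositions k r. ks ! (i - 1) \<ge> 2 \<and> ks ! (j - 1) \<ge> 2}"
    if "i \<in> {1..r}" "j \<in> {1..r}" "i \<noteq> j" for i j
  proof (cases "i < j")
    case True
    then show ?thesis using less[of i j] that by simp
  next
    case False
    have "{ks \<in> compositions k r. ks ! (i - 1) \<ge> 2 \<and> ks ! (j - 1) \<ge> 2}
        = {ks \<in> compositions k r. ks ! (j - 1) \<ge> 2 \<and> ks ! (i - 1) \<ge> 2}" by blast
    then show ?thesis using less[of j i] that False by simp
  qed
  from 1 2 show ?thesis unfolding P_def Let_def by blast
qed

end
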